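(* Let $X$ be a compact Riemann surface of genus one and $\varphi\colon X\to\mathbb{CP}^3$ a transverse $J$-holomorphic curve in nearly Kähler $\mathbb{CP}^3$. As a holomorphic bundle, the normal bundle $\nu$ of $\varphi$ is the unique non-trivial extension $$0\to\underline{\mathbb{C}}\to\nu\to\underline{\mathbb{C}}\to0$$ of the trivial holomorphic line bundle $\underline{\mathbb{C}}$ by itself over $X$.
   Context: Nearly Kähler $\mathbb{CP}^3$: identify $\mathbb{H}=\mathbb{C}\oplus j\mathbb{C}$ and $\mathbb{H}^2\cong\mathbb{C}^4$ via $(z_0+jz_1,z_2+jz_3)\leftrightarrow(z_0,z_1,z_2,z_3)$. $\mathrm{Sp}(2)$ acts transitively on $\mathbb{CP}^3$ with stabiliser $S^1\times S^3=\{\mathrm{diag}(z,q)\}$ of $[1,0,0,0]$. Write the left-invariant Maurer–Cartan form as $$\Omega_{MC}=\begin{pmatrix} i\rho_1+j\overline{\omega_3} & -\frac{\overline{\omega_1}}{\sqrt2}+j\frac{\omega_2}{\sqrt2}\\ \frac{\omega_1}{\sqrt2}+j\frac{\omega_2}{\sqrt2} & i\rho_2+j\tau\end{pmatrix}$$ with $\omega_i,\tau$ complex-valued and $\rho_i$ real. $J$ and $g$ are determined by requiring that $s^*\omega_1,s^*\omega_2,s^*\omega_3$ be unitary $(1,0)$-forms for every local section $s$ of $\mathrm{Sp}(2)\to\mathbb{CP}^3$. $\overline\nabla$ is the nearly Kähler connection, the unique connection with skew-symmetric torsion and holonomy in $\mathrm{SU}(3)$; in the frame $(e_1,e_2,e_3)$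 dual to $(\omega_1,\omega_2,\omega_3)$ it is $\overline\nabla e_b=\sum_a\kappa_{ab}e_a$ with $$\kappa=\begin{pmatrix} i(\rho_2-\rho_1)&-\overline\tau&0\\ \tau&-i(\rho_1+\rho_2)&0\\0&0&2i\rho_1\end{pmatrix}.$$ $\mathcal V$ (where $\omega_1=\omega_2=0$) is the vertical bundle of the twistor fibration $\mathbb{CP}^3\to S^4$, and $\mathcal H=\mathcal V^\perp$ (where $\omega_3=0$). For a nowhere vertical $J$-holomorphic curve, $\varphi^*\mathrm{Sp}(2)$ reduces to the $S^1\times S^1$-bundle cut out by $\omega_2=0$, on which $\tau$ is of type $(1,0)$. The curve is transverse if it is nowhere tangent to $\mathcal H$, nowhere tangent to $\mathcal V$, and this $\tau$ vanishes nowhere. The normal bundle $\nu$ of $TX$ in $\varphi^*T\mathbb{CP}^3$ is a complex rank-two bundle; its holomorphic structure is the one given by the $(0,1)$-part of the connection $\overline\nabla^\perp$ obtained by projecting $\overline\nabla$ to $\nu$. *)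

theory Defs
  imports
    "HOL-Analysis.Analysis"
    "HOL-Homology.Homology"
begin

unbundle no fps_syntax

section \<open>Riemann surfaces\<close>

text \<open>A chart is a pair of a domain and a coordinate; the coordinate is only meaningful on
  the domain. The Riemann surface is the whole type together with an atlas.\<close>

type_synonym 'x chart = "'x set \<times> ('x \<Rightarrow> complex)"

definition chart_inv :: "'x chart \<Rightarrow> complex \<Rightarrow> 'x" where
  "chart_inv c = inv_into (fst c) (snd c)"

definition riemann_surface :: "('x::t2_space) chart set \<Rightarrow> bool" where
  "riemann_surface \<A> \<longleftrightarrow>
     connected (UNIV :: 'x set) \<and>
     (\<Union>c\<in>\<A>. fst c) = UNIV \<and>
     (\<forall>c\<in>\<A>. open (fst c) \<and> open (snd c ` fst c) \<and>
        homeomorphism (fst c) (snd c ` fst c) (snd c) (chart_inv c)) \<and>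
     (\<forall>c\<in>\<A>. \<forall>d\<in>\<A>. (snd d \<circ> chart_inv c) holomorphic_on (snd c ` (fst c \<inter> fst d)))"

definition compact_riemann_surface :: "('x::t2_space) chart set \<Rightarrow> bool" where
  "compact_riemann_surface \<A> \<longleftrightarrow> riemann_surface \<A> \<and> compact (UNIV :: 'x set)"

text \<open>Genus \<open>g\<close> of a compact connected oriented surface: the first integral homology is free
  abelian of rank \<open>2g\<close>.\<close>

definition has_genus :: "'x::t2_space itself \<Rightarrow> nat \<Rightarrow> bool" where
  "has_genus (_ :: 'x itself) g \<longleftrightarrow>
     homology_group 1 (euclidean :: 'x topology) \<cong> free_Abelian_group {..<2 * g}"

text \<open>Smoothness on an open set, by iterated directional derivatives.\<close>

fun k_smooth_on ::
  "nat \<Rightarrow> 'a::real_normed_vector set \<Rightarrow> ('a \<Rightarrow> 'b::real_normed_vector) \<Rightarrow> bool" where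
  "k_smooth_on 0 S f \<longleftrightarrow> continuous_on S f"
| "k_smooth_on (Suc k) S f \<longleftrightarrow>
     (\<forall>x\<in>S. f differentiable (at x)) \<and>
     (\<forall>v. k_smooth_on k S (\<lambda>x. frechet_derivative f (at x) v))"

definition smooth_on ::
  "'a::real_normed_vector set \<Rightarrow> ('a \<Rightarrow> 'b::real_normed_vector) \<Rightarrow> bool" where
  "smooth_on S f \<longleftrightarrow> (\<forall>k. k_smooth_on k S f)"

definition surf_smooth_on ::
  "'x chart set \<Rightarrow> 'x set \<Rightarrow> ('x \<Rightarrow> 'b::real_normed_vector) \<Rightarrow> bool" where
  "surf_smooth_on \<A> U f \<longleftrightarrow>
     (\<forall>c\<in>\<A>. smooth_on (snd c ` (U \<inter> fst c)) (f \<circ> chart_inv c))"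

definition surf_holomorphic_on :: "'x chart set \<Rightarrow> 'x set \<Rightarrow> ('x \<Rightarrow> complex) \<Rightarrow> bool" where
  "surf_holomorphic_on \<A> U f \<longleftrightarrow>
     (\<forall>c\<in>\<A>. (f \<circ> chart_inv c) holomorphic_on (snd c ` (U \<inter> fst c)))"

text \<open>Derivative at \<open>x\<close> of a function on the surface along the tangent vector which the chart
  identifies with \<open>v \<in> \<complex>\<close>; the complex structure of the surface is \<open>v \<mapsto> \<i> * v\<close>.\<close>

definition chart_deriv ::
  "'x chart \<Rightarrow> ('x \<Rightarrow> 'b::real_normed_vector) \<Rightarrow> 'x \<Rightarrow> complex \<Rightarrow> 'b" where
  "chart_deriv c f x v = frechet_derivative (f \<circ> chart_inv c) (at (snd c x)) v"


section \<open>Holomorphic vector bundles\<close>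

text \<open>A bundle of rank \<open>CARD('r)\<close> is given by local trivialisations \<open>(U, t)\<close>, where
  \<open>t x : \<complex>\<^sup>r \<rightarrow> E\<^sub>x\<close> for \<open>x \<in> U\<close>; the vector space structure of the fibre is transported
  along \<open>t x\<close>.\<close>

type_synonym ('x, 'r, 'v) vector_bundle = "('x set \<times> ('x \<Rightarrow> complex^'r \<Rightarrow> 'v)) set"

definition fibre :: "('x, 'r, 'v) vector_bundle \<Rightarrow> 'x \<Rightarrow> 'v set" where
  "fibre E x = (\<Union>(U, t)\<in>{(U, t)\<in>E. x \<in> U}. range (t x))"

definition holomorphic_bundle ::
  "('x::t2_space) chart set \<Rightarrow> ('x, 'r::finite, 'v) vector_bundle \<Rightarrow> bool" where
  "holomorphic_bundle \<A> E \<longleftrightarrow>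
     (\<Union>(U, t)\<in>E. U) = UNIV \<and>
     (\<forall>(U, t)\<in>E. open U \<and> (\<forall>x\<in>U. inj (t x))) \<and>
     (\<forall>(U, t)\<in>E. \<forall>(U', t')\<in>E. \<exists>G :: 'x \<Rightarrow> complex^'r^'r.
        (\<forall>i j. surf_holomorphic_on \<A> (U \<inter> U') (\<lambda>x. G x $ i $ j)) \<and>
        (\<forall>x\<in>U \<inter> U'. \<forall>w. t' x w = t x (G x *v w)))"

definition bundle_hom ::
  "('x::t2_space) chart set \<Rightarrow> ('x, 'r::finite, 'v) vector_bundle \<Rightarrow> ('x, 's::finite, 'w) vector_bundle \<Rightarrow>
     ('x \<Rightarrow> 'v \<Rightarrow> 'w) \<Rightarrow> bool" where
  "bundle_hom \<A> E F f \<longleftrightarrow>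
     (\<forall>(U, t)\<in>E. \<forall>(U', t')\<in>F. \<exists>G :: 'x \<Rightarrow> complex^'r^'s.
        (\<forall>i j. surf_holomorphic_on \<A> (U \<inter> U') (\<lambda>x. G x $ i $ j)) \<and>
        (\<forall>x\<in>U \<inter> U'. \<forall>w. f x (t x w) = t' x (G x *v w)))"

definition bundle_isomorphic ::
  "('x::t2_space) chart set \<Rightarrow> ('x, 'r::finite, 'v) vector_bundle \<Rightarrow> ('x, 's::finite, 'w) vector_bundle \<Rightarrow> bool"
where
  "bundle_isomorphic \<A> E F \<longleftrightarrow>
     (\<exists>f f'. bundle_hom \<A> E F f \<and> bundle_hom \<A> F E f' \<and>
        (\<forall>x. (\<forall>e\<in>fibre E x. f' x (f x e) = e) \<and> (\<forall>e\<in>fibre F x. f x (f' x e) = e)))"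

definition trivial_line :: "('x, 1, complex) vector_bundle" where
  "trivial_line = {(UNIV, \<lambda>x w. w $ 1)}"

text \<open>\<open>0 \<rightarrow> \<complex> \<rightarrow> E \<rightarrow> \<complex> \<rightarrow> 0\<close> is an exact sequence of holomorphic bundles.\<close>

definition extension_of_trivial ::
  "('x::t2_space) chart set \<Rightarrow> ('x, 'r::finite, 'v) vector_bundle \<Rightarrow>
     ('x \<Rightarrow> complex \<Rightarrow> 'v) \<Rightarrow> ('x \<Rightarrow> 'v \<Rightarrow> complex) \<Rightarrow> bool" where
  "extension_of_trivial \<A> E \<iota> \<pi> \<longleftrightarrow>
     holomorphic_bundle \<A> E \<and>
     bundle_hom \<A> trivial_line E \<iota> \<and> bundle_hom \<A> E trivial_line \<pi> \<and>
     (\<forall>x. inj (\<iota> x) \<and> range (\<iota> x) = {e \<in> fibre E x. \<pi> x e = 0} \<and> \<pi> x ` fibre E x = UNIV)"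

definition extension_splits ::
  "('x::t2_space) chart set \<Rightarrow> ('x, 'r::finite, 'v) vector_bundle \<Rightarrow> ('x \<Rightarrow> 'v \<Rightarrow> complex) \<Rightarrow> bool" where
  "extension_splits \<A> E \<pi> \<longleftrightarrow>
     (\<exists>r. bundle_hom \<A> trivial_line E r \<and> (\<forall>x a. \<pi> x (r x a) = a))"

definition nontrivial_extension ::
  "('x::t2_space) chart set \<Rightarrow> ('x, 'r::finite, 'v) vector_bundle \<Rightarrow> bool" where
  "nontrivial_extension \<A> E \<longleftrightarrow>
     (\<exists>\<iota> \<pi>. extension_of_trivial \<A> E \<iota> \<pi> \<and> \<not> extension_splits \<A> E \<pi>)"


section \<open>\<open>Sp(2)\<close> and its Maurer--Cartan form\<close>

text \<open>With \<open>(z\<^sub>0 + j z\<^sub>1, z\<^sub>2 + j z\<^sub>3)\<close> identified with \<open>(z\<^sub>0, z\<^sub>1, z\<^sub>2, z\<^sub>3)\<close> and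
  \<open>\<complex> \<subseteq> \<H>\<close> acting from the right, quaternionic matrices act from the left. The coordinate
  \<open>z\<^sub>k\<close> is the component with index \<open>k + 1\<close>.\<close>

definition adj :: "complex^'n^'m \<Rightarrow> complex^'m^'n" where
  "adj A = (\<chi> i k. cnj (A $ k $ i))"

text \<open>Right multiplication by \<open>j\<close>: \<open>(z\<^sub>0 + j z\<^sub>1) j = - cnj z\<^sub>1 + j cnj z\<^sub>0\<close>.\<close>

definition right_j :: "complex^4 \<Rightarrow> complex^4" where
  "right_j z = vector [- cnj (z $ 2), cnj (z $ 1), - cnj (z $ 4), cnj (z $ 3)]"

definition Sp2 :: "(complex^4^4) set" where
  "Sp2 = {A. adj A ** A = mat 1 \<and> (\<forall>z. A *v right_j z = right_j (A *v z))}"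

definition sp2 :: "(complex^4^4) set" where
  "sp2 = {A. adj A = - A \<and> (\<forall>z. A *v right_j z = right_j (A *v z))}"

text \<open>The complex matrix of a quaternionic \<open>2 \<times> 2\<close> matrix, a pair \<open>(a, b)\<close> standing for
  \<open>a + j b\<close>: \<open>(a + j b) (z\<^sub>0 + j z\<^sub>1) = (a z\<^sub>0 - cnj b z\<^sub>1) + j (b z\<^sub>0 + cnj a z\<^sub>1)\<close>.\<close>

fun quat_matrix ::
  "complex \<times> complex \<Rightarrow> complex \<times> complex \<Rightarrow> complex \<times> complex \<Rightarrow> complex \<times> complex \<Rightarrow>
     complex^4^4" where
  "quat_matrix (a, b) (c, d) (e, f) (g, h) = vector [
     vector [a, - cnj b, c, - cnj d],
     vector [b, cnj a, d, cnj c],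
     vector [e, - cnj f, g, - cnj h],
     vector [f, cnj e, h, cnj g]]"

definition maurer_cartan ::
  "real \<Rightarrow> real \<Rightarrow> complex \<Rightarrow> complex \<Rightarrow> complex \<Rightarrow> complex \<Rightarrow> complex^4^4" where
  "maurer_cartan r1 r2 w1 w2 w3 t = quat_matrix
     (\<i> * of_real r1, cnj w3)                        (- cnj w1 / of_real (sqrt 2), w2 / of_real (sqrt 2))
     (w1 / of_real (sqrt 2), w2 / of_real (sqrt 2))  (\<i> * of_real r2, t)"

text \<open>The entries of the Maurer--Cartan form as functions on \<open>sp(2)\<close>; see
  \<open>maurer_cartan_components\<close> below.\<close>

definition rho1 :: "complex^4^4 \<Rightarrow> real" where "rho1 \<Omega> = Im (\<Omega> $ 1 $ 1)"
definition rho2 :: "complex^4^4 \<Rightarrow> real" where "rho2 \<Omega> = Im (\<Omega> $ 3 $ 3)"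
definition omega1 :: "complex^4^4 \<Rightarrow> complex" where "omega1 \<Omega> = of_real (sqrt 2) * \<Omega> $ 3 $ 1"
definition omega2 :: "complex^4^4 \<Rightarrow> complex" where "omega2 \<Omega> = of_real (sqrt 2) * \<Omega> $ 4 $ 1"
definition omega3 :: "complex^4^4 \<Rightarrow> complex" where "omega3 \<Omega> = cnj (\<Omega> $ 2 $ 1)"
definition tau :: "complex^4^4 \<Rightarrow> complex" where "tau \<Omega> = \<Omega> $ 4 $ 3"

definition kappa :: "complex^4^4 \<Rightarrow> complex^3^3" where
  "kappa \<Omega> = vector [
     vector [\<i> * of_real (rho2 \<Omega> - rho1 \<Omega>), - cnj (tau \<Omega>), 0],
     vector [tau \<Omega>, - \<i> * of_real (rho1 \<Omega> + rho2 \<Omega>), 0],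
     vector [0, 0, 2 * \<i> * of_real (rho1 \<Omega>)]]"


section \<open>Nearly Kaehler \<open>\<complex>P\<^sup>3\<close>\<close>

text \<open>\<open>\<complex>P\<^sup>3\<close> is the submanifold of orthogonal projectors of rank one (a line corresponds to the
  projector onto it), on which \<open>Sp(2)\<close> acts by conjugation.\<close>

definition CP3 :: "(complex^4^4) set" where
  "CP3 = {P. adj P = P \<and> P ** P = P \<and> trace P = 1}"

definition tangent_CP3 :: "complex^4^4 \<Rightarrow> (complex^4^4) set" where
  "tangent_CP3 P = {A. adj A = A \<and> A ** P + P ** A = A}"

definition base_point :: "complex^4^4" where
  "base_point = (\<chi> i k. if i = 1 \<and> k = 1 then 1 else 0)"

definition orbit_map :: "complex^4^4 \<Rightarrow> complex^4^4" where
  "orbit_map s = s ** base_point ** adj s"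

text \<open>\<open>frame s c\<close> is \<open>\<Sum>\<^sub>a c\<^sub>a e\<^sub>a\<close>, where \<open>(e\<^sub>1, e\<^sub>2, e\<^sub>3)\<close> is the frame at \<open>orbit_map s\<close> dual to the
  forms \<open>\<omega>\<^sub>a\<close> pulled back along a local section through \<open>s\<close>. The differential of
  \<open>orbit_map\<close> at \<open>s\<close> sends \<open>s \<Omega>\<close> to \<open>s [\<Omega>, base_point] s\<^sup>*\<close>, and \<open>[\<Omega>, base_point]\<close> and \<open>\<Omega>\<close>
  have the same entries in the first column below the diagonal, where the \<open>\<omega>\<^sub>a\<close> are read off.\<close>

definition frame :: "complex^4^4 \<Rightarrow> complex^3 \<Rightarrow> complex^4^4" where
  "frame s c = (let \<Omega> = maurer_cartan 0 0 (c $ 1) (c $ 2) (c $ 3) 0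
                in s ** (\<Omega> ** base_point - base_point ** \<Omega>) ** adj s)"

definition coframe :: "complex^4^4 \<Rightarrow> complex^4^4 \<Rightarrow> complex^3" where
  "coframe s A = (let B = adj s ** A ** s in vector [omega1 B, omega2 B, omega3 B])"

definition nk_J :: "complex^4^4 \<Rightarrow> complex^4^4 \<Rightarrow> complex^4^4" where
  "nk_J P A = (THE B. B \<in> tangent_CP3 P \<and>
     (\<forall>s\<in>Sp2. orbit_map s = P \<longrightarrow> coframe s B = \<i> *s coframe s A))"

definition nk_g :: "complex^4^4 \<Rightarrow> complex^4^4 \<Rightarrow> complex^4^4 \<Rightarrow> real" where
  "nk_g P A B = (THE r. \<forall>s\<in>Sp2. orbit_map s = P \<longrightarrow>
     r = (\<Sum>a\<in>UNIV. Re (coframe s A $ a * cnj (coframe s B $ a))))"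

text \<open>Consistency of the conventions above.\<close>

lemma vector_4_nth [simp]:
  "(vector [a,b,c,d] :: 'a::zero^4) $ 1 = a" "(vector [a,b,c,d] :: 'a^4) $ 2 = b"
  "(vector [a,b,c,d] :: 'a^4) $ 3 = c" "(vector [a,b,c,d] :: 'a^4) $ 4 = d"
  by (simp_all add: vector_def)

lemma adj_mult: "adj (A ** B) = adj B ** adj (A :: complex^'k::finite^'m)"
  for B :: "complex^'n^'k"
  by (simp add: adj_def matrix_matrix_mult_def vec_eq_iff mult.commute)

lemma adj_adj [simp]: "adj (adj A) = A"
  by (simp add: adj_def vec_eq_iff)

lemma quaternionic_entries:
  assumes "\<forall>z. A *v right_j z = right_j (A *v z)"
  shows "A $ 1 $ 2 = - cnj (A $ 2 $ 1)" "A $ 2 $ 2 = cnj (A $ 1 $ 1)"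
    "A $ 3 $ 2 = - cnj (A $ 4 $ 1)" "A $ 4 $ 2 = cnj (A $ 3 $ 1)"
    "A $ 1 $ 4 = - cnj (A $ 2 $ 3)" "A $ 2 $ 4 = cnj (A $ 1 $ 3)"
    "A $ 3 $ 4 = - cnj (A $ 4 $ 3)" "A $ 4 $ 4 = cnj (A $ 3 $ 3)"
  using assms[rule_format, of "vector [1,0,0,0]"] assms[rule_format, of "vector [0,0,1,0]"]
  by (simp_all add: vec_eq_iff forall_4 right_j_def matrix_vector_mult_def sum_4)

lemma maurer_cartan_components:
  assumes "\<Omega> \<in> sp2"
  shows "\<Omega> = maurer_cartan (rho1 \<Omega>) (rho2 \<Omega>) (omega1 \<Omega>) (omega2 \<Omega>) (omega3 \<Omega>) (tau \<Omega>)"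
proof -
  have q: "\<forall>z. \<Omega> *v right_j z = right_j (\<Omega> *v z)" and "adj \<Omega> = - \<Omega>"
    using assms by (auto simp: sp2_def)
  then have s: "cnj (\<Omega> $ k $ i) = - \<Omega> $ i $ k" for i k
    by (metis (no_types, lifting) adj_def vec_lambda_beta vector_uminus_component)
  show ?thesis
    using s[of 1 1] s[of 3 3] s[of 3 1] s[of 4 1] s[of 1 3] s[of 2 3] s[of 3 2] s[of 4 2]
      s[of 2 1] s[of 1 2] s[of 4 3] s[of 3 4]
    by (simp add: vec_eq_iff forall_4 maurer_cartan_def rho1_def rho2_def omega1_def omega2_def
        omega3_def tau_def quaternionic_entries[OF q])
       (auto simp: complex_eq_iff)
qed

lemma matrix_add_rdistrib': "(A + B) ** C = A ** C + B ** (C :: complex^'k::finite^'m::finite)"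
  for A B :: "complex^'m^'n::finite"
  by (simp add: matrix_matrix_mult_def vec_eq_iff distrib_right sum.distrib)

lemma Sp2_inverse: "s \<in> Sp2 \<Longrightarrow> adj s ** s = mat 1" "s \<in> Sp2 \<Longrightarrow> s ** adj s = mat 1"
  by (auto simp: Sp2_def matrix_left_right_inverse)

lemma Sp2_cancel:
  assumes "s \<in> Sp2" shows "adj s ** (s ** X) = X" "s ** (adj s ** X) = X"
  using Sp2_inverse[OF assms] by (simp_all add: matrix_mul_assoc)

lemma conj_cancel:
  assumes "s \<in> Sp2"
  shows "adj s ** (s ** B ** adj s) ** s = B" "s ** (adj s ** B ** s) ** adj s = B"
  by (simp_all add: matrix_mul_assoc[symmetric] Sp2_cancel[OF assms] Sp2_inverse[OF assms])

lemma coframe_frame: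
  assumes "s \<in> Sp2" shows "coframe s (frame s c) = c"
  unfolding coframe_def frame_def Let_def conj_cancel(1)[OF assms]
  by (simp add: vec_eq_iff forall_3 vector_3 omega1_def omega2_def omega3_def
      matrix_matrix_mult_def sum_4 base_point_def maurer_cartan_def)

lemma adj_base [simp]: "adj base_point = base_point"
  by (auto simp: adj_def base_point_def vec_eq_iff)

lemma frame_tangent:
  assumes "s \<in> Sp2" shows "frame s c \<in> tangent_CP3 (orbit_map s)"
proof -
  define O' where "O' = maurer_cartan 0 0 (c $ 1) (c $ 2) (c $ 3) 0"
  define B where "B = O' ** base_point - base_point ** O'"
  have B1: "adj B = B" and B2: "B ** base_point + base_point ** B = B"
    by (simp_all add: B_def O'_def vec_eq_iff forall_4 adj_def matrix_matrix_mult_def sum_4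
        base_point_def maurer_cartan_def)
  have f: "frame s c = s ** B ** adj s" by (simp add: frame_def B_def O'_def Let_def)
  have "frame s c ** orbit_map s = s ** (B ** base_point) ** adj s"
    and "orbit_map s ** frame s c = s ** (base_point ** B) ** adj s"
    unfolding f orbit_map_def
    by (simp_all add: matrix_mul_assoc[symmetric] Sp2_cancel[OF assms])
  then have "frame s c ** orbit_map s + orbit_map s ** frame s c
      = s ** (B ** base_point + base_point ** B) ** adj s"
    by (simp add: matrix_add_ldistrib matrix_add_rdistrib')
  then show ?thesis
    using B1 B2 by (simp add: tangent_CP3_def f adj_mult matrix_mul_assoc)
qed

lemma frame_coframe:
  assumes "s \<in> Sp2" "A \<in> tangent_CP3 (orbit_map s)"
  shows "frame s (coframe s A) = A"
proof -
  define B where "B = adj s ** A ** s"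
  have A: "A = s ** B ** adj s" by (simp add: B_def conj_cancel[OF assms(1)])
  have t: "adj A = A" "A ** orbit_map s + orbit_map s ** A = A"
    using assms(2) by (auto simp: tangent_CP3_def)
  have "adj B = B" by (simp add: B_def adj_mult t matrix_mul_assoc)
  then have B1: "cnj (B $ k $ i) = B $ i $ k" for i k
    by (metis (no_types, lifting) adj_def vec_lambda_beta)
  have "B = adj s ** (A ** orbit_map s + orbit_map s ** A) ** s"
    using t by (simp add: B_def)
  also have "\<dots> = adj s ** (A ** orbit_map s) ** s + adj s ** (orbit_map s ** A) ** s"
    by (simp add: matrix_add_ldistrib matrix_add_rdistrib')
  also have "\<dots> = B ** base_point + base_point ** B"
    unfolding orbit_map_def B_def
    by (simp add: matrix_mul_assoc[symmetric] Sp2_cancel[OF assms(1)] Sp2_inverse[OF assms(1)])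
  finally have B2: "B = B ** base_point + base_point ** B" .
  have "(B ** base_point + base_point ** B) $ i $ k
      = (if k = 1 then B $ i $ 1 else 0) + (if i = 1 then B $ 1 $ k else 0)" for i k
    by (simp add: matrix_matrix_mult_def base_point_def sum_4)
  then have e: "B $ i $ k = (if k = 1 then B $ i $ 1 else 0) + (if i = 1 then B $ 1 $ k else 0)"
    for i k
    by (simp flip: B2)
  have z: "B $ 1 $ 1 = 0" "i \<noteq> 1 \<Longrightarrow> k \<noteq> 1 \<Longrightarrow> B $ i $ k = 0" for i k
    using e[of 1 1] e[of i k] by auto
  define c where "c = coframe s A"
  have c: "c $ 1 = omega1 B" "c $ 2 = omega2 B" "c $ 3 = omega3 B"
    by (simp_all add: c_def coframe_def B_def Let_def vector_3)
  have "maurer_cartan 0 0 (c $ 1) (c $ 2) (c $ 3) 0 ** base_point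
      - base_point ** maurer_cartan 0 0 (c $ 1) (c $ 2) (c $ 3) 0 = B"
    unfolding c
    by (simp add: vec_eq_iff forall_4 matrix_matrix_mult_def sum_4 base_point_def maurer_cartan_def
        omega1_def omega2_def omega3_def z B1)
  then show ?thesis
    unfolding c_def[symmetric] frame_def Let_def using A by simp
qed

lemma Sp2_closed: assumes "s \<in> Sp2" "s' \<in> Sp2" shows "adj s' ** s \<in> Sp2"
proof -
  have "adj s' *v right_j z = right_j (adj s' *v z)" for z
  proof -
    have "s' *v right_j (adj s' *v z) = right_j (s' *v (adj s' *v z))"
      using assms(2) by (simp add: Sp2_def)
    also have "\<dots> = right_j z"
      by (simp add: matrix_vector_mul_assoc Sp2_inverse assms)
    finally have "adj s' *v (s' *v right_j (adj s' *v z)) = adj s' *v right_j z" by simp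
    then show ?thesis by (simp add: matrix_vector_mul_assoc Sp2_inverse assms)
  qed
  moreover have "adj (adj s' ** s) ** (adj s' ** s) = mat 1"
    by (simp add: adj_mult matrix_mul_assoc[symmetric] Sp2_cancel[OF assms(2)]
        Sp2_inverse[OF assms(1)])
  ultimately show ?thesis using assms
    by (simp add: Sp2_def matrix_vector_mul_assoc[symmetric])
qed

text \<open>Two lifts of the same point differ by an element \<open>diag(z, q)\<close> of the stabiliser, which
  acts on the coframe by a unitary map.\<close>

lemma coframe_change:
  assumes "s \<in> Sp2" "s' \<in> Sp2" "orbit_map s = orbit_map s'"
  obtains h :: "complex^3^3" where "adj h ** h = mat 1" "\<And>A. coframe s' A = h *v coframe s A"
proof -
  define k where "k = adj s' ** s"
  have k: "k \<in> Sp2" unfolding k_def by (rule Sp2_closed[OF assms(1,2)])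
  have "k ** base_point = base_point ** k"
  proof -
    have "k ** base_point = adj s' ** (s ** base_point ** adj s) ** s"
      unfolding k_def by (simp add: matrix_mul_assoc[symmetric] Sp2_inverse[OF assms(1)])
    also have "\<dots> = adj s' ** (s' ** base_point ** adj s') ** s"
      using assms(3) by (simp add: orbit_map_def)
    also have "\<dots> = base_point ** k"
      unfolding k_def by (simp add: matrix_mul_assoc[symmetric] Sp2_cancel[OF assms(2)])
    finally show ?thesis .
  qed
  then have z0: "k $ 2 $ 1 = 0" "k $ 3 $ 1 = 0" "k $ 4 $ 1 = 0" "k $ 1 $ 3 = 0" "k $ 1 $ 4 = 0"
    by (simp_all add: vec_eq_iff forall_4 matrix_matrix_mult_def sum_4 base_point_def)
  have "mat 1 \<in> Sp2"
    by (simp add: Sp2_def) (simp add: adj_def mat_def matrix_matrix_mult_def vec_eq_iff forall_4 sum_4)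
  then have "adj k \<in> Sp2"
    using Sp2_closed[of "mat 1" k] k by simp
  then have qa: "\<forall>z. adj k *v right_j z = right_j (adj k *v z)" by (simp add: Sp2_def)
  have q: "\<forall>z. k *v right_j z = right_j (k *v z)" using k by (simp add: Sp2_def)
  note e = quaternionic_entries[OF q]
  have "adj k $ 3 $ 2 = 0" "adj k $ 4 $ 2 = 0"
    unfolding quaternionic_entries[OF qa] using z0 by (simp_all add: adj_def)
  then have z1: "k $ 2 $ 3 = 0" "k $ 2 $ 4 = 0" by (simp_all add: adj_def)
  define h :: "complex^3^3" where "h = vector [
    vector [k $ 3 $ 3 * cnj (k $ 1 $ 1), k $ 3 $ 4 * cnj (k $ 1 $ 1), 0],
    vector [k $ 4 $ 3 * cnj (k $ 1 $ 1), k $ 4 $ 4 * cnj (k $ 1 $ 1), 0],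
    vector [0, 0, cnj (k $ 2 $ 2) * k $ 1 $ 1]]"
  have "adj k ** k = mat 1" using Sp2_inverse[OF k] by auto
  then have l: "(adj k ** k) $ i $ j = (if i = j then 1 else 0)" for i j
    by (simp add: mat_def)
  have u: "cnj (k $ 1 $ 1) * k $ 1 $ 1 = 1" "cnj (k $ 2 $ 2) * k $ 2 $ 2 = 1"
    "cnj (k $ 3 $ 3) * k $ 3 $ 3 + cnj (k $ 4 $ 3) * k $ 4 $ 3 = 1"
    "cnj (k $ 3 $ 4) * k $ 3 $ 4 + cnj (k $ 4 $ 4) * k $ 4 $ 4 = 1"
    "cnj (k $ 3 $ 3) * k $ 3 $ 4 + cnj (k $ 4 $ 3) * k $ 4 $ 4 = 0"
    "cnj (k $ 3 $ 4) * k $ 3 $ 3 + cnj (k $ 4 $ 4) * k $ 4 $ 3 = 0"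
    using l[of 1 1] l[of 2 2] l[of 3 3] l[of 4 4] l[of 3 4] l[of 4 3]
    by (simp_all only: matrix_matrix_mult_def adj_def sum_4 z0 z1 e vec_lambda_beta)
       (simp_all add: z0 z1 mult.commute)
  have "adj h ** h = mat 1"
  proof -
    have 1: "cnj (k $ a $ b * cnj (k $ 1 $ 1)) * (k $ c $ d * cnj (k $ 1 $ 1))
      = (cnj (k $ 1 $ 1) * k $ 1 $ 1) * (cnj (k $ a $ b) * k $ c $ d)" for a b c d
      by (simp add: mult_ac)
    have 2: "cnj (cnj (k $ 2 $ 2) * k $ 1 $ 1) * (cnj (k $ 2 $ 2) * k $ 1 $ 1)
      = (cnj (k $ 1 $ 1) * k $ 1 $ 1) * (cnj (k $ 2 $ 2) * k $ 2 $ 2)"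
      by (simp add: mult_ac)
    show ?thesis
      by (simp only: vec_eq_iff forall_3 matrix_matrix_mult_def adj_def sum_3 h_def vector_3
          vec_lambda_beta mat_def 1 2 u) (simp add: u)
  qed
  moreover have "coframe s' A = h *v coframe s A" for A
  proof -
    define B where "B = adj s ** A ** s"
    have "adj s' ** A ** s' = k ** B ** adj k"
      unfolding k_def B_def
      by (simp add: adj_mult matrix_mul_assoc[symmetric] Sp2_cancel[OF assms(1)])
    moreover have "k $ 3 $ 2 = 0" "k $ 4 $ 2 = 0" "k $ 1 $ 2 = 0"
      using e z0 by simp_all
    ultimately show ?thesis
      using z0 z1
      by (simp add: coframe_def Let_def flip: B_def)
         (simp add: vec_eq_iff forall_3 vector_3 h_def matrix_vector_mult_def sum_3 sum_4
           matrix_matrix_mult_def adj_def omega1_def omega2_def omega3_def algebra_simps)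
  qed
  ultimately show ?thesis using that by blast
qed

text \<open>The requirements determining \<open>J\<close> and \<open>g\<close> are consistent.\<close>

lemma nk_J_eq:
  assumes "s \<in> Sp2" "A \<in> tangent_CP3 (orbit_map s)"
  shows "nk_J (orbit_map s) A = frame s (\<i> *s coframe s A)"
  unfolding nk_J_def
proof (rule the_equality)
  let ?B = "frame s (\<i> *s coframe s A)"
  have "coframe s' ?B = \<i> *s coframe s' A" if s': "s' \<in> Sp2" "orbit_map s' = orbit_map s" for s'
  proof -
    obtain h where "\<And>A. coframe s' A = h *v coframe s A"
      using coframe_change[OF assms(1) s'(1) s'(2)[symmetric]] by metis
    then show ?thesis
      by (simp add: coframe_frame assms(1) vec_eq_iff matrix_vector_mult_def sum_distrib_left
          mult_ac)
  qed
  then show "?B \<in> tangent_CP3 (orbit_map s) \<and>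
    (\<forall>s'\<in>Sp2. orbit_map s' = orbit_map s \<longrightarrow> coframe s' ?B = \<i> *s coframe s' A)"
    using frame_tangent[OF assms(1)] by blast
next
  fix B assume "B \<in> tangent_CP3 (orbit_map s) \<and>
    (\<forall>s'\<in>Sp2. orbit_map s' = orbit_map s \<longrightarrow> coframe s' B = \<i> *s coframe s' A)"
  then show "B = frame s (\<i> *s coframe s A)"
    using frame_coframe[OF assms(1)] assms(1) by metis
qed

lemma nk_g_eq:
  assumes "s \<in> Sp2"
  shows "nk_g (orbit_map s) A B = (\<Sum>a\<in>UNIV. Re (coframe s A $ a * cnj (coframe s B $ a)))"
  unfolding nk_g_def
proof (rule the_equality)
  have "(\<Sum>a\<in>UNIV. Re (coframe s' A $ a * cnj (coframe s' B $ a)))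
      = (\<Sum>a\<in>UNIV. Re (coframe s A $ a * cnj (coframe s B $ a)))"
    if s': "s' \<in> Sp2" "orbit_map s' = orbit_map s" for s'
  proof -
    obtain h :: "complex^3^3" where h: "adj h ** h = mat 1" "\<And>A. coframe s' A = h *v coframe s A"
      using coframe_change[OF assms s'(1) s'(2)[symmetric]] by metis
    have "(adj h ** h) $ i $ j = (if i = j then 1 else 0)" for i j
      by (simp add: h mat_def)
    then have o: "(\<Sum>a\<in>UNIV. h $ a $ j * cnj (h $ a $ i)) = (if i = j then 1 else 0)" for i j
      by (simp add: matrix_matrix_mult_def adj_def mult.commute)
    let ?x = "coframe s A" and ?y = "coframe s B"
    have "(\<Sum>a\<in>UNIV. (h *v ?x) $ a * cnj ((h *v ?y) $ a))
      = (\<Sum>a\<in>UNIV. \<Sum>j\<in>UNIV. \<Sum>i\<in>UNIV. (h $ a $ j * cnj (h $ a $ i)) * (?x $ j * cnj (?y $ i)))"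
      by (simp add: matrix_vector_mult_def sum_product mult_ac)
    also have "\<dots> = (\<Sum>j\<in>UNIV. \<Sum>i\<in>UNIV. (\<Sum>a\<in>UNIV. h $ a $ j * cnj (h $ a $ i)) * (?x $ j * cnj (?y $ i)))"
      unfolding sum_distrib_right by (subst sum.swap, rule sum.cong[OF refl], rule sum.swap)
    also have "\<dots> = (\<Sum>j\<in>UNIV. ?x $ j * cnj (?y $ j))"
      by (simp add: o if_distrib if_distribR cong: if_cong)
    finally show ?thesis unfolding h(2) Re_sum[symmetric] by (rule arg_cong)
  qed
  then show "\<forall>s'\<in>Sp2. orbit_map s' = orbit_map s \<longrightarrow>
    (\<Sum>a\<in>UNIV. Re (coframe s A $ a * cnj (coframe s B $ a)))
      = (\<Sum>a\<in>UNIV. Re (coframe s' A $ a * cnj (coframe s' B $ a)))"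
    by simp
qed (use assms in blast)

definition vertical :: "complex^4^4 \<Rightarrow> (complex^4^4) set" where
  "vertical P = {A \<in> tangent_CP3 P. \<forall>s\<in>Sp2. orbit_map s = P \<longrightarrow>
     coframe s A $ 1 = 0 \<and> coframe s A $ 2 = 0}"

definition horizontal :: "complex^4^4 \<Rightarrow> (complex^4^4) set" where
  "horizontal P = {A \<in> tangent_CP3 P. \<forall>s\<in>Sp2. orbit_map s = P \<longrightarrow> coframe s A $ 3 = 0}"


section \<open>Curves\<close>

text \<open>\<open>curve_tangent\<close> is the image of the differential of \<open>\<phi>\<close> at \<open>x\<close>.\<close>

definition curve_tangent ::
  "'x chart set \<Rightarrow> ('x \<Rightarrow> complex^4^4) \<Rightarrow> 'x \<Rightarrow> (complex^4^4) set" where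
  "curve_tangent \<A> \<phi> x = {chart_deriv c \<phi> x v | c v. c \<in> \<A> \<and> x \<in> fst c}"

definition J_holomorphic_curve ::
  "'x chart set \<Rightarrow> ('x \<Rightarrow> complex^4^4) \<Rightarrow> bool" where
  "J_holomorphic_curve \<A> \<phi> \<longleftrightarrow>
     (\<forall>x. \<phi> x \<in> CP3) \<and> surf_smooth_on \<A> UNIV \<phi> \<and>
     (\<forall>c\<in>\<A>. \<forall>x\<in>fst c. \<forall>v.
        chart_deriv c \<phi> x (\<i> * v) = nk_J (\<phi> x) (chart_deriv c \<phi> x v))"

text \<open>Local sections of the pullback of \<open>Sp(2) \<rightarrow> \<complex>P\<^sup>3\<close> along \<open>\<phi>\<close>, and the pullback of the
  Maurer--Cartan form along them.\<close>

definition local_lift ::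
  "('x::t2_space) chart set \<Rightarrow> ('x \<Rightarrow> complex^4^4) \<Rightarrow> 'x set \<Rightarrow> ('x \<Rightarrow> complex^4^4) \<Rightarrow> bool" where
  "local_lift \<A> \<phi> V s \<longleftrightarrow>
     open V \<and> surf_smooth_on \<A> V s \<and> (\<forall>x\<in>V. s x \<in> Sp2 \<and> orbit_map (s x) = \<phi> x)"

definition mc_pullback ::
  "'x chart \<Rightarrow> ('x \<Rightarrow> complex^4^4) \<Rightarrow> 'x \<Rightarrow> complex \<Rightarrow> complex^4^4" where
  "mc_pullback c s x v = adj (s x) ** chart_deriv c s x v"

text \<open>Local sections of the \<open>S\<^sup>1 \<times> S\<^sup>1\<close>-reduction cut out by \<open>\<omega>\<^sub>2 = 0\<close>.\<close>

definition adapted_lift ::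
  "('x::t2_space) chart set \<Rightarrow> ('x \<Rightarrow> complex^4^4) \<Rightarrow> 'x set \<Rightarrow> ('x \<Rightarrow> complex^4^4) \<Rightarrow> bool" where
  "adapted_lift \<A> \<phi> V s \<longleftrightarrow> local_lift \<A> \<phi> V s \<and>
     (\<forall>c\<in>\<A>. \<forall>x\<in>V \<inter> fst c. \<forall>v. omega2 (mc_pullback c s x v) = 0)"

definition transverse_curve ::
  "('x::t2_space) chart set \<Rightarrow> ('x \<Rightarrow> complex^4^4) \<Rightarrow> bool" where
  "transverse_curve \<A> \<phi> \<longleftrightarrow>
     (\<forall>x. \<not> curve_tangent \<A> \<phi> x \<subseteq> horizontal (\<phi> x)) \<and>
     (\<forall>x. \<not> curve_tangent \<A> \<phi> x \<subseteq> vertical (\<phi> x)) \<and>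
     (\<forall>V s. adapted_lift \<A> \<phi> V s \<longrightarrow>
        (\<forall>c\<in>\<A>. \<forall>x\<in>V \<inter> fst c. \<exists>v. tau (mc_pullback c s x v) \<noteq> 0))"


section \<open>The normal bundle\<close>

text \<open>The normal bundle of \<open>TX\<close> is realised as the orthogonal complement.\<close>

definition normal_space ::
  "'x chart set \<Rightarrow> ('x \<Rightarrow> complex^4^4) \<Rightarrow> 'x \<Rightarrow> (complex^4^4) set" where
  "normal_space \<A> \<phi> x =
     {A \<in> tangent_CP3 (\<phi> x). \<forall>B\<in>curve_tangent \<A> \<phi> x. nk_g (\<phi> x) A B = 0}"

definition normal_proj ::
  "'x chart set \<Rightarrow> ('x \<Rightarrow> complex^4^4) \<Rightarrow> 'x \<Rightarrow> complex^4^4 \<Rightarrow> complex^4^4" where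
  "normal_proj \<A> \<phi> x A =
     (THE B. B \<in> normal_space \<A> \<phi> x \<and> A - B \<in> curve_tangent \<A> \<phi> x)"

text \<open>The pulled-back nearly Kaehler connection, computed in the frame belonging to a local
  lift \<open>s\<close>: for \<open>\<sigma> = \<Sum>\<^sub>b \<sigma>\<^sub>b e\<^sub>b\<close> it is \<open>\<Sum>\<^sub>a (d\<sigma>\<^sub>a + \<Sum>\<^sub>b \<kappa>\<^sub>a\<^sub>b \<sigma>\<^sub>b) e\<^sub>a\<close>. It does not depend on the choice
  of \<open>s\<close>.\<close>

definition nk_connection ::
  "'x chart \<Rightarrow> ('x \<Rightarrow> complex^4^4) \<Rightarrow> ('x \<Rightarrow> complex^4^4) \<Rightarrow> 'x \<Rightarrow> complex \<Rightarrow> complex^4^4" where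
  "nk_connection c s \<sigma> x v = frame (s x)
     (chart_deriv c (\<lambda>y. coframe (s y) (\<sigma> y)) x v
      + kappa (mc_pullback c s x v) *v coframe (s x) (\<sigma> x))"

definition normal_connection ::
  "'x chart set \<Rightarrow> ('x \<Rightarrow> complex^4^4) \<Rightarrow> 'x chart \<Rightarrow>
     ('x \<Rightarrow> complex^4^4) \<Rightarrow> ('x \<Rightarrow> complex^4^4) \<Rightarrow> 'x \<Rightarrow> complex \<Rightarrow> complex^4^4" where
  "normal_connection \<A> \<phi> c s \<sigma> x v = normal_proj \<A> \<phi> x (nk_connection c s \<sigma> x v)"

text \<open>Smooth sections of the normal bundle over \<open>U\<close> annihilated by the \<open>(0,1)\<close>-part
  \<open>(\<nabla>\<^sub>v + J \<nabla>\<^sub>i\<^sub>v) / 2\<close> of the normal connection.\<close>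

definition normal_holomorphic ::
  "('x::t2_space) chart set \<Rightarrow> ('x \<Rightarrow> complex^4^4) \<Rightarrow> 'x set \<Rightarrow> ('x \<Rightarrow> complex^4^4) \<Rightarrow> bool" where
  "normal_holomorphic \<A> \<phi> U \<sigma> \<longleftrightarrow>
     surf_smooth_on \<A> U \<sigma> \<and> (\<forall>x\<in>U. \<sigma> x \<in> normal_space \<A> \<phi> x) \<and>
     (\<forall>V s. local_lift \<A> \<phi> V s \<longrightarrow> (\<forall>c\<in>\<A>. \<forall>x\<in>U \<inter> V \<inter> fst c. \<forall>v.
        normal_connection \<A> \<phi> c s \<sigma> x v
        + nk_J (\<phi> x) (normal_connection \<A> \<phi> c s \<sigma> x (\<i> * v)) = 0))"

text \<open>All trivialisations of the normal bundle, complex linear with respect to \<open>J\<close>, by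
  holomorphic local frames.\<close>

definition normal_bundle ::
  "('x::t2_space) chart set \<Rightarrow> ('x \<Rightarrow> complex^4^4) \<Rightarrow> ('x, 2, complex^4^4) vector_bundle" where
  "normal_bundle \<A> \<phi> = {(U, t). open U \<and>
     (\<forall>x\<in>U. bij_betw (t x) UNIV (normal_space \<A> \<phi> x) \<and>
        (\<forall>w w'. t x (w + w') = t x w + t x w') \<and>
        (\<forall>a w. t x (a *s w) = Re a *\<^sub>R t x w + Im a *\<^sub>R nk_J (\<phi> x) (t x w))) \<and>
     (\<forall>w. normal_holomorphic \<A> \<phi> U (\<lambda>x. t x w))}"

end

theory Submission
  imports Defs "HOL-Complex_Analysis.Complex_Analysis"
begin

text \<open>
  In a lift to \<open>Sp(2)\<close> adapted to the curve write \<open>a\<close>, \<open>b\<close>, \<open>t\<close> for the values of \<open>\<omega>\<^sub>1\<close>, \<open>\<omega>\<^sub>3\<close>, \<open>\<tau>\<close> on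
  the coordinate vector field. By the structure equations \<open>a\<^sup>2 b t\<close> is a holomorphic quartic
  differential; it does not depend on the lift and has no zeros. Coordinates in which it
  equals 1 develop to a covering \<open>p\<close> of the surface by the plane whose deck transformations are
  translations.

  Over the plane the normal bundle has the coordinates \<open>\<gamma> = c\<^sub>1/a - c\<^sub>3/b\<close> and \<open>\<beta> = c\<^sub>2/(a t)\<close>, and a section
  is holomorphic iff \<open>\<partial>\<beta>/\<partial>cnj z = 0\<close> and \<open>\<partial>\<gamma>/\<partial>cnj z = |t|\<^sup>2 \<beta>\<close>. So \<open>\<beta>\<close> and \<open>\<gamma>\<close> give the projection and the
  inclusion of an extension of the trivial bundle by itself. Its class is the average of \<open>|t|\<^sup>2\<close>,
  which is positive.

  On the other side, a partition of unity and the solution of the Cauchy--Riemann equation on a torus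
  by Fourier series bring every such extension into a normal form over the plane: deck
  transformations act by unipotent matrices with off-diagonal entry \<open>- m cnj \<lambda>\<close>. The
  extension splits iff \<open>m = 0\<close>, and rescaling identifies all extensions with \<open>m \<noteq> 0\<close>.
\<close>

text \<open>The exponents in a^2 b t come from the residual torus: a change of adapted lift
  multiplies a, b, t by cnj k1 k3, k1^2, cnj k3^2 with k1, k3 unimodular. The same weights make
  c_1/a, c_3/b and c_2/(a t) independent of the lift; the first two are subtracted because (a, 0, b)
  spans the tangent line. Since tau is of type (1,0), the (0,1)-part of the connection keeps only
  its entry - cnj t off the diagonal, and this entry survives as |t|^2.

  Frames exist only locally and up to the torus, so everything is moved to the plane, where the
  invariant coordinates give one frame. Only two independent periods of p are known, and the deck
  group may be larger than the lattice they span; solutions periodic under that lattice must still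
  be shown to descend.

  On a torus dbar f = g has a periodic solution only for g of mean zero, so the mean m needs the
  non-periodic primitive m cnj z, whose increment under a deck translation is the off-diagonal entry
  up to sign. One scalar thus carries the class, and diag(m'/m, 1) identifies any two nonzero
  values.\<close>

no_notation fps_nth (infixl "$" 75)

section \<open>Calculus of smooth functions\<close>

lemma frechet_derivative_eq: "(f has_derivative f') (at x) \<Longrightarrow> frechet_derivative f (at x) = f'"
  by (simp add: frechet_derivative_at[symmetric])

lemma has_derivative_cong_open:
  assumes "open S" "x \<in> S" "\<And>y. y \<in> S \<Longrightarrow> f y = g y"
  shows "(f has_derivative f') (at x) = (g has_derivative f') (at x)"
proof
  show "(f has_derivative f') (at x) \<Longrightarrow> (g has_derivative f') (at x)"
    by (rule has_derivative_transform_within_open[of f f' x UNIV S g]) (use assms in auto)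
  show "(g has_derivative f') (at x) \<Longrightarrow> (f has_derivative f') (at x)"
    by (rule has_derivative_transform_within_open[of g f' x UNIV S f]) (use assms in auto)
qed

lemma frechet_derivative_cong:
  assumes "open S" "x \<in> S" "\<And>y. y \<in> S \<Longrightarrow> f y = g y"
  shows "frechet_derivative f (at x) = frechet_derivative g (at x)"
proof -
  have "(\<lambda>f'. (f has_derivative f') (at x)) = (\<lambda>f'. (g has_derivative f') (at x))"
    by (intro ext has_derivative_cong_open[of S] assms)
  then show ?thesis by (simp add: frechet_derivative_def)
qed

lemma differentiable_cong_open:
  assumes "open S" "x \<in> S" "\<And>y. y \<in> S \<Longrightarrow> f y = g y"
  shows "f differentiable (at x) \<longleftrightarrow> g differentiable (at x)"
proof -
  have "(\<lambda>f'. (f has_derivative f') (at x)) = (\<lambda>f'. (g has_derivative f') (at x))"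
    by (intro ext has_derivative_cong_open[of S] assms)
  then show ?thesis by (simp add: differentiable_def fun_eq_iff)
qed

lemma k_smooth_on_cong:
  assumes "open S" "\<And>x. x \<in> S \<Longrightarrow> f x = g x"
  shows "k_smooth_on k S f \<longleftrightarrow> k_smooth_on k S g"
  using assms(2)
proof (induction k arbitrary: f g)
  case 0 then show ?case by (auto intro: continuous_on_cong)
next
  case (Suc k)
  have "k_smooth_on k S (\<lambda>x. frechet_derivative f (at x) v) \<longleftrightarrow>
    k_smooth_on k S (\<lambda>x. frechet_derivative g (at x) v)" for v
    using frechet_derivative_cong[OF assms(1), of _ f g] Suc.prems by (intro Suc.IH) auto
  then show ?case
    using differentiable_cong_open[OF assms(1), of _ f g] Suc.prems by simp
qed

lemma k_smooth_on_subset: "k_smooth_on k S f \<Longrightarrow> T \<subseteq> S \<Longrightarrow> k_smooth_on k T f"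
  by (induction k arbitrary: f) (auto intro: continuous_on_subset)

text \<open>Derivatives are taken in the full space, so the neighbourhood \<open>T\<close> need not
  lie inside \<open>S\<close>.\<close>

lemma k_smooth_on_local:
  "(\<And>x. x \<in> S \<Longrightarrow> \<exists>T. open T \<and> x \<in> T \<and> k_smooth_on k T f) \<Longrightarrow> k_smooth_on k S f"
proof (induction k arbitrary: f)
  case 0
  have "isCont f x" if "x \<in> S" for x
    using 0[OF that] by (auto simp: continuous_on_eq_continuous_at)
  then show ?case by (auto intro!: continuous_at_imp_continuous_on)
next
  case (Suc k)
  have "f differentiable (at x)" if "x \<in> S" for x
    using Suc.prems[OF that] by auto
  moreover have "k_smooth_on k S (\<lambda>x. frechet_derivative f (at x) v)" for v
    using Suc.prems by (intro Suc.IH) (metis k_smooth_on.simps(2))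
  ultimately show ?case by simp
qed

lemma k_smooth_on_continuous: "k_smooth_on k S f \<Longrightarrow> continuous_on S f"
  by (cases k) (auto intro!: continuous_at_imp_continuous_on differentiable_imp_continuous_within)

lemma k_smooth_on_Suc_lower: "k_smooth_on (Suc k) S f \<Longrightarrow> k_smooth_on k S f"
proof (induction k arbitrary: f)
  case 0 then show ?case using k_smooth_on_continuous[of "Suc 0"] by auto
next
  case (Suc k) then show ?case by (simp del: k_smooth_on.simps(1))
qed

lemma k_smooth_on_mono: "k_smooth_on n S f \<Longrightarrow> k \<le> n \<Longrightarrow> k_smooth_on k S f"
  by (induction n) (auto simp: le_Suc_eq simp del: k_smooth_on.simps dest: k_smooth_on_Suc_lower)

lemma k_smooth_on_differentiable:
  "k_smooth_on (Suc k) S f \<Longrightarrow> x \<in> S \<Longrightarrow> f differentiable (at x)"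
  by simp

lemma k_smooth_on_has_derivative:
  "k_smooth_on (Suc k) S f \<Longrightarrow> x \<in> S \<Longrightarrow> (f has_derivative frechet_derivative f (at x)) (at x)"
  by (simp add: frechet_derivative_works)

lemma k_smooth_on_const [simp]: "k_smooth_on k S (\<lambda>x. c)"
  by (induction k arbitrary: c) auto

lemma k_smooth_on_bounded_linear: "bounded_linear L \<Longrightarrow> k_smooth_on k S L"
  by (cases k)
     (auto simp: frechet_derivative_eq[OF bounded_linear_imp_has_derivative]
       intro: bounded_linear_imp_differentiable linear_continuous_on)

lemma k_smooth_on_linear:
  assumes "bounded_linear L" "open S"
  shows "k_smooth_on k S f \<Longrightarrow> k_smooth_on k S (\<lambda>x. L (f x))"
proof (induction k arbitrary: f)
  case 0 then show ?case by (auto intro: bounded_linear.continuous_on[OF assms(1)])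
next
  case (Suc k)
  have d: "((\<lambda>x. L (f x)) has_derivative (\<lambda>v. L (frechet_derivative f (at x) v))) (at x)"
    if "x \<in> S" for x
    by (intro bounded_linear.has_derivative[OF assms(1)] k_smooth_on_has_derivative[OF Suc.prems that])
  have "k_smooth_on k S (\<lambda>x. frechet_derivative (\<lambda>x. L (f x)) (at x) v)" for v
    by (subst k_smooth_on_cong[OF assms(2), of _ "\<lambda>x. L (frechet_derivative f (at x) v)"])
       (use Suc frechet_derivative_eq[OF d] in auto)
  then show ?case using d by (auto simp: differentiable_def)
qed

lemma k_smooth_on_add:
  assumes "open S"
  shows "k_smooth_on k S f \<Longrightarrow> k_smooth_on k S g \<Longrightarrow> k_smooth_on k S (\<lambda>x. f x + g x)"
proof (induction k arbitrary: f g)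
  case 0 then show ?case by (auto intro: continuous_on_add)
next
  case (Suc k)
  have d: "((\<lambda>x. f x + g x) has_derivative
      (\<lambda>v. frechet_derivative f (at x) v + frechet_derivative g (at x) v)) (at x)" if "x \<in> S" for x
    by (intro has_derivative_add k_smooth_on_has_derivative[OF _ that]) (use Suc.prems in blast)+
  have "k_smooth_on k S (\<lambda>x. frechet_derivative (\<lambda>x. f x + g x) (at x) v)" for v
    by (subst k_smooth_on_cong[OF assms,
          of _ "\<lambda>x. frechet_derivative f (at x) v + frechet_derivative g (at x) v"])
       (use Suc frechet_derivative_eq[OF d] in auto)
  then show ?case using d by (auto simp: differentiable_def)
qed

lemma k_smooth_on_sum:
  assumes "open S" "\<And>i. i \<in> I \<Longrightarrow> k_smooth_on k S (f i)"
  shows "k_smooth_on k S (\<lambda>x. \<Sum>i\<in>I. f i x)"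
  using assms(2) by (induction I rule: infinite_finite_induct) (auto intro: k_smooth_on_add[OF assms(1)])

lemma k_smooth_on_bilinear:
  assumes "bounded_bilinear B" "open S"
  shows "k_smooth_on k S f \<Longrightarrow> k_smooth_on k S g \<Longrightarrow> k_smooth_on k S (\<lambda>x. B (f x) (g x))"
proof (induction k arbitrary: f g)
  case 0 then show ?case by (auto intro: bounded_bilinear.continuous_on[OF assms(1)])
next
  case (Suc k)
  have d: "((\<lambda>x. B (f x) (g x)) has_derivative
      (\<lambda>v. B (f x) (frechet_derivative g (at x) v) + B (frechet_derivative f (at x) v) (g x))) (at x)"
    if "x \<in> S" for x
    by (intro bounded_bilinear.FDERIV[OF assms(1)] k_smooth_on_has_derivative[OF _ that])
       (use Suc.prems in blast)+
  have fg: "k_smooth_on k S f" "k_smooth_on k S g" using Suc.prems k_smooth_on_Suc_lower by blast+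
  have "k_smooth_on k S (\<lambda>x. frechet_derivative (\<lambda>x. B (f x) (g x)) (at x) v)" for v
    by (subst k_smooth_on_cong[OF assms(2), of _ "\<lambda>x. B (f x) (frechet_derivative g (at x) v)
          + B (frechet_derivative f (at x) v) (g x)"])
       (use Suc fg frechet_derivative_eq[OF d] in \<open>auto intro!: k_smooth_on_add[OF assms(2)]\<close>)
  then show ?case using d by (auto simp: differentiable_def)
qed

lemma k_smooth_on_minus: "open S \<Longrightarrow> k_smooth_on k S f \<Longrightarrow> k_smooth_on k S (\<lambda>x. - f x)"
  by (rule k_smooth_on_linear[OF bounded_linear_minus[OF bounded_linear_ident]])

lemma k_smooth_on_diff:
  "open S \<Longrightarrow> k_smooth_on k S f \<Longrightarrow> k_smooth_on k S g \<Longrightarrow> k_smooth_on k S (\<lambda>x. f x - g x)"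
  using k_smooth_on_add[of S k f "\<lambda>x. - g x"] k_smooth_on_minus[of S k g] by simp

lemmas k_smooth_on_mult = k_smooth_on_bilinear[OF bounded_bilinear_mult]
lemmas k_smooth_on_scaleR = k_smooth_on_bilinear[OF bounded_bilinear_scaleR]

text \<open>The chain rule applies the derivative of \<open>f\<close> to a direction that varies
  with the point, whereas the induction hypothesis only covers derivatives in fixed directions.
  Expanding the direction in \<open>Basis\<close> turns the derivative into a finite sum of products
  covered by induction; hence the intermediate space is Euclidean.\<close>

lemma k_smooth_on_compose:
  fixes g :: "'a::real_normed_vector \<Rightarrow> 'b::euclidean_space" and f :: "'b \<Rightarrow> 'c::real_normed_vector"
  assumes "open S" "open T" "g ` S \<subseteq> T"
  shows "k_smooth_on k T f \<Longrightarrow> k_smooth_on k S g \<Longrightarrow> k_smooth_on k S (\<lambda>x. f (g x))"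
proof (induction k arbitrary: f)
  case 0 then show ?case using assms by (auto intro: continuous_on_compose2)
next
  case (Suc k)
  have d: "((\<lambda>x. f (g x)) has_derivative
      (\<lambda>v. frechet_derivative f (at (g x)) (frechet_derivative g (at x) v))) (at x)"
    if "x \<in> S" for x
    by (rule has_derivative_compose[OF k_smooth_on_has_derivative[OF Suc.prems(2) that]])
       (use Suc.prems(1) that assms in \<open>auto intro!: k_smooth_on_has_derivative\<close>)
  have e: "frechet_derivative f (at (g x)) (frechet_derivative g (at x) v)
      = (\<Sum>b\<in>Basis. (frechet_derivative g (at x) v \<bullet> b) *\<^sub>R frechet_derivative f (at (g x)) b)"
    if "x \<in> S" for x v
  proof -
    interpret l: linear "frechet_derivative f (at (g x))"
      using Suc.prems(1) that assms by (intro linear_frechet_derivative) auto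
    have "frechet_derivative f (at (g x)) (frechet_derivative g (at x) v)
      = frechet_derivative f (at (g x)) (\<Sum>b\<in>Basis. (frechet_derivative g (at x) v \<bullet> b) *\<^sub>R b)"
      by (simp add: euclidean_representation)
    then show ?thesis by (simp add: l.sum l.scaleR)
  qed
  have "k_smooth_on k S (\<lambda>x. frechet_derivative (\<lambda>x. f (g x)) (at x) v)" for v
  proof (subst k_smooth_on_cong[OF assms(1), of _ "\<lambda>x. \<Sum>b\<in>Basis.
      (frechet_derivative g (at x) v \<bullet> b) *\<^sub>R frechet_derivative f (at (g x)) b"])
    show "k_smooth_on k S (\<lambda>x. \<Sum>b\<in>Basis.
      (frechet_derivative g (at x) v \<bullet> b) *\<^sub>R frechet_derivative f (at (g x)) b)"
    proof (intro k_smooth_on_sum k_smooth_on_scaleR assms Suc.IH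
        k_smooth_on_linear[OF bounded_linear_inner_left])
      show "k_smooth_on k T (\<lambda>a. frechet_derivative f (at a) i)" for i
        using Suc.prems by simp
      show "k_smooth_on k S g" using Suc.prems k_smooth_on_Suc_lower by blast
      show "k_smooth_on k S (\<lambda>x. frechet_derivative g (at x) v)" using Suc.prems by simp
    qed
  qed (use frechet_derivative_eq[OF d] e in auto)
  then show ?case using d by (auto simp: differentiable_def)
qed

text \<open>The derivative is a polynomial in the reciprocal itself and the derivative of
  \<open>f\<close>, so the induction on the order feeds on its own conclusion.\<close>

lemma k_smooth_on_inverse:
  fixes f :: "'a::real_normed_vector \<Rightarrow> 'b::real_normed_field"
  assumes "open S" "\<And>x. x \<in> S \<Longrightarrow> f x \<noteq> 0"
  shows "k_smooth_on k S f \<Longrightarrow> k_smooth_on k S (\<lambda>x. inverse (f x))"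
proof (induction k)
  case 0 then show ?case using assms by (auto intro!: continuous_on_inverse)
next
  case (Suc k)
  have d: "((\<lambda>x. inverse (f x)) has_derivative
      (\<lambda>v. - (inverse (f x) * frechet_derivative f (at x) v * inverse (f x)))) (at x)"
    if "x \<in> S" for x
    by (rule Deriv.has_derivative_inverse[OF assms(2)[OF that] k_smooth_on_has_derivative[OF Suc.prems that]])
  have f: "k_smooth_on k S (\<lambda>x. inverse (f x))"
    using Suc k_smooth_on_Suc_lower by blast
  have "k_smooth_on k S (\<lambda>x. frechet_derivative (\<lambda>x. inverse (f x)) (at x) v)" for v
    by (subst k_smooth_on_cong[OF assms(1), of _ "\<lambda>x. - (inverse (f x) * frechet_derivative f (at x) v * inverse (f x))"])
       (use Suc f frechet_derivative_eq[OF d] assms in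
         \<open>auto intro!: k_smooth_on_mult k_smooth_on_minus\<close>)
  then show ?case using d by (auto simp: differentiable_def)
qed

lemma k_smooth_on_divide:
  fixes f :: "'a::real_normed_vector \<Rightarrow> 'b::real_normed_field"
  assumes "open S" "\<And>x. x \<in> S \<Longrightarrow> g x \<noteq> 0" "k_smooth_on k S f" "k_smooth_on k S g"
  shows "k_smooth_on k S (\<lambda>x. f x / g x)"
  unfolding divide_inverse using assms by (intro k_smooth_on_mult k_smooth_on_inverse)

text \<open>The same bootstrapping as for reciprocals: the derivative contains the reciprocal of the
  root, which is smooth to the order already reached.\<close>

lemma k_smooth_on_sqrt:
  assumes "open S" "\<And>x. x \<in> S \<Longrightarrow> f x > 0"
  shows "k_smooth_on k S f \<Longrightarrow> k_smooth_on k S (\<lambda>x. sqrt (f x))"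
proof (induction k)
  case 0 then show ?case by (auto intro!: continuous_on_real_sqrt)
next
  case (Suc k)
  have d: "((\<lambda>x. sqrt (f x)) has_derivative
      (\<lambda>v. frechet_derivative f (at x) v * (inverse (sqrt (f x)) / 2))) (at x)"
    if "x \<in> S" for x
    using DERIV_compose_FDERIV[OF DERIV_real_sqrt[OF assms(2)[OF that]]
        k_smooth_on_has_derivative[OF Suc.prems that]] by simp
  have f: "k_smooth_on k S (\<lambda>x. inverse (sqrt (f x)))"
  proof (rule k_smooth_on_inverse[OF assms(1)])
    show "sqrt (f x) \<noteq> 0" if "x \<in> S" for x using assms(2)[OF that] by simp
    show "k_smooth_on k S (\<lambda>x. sqrt (f x))"
      by (rule Suc.IH[OF k_smooth_on_Suc_lower[OF Suc.prems]])
  qed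
  have "k_smooth_on k S (\<lambda>x. frechet_derivative (\<lambda>x. sqrt (f x)) (at x) v)" for v
    by (subst k_smooth_on_cong[OF assms(1), of _ "\<lambda>x. frechet_derivative f (at x) v * (inverse (sqrt (f x)) * (1/2))"])
       (use Suc f frechet_derivative_eq[OF d] assms in \<open>auto intro!: k_smooth_on_mult k_smooth_on_divide\<close>)
  then show ?case using d by (auto simp: differentiable_def)
qed

lemma k_smooth_on_vec:
  fixes f :: "'a::real_normed_vector \<Rightarrow> 'b::euclidean_space^'n"
  assumes "open S" "\<And>i. k_smooth_on k S (\<lambda>x. f x $ i)"
  shows "k_smooth_on k S f"
proof -
  have 0: "bounded_linear (axis i :: 'b \<Rightarrow> 'b^'n)" for i
    by (intro linear_conv_bounded_linear[THEN iffD1] linearI) (auto simp: axis_def vec_eq_iff)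
  have "f = (\<lambda>x. \<Sum>i\<in>UNIV. axis i (f x $ i))"
    by (rule ext) (simp add: vec_eq_iff axis_def if_distrib cong: if_cong)
  moreover have "k_smooth_on k S (\<lambda>x. \<Sum>i\<in>UNIV. axis i (f x $ i))"
    by (intro k_smooth_on_sum k_smooth_on_linear[OF 0] assms)
  ultimately show ?thesis by simp
qed

lemma k_smooth_on_vec_nth:
  "open S \<Longrightarrow> k_smooth_on k S f \<Longrightarrow> k_smooth_on k S (\<lambda>x. f x $ i)"
  by (rule k_smooth_on_linear[OF bounded_linear_vec_nth])

lemma k_smooth_on_cnj: "open S \<Longrightarrow> k_smooth_on k S f \<Longrightarrow> k_smooth_on k S (\<lambda>x. cnj (f x))"
  by (rule k_smooth_on_linear[OF bounded_linear_cnj])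

lemma k_smooth_on_of_real:
  "open S \<Longrightarrow> k_smooth_on k S f \<Longrightarrow> k_smooth_on k S (\<lambda>x. complex_of_real (f x))"
  by (rule k_smooth_on_linear[OF bounded_linear_of_real])

lemma k_smooth_on_Re: "open S \<Longrightarrow> k_smooth_on k S f \<Longrightarrow> k_smooth_on k S (\<lambda>x. Re (f x))"
  by (rule k_smooth_on_linear[OF bounded_linear_Re])

lemma k_smooth_on_Im: "open S \<Longrightarrow> k_smooth_on k S f \<Longrightarrow> k_smooth_on k S (\<lambda>x. Im (f x))"
  by (rule k_smooth_on_linear[OF bounded_linear_Im])

lemma k_smooth_on_matrix_mult:
  fixes f :: "'a::real_normed_vector \<Rightarrow> complex^'m^'n" and g :: "'a \<Rightarrow> complex^'p^'m"
  assumes "open S" "k_smooth_on k S f" "k_smooth_on k S g"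
  shows "k_smooth_on k S (\<lambda>x. f x ** g x)"
  using assms by (intro k_smooth_on_vec)
    (auto simp: matrix_matrix_mult_def intro!: k_smooth_on_sum k_smooth_on_mult k_smooth_on_vec_nth)

lemma k_smooth_on_adj:
  fixes f :: "'a::real_normed_vector \<Rightarrow> complex^'m^'n"
  assumes "open S" "k_smooth_on k S f"
  shows "k_smooth_on k S (\<lambda>x. adj (f x))"
  using assms by (intro k_smooth_on_vec)
    (auto simp: adj_def intro!: k_smooth_on_cnj k_smooth_on_vec_nth)

text \<open>Directional derivatives are \<open>deriv f x * v\<close>, and \<open>deriv f\<close> is
  again holomorphic.\<close>

lemma k_smooth_on_holomorphic:
  assumes "open S" shows "f holomorphic_on S \<Longrightarrow> k_smooth_on k S f"
proof (induction k arbitrary: f)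
  case 0 then show ?case by (auto intro: holomorphic_on_imp_continuous_on)
next
  case (Suc k)
  have d: "(f has_derivative (\<lambda>v. deriv f x * v)) (at x)" if "x \<in> S" for x
    using holomorphic_derivI[OF Suc.prems assms that] by (simp add: has_field_derivative_def)
  have "k_smooth_on k S (\<lambda>x. frechet_derivative f (at x) v)" for v
    by (subst k_smooth_on_cong[OF assms, of _ "\<lambda>x. deriv f x * v"])
       (use Suc assms frechet_derivative_eq[OF d] in
         \<open>auto intro!: k_smooth_on_mult holomorphic_deriv\<close>)
  then show ?case using d by (auto simp: differentiable_def)
qed

lemma smooth_onD: "smooth_on S f \<Longrightarrow> k_smooth_on k S f"
  by (simp add: smooth_on_def)

lemma smooth_on_has_derivative:
  "smooth_on S f \<Longrightarrow> x \<in> S \<Longrightarrow> (f has_derivative frechet_derivative f (at x)) (at x)"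
  by (rule k_smooth_on_has_derivative[OF smooth_onD])

lemma smooth_on_frechet: "smooth_on S f \<Longrightarrow> smooth_on S (\<lambda>x. frechet_derivative f (at x) v)"
  unfolding smooth_on_def by (metis k_smooth_on.simps(2))

lemma smooth_on_subset: "smooth_on S f \<Longrightarrow> T \<subseteq> S \<Longrightarrow> smooth_on T f"
  unfolding smooth_on_def by (auto intro: k_smooth_on_subset)

lemma smooth_on_cong:
  assumes "open S" "\<And>x. x \<in> S \<Longrightarrow> f x = g x" shows "smooth_on S f \<longleftrightarrow> smooth_on S g"
  unfolding smooth_on_def using k_smooth_on_cong[OF assms] by simp

lemma smooth_on_local:
  assumes "\<And>x. x \<in> S \<Longrightarrow> \<exists>T. open T \<and> x \<in> T \<and> smooth_on T f" shows "smooth_on S f"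
  unfolding smooth_on_def
proof (intro allI k_smooth_on_local)
  fix k x assume "x \<in> S"
  then show "\<exists>T. open T \<and> x \<in> T \<and> k_smooth_on k T f"
    using assms smooth_onD by blast
qed

section \<open>The Cauchy--Riemann operator\<close>

text \<open>The Wirtinger derivative with respect to \<open>cnj z\<close>; the directions 1 and \<i>
  are the coordinate vectors of the real and imaginary part.\<close>

definition dbar :: "(complex \<Rightarrow> complex) \<Rightarrow> complex \<Rightarrow> complex" where
  "dbar f z = (frechet_derivative f (at z) 1 + \<i> * frechet_derivative f (at z) \<i>) / 2"

lemma linear_complex_eq:
  fixes L :: "complex \<Rightarrow> 'a::real_vector"
  assumes "linear L" shows "L v = Re v *\<^sub>R L 1 + Im v *\<^sub>R L \<i>"
proof -
  have "Re v *\<^sub>R 1 + Im v *\<^sub>R \<i> = v" by (simp add: complex_eq_iff)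
  then have "L v = L (Re v *\<^sub>R 1 + Im v *\<^sub>R \<i>)" by simp
  then show ?thesis using assms by (simp add: linear_add linear_scale)
qed

lemma dbar_eq: "(f has_derivative f') (at z) \<Longrightarrow> dbar f z = (f' 1 + \<i> * f' \<i>) / 2"
  by (simp add: dbar_def frechet_derivative_eq)

text \<open>Vanishing of \<open>dbar\<close> says that the real differential L satisfies L(\<i>) =
  \<i> L(1), and a real-linear map with this property is multiplication by L(1).\<close>

lemma dbar_0_field_differentiable:
  assumes "f differentiable (at z)" "dbar f z = 0"
  shows "f field_differentiable (at z)"
proof -
  let ?L = "frechet_derivative f (at z)"
  have d: "(f has_derivative ?L) (at z)" using assms(1) frechet_derivative_works by blast
  have eq: "?L \<i> = \<i> * ?L 1"
    using assms(2) by (simp add: dbar_def complex_eq_iff)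
  have lin: "?L v = Re v *\<^sub>R ?L 1 + Im v *\<^sub>R ?L \<i>" for v
    by (rule linear_complex_eq[OF linear_frechet_derivative[OF assms(1)]])
  have "?L v = ?L 1 * v" for v
    by (subst lin) (simp add: eq complex_eq_iff)
  then have L: "?L = (*) (?L 1)" by (rule ext)
  have "(f has_derivative (*) (?L 1)) (at z)"
    by (rule subst[where P = "\<lambda>L. (f has_derivative L) (at z)", OF L d])
  then show ?thesis by (auto simp: field_differentiable_def has_field_derivative_def)
qed

lemma dbar_0_holomorphic:
  assumes "\<And>z. z \<in> S \<Longrightarrow> f differentiable (at z)" "\<And>z. z \<in> S \<Longrightarrow> dbar f z = 0"
  shows "f holomorphic_on S"
  unfolding holomorphic_on_def
  using assms dbar_0_field_differentiable field_differentiable_at_within by blast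

lemma dbar_field_differentiable:
  assumes "f field_differentiable (at z)" shows "dbar f z = 0"
proof -
  obtain c where "(f has_derivative (*) c) (at z)"
    using assms by (auto simp: field_differentiable_def has_field_derivative_def)
  from dbar_eq[OF this] show ?thesis by (simp add: algebra_simps)
qed

lemma dbar_holomorphic: "f holomorphic_on S \<Longrightarrow> open S \<Longrightarrow> z \<in> S \<Longrightarrow> dbar f z = 0"
  by (rule dbar_field_differentiable[OF holomorphic_on_imp_differentiable_at])

lemma dbar_cong:
  assumes "open S" "z \<in> S" "\<And>y. y \<in> S \<Longrightarrow> f y = g y"
  shows "dbar f z = dbar g z"
proof -
  have "frechet_derivative f (at z) = frechet_derivative g (at z)"
    by (rule frechet_derivative_cong[OF assms])
  then show ?thesis by (simp add: dbar_def)
qed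

lemma dbar_add:
  "f differentiable (at z) \<Longrightarrow> g differentiable (at z) \<Longrightarrow> dbar (\<lambda>z. f z + g z) z = dbar f z + dbar g z"
  unfolding frechet_derivative_works
  by (subst dbar_eq[OF has_derivative_add], assumption, assumption) (simp add: dbar_def field_simps)

lemma dbar_diff:
  "f differentiable (at z) \<Longrightarrow> g differentiable (at z) \<Longrightarrow> dbar (\<lambda>z. f z - g z) z = dbar f z - dbar g z"
  unfolding frechet_derivative_works
  by (subst dbar_eq[OF has_derivative_diff], assumption, assumption) (simp add: dbar_def field_simps)

lemma dbar_mult:
  "f differentiable (at z) \<Longrightarrow> g differentiable (at z) \<Longrightarrow>
    dbar (\<lambda>z. f z * g z) z = f z * dbar g z + dbar f z * g z"
  unfolding frechet_derivative_works
  by (subst dbar_eq[OF has_derivative_mult], assumption, assumption) (simp add: dbar_def field_simps)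

text \<open>The constant \<open>m\<close> has this non-periodic primitive; its increments under
  translations are what remains of an extension class.\<close>

lemma dbar_cnj_id: "dbar (\<lambda>z. m * cnj z) z = m"
proof -
  have "bounded_linear (\<lambda>z. m * cnj z)"
    by (rule bounded_linear_compose[OF bounded_linear_mult_right bounded_linear_cnj])
  from dbar_eq[OF bounded_linear_imp_has_derivative[OF this]] show ?thesis
    by (simp add: complex_eq_iff)
qed

lemma has_vector_derivative_line:
  assumes "(g has_derivative g') (at (a + s *\<^sub>R v))"
  shows "((\<lambda>s. g (a + s *\<^sub>R v)) has_vector_derivative g' v) (at s within T)"
proof -
  have "((\<lambda>s. a + s *\<^sub>R v) has_derivative (\<lambda>h. h *\<^sub>R v)) (at s within T)"
    by (auto intro!: derivative_eq_intros)
  from has_derivative_compose[OF this assms]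
  have "((\<lambda>s. g (a + s *\<^sub>R v)) has_derivative (\<lambda>h. g' (h *\<^sub>R v))) (at s within T)" .
  moreover have "g' (h *\<^sub>R v) = h *\<^sub>R g' v" for h
    using assms has_derivative_linear linear_scale by blast
  ultimately show ?thesis by (simp add: has_vector_derivative_def)
qed

text \<open>Differentiate \<open>\<integral> \<partial>\<^sub>x f (s + i y) ds\<close> first in \<open>y\<close> and then in \<open>x\<close>.\<close>

lemma mixed_partials:
  fixes f :: "complex \<Rightarrow> 'b::euclidean_space"
  assumes "open S" "z \<in> S" "k_smooth_on 2 S f"
  shows "frechet_derivative (\<lambda>z. frechet_derivative f (at z) 1) (at z) \<i>
       = frechet_derivative (\<lambda>z. frechet_derivative f (at z) \<i>) (at z) 1"
proof -
  define fx where "fx = (\<lambda>z. frechet_derivative f (at z) 1)"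
  define fy where "fy = (\<lambda>z. frechet_derivative f (at z) \<i>)"
  define fxy where "fxy = (\<lambda>z. frechet_derivative fx (at z) \<i>)"
  have f2: "k_smooth_on (Suc (Suc 0)) S f" using assms(3) by (simp only: numeral_2_eq_2)
  then have sm: "k_smooth_on (Suc 0) S fx" "k_smooth_on (Suc 0) S fy"
    unfolding fx_def fy_def by (simp_all only: k_smooth_on.simps(2)[of "Suc 0"])
  then have cfxy: "continuous_on S fxy"
    unfolding fxy_def by (simp only: k_smooth_on.simps)
  have cfx: "continuous_on S fx" by (rule k_smooth_on_continuous[OF sm(1)])
  note df = k_smooth_on_has_derivative[OF f2] k_smooth_on_has_derivative[OF sm(1)]
    k_smooth_on_has_derivative[OF sm(2)]
  obtain e where e: "e > 0" "ball z e \<subseteq> S" using assms openE by blast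
  \<comment> \<open>With both coordinates at most e/3 the rectangle below stays inside the
    ball.\<close>
  define d where "d = e / 3"
  have d0: "d > 0" using e by (simp add: d_def)
  let ?p = "\<lambda>s y. z + s *\<^sub>R 1 + y *\<^sub>R \<i>"
  have p_eq: "z + y *\<^sub>R \<i> + s *\<^sub>R 1 = ?p s y" for s y by simp
  have inS: "?p s y \<in> S" if "s \<in> {0..d}" "y \<in> {-d..d}" for s y
  proof -
    have "cmod (s *\<^sub>R 1 + y *\<^sub>R \<i>) \<le> \<bar>s\<bar> + \<bar>y\<bar>"
      by (rule order.trans[OF norm_triangle_ineq]) simp
    then have "?p s y \<in> ball z e"
      using that e(1) by (auto simp: d_def dist_norm norm_minus_commute algebra_simps)
    then show ?thesis using e by auto
  qed
  have ftc: "((\<lambda>s. fx (?p s y)) has_integral f (?p x y) - f (?p 0 y)) {0..x}"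
    if "x \<in> {0..d}" "y \<in> {-d..d}" for x y
  proof (rule fundamental_theorem_of_calculus)
    fix s assume "s \<in> {0..x}"
    then have "?p s y \<in> S" using that by (intro inS) auto
    then have "(f has_derivative frechet_derivative f (at (z + y *\<^sub>R \<i> + s *\<^sub>R 1))) (at (z + y *\<^sub>R \<i> + s *\<^sub>R 1))"
      by (subst (1 2) p_eq) (rule df(1))
    from has_vector_derivative_line[OF this]
    show "((\<lambda>s. f (?p s y)) has_vector_derivative fx (?p s y)) (at s within {0..x})"
      unfolding p_eq by (simp only: fx_def p_eq)
  qed (use that in auto)
  have fy_eq: "fy (?p x 0) = fy (?p 0 0) + integral {0..x} (\<lambda>s. fxy (?p s 0))"
    if x: "x \<in> {0..d}" for x
  proof -
    have "((\<lambda>y. integral (cbox 0 x) (\<lambda>s. fx (?p s y))) has_vector_derivative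
        integral (cbox 0 x) (\<lambda>s. fxy (?p s 0))) (at 0 within {-d..d})"
    proof (rule leibniz_rule_vector_derivative)
      fix y s :: real assume y: "y \<in> {-d..d}" and s: "s \<in> cbox 0 x"
      have "?p s y \<in> S" using x y s by (intro inS) auto
      then show "((\<lambda>y. fx (?p s y)) has_vector_derivative fxy (?p s y)) (at y within {-d..d})"
        unfolding fxy_def by (intro has_vector_derivative_line df)
    next
      fix y :: real assume y: "y \<in> {-d..d}"
      show "(\<lambda>s. fx (?p s y)) integrable_on cbox 0 x"
        using ftc[OF x y] by (auto simp: integrable_on_def)
    next
      show "continuous_on ({-d..d} \<times> cbox 0 x) (\<lambda>(y, s). fxy (?p s y))"
        unfolding case_prod_beta
        by (rule continuous_on_compose2[OF cfxy]) (use x inS in \<open>auto intro!: continuous_intros\<close>)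
    qed (use d0 in auto)
    then have 1: "((\<lambda>y. integral {0..x} (\<lambda>s. fx (?p s y))) has_vector_derivative
        integral {0..x} (\<lambda>s. fxy (?p s 0))) (at 0 within {-d..d})" by simp
    have 2: "((\<lambda>y. f (?p x y) - f (?p 0 y)) has_vector_derivative
        fy (?p x 0) - fy (?p 0 0)) (at 0 within {-d..d})"
      unfolding fy_def using d0 x
      by (intro has_vector_derivative_diff has_vector_derivative_line df inS) auto
    have "((\<lambda>y. integral {0..x} (\<lambda>s. fx (?p s y))) has_vector_derivative
        fy (?p x 0) - fy (?p 0 0)) (at 0 within {-d..d})"
    proof (rule has_vector_derivative_transform[OF _ _ 2])
      show "integral {0..x} (\<lambda>s. fx (?p s y)) = f (?p x y) - f (?p 0 y)" if "y \<in> {-d..d}" for y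
        using ftc[OF x that] by (rule integral_unique)
    qed (use d0 in auto)
    then have "fy (?p x 0) - fy (?p 0 0) = integral {0..x} (\<lambda>s. fxy (?p s 0))"
      by (rule vector_derivative_unique_within[rotated, OF _ 1])
        (use d0 in \<open>auto simp: trivial_limit_within islimpt_Icc\<close>)
    then show ?thesis by (simp add: algebra_simps)
  qed
  \<comment> \<open>Differentiating \<open>fy_eq\<close> at x = 0 is only possible from the right;
    one-sided derivatives are unique, which suffices for comparing with the derivative of
    \<open>fy\<close>.\<close>
  have "((\<lambda>x. integral {0..x} (\<lambda>s. fxy (?p s 0))) has_vector_derivative fxy (?p 0 0)) (at 0 within {0..d})"
    by (rule integral_has_vector_derivative)
       (use d0 inS[of _ 0] in \<open>auto intro!: continuous_on_compose2[OF cfxy] continuous_intros\<close>)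
  then have "((\<lambda>x. fy (?p 0 0) + integral {0..x} (\<lambda>s. fxy (?p s 0))) has_vector_derivative 0 + fxy (?p 0 0))
      (at 0 within {0..d})"
    by (intro has_vector_derivative_add has_vector_derivative_const)
  from has_vector_derivative_transform[of 0 "{0..d}", OF _ fy_eq this] d0
  have 3: "((\<lambda>x. fy (?p x 0)) has_vector_derivative fxy z) (at 0 within {0..d})" by simp
  have "((\<lambda>x. fy (z + x *\<^sub>R 1)) has_vector_derivative frechet_derivative fy (at z) 1) (at 0 within {0..d})"
    by (rule has_vector_derivative_line) (use df(3)[OF assms(2)] in simp)
  then have 4: "((\<lambda>x. fy (?p x 0)) has_vector_derivative frechet_derivative fy (at z) 1) (at 0 within {0..d})"
    by simp
  have "fxy z = frechet_derivative fy (at z) 1"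
    by (rule vector_derivative_unique_within[OF _ 3 4])
       (use d0 in \<open>auto simp: trivial_limit_within islimpt_Icc\<close>)
  then show ?thesis by (simp add: fxy_def fx_def fy_def)
qed

section \<open>Fourier series\<close>

definition fchar :: "int \<Rightarrow> real \<Rightarrow> complex" where
  "fchar n x = cis (2 * pi * of_int n * x)"

definition fcoeff :: "(real \<Rightarrow> complex) \<Rightarrow> int \<Rightarrow> complex" where
  "fcoeff h n = integral {0..1} (\<lambda>x. h x * fchar (- n) x)"

lemma fchar_add: "fchar (m + n) x = fchar m x * fchar n x"
  by (simp add: fchar_def cis_mult algebra_simps)

lemma fchar_0 [simp]: "fchar 0 x = 1" "fchar n 0 = 1"
  by (simp_all add: fchar_def)

lemma fchar_1 [simp]: "fchar n 1 = 1"
  using cis_multiple_2pi[of "of_int n"] by (simp add: fchar_def mult.assoc)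

lemma norm_fchar [simp]: "cmod (fchar n x) = 1"
  by (simp add: fchar_def)

lemma cnj_fchar: "cnj (fchar n x) = fchar (- n) x"
  by (simp add: fchar_def cis_cnj)

lemma fchar_mult_neg: "fchar n x * fchar (- n) x = 1"
  by (simp flip: fchar_add)

lemma fchar_deriv:
  "((\<lambda>x. fchar n x) has_vector_derivative (2 * pi * of_int n * \<i>) * fchar n x) (at x within S)"
proof -
  let ?c = "2 * pi * of_int n * \<i> :: complex"
  have "((\<lambda>z. exp (?c * z)) has_field_derivative ?c * exp (?c * of_real x)) (at (of_real x))"
    by (auto intro!: derivative_eq_intros)
  from has_vector_derivative_real_field[OF this] show ?thesis
    by (simp add: fchar_def[abs_def] cis_conv_exp mult_ac)
qed

text \<open>In this form, two functions vanishing at a point can be divided, and the quotient of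
  their derivatives is the limit there.\<close>

lemma vector_derivative_quotient:
  fixes f :: "real \<Rightarrow> complex"
  assumes "(f has_vector_derivative f') (at x)"
  shows "((\<lambda>y. (f y - f x) / of_real (y - x)) \<longlongrightarrow> f') (at x)"
proof -
  have "((\<lambda>y. norm ((f y - f x) - (y - x) *\<^sub>R f') / norm (y - x)) \<longlongrightarrow> 0) (at x)"
    using assms by (simp add: has_vector_derivative_def has_derivative_iff_norm)
  moreover have "norm ((f y - f x) - (y - x) *\<^sub>R f') / norm (y - x)
      = norm ((f y - f x) / of_real (y - x) - f')" if "y \<noteq> x" for y
  proof -
    have "(f y - f x) / of_real (y - x) - f' = ((f y - f x) - (y - x) *\<^sub>R f') / of_real (y - x)"
      using that by (simp add: field_simps scaleR_conv_of_real)
    then show ?thesis by (simp only: norm_divide norm_of_real real_norm_def)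
  qed
  ultimately have "((\<lambda>y. norm ((f y - f x) / of_real (y - x) - f')) \<longlongrightarrow> 0) (at x)"
    by (simp cong: Lim_cong_within)
  then show ?thesis by (rule LIM_zero_cancel[OF tendsto_norm_zero_cancel])
qed

lemma continuous_on_fchar [continuous_intros]:
  "continuous_on S f \<Longrightarrow> continuous_on S (\<lambda>x. fchar n (f x))"
  unfolding fchar_def cis_conv_exp by (intro continuous_intros)

lemma integral_fchar: "(fchar n has_integral (if n = 0 then 1 else 0)) {0..1}"
proof (cases "n = 0")
  case True
  then show ?thesis using has_integral_const_real[of "1::complex" 0 1] by (simp add: fchar_def[abs_def])
next
  case False
  let ?c = "2 * pi * of_int n * \<i> :: complex"
  have "((\<lambda>x. ?c * fchar n x) has_integral fchar n 1 - fchar n 0) {0..1}"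
    by (rule fundamental_theorem_of_calculus[OF _ fchar_deriv]) simp
  from has_integral_mult_right[OF this, of "inverse ?c"] show ?thesis
    using False by (simp add: field_simps)
qed

text \<open>The trigonometric polynomial \<open>P\<close> built from the Fourier coefficients is the
  orthogonal projection of \<open>h\<close>: pairing \<open>P\<close> with \<open>h\<close> and with
  itself gives the same value, so the integral of |h - P|^2 is the difference of the two
  sides.\<close>

lemma bessel_inequality:
  assumes h: "continuous_on {0..1} h" and N: "finite N"
  shows "(\<Sum>n\<in>N. (cmod (fcoeff h n))\<^sup>2) \<le> integral {0..1} (\<lambda>x. (cmod (h x))\<^sup>2)"
proof -
  let ?d = "fcoeff h"
  define P where "P = (\<lambda>x. \<Sum>n\<in>N. ?d n * fchar n x)"
  have d: "((\<lambda>x. h x * fchar (- n) x) has_integral ?d n) {0..1}" for n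
    unfolding fcoeff_def by (intro integrable_integral integrable_continuous_real continuous_intros h)
  have cP: "continuous_on {0..1} P"
    unfolding P_def by (intro continuous_intros)
  have 1: "((\<lambda>x. h x * cnj (P x)) has_integral (\<Sum>n\<in>N. cnj (?d n) * ?d n)) {0..1}"
  proof -
    have "((\<lambda>x. \<Sum>n\<in>N. cnj (?d n) * (h x * fchar (- n) x)) has_integral (\<Sum>n\<in>N. cnj (?d n) * ?d n)) {0..1}"
      by (intro has_integral_sum N has_integral_mult_right d)
    then show ?thesis by (simp add: P_def cnj_fchar sum_distrib_left mult_ac)
  qed
  have 2: "((\<lambda>x. P x * cnj (P x)) has_integral (\<Sum>n\<in>N. cnj (?d n) * ?d n)) {0..1}"
  proof -
    have "((\<lambda>x. \<Sum>n\<in>N. \<Sum>m\<in>N. cnj (?d n) * ?d m * fchar (m - n) x) has_integral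
      (\<Sum>n\<in>N. \<Sum>m\<in>N. cnj (?d n) * ?d m * (if m - n = 0 then 1 else 0))) {0..1}"
      by (intro has_integral_sum N has_integral_mult_right integral_fchar)
    moreover have "P x * cnj (P x) = (\<Sum>n\<in>N. \<Sum>m\<in>N. cnj (?d n) * ?d m * fchar (m - n) x)" for x
    proof -
      have "fchar (m - n) x = fchar m x * fchar (- n) x" for m n
        by (simp flip: fchar_add)
      then show ?thesis
        by (subst mult.commute) (simp only: P_def cnj_sum sum_product, simp add: cnj_fchar mult_ac)
    qed
    moreover have "(\<Sum>n\<in>N. \<Sum>m\<in>N. cnj (?d n) * ?d m * (if m - n = 0 then 1 else 0))
       = (\<Sum>n\<in>N. cnj (?d n) * ?d n)"
      by (intro sum.cong refl) (simp add: if_distrib N cong: if_cong)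
    ultimately show ?thesis by simp
  qed
  have s: "(\<Sum>n\<in>N. cnj (?d n) * ?d n) = of_real (\<Sum>n\<in>N. (cmod (?d n))\<^sup>2)"
    by (simp add: complex_norm_square mult.commute del: of_real_power)
  have "((\<lambda>x. Re (h x * cnj (P x))) has_integral (\<Sum>n\<in>N. (cmod (?d n))\<^sup>2)) {0..1}"
    "((\<lambda>x. Re (P x * cnj (P x))) has_integral (\<Sum>n\<in>N. (cmod (?d n))\<^sup>2)) {0..1}"
    using has_integral_Re[OF 1] has_integral_Re[OF 2] unfolding s by simp_all
  moreover have "((\<lambda>x. (cmod (h x))\<^sup>2) has_integral integral {0..1} (\<lambda>x. (cmod (h x))\<^sup>2)) {0..1}"
    by (intro integrable_integral integrable_continuous_real continuous_intros h)
  ultimately have "((\<lambda>x. (cmod (h x))\<^sup>2 - 2 * Re (h x * cnj (P x)) + Re (P x * cnj (P x))) has_integral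
     integral {0..1} (\<lambda>x. (cmod (h x))\<^sup>2) - 2 * (\<Sum>n\<in>N. (cmod (?d n))\<^sup>2) + (\<Sum>n\<in>N. (cmod (?d n))\<^sup>2)) {0..1}"
    by (intro has_integral_add has_integral_diff has_integral_mult_right)
  moreover have "(cmod (h x))\<^sup>2 - 2 * Re (h x * cnj (P x)) + Re (P x * cnj (P x)) = (cmod (h x - P x))\<^sup>2" for x
    by (simp only: cmod_power2) (simp add: power2_eq_square algebra_simps)
  ultimately have "((\<lambda>x. (cmod (h x - P x))\<^sup>2) has_integral
     integral {0..1} (\<lambda>x. (cmod (h x))\<^sup>2) - (\<Sum>n\<in>N. (cmod (?d n))\<^sup>2)) {0..1}"
    by simp
  then have "0 \<le> integral {0..1} (\<lambda>x. (cmod (h x))\<^sup>2) - (\<Sum>n\<in>N. (cmod (?d n))\<^sup>2)"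
    by (rule has_integral_nonneg) simp
  then show ?thesis by simp
qed

text \<open>A Riemann-Lebesgue statement: by Bessel the squared moduli are summable along any
  injective enumeration. The enumerations in use are n and - n - 1.\<close>

lemma fcoeff_tendsto_0:
  assumes "continuous_on {0..1} h" "inj \<theta>"
  shows "(\<lambda>k. fcoeff h (\<theta> (k::nat))) \<longlonglongrightarrow> 0"
proof -
  have "summable (\<lambda>k. (cmod (fcoeff h (\<theta> k)))\<^sup>2)"
  proof (rule summableI_nonneg_bounded)
    fix n
    have "(\<Sum>k<n. (cmod (fcoeff h (\<theta> k)))\<^sup>2) = (\<Sum>m\<in>\<theta> ` {..<n}. (cmod (fcoeff h m))\<^sup>2)"
      by (subst sum.reindex) (use assms(2) in \<open>auto intro: inj_on_subset\<close>)
    also have "\<dots> \<le> integral {0..1} (\<lambda>x. (cmod (h x))\<^sup>2)"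
      by (rule bessel_inequality[OF assms(1)]) simp
    finally show "(\<Sum>k<n. (cmod (fcoeff h (\<theta> k)))\<^sup>2) \<le> integral {0..1} (\<lambda>x. (cmod (h x))\<^sup>2)" .
  qed simp
  from summable_LIMSEQ_zero[OF this] have "(\<lambda>k. sqrt ((cmod (fcoeff h (\<theta> k)))\<^sup>2)) \<longlonglongrightarrow> sqrt 0"
    by (rule tendsto_real_sqrt)
  then show ?thesis by (simp add: tendsto_norm_zero_iff)
qed

text \<open>With \<open>g x - g x\<^sub>0 = (e\<^sup>2\<^sup>\<pi>\<^sup>i\<^sup>(\<^sup>x\<^sup>-\<^sup>x\<^sup>0\<^sup>) - 1) h x\<close> the partial sums of the Fourier series at \<open>x\<^sub>0\<close>
  telescope to Fourier coefficients of \<open>h\<close>.\<close>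

lemma fourier_pointwise:
  assumes g: "continuous_on {0..1} g" "(g has_vector_derivative g') (at x0)" and x0: "x0 \<in> {0<..<1}"
  shows "(\<lambda>N. \<Sum>n\<in>{- int N..int N}. fcoeff g n * fchar n x0) \<longlonglongrightarrow> g x0"
proof -
  define u where "u = (\<lambda>x. fchar 1 x * fchar (- 1) x0 - 1)"
  \<comment> \<open>The value at \<open>x0\<close> is the limit of the quotient, since
    \<open>u\<close> has derivative 2 pi \<i> there; this makes \<open>h\<close> continuous.\<close>
  define h where "h = (\<lambda>x. if x = x0 then g' / (2 * pi * \<i>) else (g x - g x0) / u x)"
  have u0: "u x0 = 0" by (simp add: u_def fchar_mult_neg)
  have du: "(u has_vector_derivative 2 * pi * \<i>) (at x within S)" if "x = x0" for x S
  proof -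
    have "(u has_vector_derivative (2 * pi * of_int 1 * \<i>) * fchar 1 x0 * fchar (- 1) x0 - 0) (at x0 within S)"
      unfolding u_def
      by (intro has_vector_derivative_diff has_vector_derivative_mult_left fchar_deriv has_vector_derivative_const)
    then show ?thesis using that by (simp add: mult.assoc fchar_mult_neg)
  qed
  \<comment> \<open>On the unit interval \<open>u\<close> vanishes only at \<open>x0\<close> because
    \<open>x0\<close> is interior; for an endpoint, the other endpoint would be a second
    zero.\<close>
  have u_nz: "u x \<noteq> 0" if "x \<in> {0..1}" "x \<noteq> x0" for x
  proof
    assume "u x = 0"
    then have "cis (2 * pi * x - 2 * pi * x0) = 1"
      by (simp add: u_def fchar_def cis_mult)
    then have "cos (2 * pi * x - 2 * pi * x0) = 1" by (simp only: cis.simps one_complex.simps complex_eq_iff)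
    then obtain n :: int where "2 * pi * x - 2 * pi * x0 = of_int n * 2 * pi"
      unfolding cos_one_2pi_int by blast
    then have "(2 * pi) * (x - x0) = (2 * pi) * of_int n"
      by (simp add: algebra_simps)
    then have "x - x0 = of_int n" by simp
    moreover have "x - x0 < 1" "x - x0 > -1" using that x0 by auto
    ultimately have "n < 1" "n > -1" by linarith+
    then show False using \<open>x - x0 = of_int n\<close> that(2) by simp
  qed
  have cu: "continuous_on S u" for S
    unfolding u_def by (intro continuous_intros)
  have ch: "continuous_on {0..1} h"
    unfolding continuous_on_eq_continuous_within
  proof -
    show "\<forall>x\<in>{0..1}. continuous (at x within {0..1}) h"
    proof
      fix x :: real assume x: "x \<in> {0..1}"
      show "continuous (at x within {0..1}) h"
      proof (cases "x = x0")
        case True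
        have "((\<lambda>y. ((g y - g x0) / of_real (y - x0)) / ((u y - u x0) / of_real (y - x0))) \<longlongrightarrow> g' / (2 * pi * \<i>)) (at x0)"
          using g(2) du[OF refl, of UNIV]
          by (intro tendsto_divide vector_derivative_quotient) auto
        moreover have "((\<lambda>y. ((g y - g x0) / of_real (y - x0)) / ((u y - u x0) / of_real (y - x0))) \<longlongrightarrow> l) (at x0)
          \<longleftrightarrow> (h \<longlongrightarrow> l) (at x0)" for l
          by (rule Lim_cong_within) (auto simp: h_def u0)
        ultimately have "(h \<longlongrightarrow> h x0) (at x0)" by (simp add: h_def)
        then have "isCont h x" unfolding True by (simp only: isCont_def)
        then show ?thesis by (rule continuous_at_imp_continuous_at_within)
      next
        case False
        have "continuous (at x within {0..1}) (\<lambda>x. (g x - g x0) / u x)"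
          using u_nz[OF x False] g(1) cu[of "{0..1}"] x
          by (intro continuous_intros) (auto simp: continuous_on_eq_continuous_within)
        then show ?thesis
          by (rule continuous_transform_within[where \<delta> = "dist x x0"]) (use False x in \<open>auto simp: h_def dist_commute\<close>)
      qed
    qed
  qed
  have key: "g x - g x0 = u x * h x" if "x \<in> {0..1}" for x
    using u_nz[OF that] by (simp add: h_def u0)
  \<comment> \<open>Taking Fourier coefficients in g - g(x0) = u h shifts the index by one, since
    \<open>u\<close> is a multiple of \<open>fchar 1\<close> minus 1. The n-th term of the series at
    \<open>x0\<close> becomes T (n - 1) - T n, plus g(x0) when n = 0.\<close>
  define T where "T n = fchar n x0 * fcoeff h n" for n
  have "fcoeff g n * fchar n x0 - (if n = 0 then g x0 else 0) = T (n - 1) - T n" for n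
  proof -
    have ih: "((\<lambda>x. h x * fchar (- n) x) has_integral fcoeff h n) {0..1}" for n
      unfolding fcoeff_def by (intro integrable_integral integrable_continuous_real continuous_intros ch)
    have ig: "((\<lambda>x. g x * fchar (- n) x) has_integral fcoeff g n) {0..1}"
      unfolding fcoeff_def by (intro integrable_integral integrable_continuous_real continuous_intros g)
    have 1: "((\<lambda>x. g x * fchar (- n) x - g x0 * fchar (- n) x) has_integral
       fcoeff g n - g x0 * (if - n = 0 then 1 else 0)) {0..1}"
      by (intro has_integral_diff ig has_integral_mult_right integral_fchar)
    have "((\<lambda>x. fchar (- 1) x0 * (h x * fchar (- (n - 1)) x) - h x * fchar (- n) x) has_integral
       fchar (- 1) x0 * fcoeff h (n - 1) - fcoeff h n) {0..1}"
      by (intro has_integral_diff ih has_integral_mult_right)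
    then have 2: "((\<lambda>x. g x * fchar (- n) x - g x0 * fchar (- n) x) has_integral
       fchar (- 1) x0 * fcoeff h (n - 1) - fcoeff h n) {0..1}"
    proof (rule has_integral_eq[rotated])
      fix x :: real assume "x \<in> {0..1}"
      note key[OF this, symmetric]
      then have "g x * fchar (- n) x - g x0 * fchar (- n) x = u x * h x * fchar (- n) x"
        by (simp only: left_diff_distrib)
      also have "\<dots> = fchar (- 1) x0 * (h x * (fchar 1 x * fchar (- n) x)) - h x * fchar (- n) x"
        by (simp add: u_def algebra_simps)
      finally show "fchar (- 1) x0 * (h x * fchar (- (n - 1)) x) - h x * fchar (- n) x
          = g x * fchar (- n) x - g x0 * fchar (- n) x"
        by (simp flip: fchar_add)
    qed
    from has_integral_unique[OF 1 2]
    have "fcoeff g n - g x0 * (if n = 0 then 1 else 0)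
       = fchar (- 1) x0 * fcoeff h (n - 1) - fcoeff h n" by simp
    then have "fchar n x0 * (fcoeff g n - g x0 * (if n = 0 then 1 else 0))
       = fchar n x0 * (fchar (- 1) x0 * fcoeff h (n - 1) - fcoeff h n)" by simp
    then show ?thesis
      unfolding T_def by (auto simp: algebra_simps fchar_add[of n "- 1", simplified])
  qed
  then have step: "fcoeff g n * fchar n x0 = (if n = 0 then g x0 else 0) + (T (n - 1) - T n)" for n
    by (simp add: algebra_simps)
  have "(\<Sum>n\<in>{- int N..int N}. fcoeff g n * fchar n x0) = g x0 + (T (- int N - 1) - T (int N))" for N
  proof (induction N)
    case 0 show ?case by (simp add: step[of 0, simplified])
  next
    case (Suc N)
    have "{- int (Suc N)..int (Suc N)} = insert (int N + 1) (insert (- int N - 1) {- int N..int N})"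
      by auto
    then have "(\<Sum>n\<in>{- int (Suc N)..int (Suc N)}. fcoeff g n * fchar n x0)
      = fcoeff g (int N + 1) * fchar (int N + 1) x0 + (fcoeff g (- int N - 1) * fchar (- int N - 1) x0
        + (\<Sum>n\<in>{- int N..int N}. fcoeff g n * fchar n x0))"
      by simp
    also have "\<dots> = (T (int N) - T (int N + 1)) + ((T (- int N - 1 - 1) - T (- int N - 1))
        + (g x0 + (T (- int N - 1) - T (int N))))"
      unfolding Suc step[of "int N + 1"] step[of "- int N - 1"] by simp
    finally show ?case by (simp add: algebra_simps)
  qed
  moreover have lim: "(\<lambda>N. T (\<theta> N)) \<longlonglongrightarrow> 0" if "inj \<theta>" for \<theta> :: "nat \<Rightarrow> int"
  proof (rule tendsto_norm_zero_cancel)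
    show "(\<lambda>N. cmod (T (\<theta> N))) \<longlonglongrightarrow> 0"
      using tendsto_norm_zero[OF fcoeff_tendsto_0[OF ch that]] by (simp add: T_def norm_mult)
  qed
  have "(\<lambda>N. T (- int N - 1)) \<longlonglongrightarrow> 0" "(\<lambda>N. T (int N)) \<longlonglongrightarrow> 0"
    by (rule lim; simp add: inj_def)+
  then have "(\<lambda>N. g x0 + (T (- int N - 1) - T (int N))) \<longlonglongrightarrow> g x0 + (0 - 0)"
    by (intro tendsto_intros)
  ultimately show ?thesis by simp
qed

section \<open>Superpositions of plane waves\<close>

definition wave :: "complex \<Rightarrow> complex \<Rightarrow> complex" where
  "wave w z = exp (\<i> * of_real (w \<bullet> z))"

lemma norm_wave [simp]: "cmod (wave w z) = 1"
  by (simp add: wave_def)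

lemma wave_deriv: "(wave w has_derivative (\<lambda>h. (\<i> * of_real (w \<bullet> h)) * wave w z)) (at z within S)"
proof -
  have 0: "bounded_linear (\<lambda>z. complex_of_real (w \<bullet> z))"
    by (rule bounded_linear_compose[OF bounded_linear_of_real bounded_linear_inner_right])
  have "bounded_linear (\<lambda>z. \<i> * complex_of_real (w \<bullet> z))"
    by (rule bounded_linear_const_mult[OF 0])
  then have 1: "((\<lambda>z. \<i> * complex_of_real (w \<bullet> z)) has_derivative (\<lambda>h. \<i> * of_real (w \<bullet> h))) (at z within S)"
    by (rule bounded_linear_imp_has_derivative)
  have 2: "(exp has_derivative (*) (exp (\<i> * of_real (w \<bullet> z)))) (at (\<i> * complex_of_real (w \<bullet> z)))"
    by (rule DERIV_exp[THEN has_field_derivative_imp_has_derivative])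
  have "((\<lambda>z. exp (\<i> * of_real (w \<bullet> z))) has_derivative
     (\<lambda>h. exp (\<i> * of_real (w \<bullet> z)) * (\<i> * of_real (w \<bullet> h)))) (at z within S)"
    by (rule has_derivative_compose[OF 1 2])
  then show ?thesis by (simp only: wave_def[abs_def] mult.commute)
qed

definition wave_sum :: "(nat \<Rightarrow> complex) \<Rightarrow> (nat \<Rightarrow> complex) \<Rightarrow> complex \<Rightarrow> complex" where
  "wave_sum w a z = suminf (\<lambda>i. a i * wave (w i) z)"

lemma wave_sum_sums:
  assumes "summable (\<lambda>i. cmod (a i))" shows "(\<lambda>i. a i * wave (w i) z) sums wave_sum w a z"
  unfolding wave_sum_def
  by (rule summable_sums[OF summable_norm_cancel]) (simp add: norm_mult assms)

text \<open>The derived series is dominated by |a i| |w i| |h| uniformly in the point, so its tails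
  are uniformly small and termwise differentiation is allowed. The weight 1 + |w i| controls the
  series and its derivative together.\<close>

lemma wave_sum_deriv:
  assumes s: "summable (\<lambda>i. cmod (a i) * (1 + cmod (w i)))"
  shows "(wave_sum w a has_derivative (\<lambda>h. wave_sum w (\<lambda>i. a i * (\<i> * of_real (w i \<bullet> h))) z)) (at z)"
proof -
  have s0: "summable (\<lambda>i. cmod (a i))"
    by (rule summable_comparison_test'[OF s, of 0]) (simp add: algebra_simps)
  have s1: "summable (\<lambda>i. cmod (a i) * cmod (w i))"
    by (rule summable_comparison_test'[OF s, of 0]) (simp add: algebra_simps)
  have bd: "cmod (a i * (\<i> * of_real (w i \<bullet> h)) * wave (w i) z) \<le> cmod (a i) * cmod (w i) * cmod h" for i h z
  proof -
    have "\<bar>w i \<bullet> h\<bar> \<le> cmod (w i) * cmod h" by (rule Cauchy_Schwarz_ineq2)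
    then show ?thesis by (simp add: norm_mult mult.assoc mult_left_mono)
  qed
  have s2: "summable (\<lambda>i. a i * (\<i> * of_real (w i \<bullet> h)) * wave (w i) z)" for h z
    by (rule summable_comparison_test'[OF summable_mult2[OF s1, of "cmod h"], of 0]) (rule bd)
  have "\<exists>g. \<forall>x\<in>UNIV. (\<lambda>i. a i * wave (w i) x) sums g x \<and>
      (g has_derivative (\<lambda>h. wave_sum w (\<lambda>i. a i * (\<i> * of_real (w i \<bullet> h))) x)) (at x within UNIV)"
  proof (rule has_derivative_series)
    show "((\<lambda>z. a i * wave (w i) z) has_derivative (\<lambda>h. a i * (\<i> * of_real (w i \<bullet> h)) * wave (w i) x)) (at x within UNIV)" for i x
      using has_derivative_mult_right[OF wave_deriv, of "a i"] by (simp add: mult.assoc)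
    fix e :: real assume "e > 0"
    have "(\<lambda>n. suminf (\<lambda>i. cmod (a i) * cmod (w i)) - (\<Sum>i<n. cmod (a i) * cmod (w i))) \<longlonglongrightarrow>
       suminf (\<lambda>i. cmod (a i) * cmod (w i)) - suminf (\<lambda>i. cmod (a i) * cmod (w i))"
      by (intro tendsto_intros summable_LIMSEQ s1)
    then have "eventually (\<lambda>n. suminf (\<lambda>i. cmod (a i) * cmod (w i)) - (\<Sum>i<n. cmod (a i) * cmod (w i)) < e) sequentially"
      using \<open>e > 0\<close> by (simp add: order_tendstoD(2))
    then show "\<forall>\<^sub>F n in sequentially. \<forall>x\<in>UNIV. \<forall>h.
      norm ((\<Sum>i<n. a i * (\<i> * of_real (w i \<bullet> h)) * wave (w i) x) - wave_sum w (\<lambda>i. a i * (\<i> * of_real (w i \<bullet> h))) x) \<le> e * norm h"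
    proof (rule eventually_mono, intro ballI allI)
      fix n x h assume n: "suminf (\<lambda>i. cmod (a i) * cmod (w i)) - (\<Sum>i<n. cmod (a i) * cmod (w i)) < e"
      let ?f = "\<lambda>i. a i * (\<i> * of_real (w i \<bullet> h)) * wave (w i) x"
      have "norm ((\<Sum>i<n. ?f i) - wave_sum w (\<lambda>i. a i * (\<i> * of_real (w i \<bullet> h))) x) = norm (suminf (\<lambda>i. ?f (i + n)))"
        unfolding wave_sum_def suminf_minus_initial_segment[OF s2] by (rule norm_minus_commute)
      also have "\<dots> \<le> suminf (\<lambda>i. cmod (a (i + n)) * cmod (w (i + n)) * cmod h)"
        by (rule norm_suminf_le[OF bd]) (intro summable_mult2 summable_ignore_initial_segment[OF s1])
      also have "\<dots> = suminf (\<lambda>i. cmod (a (i + n)) * cmod (w (i + n))) * cmod h"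
        by (rule suminf_mult2[symmetric]) (rule summable_ignore_initial_segment[OF s1])
      also have "\<dots> \<le> e * cmod h"
        using n unfolding suminf_minus_initial_segment[OF s1] by (intro mult_right_mono) auto
      finally show "norm ((\<Sum>i<n. ?f i) - wave_sum w (\<lambda>i. a i * (\<i> * of_real (w i \<bullet> h))) x) \<le> e * norm h" .
    qed
  qed (use wave_sum_sums[OF s0] in auto)
  then obtain g where g: "\<And>x. (\<lambda>i. a i * wave (w i) x) sums g x"
      "\<And>x. (g has_derivative (\<lambda>h. wave_sum w (\<lambda>i. a i * (\<i> * of_real (w i \<bullet> h))) x)) (at x)" by auto
  have "g = wave_sum w a" by (rule ext, rule sums_unique2[OF g(1) wave_sum_sums[OF s0]])
  then show ?thesis using g(2) by simp
qed

text \<open>A derivative in direction h multiplies the amplitude by \<i> times the inner product of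
  w i and h, at the cost of one factor |w i|. The exponent is \<open>Suc k\<close> because the base
  case obtains continuity from differentiability.\<close>

lemma k_smooth_on_wave_sum:
  "summable (\<lambda>i. cmod (a i) * (1 + cmod (w i)) ^ Suc k) \<Longrightarrow> k_smooth_on k UNIV (wave_sum w a)"
proof (induction k arbitrary: a)
  case 0
  then have "(wave_sum w a) differentiable (at z)" for z
    using wave_sum_deriv[of a w z] by (auto simp: differentiable_def)
  then show ?case
    by (auto intro!: continuous_at_imp_continuous_on differentiable_imp_continuous_within)
next
  case (Suc k)
  have s: "summable (\<lambda>i. cmod (a i) * (1 + cmod (w i)))"
  proof (rule summable_comparison_test'[OF Suc.prems, of 0])
    fix i
    have "(1 + cmod (w i)) ^ 1 \<le> (1 + cmod (w i)) ^ Suc (Suc k)" by (rule power_increasing) auto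
    then show "norm (cmod (a i) * (1 + cmod (w i))) \<le> cmod (a i) * (1 + cmod (w i)) ^ Suc (Suc k)"
      by (simp add: mult_left_mono)
  qed
  note d = wave_sum_deriv[OF s]
  have "k_smooth_on k UNIV (wave_sum w (\<lambda>i. a i * (\<i> * of_real (w i \<bullet> h))))" for h
  proof (rule Suc.IH, rule summable_comparison_test'[OF summable_mult2[OF Suc.prems, of "cmod h"], of 0])
    fix i
    have "\<bar>w i \<bullet> h\<bar> \<le> cmod (w i) * cmod h" by (rule Cauchy_Schwarz_ineq2)
    also have "\<dots> \<le> (1 + cmod (w i)) * cmod h" by (intro mult_right_mono) auto
    finally have "\<bar>w i \<bullet> h\<bar> \<le> (1 + cmod (w i)) * cmod h" .
    from mult_left_mono[OF this, of "cmod (a i) * (1 + cmod (w i)) ^ Suc k"]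
    show "norm (cmod (a i * (\<i> * of_real (w i \<bullet> h))) * (1 + cmod (w i)) ^ Suc k)
        \<le> cmod (a i) * (1 + cmod (w i)) ^ Suc (Suc k) * cmod h"
      by (simp add: norm_mult mult_ac)
  qed
  moreover have "(\<lambda>x. frechet_derivative (wave_sum w a) (at x) h) = wave_sum w (\<lambda>i. a i * (\<i> * of_real (w i \<bullet> h)))" for h
    by (rule ext) (simp add: frechet_derivative_eq[OF d])
  ultimately show ?case using d by (auto simp: differentiable_def simp del: power_Suc)
qed

text \<open>The inner products of w with 1 and \<i> are the real and imaginary part of w, so
  \<open>dbar\<close> multiplies the amplitude of frequency w by \<i> w / 2.\<close>

lemma dbar_wave_sum:
  assumes s: "summable (\<lambda>i. cmod (a i) * (1 + cmod (w i)))"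
  shows "dbar (wave_sum w a) z = wave_sum w (\<lambda>i. (\<i> / 2) * w i * a i) z"
proof -
  have s1: "summable (\<lambda>i. cmod (a i * (\<i> * of_real (w i \<bullet> h))))" if h: "cmod h = 1" for h
  proof (rule summable_comparison_test'[OF s, of 0])
    fix i
    have "\<bar>w i \<bullet> h\<bar> \<le> cmod (w i) * cmod h" by (rule Cauchy_Schwarz_ineq2)
    then show "norm (cmod (a i * (\<i> * of_real (w i \<bullet> h)))) \<le> cmod (a i) * (1 + cmod (w i))"
      using h by (auto simp: norm_mult intro!: mult_left_mono)
  qed
  have "(\<lambda>i. (a i * (\<i> * of_real (w i \<bullet> 1)) * wave (w i) z + \<i> * (a i * (\<i> * of_real (w i \<bullet> \<i>)) * wave (w i) z)) / 2)
     sums dbar (wave_sum w a) z"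
    unfolding dbar_eq[OF wave_sum_deriv[OF s]]
    by (rule sums_divide[OF sums_add[OF wave_sum_sums[OF s1] sums_mult[OF wave_sum_sums[OF s1]]]]) auto
  moreover have "(a i * (\<i> * of_real (w i \<bullet> 1)) * wave (w i) z + \<i> * (a i * (\<i> * of_real (w i \<bullet> \<i>)) * wave (w i) z)) / 2
     = (\<i> / 2) * w i * a i * wave (w i) z" for i
  proof -
    have alg: "(A * (\<i> * x) * e + \<i> * (A * (\<i> * y) * e)) / 2 = (\<i> / 2) * (x + \<i> * y) * A * e" for A x y e :: complex
      by (simp add: field_simps)
    have "of_real (w i \<bullet> 1) + \<i> * of_real (w i \<bullet> \<i>) = w i"
      by (simp add: complex_eq_iff inner_complex_def)
    then show ?thesis by (simp only: alg)
  qed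
  ultimately have "(\<lambda>i. (\<i> / 2) * w i * a i * wave (w i) z) sums dbar (wave_sum w a) z" by (simp only:)
  then show ?thesis unfolding wave_sum_def by (rule sums_unique)
qed

text \<open>Integration by parts; the boundary terms cancel because the endpoint values
  agree.\<close>

lemma fcoeff_deriv:
  assumes f: "\<And>t. t \<in> {0..1} \<Longrightarrow> (f has_vector_derivative f' t) (at t within {0..1})"
    and "f 1 = f 0"
  shows "fcoeff f' n = (2 * pi * of_int n * \<i>) * fcoeff f n"
proof -
  let ?c = "2 * pi * of_int (- n) * \<i> :: complex"
  have cf: "continuous_on {0..1} f"
    unfolding continuous_on_eq_continuous_within using has_vector_derivative_continuous[OF f] by blast
  have "((\<lambda>t. f t * (?c * fchar (- n) t) + f' t * fchar (- n) t) has_integral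
      f 1 * fchar (- n) 1 - f 0 * fchar (- n) 0) {0..1}"
    by (rule fundamental_theorem_of_calculus)
       (simp_all only: zero_le_one has_vector_derivative_mult[OF f fchar_deriv[of "- n"]])
  moreover have "((\<lambda>t. ?c * (f t * fchar (- n) t)) has_integral ?c * fcoeff f n) {0..1}"
    unfolding fcoeff_def
    by (intro has_integral_mult_right integrable_integral integrable_continuous_real continuous_intros cf)
  ultimately have "((\<lambda>t. (f t * (?c * fchar (- n) t) + f' t * fchar (- n) t) - ?c * (f t * fchar (- n) t))
     has_integral (f 1 * fchar (- n) 1 - f 0 * fchar (- n) 0) - ?c * fcoeff f n) {0..1}"
    by (rule has_integral_diff)
  then have "((\<lambda>t. f' t * fchar (- n) t) has_integral - (?c * fcoeff f n)) {0..1}"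
    using assms(2) by (simp add: algebra_simps)
  then show ?thesis unfolding fcoeff_def[of f'] by (simp add: integral_unique)
qed

lemma fcoeff_bound:
  assumes "continuous_on {0..1} f" "\<And>t. t \<in> {0..1} \<Longrightarrow> cmod (f t) \<le> B"
  shows "cmod (fcoeff f n) \<le> B"
proof -
  have "B \<ge> 0" using assms(2)[of 0] norm_ge_zero[of "f 0"] by (auto simp del: norm_ge_zero)
  have "((\<lambda>x. f x * fchar (- n) x) has_integral fcoeff f n) (cbox 0 1)"
    unfolding fcoeff_def cbox_interval
    by (intro integrable_integral integrable_continuous_real continuous_intros assms)
  then have "cmod (fcoeff f n) \<le> B * Henstock_Kurzweil_Integration.content (cbox 0 1 :: real set)"
    by (rule has_integral_bound[OF \<open>B \<ge> 0\<close>]) (use assms(2) in \<open>auto simp: norm_mult\<close>)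
  then show ?thesis by simp
qed

section \<open>The Cauchy--Riemann equation on a torus\<close>

locale period_pair =
  fixes u v :: complex
  assumes indep: "Im (u * cnj v) \<noteq> 0"
begin

text \<open>Cramer's rule for the coordinates of z in the real basis (u, v), \<open>cs\<close> along
  \<open>u\<close> and \<open>ct\<close> along \<open>v\<close>: up to sign,
  \<open>Im (x * cnj y)\<close> is the determinant of the pair x, y.\<close>

definition cs :: "complex \<Rightarrow> real" where "cs z = Im (z * cnj v) / Im (u * cnj v)"
definition ct :: "complex \<Rightarrow> real" where "ct z = Im (z * cnj u) / Im (v * cnj u)"

definition periodic :: "(complex \<Rightarrow> 'a) \<Rightarrow> bool" where
  "periodic f \<longleftrightarrow> (\<forall>z. f (z + u) = f z \<and> f (z + v) = f z)"

text \<open>The Fourier coefficient along \<open>u\<close> on the line at height t;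
  \<open>coeff\<close> then expands in t, so m belongs to \<open>u\<close> and n to
  \<open>v\<close>.\<close>

definition inner_coeff :: "(complex \<Rightarrow> complex) \<Rightarrow> int \<Rightarrow> real \<Rightarrow> complex" where
  "inner_coeff G m t = fcoeff (\<lambda>s. G (t *\<^sub>R v + s *\<^sub>R u)) m"

definition coeff :: "(complex \<Rightarrow> complex) \<Rightarrow> int \<Rightarrow> int \<Rightarrow> complex" where
  "coeff G m n = fcoeff (inner_coeff G m) n"

lemma indep': "Im (v * cnj u) \<noteq> 0" "u \<noteq> 0" "v \<noteq> 0"
  using indep by (auto simp: algebra_simps)

lemma coords: "ct z *\<^sub>R v + cs z *\<^sub>R u = z"
proof -
  define D where "D = Im (u * cnj v)"
  have D: "Im (v * cnj u) = - D" "D \<noteq> 0" using indep by (simp_all add: D_def)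
  have "D *\<^sub>R (ct z *\<^sub>R v + cs z *\<^sub>R u) = D *\<^sub>R z"
    unfolding cs_def ct_def D D_def[symmetric]
    by (simp add: complex_eq_iff D field_simps) (simp add: D_def algebra_simps)
  then show ?thesis using D by simp
qed

lemma coords_eq [simp]: "cs (t *\<^sub>R v + s *\<^sub>R u) = s" "ct (t *\<^sub>R v + s *\<^sub>R u) = t"
proof -
  have "Im ((t *\<^sub>R v + s *\<^sub>R u) * cnj v) = s * Im (u * cnj v)" "Im ((t *\<^sub>R v + s *\<^sub>R u) * cnj u) = t * Im (v * cnj u)"
    by (simp_all add: algebra_simps)
  then show "cs (t *\<^sub>R v + s *\<^sub>R u) = s" "ct (t *\<^sub>R v + s *\<^sub>R u) = t"
    unfolding cs_def ct_def
    by (simp_all only:) (rule nonzero_mult_div_cancel_right, rule indep indep'(1))+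
qed

lemma bounded_linear_coords: "bounded_linear cs" "bounded_linear ct"
  unfolding cs_def[abs_def] ct_def[abs_def]
  by (intro bounded_linear_divide bounded_linear_compose[OF bounded_linear_divide]
      bounded_linear_compose[OF bounded_linear_Im] bounded_linear_mult_left)+

lemma periodic_int:
  assumes "periodic f" shows "f (z + of_int m * u + of_int n * v) = f z"
proof -
  have 1: "f (z + of_int m * u) = f z" for z m
  proof (induction m rule: int_induct[where k = 0])
    case (step1 i)
    then show ?case using assms by (simp add: periodic_def algebra_simps) (metis add.assoc add.commute)
  next
    case (step2 i)
    have "f (z + of_int (i - 1) * u) = f (z + of_int (i - 1) * u + u)" using assms by (simp add: periodic_def)
    also have "z + of_int (i - 1) * u + u = z + of_int i * u" by (simp add: algebra_simps)
    finally show ?case using step2 by simp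
  qed simp
  have 2: "f (z + of_int n * v) = f z" for z n
  proof (induction n rule: int_induct[where k = 0])
    case (step1 i)
    then show ?case using assms by (simp add: periodic_def algebra_simps) (metis add.assoc add.commute)
  next
    case (step2 i)
    have "f (z + of_int (i - 1) * v) = f (z + of_int (i - 1) * v + v)" using assms by (simp add: periodic_def)
    also have "z + of_int (i - 1) * v + v = z + of_int i * v" by (simp add: algebra_simps)
    finally show ?case using step2 by simp
  qed simp
  show ?thesis by (simp add: 1 2)
qed

lemma periodic_reduce:
  obtains s t where "s \<in> {0..1}" "t \<in> {0..1}"
    "\<And>f :: complex \<Rightarrow> 'a. periodic f \<Longrightarrow> f z = f (t *\<^sub>R v + s *\<^sub>R u)"
proof -
  let ?s = "frac (cs z)" and ?t = "frac (ct z)"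
  have "f z = f (?t *\<^sub>R v + ?s *\<^sub>R u)" if "periodic f" for f :: "complex \<Rightarrow> 'a"
  proof -
    have "z = ct z *\<^sub>R v + cs z *\<^sub>R u" by (simp add: coords)
    also have "\<dots> = (?t *\<^sub>R v + ?s *\<^sub>R u) + of_int \<lfloor>cs z\<rfloor> * u + of_int \<lfloor>ct z\<rfloor> * v"
      by (simp add: frac_def scaleR_conv_of_real algebra_simps)
    finally show ?thesis using periodic_int[OF that] by metis
  qed
  then show ?thesis using frac_ge_0 frac_lt_1 by (intro that[of ?s ?t]) (auto intro: less_imp_le)
qed

lemma periodic_bounded:
  fixes f :: "complex \<Rightarrow> 'a::real_normed_vector"
  assumes "periodic f" "continuous_on UNIV f"
  obtains B where "B \<ge> 0" "\<And>z. norm (f z) \<le> B"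
proof -
  have "compact ((\<lambda>(s, t). f (t *\<^sub>R v + s *\<^sub>R u)) ` ({0..1} \<times> {0..1}))"
    unfolding case_prod_beta
    by (intro compact_continuous_image compact_Times compact_Icc continuous_on_compose2[OF assms(2)]
        continuous_intros) auto
  from compact_imp_bounded[OF this] obtain B
    where "\<forall>x\<in>{0..1}. \<forall>y\<in>{0..1}. norm (f (y *\<^sub>R v + x *\<^sub>R u)) \<le> B"
    unfolding bounded_iff by auto
  then have B: "norm (f (t *\<^sub>R v + s *\<^sub>R u)) \<le> B" if "s \<in> {0..1}" "t \<in> {0..1}" for s t
    using that by blast
  have "norm (f z) \<le> B" for z
    using periodic_reduce[of z] assms(1) B by metis
  moreover from this[of 0] have "B \<ge> 0" using norm_ge_zero order.trans by blast
  ultimately show ?thesis using that by blast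
qed

lemma periodic_frechet:
  fixes G :: "complex \<Rightarrow> complex"
  assumes "periodic G"
  shows "periodic (\<lambda>z. frechet_derivative G (at z) w)"
proof -
  have "frechet_derivative G (at (z + a)) = frechet_derivative G (at z)" if a: "\<And>z. G (z + a) = G z" for z a
  proof -
    have "(G has_derivative D) (at (z + a)) \<longleftrightarrow> (G has_derivative D) (at z)" for D
    proof
      assume "(G has_derivative D) (at (z + a))"
      moreover have "((\<lambda>z. z + a) has_derivative (\<lambda>h. h)) (at z)"
        by (auto intro!: derivative_eq_intros)
      ultimately have "((\<lambda>z. G (z + a)) has_derivative D) (at z)"
        using has_derivative_compose[of "\<lambda>z. z + a" "\<lambda>h. h" z UNIV G D] by blast
      then show "(G has_derivative D) (at z)" by (simp add: a)
    next
      assume "(G has_derivative D) (at z)"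
      moreover have "((\<lambda>z. z - a) has_derivative (\<lambda>h. h)) (at (z + a))"
        by (auto intro!: derivative_eq_intros)
      ultimately have "((\<lambda>z. G (z - a)) has_derivative D) (at (z + a))"
        using has_derivative_compose[of "\<lambda>z. z - a" "\<lambda>h. h" "z + a" UNIV G D] by simp
      moreover have "G (z - a) = G z" for z using a[of "z - a"] by simp
      ultimately show "(G has_derivative D) (at (z + a))" by simp
    qed
    then show ?thesis by (simp add: frechet_derivative_def)
  qed
  then show ?thesis using assms by (simp add: periodic_def)
qed

lemma continuous_on_lattice:
  "continuous_on UNIV G \<Longrightarrow> continuous_on S f \<Longrightarrow> continuous_on S g \<Longrightarrow>
    continuous_on S (\<lambda>x. G (f x *\<^sub>R v + g x *\<^sub>R u))"
  by (rule continuous_on_compose2[of UNIV G]) (auto intro!: continuous_intros)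

context
  fixes G :: "complex \<Rightarrow> complex"
  assumes G: "k_smooth_on (Suc 0) UNIV G" "periodic G"
begin

lemma G_deriv: "(G has_derivative frechet_derivative G (at z)) (at z)"
  using k_smooth_on_has_derivative[OF G(1)] by simp

lemma inner_coeff_u:
  "inner_coeff (\<lambda>z. frechet_derivative G (at z) u) m t = (2 * pi * of_int m * \<i>) * inner_coeff G m t"
  unfolding inner_coeff_def
  by (rule fcoeff_deriv, rule has_vector_derivative_line[OF G_deriv])
     (use G(2) in \<open>simp add: periodic_def\<close>)

text \<open>Differentiation under the integral sign, in the direction transverse to the
  integration.\<close>

lemma inner_coeff_deriv:
  "(inner_coeff G m has_vector_derivative inner_coeff (\<lambda>z. frechet_derivative G (at z) v) m t)
     (at t within S)"
proof -
  have cG: "continuous_on UNIV G" by (rule k_smooth_on_continuous[OF G(1)])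
  have cD: "continuous_on UNIV (\<lambda>z. frechet_derivative G (at z) v)"
    using G(1) by simp
  have "((\<lambda>t. integral (cbox 0 1) (\<lambda>s. G (t *\<^sub>R v + s *\<^sub>R u) * fchar (- m) s)) has_vector_derivative
     integral (cbox 0 1) (\<lambda>s. frechet_derivative G (at (t *\<^sub>R v + s *\<^sub>R u)) v * fchar (- m) s)) (at t within UNIV)"
  proof (rule leibniz_rule_vector_derivative)
    fix t s :: real
    have "((\<lambda>t. G (s *\<^sub>R u + t *\<^sub>R v)) has_vector_derivative
        frechet_derivative G (at (s *\<^sub>R u + t *\<^sub>R v)) v) (at t within UNIV)"
      by (rule has_vector_derivative_line[OF G_deriv])
    from has_vector_derivative_mult_left[OF this]
    show "((\<lambda>t. G (t *\<^sub>R v + s *\<^sub>R u) * fchar (- m) s) has_vector_derivative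
        frechet_derivative G (at (t *\<^sub>R v + s *\<^sub>R u)) v * fchar (- m) s) (at t within UNIV)"
      by (simp add: add.commute)
  next
    show "(\<lambda>s. G (t *\<^sub>R v + s *\<^sub>R u) * fchar (- m) s) integrable_on cbox 0 1" for t
      unfolding cbox_interval
      by (intro integrable_continuous_real continuous_intros continuous_on_lattice cG)
    show "continuous_on (UNIV \<times> cbox 0 1)
       (\<lambda>(t, s). frechet_derivative G (at (t *\<^sub>R v + s *\<^sub>R u)) v * fchar (- m) s)"
      unfolding case_prod_beta
      by (intro continuous_intros continuous_on_lattice[OF cD])
  qed auto
  then show ?thesis
    unfolding inner_coeff_def[abs_def] fcoeff_def cbox_interval
    by (rule has_vector_derivative_at_within)
qed

lemma continuous_inner_coeff: "continuous_on S (inner_coeff G m)"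
  unfolding continuous_on_eq_continuous_within
  using inner_coeff_deriv has_vector_derivative_continuous by blast

lemma coeff_u: "coeff (\<lambda>z. frechet_derivative G (at z) u) m n = (2 * pi * of_int m * \<i>) * coeff G m n"
proof -
  have "inner_coeff (\<lambda>z. frechet_derivative G (at z) u) m = (\<lambda>t. (2 * pi * of_int m * \<i>) * inner_coeff G m t)"
    using inner_coeff_u by blast
  then show ?thesis unfolding coeff_def fcoeff_def by (simp add: mult.assoc)
qed

lemma coeff_v: "coeff (\<lambda>z. frechet_derivative G (at z) v) m n = (2 * pi * of_int n * \<i>) * coeff G m n"
  unfolding coeff_def
proof (rule fcoeff_deriv, rule inner_coeff_deriv)
  have "G (1 *\<^sub>R v + s *\<^sub>R u) = G (0 *\<^sub>R v + s *\<^sub>R u)" for s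
    using G(2) unfolding periodic_def by (metis add.commute add_0 scaleR_one scaleR_zero_left)
  then show "inner_coeff G m 1 = inner_coeff G m 0" by (simp only: inner_coeff_def)
qed

lemma coeff_bounded: "\<exists>C. \<forall>m n. cmod (coeff G m n) \<le> C"
proof -
  have cG: "continuous_on UNIV G" by (rule k_smooth_on_continuous[OF G(1)])
  obtain B where B: "\<And>z. norm (G z) \<le> B" using periodic_bounded[OF G(2) cG] by blast
  have "cmod (inner_coeff G m t) \<le> B" for m t
    unfolding inner_coeff_def
    by (rule fcoeff_bound[OF continuous_on_lattice[OF cG] B]) (auto intro: continuous_intros)
  then have "cmod (coeff G m n) \<le> B" for m n
    unfolding coeff_def by (intro fcoeff_bound continuous_inner_coeff)
  then show ?thesis by blast
qed

end

text \<open>A derivative along \<open>u\<close> or \<open>v\<close> multiplies the coefficient by 2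
  pi \<i> m or 2 pi \<i> n, and coefficients of a continuous periodic function are bounded. The
  extra order in \<open>Suc (a + b)\<close> is the one that the preceding rules assume of
  \<open>G\<close>.\<close>

lemma coeff_decay:
  "k_smooth_on (Suc (a + b)) UNIV G \<Longrightarrow> periodic G \<Longrightarrow>
    \<exists>C. \<forall>m n. \<bar>of_int m\<bar> ^ a * \<bar>of_int n\<bar> ^ b * cmod (coeff G m n) \<le> C"
proof (induction a arbitrary: G)
  case 0
  then show ?case
  proof (induction b arbitrary: G)
    case 0 then show ?case using coeff_bounded by simp
  next
    case (Suc b)
    let ?G' = "\<lambda>z. frechet_derivative G (at z) v"
    have G': "k_smooth_on (Suc (0 + b)) UNIV ?G'" "periodic ?G'"
      using Suc.prems periodic_frechet by (simp_all only: k_smooth_on.simps(2)[of "Suc _"] add_0)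
    from Suc.IH[OF this] obtain C
      where C: "\<And>m n. \<bar>of_int m\<bar> ^ 0 * \<bar>of_int n\<bar> ^ b * cmod (coeff ?G' m n) \<le> C" by blast
    have "k_smooth_on (Suc 0) UNIV G" using Suc.prems(1) by (rule k_smooth_on_mono) simp
    note c = coeff_v[OF this Suc.prems(2)]
    have "\<bar>of_int m\<bar> ^ 0 * \<bar>of_int n\<bar> ^ Suc b * cmod (coeff G m n) \<le> C / (2 * pi)" for m n
      using C[of m n] unfolding c by (simp add: norm_mult field_simps)
    then show ?case by blast
  qed
next
  case (Suc a)
  let ?G' = "\<lambda>z. frechet_derivative G (at z) u"
  have G': "k_smooth_on (Suc (a + b)) UNIV ?G'" "periodic ?G'"
    using Suc.prems periodic_frechet by (simp_all only: k_smooth_on.simps(2)[of "Suc _"] add_Suc)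
  from Suc.IH[OF this] obtain C
    where C: "\<And>m n. \<bar>of_int m\<bar> ^ a * \<bar>of_int n\<bar> ^ b * cmod (coeff ?G' m n) \<le> C" by blast
  have "k_smooth_on (Suc 0) UNIV G" using Suc.prems(1) by (rule k_smooth_on_mono) simp
  note c = coeff_u[OF this Suc.prems(2)]
  have "\<bar>of_int m\<bar> ^ Suc a * \<bar>of_int n\<bar> ^ b * cmod (coeff G m n) \<le> C / (2 * pi)" for m n
    using C[of m n] unfolding c by (simp add: norm_mult field_simps)
  then show ?case by blast
qed

end

section \<open>Fourier inversion in two variables\<close>

lemma has_sum_fourier:
  assumes "((\<lambda>n. fcoeff g n * fchar n x0) has_sum S) UNIV"
    and g: "continuous_on {0..1} g" "(g has_vector_derivative g') (at x0)" and x0: "x0 \<in> {0<..<1}"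
  shows "S = g x0"
proof -
  \<comment> \<open>An unconditional sum over the integers is in particular the limit of the
    symmetric partial sums, which \<open>fourier_pointwise\<close> evaluates.\<close>
  have "filterlim (\<lambda>N. {- int N..int N}) (finite_subsets_at_top UNIV) sequentially"
    unfolding filterlim_finite_subsets_at_top
  proof (intro allI impI)
    fix X :: "int set" assume X: "finite X \<and> X \<subseteq> UNIV"
    then obtain B where B: "\<And>x. x \<in> X \<Longrightarrow> \<bar>x\<bar> \<le> B"
      by (metis bounded_iff finite_imp_bounded real_norm_def norm_of_int of_int_abs of_int_le_iff
          finite_abs_int_segment infinite_int_iff_unbounded_le nle_le)
    have "\<forall>N\<ge>nat B. X \<subseteq> {- int N..int N}" using B by force
    then show "\<forall>\<^sub>F N in sequentially. finite {- int N..int N} \<and> X \<subseteq> {- int N..int N} \<and> {- int N..int N} \<subseteq> UNIV"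
      unfolding eventually_sequentially by auto
  qed
  from filterlim_compose[OF assms(1)[unfolded has_sum_def] this]
  have "(\<lambda>N. \<Sum>n\<in>{- int N..int N}. fcoeff g n * fchar n x0) \<longlonglongrightarrow> S" .
  then show ?thesis using fourier_pointwise[OF g x0] LIMSEQ_unique by blast
qed

lemma summable_on_int_inverse_squares: "(\<lambda>m::int. 1 / (1 + \<bar>real_of_int m\<bar>)\<^sup>2) summable_on UNIV"
proof -
  let ?f = "\<lambda>m::int. 1 / (1 + \<bar>real_of_int m\<bar>)\<^sup>2"
  have s: "summable (\<lambda>n. 1 / (1 + real n)\<^sup>2)"
    using summable_Suc_iff[THEN iffD2, OF inverse_power_summable[of 2, where 'a = real]]
    by (simp add: inverse_eq_divide add.commute)
  have "?f summable_on range int"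
    by (subst summable_on_reindex) (use s in \<open>auto simp: o_def summable_on_UNIV_nonneg_real_iff inj_def\<close>)
  moreover have "?f summable_on range (\<lambda>n. - int n)"
    by (subst summable_on_reindex) (use s in \<open>auto simp: o_def summable_on_UNIV_nonneg_real_iff inj_def\<close>)
  ultimately have "?f summable_on (range int \<union> range (\<lambda>n. - int n))"
    by (rule summable_on_union)
  moreover have "range int \<union> range (\<lambda>n. - int n) = UNIV"
    by (auto simp: image_iff) (metis int_cases2)
  ultimately show ?thesis by simp
qed

text \<open>A product weight, so that sums over the lattice split into two sums over the
  integers.\<close>

definition lattice_weight :: "int \<times> int \<Rightarrow> real" where
  "lattice_weight = (\<lambda>(m, n). (1 + \<bar>of_int m\<bar>) * (1 + \<bar>of_int n\<bar>))"

lemma lattice_weight_ge_1: "lattice_weight p \<ge> 1"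
proof -
  have "(1::real) * 1 \<le> (1 + \<bar>of_int m\<bar>) * (1 + \<bar>of_int n\<bar>)" for m n :: int
    by (intro mult_mono) auto
  then show ?thesis by (auto simp: lattice_weight_def split: prod.split)
qed

lemma summable_on_lattice: "(\<lambda>p. 1 / (lattice_weight p)\<^sup>2) summable_on UNIV"
proof -
  let ?f = "\<lambda>m::int. 1 / (1 + \<bar>real_of_int m\<bar>)\<^sup>2"
  obtain S where S: "(?f has_sum S) UNIV"
    using summable_on_int_inverse_squares by (auto simp: summable_on_def)
  have "(\<lambda>p. 1 / (lattice_weight p)\<^sup>2) summable_on (Sigma UNIV (\<lambda>_. UNIV))"
  proof (rule summable_on_SigmaI)
    show "((\<lambda>n. 1 / (lattice_weight (m, n))\<^sup>2) has_sum ?f m * S) UNIV" for m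
      using has_sum_cmult_right[OF S, of "?f m"] by (simp add: lattice_weight_def power_mult_distrib)
    show "(\<lambda>m. ?f m * S) summable_on UNIV"
      by (rule summable_on_cmult_left[OF summable_on_int_inverse_squares])
  qed auto
  then show ?thesis by simp
qed

context period_pair
begin

text \<open>The vector of the dual lattice whose inner products with \<open>u\<close> and
  \<open>v\<close> are 2 pi m and 2 pi n. Multiplication by \<i> turns the inner product into the
  determinant form used in \<open>cs\<close> and \<open>ct\<close>.\<close>

definition dual :: "int \<times> int \<Rightarrow> complex" where
  "dual = (\<lambda>(m, n). (2 * pi / Im (u * cnj v)) *\<^sub>R (of_int m * (\<i> * v) - of_int n * (\<i> * u)))"

lemma dual_inner: "dual (m, n) \<bullet> z = 2 * pi * of_int m * cs z + 2 * pi * of_int n * ct z"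
proof -
  define D where "D = Im (u * cnj v)"
  have D: "Im (v * cnj u) = - D" "D \<noteq> 0" using indep by (simp_all add: D_def)
  have 1: "(of_int m * (\<i> * v) - of_int n * (\<i> * u)) \<bullet> z = of_int m * Im (z * cnj v) - of_int n * Im (z * cnj u)"
    by (simp add: inner_complex_def algebra_simps)
  have "2 * pi / D * (M * A - N * B) = 2 * pi * M * (A / D) + 2 * pi * N * (B / - D)" for M N A B :: real
    using D(2) by (simp add: field_simps)
  then show ?thesis
    unfolding dual_def prod.case cs_def ct_def D D_def[symmetric] inner_scaleR_left 1 .
qed

lemma wave_dual: "wave (dual (m, n)) z = fchar m (cs z) * fchar n (ct z)"
  by (simp add: wave_def dual_inner fchar_def cis_conv_exp distrib_left exp_add)

text \<open>Pair with \<open>u\<close> if m is nonzero and with \<open>v\<close> otherwise: a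
  nonzero integer multiple of 2 pi is bounded by the length of the dual vector times the longer
  period. Division by the symbol of \<open>dbar\<close> therefore meets no small divisors.\<close>

lemma dual_lower:
  obtains c where "c > 0" "\<And>p. p \<noteq> (0, 0) \<Longrightarrow> c \<le> cmod (dual p)"
proof -
  define M where "M = max (cmod u) (cmod v)"
  have M: "M > 0" using indep' by (simp add: M_def less_max_iff_disj)
  have "2 * pi / M \<le> cmod (dual p)" if p: "p \<noteq> (0, 0)" for p
  proof -
    obtain m n where mn: "p = (m, n)" by (cases p)
    have 1: "cs u = 1" "ct u = 0" "cs v = 0" "ct v = 1"
      using coords_eq[of 0 1] coords_eq[of 1 0] by simp_all
    have 2: "\<bar>dual p \<bullet> z\<bar> \<le> cmod (dual p) * M" if "z = u \<or> z = v" for z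
      by (rule order.trans[OF Cauchy_Schwarz_ineq2 mult_left_mono]) (use that in \<open>auto simp: M_def\<close>)
    have "2 * pi * 1 \<le> cmod (dual p) * M"
    proof (cases "m = 0")
      case False
      then have "1 \<le> \<bar>real_of_int m\<bar>" by linarith
      then have "2 * pi * 1 \<le> 2 * pi * \<bar>real_of_int m\<bar>" by simp
      also have "\<dots> \<le> cmod (dual p) * M" using 2[of u] by (simp add: mn dual_inner 1 abs_mult)
      finally show ?thesis .
    next
      case True
      then have "1 \<le> \<bar>real_of_int n\<bar>" using p mn by simp
      then have "2 * pi * 1 \<le> 2 * pi * \<bar>real_of_int n\<bar>" by simp
      also have "\<dots> \<le> cmod (dual p) * M" using 2[of v] by (simp add: mn dual_inner 1 abs_mult)
      finally show ?thesis .
    qed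
    then show ?thesis using M by (simp add: field_simps)
  qed
  then show ?thesis using that[of "2 * pi / M"] M by simp
qed

lemma dual_upper: obtains C where "C > 0" "\<And>p. 1 + cmod (dual p) \<le> C * lattice_weight p"
proof -
  define C where "C = 1 + \<bar>2 * pi / Im (u * cnj v)\<bar> * (cmod u + cmod v)"
  have "1 + cmod (dual p) \<le> C * lattice_weight p" for p
  proof -
    obtain m n where mn: "p = (m, n)" by (cases p)
    have "cmod (of_int m * (\<i> * v) - of_int n * (\<i> * u)) \<le> \<bar>of_int m\<bar> * cmod v + \<bar>of_int n\<bar> * cmod u"
      by (rule order.trans[OF norm_triangle_ineq4]) (simp add: norm_mult)
    also have "\<dots> \<le> lattice_weight p * cmod v + lattice_weight p * cmod u"
      by (intro add_mono mult_right_mono) (auto simp: mn lattice_weight_def algebra_simps)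
    finally have "\<bar>2 * pi / Im (u * cnj v)\<bar> * cmod (of_int m * (\<i> * v) - of_int n * (\<i> * u))
      \<le> \<bar>2 * pi / Im (u * cnj v)\<bar> * (lattice_weight p * cmod v + lattice_weight p * cmod u)"
      by (rule mult_left_mono) simp
    then have "cmod (dual p) \<le> \<bar>2 * pi / Im (u * cnj v)\<bar> * (lattice_weight p * cmod v + lattice_weight p * cmod u)"
      by (simp add: dual_def mn)
    then show ?thesis using lattice_weight_ge_1[of p] by (simp add: C_def algebra_simps)
  qed
  moreover have "C > 0" unfolding C_def by (intro add_pos_nonneg mult_nonneg_nonneg) auto
  ultimately show ?thesis using that by blast
qed

text \<open>Since (1 + |m|)^K is at most 2^K (1 + |m|^K), the weight is dominated by four monomials,
  and \<open>coeff_decay\<close> handles each.\<close>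

lemma coeff_weighted:
  assumes "k_smooth_on (Suc (2 * K)) UNIV G" "periodic G"
  obtains C where "\<And>p. lattice_weight p ^ K * cmod (case_prod (coeff G) p) \<le> C"
proof -
  have d: "\<exists>C. \<forall>m n. \<bar>of_int m\<bar> ^ a * \<bar>of_int n\<bar> ^ b * cmod (coeff G m n) \<le> C" if "a \<le> K" "b \<le> K" for a b
    by (rule coeff_decay[OF _ assms(2)], rule k_smooth_on_mono[OF assms(1)]) (use that in simp)
  obtain C0 where C0: "\<And>m n. cmod (coeff G m n) \<le> C0" using d[of 0 0] by auto
  obtain C1 where C1: "\<And>m n. \<bar>of_int m\<bar> ^ K * cmod (coeff G m n) \<le> C1" using d[of K 0] by auto
  obtain C2 where C2: "\<And>m n. \<bar>of_int n\<bar> ^ K * cmod (coeff G m n) \<le> C2" using d[of 0 K] by auto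
  obtain C3 where C3: "\<And>m n. \<bar>of_int m\<bar> ^ K * \<bar>of_int n\<bar> ^ K * cmod (coeff G m n) \<le> C3" using d[of K K] by auto
  have p: "(1 + \<bar>of_int m\<bar>) ^ K \<le> 2 ^ K * (1 + \<bar>of_int m\<bar> ^ K :: real)" for m :: int
  proof (cases "m = 0")
    case True
    have "1 * 1 \<le> (2 ^ K * (1 + \<bar>of_int m\<bar> ^ K) :: real)" by (intro mult_mono) auto
    then show ?thesis using True by simp
  next
    case False
    then have "1 \<le> \<bar>real_of_int m\<bar>" by linarith
    then have "(1 + \<bar>of_int m\<bar>) ^ K \<le> (2 * \<bar>of_int m\<bar> :: real) ^ K" by (intro power_mono) auto
    also have "\<dots> \<le> 2 ^ K * (1 + \<bar>of_int m\<bar> ^ K)" by (simp add: power_mult_distrib)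
    finally show ?thesis .
  qed
  have "lattice_weight p ^ K * cmod (case_prod (coeff G) p) \<le> 2 ^ K * 2 ^ K * (C0 + C1 + C2 + C3)" for p
  proof -
    obtain m n where mn: "p = (m, n)" by (cases p)
    have "lattice_weight p ^ K \<le> (2 ^ K * (1 + \<bar>of_int m\<bar> ^ K)) * (2 ^ K * (1 + \<bar>of_int n\<bar> ^ K))"
      unfolding mn lattice_weight_def prod.case power_mult_distrib by (intro mult_mono p) auto
    from mult_right_mono[OF this norm_ge_zero[of "coeff G m n"]]
    have "lattice_weight p ^ K * cmod (coeff G m n) \<le> 2 ^ K * 2 ^ K *
      (cmod (coeff G m n) + \<bar>of_int m\<bar> ^ K * cmod (coeff G m n) + \<bar>of_int n\<bar> ^ K * cmod (coeff G m n)
        + \<bar>of_int m\<bar> ^ K * \<bar>of_int n\<bar> ^ K * cmod (coeff G m n))"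
      by (simp add: algebra_simps)
    also have "\<dots> \<le> 2 ^ K * 2 ^ K * (C0 + C1 + C2 + C3)"
      by (intro mult_left_mono add_mono C0 C1 C2 C3) auto
    finally show ?thesis by (simp add: mn)
  qed
  then show ?thesis using that by blast
qed

text \<open>Two powers of the weight beyond \<open>k\<close> are spent on summability over the
  lattice, and the weight exponent k + 2 costs 2 (k + 2) + 1 = 2 k + 5 derivatives.\<close>

lemma coeff_summable_on:
  assumes "k_smooth_on (2 * k + 5) UNIV G" "periodic G"
  shows "(\<lambda>p. cmod (case_prod (coeff G) p) * (1 + cmod (dual p)) ^ k) summable_on UNIV"
proof -
  have "k_smooth_on (Suc (2 * (k + 2))) UNIV G" using assms(1) by (rule k_smooth_on_mono) simp
  from coeff_weighted[OF this assms(2)] obtain C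
    where C: "\<And>p. lattice_weight p ^ (k + 2) * cmod (case_prod (coeff G) p) \<le> C" by blast
  obtain D where D: "D > 0" "\<And>p. 1 + cmod (dual p) \<le> D * lattice_weight p" using dual_upper by blast
  have "(\<lambda>p. D ^ k * C * (1 / (lattice_weight p)\<^sup>2)) summable_on UNIV"
    by (rule summable_on_cmult_right[OF summable_on_lattice])
  then show ?thesis
  proof (rule summable_on_comparison_test)
    fix p
    have w: "lattice_weight p > 0" using lattice_weight_ge_1[of p] by simp
    have "(1 + cmod (dual p)) ^ k \<le> (D * lattice_weight p) ^ k" by (intro power_mono D) simp
    then have "cmod (case_prod (coeff G) p) * (1 + cmod (dual p)) ^ k
       \<le> cmod (case_prod (coeff G) p) * (D * lattice_weight p) ^ k"
      by (rule mult_left_mono) simp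
    also have "\<dots> = D ^ k * (lattice_weight p ^ (k + 2) * cmod (case_prod (coeff G) p)) / (lattice_weight p)\<^sup>2"
      using w by (simp add: power_mult_distrib power_add power2_eq_square)
    also have "\<dots> \<le> D ^ k * C / (lattice_weight p)\<^sup>2"
      using D w by (intro divide_right_mono mult_left_mono C) auto
    finally show "cmod (case_prod (coeff G) p) * (1 + cmod (dual p)) ^ k \<le> D ^ k * C * (1 / (lattice_weight p)\<^sup>2)"
      by simp
  qed auto
qed

text \<open>Absolute summability permits summing over n first. One-dimensional inversion in t
  recovers \<open>inner_coeff G m (ct z)\<close>, and a second inversion in s recovers
  \<open>G z\<close>; both are applied at interior points, which is the restriction on z.\<close>

lemma fourier_inversion:
  assumes G: "k_smooth_on 5 UNIV G" "periodic G" and z: "cs z \<in> {0<..<1}" "ct z \<in> {0<..<1}"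
  shows "((\<lambda>p. case_prod (coeff G) p * wave (dual p) z) has_sum G z) UNIV"
proof -
  have G1: "k_smooth_on (Suc 0) UNIV G" using G(1) by (rule k_smooth_on_mono) simp
  note dG = k_smooth_on_has_derivative[OF G1]
  let ?f = "\<lambda>p. case_prod (coeff G) p * wave (dual p) z"
  have "(\<lambda>p. cmod (?f p)) summable_on UNIV"
    using coeff_summable_on[of 0 G] G by (simp add: norm_mult)
  then have "?f summable_on UNIV" by (rule abs_summable_summable)
  then obtain S where S: "(?f has_sum S) (Sigma UNIV (\<lambda>_. UNIV))"
    by (auto simp: summable_on_def)
  have inner: "((\<lambda>n. ?f (m, n)) has_sum fchar m (cs z) * inner_coeff G m (ct z)) UNIV" for m
  proof -
    have "(\<lambda>n. ?f (m, n)) summable_on UNIV"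
      by (rule summable_on_SigmaD1[of "\<lambda>m n. ?f (m, n)" UNIV "\<lambda>_. UNIV" m])
         (use S in \<open>auto simp: summable_on_def case_prod_unfold\<close>)
    then obtain T where T: "((\<lambda>n. ?f (m, n)) has_sum T) UNIV" by (auto simp: summable_on_def)
    have "((\<lambda>n. fchar (- m) (cs z) * ?f (m, n)) has_sum fchar (- m) (cs z) * T) UNIV"
      by (rule has_sum_cmult_right[OF T])
    moreover have "fchar (- m) (cs z) * ?f (m, n) = fcoeff (inner_coeff G m) n * fchar n (ct z)" for n
      using fchar_mult_neg[of m "cs z"] by (simp add: wave_dual coeff_def mult_ac)
    ultimately have "((\<lambda>n. fcoeff (inner_coeff G m) n * fchar n (ct z)) has_sum fchar (- m) (cs z) * T) UNIV"
      by simp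
    from has_sum_fourier[OF this continuous_inner_coeff[OF G1 G(2)] inner_coeff_deriv[OF G1 G(2)] z(2)]
    have "fchar (- m) (cs z) * T = inner_coeff G m (ct z)" .
    then have "T = fchar m (cs z) * inner_coeff G m (ct z)"
      using fchar_mult_neg[of m "cs z"] by (metis mult.assoc mult_1)
    then show ?thesis using T by simp
  qed
  have "((\<lambda>m. fchar m (cs z) * inner_coeff G m (ct z)) has_sum S) UNIV"
    by (rule has_sum_SigmaD[OF S]) (rule inner)
  then have "((\<lambda>m. fcoeff (\<lambda>s. G (ct z *\<^sub>R v + s *\<^sub>R u)) m * fchar m (cs z)) has_sum S) UNIV"
    by (simp add: inner_coeff_def mult.commute)
  from has_sum_fourier[OF this _ has_vector_derivative_line[OF dG] z(1)]
  have "S = G (ct z *\<^sub>R v + cs z *\<^sub>R u)"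
    using continuous_on_lattice[OF k_smooth_on_continuous[OF G1]] by (auto intro!: continuous_intros)
  then show ?thesis using S by (simp add: coords)
qed

text \<open>The shifts z + (u + v) / (k + 1) raise both fractional parts slightly. Once these are
  positive and below 1, periodicity moves the point into the open parallelogram, and continuity
  gives the equality at z itself.\<close>

lemma continuous_periodic_eq:
  fixes f g :: "complex \<Rightarrow> complex"
  assumes "continuous_on UNIV f" "continuous_on UNIV g" "periodic f" "periodic g"
    and eq: "\<And>z. cs z \<in> {0<..<1} \<Longrightarrow> ct z \<in> {0<..<1} \<Longrightarrow> f z = g z"
  shows "f z = g z"
proof -
  define zz where "zz k = z + (1 / real (Suc k)) *\<^sub>R v + (1 / real (Suc k)) *\<^sub>R u" for k
  have l0: "(\<lambda>k. 1 / real (Suc k)) \<longlonglongrightarrow> 0"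
    using LIMSEQ_inverse_real_of_nat by (simp add: inverse_eq_divide)
  have lim: "zz \<longlonglongrightarrow> z + 0 *\<^sub>R v + 0 *\<^sub>R u"
    unfolding zz_def by (intro tendsto_intros l0)
  have pos: "0 < 1 - frac x" for x :: real by (simp add: frac_lt_1)
  have "eventually (\<lambda>k. 1 / real (Suc k) < 1 - frac (cs z)) sequentially"
    "eventually (\<lambda>k. 1 / real (Suc k) < 1 - frac (ct z)) sequentially"
    using order_tendstoD(2)[OF l0 pos] by blast+
  then have "eventually (\<lambda>k. f (zz k) = g (zz k)) sequentially"
  proof eventually_elim
    case (elim k)
    define w where "w = (frac (ct z) + 1 / real (Suc k)) *\<^sub>R v + (frac (cs z) + 1 / real (Suc k)) *\<^sub>R u"
    have "z = ct z *\<^sub>R v + cs z *\<^sub>R u" by (simp add: coords)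
    then have "zz k = (ct z + 1 / real (Suc k)) *\<^sub>R v + (cs z + 1 / real (Suc k)) *\<^sub>R u"
      unfolding zz_def by (simp add: algebra_simps)
    also have "\<dots> = w + of_int \<lfloor>cs z\<rfloor> * u + of_int \<lfloor>ct z\<rfloor> * v"
      by (simp add: w_def frac_def scaleR_conv_of_real algebra_simps)
    finally have "f (zz k) = f w" "g (zz k) = g w"
      using periodic_int[OF assms(3), of w] periodic_int[OF assms(4), of w] by metis+
    moreover have "cs w = frac (cs z) + 1 / real (Suc k)" "ct w = frac (ct z) + 1 / real (Suc k)"
      unfolding w_def by (rule coords_eq)+
    then have "f w = g w" using elim by (intro eq) (auto simp: add_nonneg_pos)
    ultimately show ?case by simp
  qed
  moreover have lims: "(\<lambda>k. f (zz k)) \<longlonglongrightarrow> f z" "(\<lambda>k. g (zz k)) \<longlonglongrightarrow> g z"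
    using continuous_on_tendsto_compose[OF assms(1) lim] continuous_on_tendsto_compose[OF assms(2) lim]
    by simp_all
  ultimately have "(\<lambda>k. g (zz k)) \<longlonglongrightarrow> f z"
    by (intro Lim_transform_eventually[OF lims(1)])
  then show ?thesis by (rule LIMSEQ_unique[OF _ lims(2)])
qed

text \<open>On plane waves \<open>dbar\<close> is multiplication by \<i> w / 2, so every frequency
  except 0 can be divided out, and the mean of \<open>G\<close> remains. With 1/|w| bounded by a
  constant, a k-smooth wave sum needs weight exponent k + 1, hence 2 (k + 1) + 5 = 2 k + 7
  derivatives of \<open>G\<close>.\<close>

theorem dbar_solvable:
  assumes G: "k_smooth_on 7 UNIV G" "periodic G"
  obtains f where "\<And>z. dbar f z = G z - coeff G 0 0" "periodic f"
    "\<And>k. k_smooth_on (2 * k + 7) UNIV G \<Longrightarrow> k_smooth_on k UNIV f"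
proof -
  define e where "e = from_nat_into (UNIV :: (int \<times> int) set)"
  have e: "bij_betw e UNIV UNIV"
    unfolding e_def by (rule bij_betw_from_nat_into) (auto simp: finite_prod)
  define w where "w i = dual (e i)" for i
  \<comment> \<open>The zero frequency gets amplitude 0; subtracting \<open>coeff G 0 0\<close>
    accounts for it.\<close>
  define a where "a i = (if e i = (0, 0) then 0 else case_prod (coeff G) (e i) / ((\<i> / 2) * w i))" for i
  obtain c where c: "c > 0" "\<And>p. p \<noteq> (0, 0) \<Longrightarrow> c \<le> cmod (dual p)" using dual_lower by blast
  have sm: "summable (\<lambda>i. cmod (a i) * (1 + cmod (w i)) ^ Suc k)" if "k_smooth_on (2 * k + 7) UNIV G" for k
  proof -
    have "k_smooth_on (2 * Suc k + 5) UNIV G" using that by (rule k_smooth_on_mono) simp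
    from coeff_summable_on[OF this G(2)]
    have "(\<lambda>i. cmod (case_prod (coeff G) (e i)) * (1 + cmod (w i)) ^ Suc k) summable_on UNIV"
      unfolding w_def by (subst summable_on_reindex_bij_betw[OF e])
    then have "summable (\<lambda>i. cmod (case_prod (coeff G) (e i)) * (1 + cmod (w i)) ^ Suc k)"
      by (rule summable_on_imp_summable)
    note s = summable_mult[OF this, of "2 / c"]
    show ?thesis
    proof (rule summable_comparison_test'[OF s, of 0])
      fix i
      have "cmod (a i) \<le> 2 / c * cmod (case_prod (coeff G) (e i))"
      proof (cases "e i = (0, 0)")
        case False
        have "cmod (a i) = 2 * cmod (case_prod (coeff G) (e i)) / cmod (w i)"
          using False by (simp add: a_def norm_divide norm_mult field_simps)
        also have "\<dots> \<le> 2 * cmod (case_prod (coeff G) (e i)) / c"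
          using c(1) c(2)[OF False] by (intro divide_left_mono) (auto simp: w_def intro!: mult_pos_pos)
        finally show ?thesis by simp
      qed (use c in \<open>simp add: a_def\<close>)
      from mult_right_mono[OF this, of "(1 + cmod (w i)) ^ Suc k"]
      show "norm (cmod (a i) * (1 + cmod (w i)) ^ Suc k)
          \<le> 2 / c * (cmod (case_prod (coeff G) (e i)) * (1 + cmod (w i)) ^ Suc k)"
        by (simp add: mult.assoc)
    qed
  qed
  define f where "f = wave_sum w a"
  have s1: "summable (\<lambda>i. cmod (a i) * (1 + cmod (w i)))" using sm[of 0] G(1) by simp
  have f1: "dbar f z = wave_sum w (\<lambda>i. (\<i> / 2) * w i * a i) z" for z
    unfolding f_def by (rule dbar_wave_sum[OF s1])
  have wave_per: "wave (dual p) (z + u) = wave (dual p) z" "wave (dual p) (z + v) = wave (dual p) z" for p z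
  proof -
    have "cs (z + u) = cs z + 1" "ct (z + u) = ct z" "cs (z + v) = cs z" "ct (z + v) = ct z + 1"
      using coords_eq[of 0 1] coords_eq[of 1 0] bounded_linear_coords
      by (simp_all add: linear_add[OF bounded_linear.linear])
    moreover have "fchar n (x + 1) = fchar n x" for n x
      using cis_multiple_2pi[of "of_int n"] by (simp add: fchar_def distrib_left mult.assoc flip: cis_mult)
    ultimately show "wave (dual p) (z + u) = wave (dual p) z" "wave (dual p) (z + v) = wave (dual p) z"
      by (cases p; simp add: wave_dual)+
  qed
  have f2: "periodic f"
    unfolding periodic_def f_def wave_sum_def w_def by (simp add: wave_per)
  have f3: "k_smooth_on k UNIV f" if "k_smooth_on (2 * k + 7) UNIV G" for k
    unfolding f_def by (rule k_smooth_on_wave_sum[OF sm[OF that]])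
  have s2: "summable (\<lambda>i. cmod ((\<i> / 2) * w i * a i) * (1 + cmod (w i)) ^ Suc 0)"
  proof -
    have "(\<lambda>i. cmod (case_prod (coeff G) (e i)) * (1 + cmod (w i)) ^ 1) summable_on UNIV"
      unfolding w_def using coeff_summable_on[of 1 G] G by (subst summable_on_reindex_bij_betw[OF e]) auto
    then have "summable (\<lambda>i. cmod (case_prod (coeff G) (e i)) * (1 + cmod (w i)) ^ 1)"
      by (rule summable_on_imp_summable)
    note s = this
    show ?thesis
    proof (rule summable_comparison_test'[OF s, of 0])
      fix i
      have "cmod ((\<i> / 2) * w i * a i) \<le> cmod (case_prod (coeff G) (e i))"
        using c by (auto simp: a_def w_def norm_mult norm_divide)
      from mult_right_mono[OF this, of "1 + cmod (w i)"]
      show "norm (cmod ((\<i> / 2) * w i * a i) * (1 + cmod (w i)) ^ Suc 0)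
         \<le> cmod (case_prod (coeff G) (e i)) * (1 + cmod (w i)) ^ 1"
        by simp
    qed
  qed
  have "wave_sum w (\<lambda>i. (\<i> / 2) * w i * a i) z = G z - coeff G 0 0" for z
  proof (rule continuous_periodic_eq[of "wave_sum w (\<lambda>i. (\<i> / 2) * w i * a i)" "\<lambda>z. G z - coeff G 0 0"])
    show "continuous_on UNIV (wave_sum w (\<lambda>i. (\<i> / 2) * w i * a i))"
      by (rule k_smooth_on_continuous[OF k_smooth_on_wave_sum[OF s2]])
    show "continuous_on UNIV (\<lambda>z. G z - coeff G 0 0)"
      by (intro continuous_intros k_smooth_on_continuous[OF G(1)])
    show "periodic (wave_sum w (\<lambda>i. (\<i> / 2) * w i * a i))"
      unfolding periodic_def wave_sum_def w_def by (simp add: wave_per)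
    show "periodic (\<lambda>z. G z - coeff G 0 0)" using G(2) by (simp add: periodic_def)
    fix z assume z: "cs z \<in> {0<..<1}" "ct z \<in> {0<..<1}"
    have "((\<lambda>p. case_prod (coeff G) p * wave (dual p) z) has_sum G z) UNIV"
      by (rule fourier_inversion[OF _ G(2) z]) (rule k_smooth_on_mono[OF G(1)], simp)
    moreover have "((\<lambda>p. if p = (0, 0) then - coeff G 0 0 else 0) has_sum - coeff G 0 0) UNIV"
      by (rule has_sum_finite_neutralI[of "{(0, 0)}"]) auto
    ultimately have "((\<lambda>p. case_prod (coeff G) p * wave (dual p) z + (if p = (0, 0) then - coeff G 0 0 else 0))
        has_sum G z + - coeff G 0 0) UNIV"
      by (rule has_sum_add)
    then have "((\<lambda>i. case_prod (coeff G) (e i) * wave (dual (e i)) z + (if e i = (0, 0) then - coeff G 0 0 else 0))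
        has_sum G z + - coeff G 0 0) UNIV"
      by (subst has_sum_reindex_bij_betw[OF e])
    moreover have "case_prod (coeff G) (e i) * wave (dual (e i)) z + (if e i = (0, 0) then - coeff G 0 0 else 0)
       = (\<i> / 2) * w i * a i * wave (w i) z" for i
    proof (cases "e i = (0, 0)")
      case False
      then have "w i \<noteq> 0" using c(1) c(2)[OF False] by (auto simp: w_def)
      then show ?thesis using False by (simp add: a_def w_def)
    qed (simp add: a_def wave_dual)
    ultimately have "((\<lambda>i. (\<i> / 2) * w i * a i * wave (w i) z) has_sum (G z + - coeff G 0 0)) UNIV"
      by (simp only:)
    note sums = has_sum_imp_sums[OF this]
    have "summable (\<lambda>i. cmod ((\<i> / 2) * w i * a i))"
      by (rule summable_comparison_test'[OF s2, of 0]) (simp add: algebra_simps)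
    then show "wave_sum w (\<lambda>i. (\<i> / 2) * w i * a i) z = G z - coeff G 0 0"
      using sums_unique2[OF wave_sum_sums sums] by simp
  qed
  then have "dbar f z = G z - coeff G 0 0" for z by (simp only: f1)
  then show ?thesis by (rule that[OF _ f2 f3])
qed

text \<open>The mean is at least the minimum over the closed fundamental parallelogram, which is
  attained by compactness and hence positive.\<close>

lemma coeff_0_pos:
  assumes "continuous_on UNIV r" "\<And>z. r z > 0" "periodic r"
  shows "coeff (\<lambda>z. complex_of_real (r z)) 0 0 \<noteq> 0"
proof -
  have "compact ((\<lambda>(s, t). r (t *\<^sub>R v + s *\<^sub>R u)) ` ({0..1} \<times> {0..1}))"
    unfolding case_prod_beta
    by (intro compact_continuous_image compact_Times compact_Icc continuous_on_compose2[OF assms(1)]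
        continuous_intros) auto
  from compact_attains_inf[OF this] obtain s0 t0 where
    st: "\<And>s t. s \<in> {0..1} \<Longrightarrow> t \<in> {0..1} \<Longrightarrow> r (t0 *\<^sub>R v + s0 *\<^sub>R u) \<le> r (t *\<^sub>R v + s *\<^sub>R u)"
    by fastforce
  define d where "d = r (t0 *\<^sub>R v + s0 *\<^sub>R u)"
  have c: "continuous_on ({0..1} \<times> {0..1}) (\<lambda>(t, s). r (t *\<^sub>R v + s *\<^sub>R u))"
    unfolding case_prod_beta
    by (intro continuous_on_compose2[OF assms(1)] continuous_intros) auto
  have c1: "continuous_on {0..1} (\<lambda>s. r (t *\<^sub>R v + s *\<^sub>R u))" for t
    by (intro continuous_on_compose2[OF assms(1)] continuous_intros) auto
  define I where "I t = integral {0..1} (\<lambda>s. r (t *\<^sub>R v + s *\<^sub>R u))" for t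
  have I: "((\<lambda>s. r (t *\<^sub>R v + s *\<^sub>R u)) has_integral I t) {0..1}" for t
    unfolding I_def by (intro integrable_integral integrable_continuous_real c1)
  have Id: "d \<le> I t" if "t \<in> {0..1}" for t
    using has_integral_le[OF has_integral_const_real[of d 0 1] I] st that by (simp add: d_def)
  have cI: "continuous_on {0..1} I"
    using integral_continuous_on_param[of "{0..1}" 0 1 "\<lambda>t s. r (t *\<^sub>R v + s *\<^sub>R u)"] c
    by (simp add: I_def[abs_def])
  then have J: "(I has_integral integral {0..1} I) {0..1}"
    by (intro integrable_integral integrable_continuous_real)
  have "d \<le> integral {0..1} I"
    using has_integral_le[OF has_integral_const_real[of d 0 1] J] Id by simp
  moreover have "d > 0" using assms(2) by (simp add: d_def)
  moreover have "inner_coeff (\<lambda>z. complex_of_real (r z)) 0 t = of_real (I t)" for t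
    unfolding inner_coeff_def fcoeff_def
    by (rule integral_unique) (use has_integral_of_real[OF I[of t]] in simp)
  moreover have "((\<lambda>t. complex_of_real (I t)) has_integral of_real (integral {0..1} I)) {0..1}"
    by (rule has_integral_of_real[OF J])
  ultimately have "coeff (\<lambda>z. complex_of_real (r z)) 0 0 = of_real (integral {0..1} I)" "d > 0" "d \<le> integral {0..1} I"
    unfolding coeff_def fcoeff_def by (simp_all add: integral_unique)
  then show ?thesis by simp
qed

end

lemma smooth_on_compose_holomorphic:
  fixes f :: "complex \<Rightarrow> 'a::real_normed_vector"
  assumes "open S" "open T" "g holomorphic_on S" "g ` S \<subseteq> T" "smooth_on T f"
  shows "smooth_on S (\<lambda>x. f (g x))"
  unfolding smooth_on_def
proof
  show "k_smooth_on k S (\<lambda>x. f (g x))" for k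
    by (rule k_smooth_on_compose[OF assms(1,2,4) smooth_onD[OF assms(5)] k_smooth_on_holomorphic[OF assms(1,3)]])
qed

section \<open>Holomorphic parametrisations\<close>

text \<open>Locally biholomorphic maps into the surface. Injectivity is not demanded, so that
  inverses of charts, flat discs and the covering by the plane are all instances.\<close>

definition param :: "('x::t2_space) chart set \<Rightarrow> complex set \<Rightarrow> (complex \<Rightarrow> 'x) \<Rightarrow> bool" where
  "param \<A> D \<psi> \<longleftrightarrow> open D \<and> continuous_on D \<psi> \<and>
     (\<forall>c\<in>\<A>. (snd c \<circ> \<psi>) holomorphic_on (D \<inter> \<psi> -` fst c) \<and>
        (\<forall>z\<in>D \<inter> \<psi> -` fst c. deriv (snd c \<circ> \<psi>) z \<noteq> 0))"

locale surface =
  fixes \<A> :: "('x::t2_space) chart set"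
  assumes surface: "riemann_surface \<A>"
begin

lemma chart_exists: obtains c where "c \<in> \<A>" "x \<in> fst c"
  using surface unfolding riemann_surface_def by blast

lemma chart_facts:
  assumes "c \<in> \<A>"
  shows "open (fst c)" "open (snd c ` fst c)" "continuous_on (fst c) (snd c)"
    "continuous_on (snd c ` fst c) (chart_inv c)"
    "\<And>x. x \<in> fst c \<Longrightarrow> chart_inv c (snd c x) = x"
    "\<And>w. w \<in> snd c ` fst c \<Longrightarrow> chart_inv c w \<in> fst c"
    "\<And>w. w \<in> snd c ` fst c \<Longrightarrow> snd c (chart_inv c w) = w"
proof -
  have h: "homeomorphism (fst c) (snd c ` fst c) (snd c) (chart_inv c)"
    and o: "open (fst c)" "open (snd c ` fst c)"
    using surface assms by (auto simp: riemann_surface_def)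
  show "open (fst c)" "open (snd c ` fst c)" by fact+
  show "continuous_on (fst c) (snd c)" "continuous_on (snd c ` fst c) (chart_inv c)"
    "\<And>x. x \<in> fst c \<Longrightarrow> chart_inv c (snd c x) = x"
    "\<And>w. w \<in> snd c ` fst c \<Longrightarrow> chart_inv c w \<in> fst c"
    "\<And>w. w \<in> snd c ` fst c \<Longrightarrow> snd c (chart_inv c w) = w"
    using h by (auto simp: homeomorphism_def)
qed

lemma chart_transition:
  assumes "c \<in> \<A>" "d \<in> \<A>"
  shows "(snd d \<circ> chart_inv c) holomorphic_on (snd c ` (fst c \<inter> fst d))"
  using surface assms by (auto simp: riemann_surface_def)

lemma chart_image_eq: "c \<in> \<A> \<Longrightarrow> snd c ` (U \<inter> fst c) = snd c ` fst c \<inter> chart_inv c -` U"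
  by (auto simp: chart_facts)

lemma open_chart_image: "c \<in> \<A> \<Longrightarrow> open U \<Longrightarrow> open (snd c ` (U \<inter> fst c))"
  unfolding chart_image_eq
  by (rule continuous_open_preimage[OF chart_facts(4,2)])

lemma param_open: "param \<A> D \<psi> \<Longrightarrow> open D"
  and param_continuous: "param \<A> D \<psi> \<Longrightarrow> continuous_on D \<psi>"
  by (auto simp: param_def)

lemma param_open_vimage: "param \<A> D \<psi> \<Longrightarrow> open U \<Longrightarrow> open (D \<inter> \<psi> -` U)"
  using continuous_open_preimage param_open param_continuous by blast

lemma param_holomorphic:
  assumes "param \<A> D \<psi>" "c \<in> \<A>"
  shows "(snd c \<circ> \<psi>) holomorphic_on (D \<inter> \<psi> -` fst c)"
    "\<And>z. z \<in> D \<Longrightarrow> \<psi> z \<in> fst c \<Longrightarrow> deriv (snd c \<circ> \<psi>) z \<noteq> 0"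
  using assms by (auto simp: param_def)

lemma param_subset: "param \<A> D \<psi> \<Longrightarrow> open S \<Longrightarrow> S \<subseteq> D \<Longrightarrow> param \<A> S \<psi>"
  unfolding param_def by (blast intro: continuous_on_subset holomorphic_on_subset)

lemma param_cong:
  assumes "param \<A> D \<psi>" "\<And>z. z \<in> D \<Longrightarrow> \<psi> z = \<psi>' z" shows "param \<A> D \<psi>'"
proof -
  have op: "open (D \<inter> \<psi> -` fst c)" if "c \<in> \<A>" for c
    by (rule param_open_vimage[OF assms(1) chart_facts(1)[OF that]])
  have e: "D \<inter> \<psi>' -` fst c = D \<inter> \<psi> -` fst c" for c using assms(2) by auto
  have h: "(snd c \<circ> \<psi>') holomorphic_on (D \<inter> \<psi> -` fst c)" if "c \<in> \<A>" for c
    using param_holomorphic(1)[OF assms(1) that] by (rule holomorphic_transform) (simp add: assms(2))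
  have d: "deriv (snd c \<circ> \<psi>') z = deriv (snd c \<circ> \<psi>) z" if "c \<in> \<A>" "z \<in> D \<inter> \<psi> -` fst c" for c z
    by (rule complex_derivative_transform_within_open[OF h[OF that(1)] param_holomorphic(1)[OF assms(1) that(1)] op[OF that(1)] that(2)])
       (simp add: assms(2))
  show ?thesis
    unfolding param_def
  proof (intro conjI ballI)
    show "continuous_on D \<psi>'" using param_continuous[OF assms(1)] assms(2) by (simp cong: continuous_on_cong)
    fix c assume c: "c \<in> \<A>"
    show "(snd c \<circ> \<psi>') holomorphic_on (D \<inter> \<psi>' -` fst c)"
      unfolding e by (rule h[OF c])
    show "deriv (snd c \<circ> \<psi>') z \<noteq> 0" if "z \<in> D \<inter> \<psi>' -` fst c" for z
      using d[OF c, of z] param_holomorphic(2)[OF assms(1) c, of z] that assms(2)[of z] by auto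
  qed (rule param_open[OF assms(1)])
qed

text \<open>The derivative of a transition map is nonzero because the opposite transition inverts
  it.\<close>

lemma param_chart:
  assumes "c \<in> \<A>" shows "param \<A> (snd c ` fst c) (chart_inv c)"
  unfolding param_def
proof (intro conjI ballI)
  fix d assume d: "d \<in> \<A>"
  have e: "snd c ` fst c \<inter> chart_inv c -` fst d = snd c ` (fst c \<inter> fst d)"
    using chart_image_eq[OF assms, of "fst d"] by (simp add: Int_commute)
  show h: "(snd d \<circ> chart_inv c) holomorphic_on (snd c ` fst c \<inter> chart_inv c -` fst d)"
    unfolding e by (rule chart_transition[OF assms d])
  fix z assume z: "z \<in> snd c ` fst c \<inter> chart_inv c -` fst d"
  have o: "open (snd c ` fst c \<inter> chart_inv c -` fst d)" "open (snd d ` (fst d \<inter> fst c))"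
    using open_chart_image[OF assms chart_facts(1)[OF d]] open_chart_image[OF d chart_facts(1)[OF assms]]
    unfolding e by (simp_all add: Int_commute)
  let ?w = "snd d (chart_inv c z)"
  have "(snd d \<circ> chart_inv c) field_differentiable (at z)"
    using holomorphic_on_imp_differentiable_at[OF h o(1) z] .
  moreover have "(snd c \<circ> chart_inv d) field_differentiable (at ((snd d \<circ> chart_inv c) z))"
    by (rule holomorphic_on_imp_differentiable_at[OF chart_transition[OF d assms] o(2)])
       (use z chart_facts(6)[OF assms] in auto)
  ultimately have "deriv ((snd c \<circ> chart_inv d) \<circ> (snd d \<circ> chart_inv c)) z
      = deriv (snd c \<circ> chart_inv d) ((snd d \<circ> chart_inv c) z) * deriv (snd d \<circ> chart_inv c) z"
    by (rule deriv_chain)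
  moreover have "deriv ((snd c \<circ> chart_inv d) \<circ> (snd d \<circ> chart_inv c)) z = deriv (\<lambda>w. w) z"
    by (rule complex_derivative_transform_within_open[OF _ _ o(1) z])
       (use holomorphic_on_compose_gen[OF h chart_transition[OF d assms]] chart_facts[OF assms] chart_facts[OF d]
         in \<open>auto intro!: holomorphic_intros simp: image_subset_iff\<close>)
  ultimately show "deriv (snd d \<circ> chart_inv c) z \<noteq> 0" by auto
qed (use chart_facts[OF assms] in auto)

lemma param_compose:
  assumes p: "param \<A> D' \<psi>'" and g: "g holomorphic_on D" "open D" "g ` D \<subseteq> D'"
    "\<And>z. z \<in> D \<Longrightarrow> deriv g z \<noteq> 0"
  shows "param \<A> D (\<psi>' \<circ> g)"
  unfolding param_def
proof (intro conjI ballI)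
  show "continuous_on D (\<psi>' \<circ> g)"
    using param_continuous[OF p] g
    by (intro continuous_on_compose) (auto intro: holomorphic_on_imp_continuous_on continuous_on_subset)
  fix c assume c: "c \<in> \<A>"
  let ?E = "D \<inter> (\<psi>' \<circ> g) -` fst c" and ?E' = "D' \<inter> \<psi>' -` fst c"
  have sub: "g ` ?E \<subseteq> ?E'" using g by auto
  have gE: "g holomorphic_on ?E" using g(1) by (rule holomorphic_on_subset) auto
  show "(snd c \<circ> (\<psi>' \<circ> g)) holomorphic_on ?E"
    using holomorphic_on_compose_gen[OF gE param_holomorphic(1)[OF p c] sub] by (simp add: o_assoc)
  fix z assume z: "z \<in> ?E"
  have 1: "g field_differentiable (at z)" using g z by (auto intro: holomorphic_on_imp_differentiable_at)
  have 2: "(snd c \<circ> \<psi>') field_differentiable (at (g z))"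
    by (rule holomorphic_on_imp_differentiable_at[OF param_holomorphic(1)[OF p c] param_open_vimage[OF p chart_facts(1)[OF c]]])
       (use z sub in auto)
  show "deriv (snd c \<circ> (\<psi>' \<circ> g)) z \<noteq> 0"
    unfolding o_assoc deriv_chain[OF 1 2]
    using g(4)[of z] param_holomorphic(2)[OF p c, of "g z"] z sub by (simp add: image_subset_iff)
qed (rule g)

text \<open>In a chart around the common point both parametrisations become holomorphic functions
  with nonzero derivative. The one of \<open>\<psi>'\<close> has a local inverse, and composing with
  it gives \<open>g\<close>; injectivity of the chart turns equal coordinates into equal
  points.\<close>

lemma param_transition:
  assumes p: "param \<A> D \<psi>" and p': "param \<A> D' \<psi>'" and z: "z \<in> D" "z' \<in> D'" "\<psi> z = \<psi>' z'"
  obtains B g where "open B" "z \<in> B" "B \<subseteq> D" "g holomorphic_on B" "g z = z'" "g ` B \<subseteq> D'"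
    "\<And>w. w \<in> B \<Longrightarrow> deriv g w \<noteq> 0" "\<And>w. w \<in> B \<Longrightarrow> \<psi> w = \<psi>' (g w)"
proof -
  obtain c where c: "c \<in> \<A>" "\<psi> z \<in> fst c" using chart_exists .
  define f f' where "f = snd c \<circ> \<psi>" and "f' = snd c \<circ> \<psi>'"
  let ?E = "D \<inter> \<psi> -` fst c" and ?E' = "D' \<inter> \<psi>' -` fst c"
  have oE: "open ?E" "open ?E'" using param_open_vimage p p' chart_facts(1)[OF c(1)] by blast+
  have hf: "f holomorphic_on ?E" "f' holomorphic_on ?E'"
    using param_holomorphic(1) p p' c(1) by (auto simp: f_def f'_def)
  have zE: "z \<in> ?E" "z' \<in> ?E'" using z c by auto
  have "deriv f' z' \<noteq> 0" using param_holomorphic(2)[OF p' c(1)] zE by (auto simp: f'_def)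
  then obtain r where r: "r > 0" "ball z' r \<subseteq> ?E'" "inj_on f' (ball z' r)"
    using has_complex_derivative_locally_injective[OF hf(2) zE(2) oE(2)] by blast
  have hb: "f' holomorphic_on ball z' r" using hf(2) r(2) by (rule holomorphic_on_subset)
  obtain h where h: "h holomorphic_on (f' ` ball z' r)"
    "\<And>w. w \<in> ball z' r \<Longrightarrow> deriv f' w * deriv h (f' w) = 1" "\<And>w. w \<in> ball z' r \<Longrightarrow> h (f' w) = w"
    using holomorphic_has_inverse[OF hb open_ball r(3)] by metis
  have oI: "open (f' ` ball z' r)" by (rule open_mapping_thm3[OF hb open_ball r(3)])
  define B where "B = ?E \<inter> f -` (f' ` ball z' r)"
  have oB: "open B"
    unfolding B_def by (rule continuous_open_preimage[OF holomorphic_on_imp_continuous_on[OF hf(1)] oE(1) oI])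
  have zB: "z \<in> B" using zE r(1) z(3) by (auto simp: B_def f_def f'_def image_iff intro!: bexI[of _ z'])
  have hB: "h (f w) \<in> ball z' r" "f' (h (f w)) = f w" if "w \<in> B" for w
    using that h(3) by (auto simp: B_def)
  have gh: "(h \<circ> f) holomorphic_on B"
    by (rule holomorphic_on_compose_gen[OF _ h(1)])
       (use hf(1) in \<open>auto simp: B_def intro: holomorphic_on_subset\<close>)
  show ?thesis
  proof (rule that[OF oB zB _ gh])
    show "(h \<circ> f) z = z'" using h(3)[of z'] r(1) z(3) by (simp add: f_def f'_def)
    show "(h \<circ> f) ` B \<subseteq> D'" using hB r(2) by auto
    fix w assume w: "w \<in> B"
    have "f field_differentiable (at w)"
      using w hf(1) oE(1) by (auto simp: B_def intro: holomorphic_on_imp_differentiable_at)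
    moreover have "h field_differentiable (at (f w))"
      using w h(1) oI by (auto simp: B_def intro!: holomorphic_on_imp_differentiable_at)
    ultimately have "deriv (h \<circ> f) w = deriv h (f w) * deriv f w" by (rule deriv_chain)
    moreover have "deriv h (f w) \<noteq> 0" using h(2)[OF hB(1)[OF w]] hB(2)[OF w] by auto
    moreover have "deriv f w \<noteq> 0"
      using w param_holomorphic(2)[OF p c(1)] by (auto simp: B_def f_def)
    ultimately show "deriv (h \<circ> f) w \<noteq> 0" by simp
    have "\<psi>' (h (f w)) \<in> fst c" "\<psi> w \<in> fst c" using hB(1)[OF w] r(2) w by (auto simp: B_def)
    moreover have "snd c (\<psi>' (h (f w))) = snd c (\<psi> w)" using hB(2)[OF w] by (simp add: f_def f'_def)
    ultimately show "\<psi> w = \<psi>' ((h \<circ> f) w)" using chart_facts(5)[OF c(1)] by (metis comp_apply)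
  qed (auto simp: B_def)
qed

lemma param_locally_injective:
  assumes p: "param \<A> D \<psi>" and z: "z \<in> D"
  obtains r where "r > 0" "ball z r \<subseteq> D" "inj_on \<psi> (ball z r)"
proof -
  obtain c where c: "c \<in> \<A>" "\<psi> z \<in> fst c" using chart_exists .
  obtain r where "r > 0" "ball z r \<subseteq> D \<inter> \<psi> -` fst c" "inj_on (snd c \<circ> \<psi>) (ball z r)"
    using has_complex_derivative_locally_injective[OF param_holomorphic(1)[OF p c(1)] _
        param_open_vimage[OF p chart_facts(1)[OF c(1)]] param_holomorphic(2)[OF p c(1) z c(2)]] z c by blast
  then show ?thesis using that[of r] inj_on_imageI2 by blast
qed

text \<open>A chart inverse factors locally through \<open>\<psi>\<close>, so a chart neighbourhood
  of each image point lies in the image.\<close>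

lemma param_open_map:
  assumes p: "param \<A> D \<psi>" and S: "open S" "S \<subseteq> D"
  shows "open (\<psi> ` S)"
proof (subst open_subopen, intro ballI)
  fix x assume "x \<in> \<psi> ` S"
  then obtain z where z: "z \<in> S" "x = \<psi> z" by auto
  obtain c where c: "c \<in> \<A>" "\<psi> z \<in> fst c" using chart_exists .
  have pS: "param \<A> S \<psi>" by (rule param_subset[OF p S])
  have "snd c (\<psi> z) \<in> snd c ` fst c" "chart_inv c (snd c (\<psi> z)) = \<psi> z"
    using c chart_facts(5) by auto
  from param_transition[OF param_chart[OF c(1)] pS this(1) z(1) this(2)]
  obtain B g where B: "open B" "snd c (\<psi> z) \<in> B" "B \<subseteq> snd c ` fst c" "g ` B \<subseteq> S"
    "\<And>w. w \<in> B \<Longrightarrow> chart_inv c w = \<psi> (g w)" by metis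
  have "open (fst c \<inter> snd c -` B)"
    using continuous_open_preimage[OF chart_facts(3,1)] c B(1) by blast
  moreover have "x \<in> fst c \<inter> snd c -` B" using z c B by auto
  moreover have "fst c \<inter> snd c -` B \<subseteq> \<psi> ` S"
  proof
    fix y assume y: "y \<in> fst c \<inter> snd c -` B"
    then have "y = \<psi> (g (snd c y))" using B(5)[of "snd c y"] chart_facts(5)[OF c(1)] by auto
    then show "y \<in> \<psi> ` S" using y B(4) by blast
  qed
  ultimately show "\<exists>T. open T \<and> x \<in> T \<and> T \<subseteq> \<psi> ` S" by blast
qed

text \<open>One factor \<open>\<mu>\<close>, the derivative of the transition to the chart, serves
  all functions. Inside one fact a quantified \<open>f\<close> has a fixed value type, so the rule
  is given for two types at once: matrices and coframe vectors must be differentiated with the same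
  \<open>\<mu>\<close>.\<close>

lemma param_chart_deriv2:
  assumes p: "param \<A> D \<psi>" and z: "z \<in> D" and c: "c \<in> \<A>" "\<psi> z \<in> fst c"
  obtains \<mu> where "\<mu> \<noteq> 0" "\<And>(f :: 'x \<Rightarrow> 'b::real_normed_vector) v. (f \<circ> \<psi>) differentiable (at z) \<Longrightarrow>
    chart_deriv c f (\<psi> z) v = frechet_derivative (f \<circ> \<psi>) (at z) (\<mu> * v)"
    "\<And>(f :: 'x \<Rightarrow> 'c::real_normed_vector) v. (f \<circ> \<psi>) differentiable (at z) \<Longrightarrow>
    chart_deriv c f (\<psi> z) v = frechet_derivative (f \<circ> \<psi>) (at z) (\<mu> * v)"
proof -
  let ?w = "snd c (\<psi> z)"
  have "?w \<in> snd c ` fst c" "chart_inv c ?w = \<psi> z" using c chart_facts(5) by auto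
  from param_transition[OF param_chart[OF c(1)] p this(1) z this(2)]
  obtain B g where B: "open B" "?w \<in> B" "g holomorphic_on B" "g ?w = z"
    "\<And>w. w \<in> B \<Longrightarrow> deriv g w \<noteq> 0" "\<And>w. w \<in> B \<Longrightarrow> chart_inv c w = \<psi> (g w)" by metis
  have dg: "(g has_derivative (\<lambda>v. deriv g ?w * v)) (at ?w)"
    using holomorphic_derivI[OF B(3,1,2)] by (simp add: has_field_derivative_def)
  have b: "chart_deriv c f (\<psi> z) v = frechet_derivative (f \<circ> \<psi>) (at z) (deriv g ?w * v)"
    if "(f \<circ> \<psi>) differentiable (at z)" for f :: "'x \<Rightarrow> 'b" and v
  proof -
    have 1: "((f \<circ> \<psi>) has_derivative frechet_derivative (f \<circ> \<psi>) (at z)) (at (g ?w))"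
      using that frechet_derivative_works B(4) by metis
    have "frechet_derivative (f \<circ> chart_inv c) (at ?w) = frechet_derivative (\<lambda>w. (f \<circ> \<psi>) (g w)) (at ?w)"
      by (rule frechet_derivative_cong[OF B(1,2)]) (simp add: B(6))
    also have "\<dots> = (\<lambda>v. frechet_derivative (f \<circ> \<psi>) (at z) (deriv g ?w * v))"
      by (rule frechet_derivative_eq[OF has_derivative_compose[OF dg 1]])
    finally show ?thesis by (simp add: chart_deriv_def)
  qed
  have c: "chart_deriv c f (\<psi> z) v = frechet_derivative (f \<circ> \<psi>) (at z) (deriv g ?w * v)"
    if "(f \<circ> \<psi>) differentiable (at z)" for f :: "'x \<Rightarrow> 'c" and v
  proof -
    have 1: "((f \<circ> \<psi>) has_derivative frechet_derivative (f \<circ> \<psi>) (at z)) (at (g ?w))"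
      using that frechet_derivative_works B(4) by metis
    have "frechet_derivative (f \<circ> chart_inv c) (at ?w) = frechet_derivative (\<lambda>w. (f \<circ> \<psi>) (g w)) (at ?w)"
      by (rule frechet_derivative_cong[OF B(1,2)]) (simp add: B(6))
    also have "\<dots> = (\<lambda>v. frechet_derivative (f \<circ> \<psi>) (at z) (deriv g ?w * v))"
      by (rule frechet_derivative_eq[OF has_derivative_compose[OF dg 1]])
    finally show ?thesis by (simp add: chart_deriv_def)
  qed
  show ?thesis by (rule that[of "deriv g ?w", OF B(5)[OF B(2)] b c])
qed

lemma param_chart_deriv:
  assumes p: "param \<A> D \<psi>" and z: "z \<in> D" and c: "c \<in> \<A>" "\<psi> z \<in> fst c"
  obtains \<mu> where "\<mu> \<noteq> 0" "\<And>(f :: 'x \<Rightarrow> 'b::real_normed_vector) v. (f \<circ> \<psi>) differentiable (at z) \<Longrightarrow>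
    chart_deriv c f (\<psi> z) v = frechet_derivative (f \<circ> \<psi>) (at z) (\<mu> * v)"
  by (rule param_chart_deriv2[OF assms]) (rule that)

lemma param_smooth:
  assumes p: "param \<A> D \<psi>" and U: "open U" and f: "surf_smooth_on \<A> U f"
  shows "smooth_on (D \<inter> \<psi> -` U) (f \<circ> \<psi>)"
proof (rule smooth_on_local)
  fix z assume z: "z \<in> D \<inter> \<psi> -` U"
  obtain c where c: "c \<in> \<A>" "\<psi> z \<in> fst c" using chart_exists .
  have "snd c (\<psi> z) \<in> snd c ` fst c" "\<psi> z = chart_inv c (snd c (\<psi> z))" using c chart_facts(5) by auto
  from param_transition[OF p param_chart[OF c(1)] _ this] z
  obtain B g where B: "open B" "z \<in> B" "B \<subseteq> D" "g holomorphic_on B" "g ` B \<subseteq> snd c ` fst c"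
    "\<And>w. w \<in> B \<Longrightarrow> \<psi> w = chart_inv c (g w)" by (metis IntE)
  let ?B = "B \<inter> \<psi> -` U"
  have oB: "open ?B"
    by (rule continuous_open_preimage[OF continuous_on_subset[OF param_continuous[OF p] B(3)] B(1) U])
  have "smooth_on ?B (\<lambda>w. (f \<circ> chart_inv c) (g w))"
  proof (rule smooth_on_compose_holomorphic[OF oB open_chart_image[OF c(1) U]])
    show "g ` ?B \<subseteq> snd c ` (U \<inter> fst c)"
      using B(5,6) by (auto simp: chart_image_eq[OF c(1)])
    show "smooth_on (snd c ` (U \<inter> fst c)) (f \<circ> chart_inv c)"
      using f c by (simp add: surf_smooth_on_def)
    show "g holomorphic_on ?B" by (rule holomorphic_on_subset[OF B(4)]) auto
  qed
  then have "smooth_on ?B (f \<circ> \<psi>)"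
    by (subst smooth_on_cong[OF oB, of _ "\<lambda>w. (f \<circ> chart_inv c) (g w)"]) (auto simp: B(6))
  then show "\<exists>T. open T \<and> z \<in> T \<and> smooth_on T (f \<circ> \<psi>)"
    using oB z B(2) by blast
qed

lemma surf_smooth_onI:
  assumes p: "param \<A> D \<psi>" and U: "open U" "U \<subseteq> \<psi> ` D" and f: "smooth_on (D \<inter> \<psi> -` U) (f \<circ> \<psi>)"
  shows "surf_smooth_on \<A> U f"
  unfolding surf_smooth_on_def
proof (intro ballI smooth_on_local)
  fix c w assume c: "c \<in> \<A>" and w: "w \<in> snd c ` (U \<inter> fst c)"
  then have w': "w \<in> snd c ` fst c" "chart_inv c w \<in> U" by (auto simp: chart_image_eq)
  then obtain z where z: "z \<in> D" "chart_inv c w = \<psi> z" using U by blast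
  from param_transition[OF param_chart[OF c] p w'(1) z]
  obtain B g where B: "open B" "w \<in> B" "B \<subseteq> snd c ` fst c" "g holomorphic_on B" "g ` B \<subseteq> D"
    "\<And>w. w \<in> B \<Longrightarrow> chart_inv c w = \<psi> (g w)" by metis
  let ?B = "B \<inter> chart_inv c -` U"
  have oB: "open ?B"
    by (rule continuous_open_preimage[OF continuous_on_subset[OF chart_facts(4)[OF c] B(3)] B(1) U(1)])
  have "smooth_on ?B (\<lambda>w. (f \<circ> \<psi>) (g w))"
  proof (rule smooth_on_compose_holomorphic[OF oB param_open_vimage[OF p U(1)] _ _ f])
    show "g ` ?B \<subseteq> D \<inter> \<psi> -` U" using B(5,6) by auto
    show "g holomorphic_on ?B" by (rule holomorphic_on_subset[OF B(4)]) auto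
  qed
  then have "smooth_on ?B (f \<circ> chart_inv c)"
    by (subst smooth_on_cong[OF oB, of _ "\<lambda>w. (f \<circ> \<psi>) (g w)"]) (auto simp: B(6))
  then show "\<exists>T. open T \<and> w \<in> T \<and> smooth_on T (f \<circ> chart_inv c)"
    using oB B(2) w' by blast
qed

lemma param_surf_holomorphic:
  assumes p: "param \<A> D \<psi>" and U: "open U" and f: "surf_holomorphic_on \<A> U f"
  shows "(f \<circ> \<psi>) holomorphic_on (D \<inter> \<psi> -` U)"
proof (subst holomorphic_on_open[OF param_open_vimage[OF p U]], unfold field_differentiable_def[symmetric], intro ballI)
  fix z assume z: "z \<in> D \<inter> \<psi> -` U"
  obtain c where c: "c \<in> \<A>" "\<psi> z \<in> fst c" using chart_exists .
  let ?B = "D \<inter> \<psi> -` (U \<inter> fst c)"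
  have oB: "open ?B" by (rule param_open_vimage[OF p open_Int[OF U chart_facts(1)[OF c(1)]]])
  have "((f \<circ> chart_inv c) \<circ> (snd c \<circ> \<psi>)) holomorphic_on ?B"
  proof (rule holomorphic_on_compose_gen)
    show "(snd c \<circ> \<psi>) holomorphic_on ?B"
      by (rule holomorphic_on_subset[OF param_holomorphic(1)[OF p c(1)]]) auto
    show "(f \<circ> chart_inv c) holomorphic_on snd c ` (U \<inter> fst c)"
      using f c by (simp add: surf_holomorphic_on_def)
  qed auto
  then have "(f \<circ> \<psi>) holomorphic_on ?B"
    by (rule holomorphic_transform) (simp add: chart_facts(5)[OF c(1)])
  then show "(f \<circ> \<psi>) field_differentiable (at z)"
    using oB z c by (auto intro: holomorphic_on_imp_differentiable_at)
qed

lemma surf_holomorphic_onI: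
  assumes p: "param \<A> D \<psi>" and U: "open U" "U \<subseteq> \<psi> ` D" and f: "(f \<circ> \<psi>) holomorphic_on (D \<inter> \<psi> -` U)"
  shows "surf_holomorphic_on \<A> U f"
  unfolding surf_holomorphic_on_def
proof (intro ballI)
  fix c assume c: "c \<in> \<A>"
  show "(f \<circ> chart_inv c) holomorphic_on snd c ` (U \<inter> fst c)"
  proof (subst holomorphic_on_open[OF open_chart_image[OF c U(1)]], unfold field_differentiable_def[symmetric], intro ballI)
    fix w assume w: "w \<in> snd c ` (U \<inter> fst c)"
    then have w': "w \<in> snd c ` fst c" "chart_inv c w \<in> U" using c by (auto simp: chart_image_eq)
    then obtain z where z: "z \<in> D" "chart_inv c w = \<psi> z" using U by blast
    from param_transition[OF param_chart[OF c] p w'(1) z]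
    obtain B g where B: "open B" "w \<in> B" "B \<subseteq> snd c ` fst c" "g holomorphic_on B" "g ` B \<subseteq> D"
      "\<And>w. w \<in> B \<Longrightarrow> chart_inv c w = \<psi> (g w)" by metis
    let ?B = "B \<inter> chart_inv c -` U"
    have oB: "open ?B"
      by (rule continuous_open_preimage[OF continuous_on_subset[OF chart_facts(4)[OF c] B(3)] B(1) U(1)])
    have "((f \<circ> \<psi>) \<circ> g) holomorphic_on ?B"
      by (rule holomorphic_on_compose_gen[OF holomorphic_on_subset[OF B(4)] f]) (use B(5,6) in auto)
    then have "(f \<circ> chart_inv c) holomorphic_on ?B"
      by (rule holomorphic_transform) (simp add: B(6))
    then show "(f \<circ> chart_inv c) field_differentiable (at w)"
      using oB B(2) w' by (auto intro: holomorphic_on_imp_differentiable_at)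
  qed
qed

end

section \<open>Moving frames in \<open>Sp(2)\<close>\<close>

lemma bounded_bilinear_matrix_mult:
  "bounded_bilinear ((**) :: complex^4^4 \<Rightarrow> complex^4^4 \<Rightarrow> complex^4^4)"
  unfolding bilinear_conv_bounded_bilinear[symmetric] bilinear_def
  by (auto intro!: linearI simp: matrix_matrix_mult_def vec_eq_iff sum.distrib algebra_simps scaleR_sum_right)

lemma bounded_linear_adj: "bounded_linear (adj :: complex^4^4 \<Rightarrow> complex^4^4)"
  unfolding linear_conv_bounded_linear[symmetric]
  by (auto intro!: linearI simp: adj_def vec_eq_iff)

text \<open>For \<open>S z\<close> in \<open>Sp2\<close> the adjoint is the inverse, so this is the
  left-invariant form S^-1 dS in the coordinate of the plane.\<close>

definition mc :: "(complex \<Rightarrow> complex^4^4) \<Rightarrow> complex \<Rightarrow> complex \<Rightarrow> complex^4^4" where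
  "mc S z v = adj (S z) ** frechet_derivative S (at z) v"

lemma matrix_mult_uminus: "(- A) ** B = - (A ** B)" "A ** (- B) = - (A ** B)" for A :: "complex^4^4" and B :: "complex^4^4"
  by (simp_all add: matrix_matrix_mult_def vec_eq_iff sum_negf)

lemma matrix_diff_distrib: "(A - B) ** C = A ** C - B ** C" "C ** (A - B) = C ** A - C ** B"
  for A :: "complex^4^4" and B :: "complex^4^4" and C :: "complex^4^4"
  by (simp_all add: matrix_matrix_mult_def vec_eq_iff algebra_simps sum_subtractf)

lemma sp2_entries:
  assumes "\<Omega> \<in> sp2"
  shows "\<Omega> $ 1 $ 1 = \<i> * rho1 \<Omega>" "\<Omega> $ 2 $ 2 = - \<i> * rho1 \<Omega>" "\<Omega> $ 3 $ 3 = \<i> * rho2 \<Omega>" "\<Omega> $ 4 $ 4 = - \<i> * rho2 \<Omega>"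
    "\<Omega> $ 2 $ 1 = cnj (omega3 \<Omega>)" "\<Omega> $ 1 $ 2 = - omega3 \<Omega>"
    "\<Omega> $ 3 $ 1 = omega1 \<Omega> / sqrt 2" "\<Omega> $ 4 $ 1 = omega2 \<Omega> / sqrt 2"
    "\<Omega> $ 3 $ 2 = - cnj (omega2 \<Omega>) / sqrt 2" "\<Omega> $ 4 $ 2 = cnj (omega1 \<Omega>) / sqrt 2"
    "\<Omega> $ 1 $ 3 = - cnj (omega1 \<Omega>) / sqrt 2" "\<Omega> $ 2 $ 3 = omega2 \<Omega> / sqrt 2"
    "\<Omega> $ 1 $ 4 = - cnj (omega2 \<Omega>) / sqrt 2" "\<Omega> $ 2 $ 4 = - omega1 \<Omega> / sqrt 2"
    "\<Omega> $ 4 $ 3 = tau \<Omega>" "\<Omega> $ 3 $ 4 = - cnj (tau \<Omega>)"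
  by (subst maurer_cartan_components[OF assms], simp add: maurer_cartan_def)+

locale lift =
  fixes D :: "complex set" and S :: "complex \<Rightarrow> complex^4^4"
  assumes open_D: "open D" and smooth: "smooth_on D S" and Sp2: "\<And>z. z \<in> D \<Longrightarrow> S z \<in> Sp2"
begin

lemma S_deriv: "z \<in> D \<Longrightarrow> (S has_derivative frechet_derivative S (at z)) (at z)"
  by (rule smooth_on_has_derivative[OF smooth])

lemma mc_linear: "z \<in> D \<Longrightarrow> linear (mc S z)"
proof -
  assume "z \<in> D"
  then have "linear (frechet_derivative S (at z))" using S_deriv has_derivative_linear by blast
  then show ?thesis
    unfolding mc_def[abs_def]
    by (auto intro!: linearI simp: linear_add linear_scale matrix_add_ldistrib matrix_matrix_mult_def
        vec_eq_iff scaleR_sum_right sum.distrib algebra_simps)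
qed

lemma mc_eq: "z \<in> D \<Longrightarrow> frechet_derivative S (at z) v = S z ** mc S z v"
  by (simp add: mc_def Sp2_cancel Sp2)

text \<open>Differentiating \<open>adj (S z) ** S z = mat 1\<close> gives skewness; differentiating
  the commutation with \<open>right_j\<close> gives the quaternionic condition.\<close>

lemma mc_in_sp2:
  assumes "z \<in> D" shows "mc S z v \<in> sp2"
proof -
  have "((\<lambda>z. adj (S z) ** S z) has_derivative
     (\<lambda>v. adj (S z) ** frechet_derivative S (at z) v + adj (frechet_derivative S (at z) v) ** S z)) (at z)"
    by (intro bounded_bilinear.FDERIV[OF bounded_bilinear_matrix_mult]
        bounded_linear.has_derivative[OF bounded_linear_adj] S_deriv assms)
  note h1 = this
  have h2: "((\<lambda>z. adj (S z) ** S z) has_derivative (\<lambda>v. 0)) (at z)"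
    by (subst has_derivative_cong_open[OF open_D assms, of _ "\<lambda>z. mat 1"]) (auto simp: Sp2_inverse Sp2)
  from fun_cong[OF has_derivative_unique[OF h1 h2], of v]
  have "adj (S z) ** frechet_derivative S (at z) v + adj (frechet_derivative S (at z) v) ** S z = 0" .
  then have 1: "adj (mc S z v) = - mc S z v"
    by (simp add: mc_def adj_mult add_eq_0_iff)
  have "frechet_derivative S (at z) v *v right_j w = right_j (frechet_derivative S (at z) v *v w)" for w
  proof -
    have l1: "bounded_linear (\<lambda>A :: complex^4^4. A *v right_j w)"
      unfolding linear_conv_bounded_linear[symmetric]
      by (auto intro!: linearI simp: matrix_vector_mult_def vec_eq_iff algebra_simps sum.distrib scaleR_sum_right)
    have l2: "bounded_linear (\<lambda>A :: complex^4^4. right_j (A *v w))"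
      unfolding linear_conv_bounded_linear[symmetric]
      by (auto intro!: linearI simp: right_j_def vec_eq_iff forall_4 matrix_vector_mult_def sum_4 algebra_simps)
    have h1: "((\<lambda>z. S z *v right_j w) has_derivative (\<lambda>v. frechet_derivative S (at z) v *v right_j w)) (at z)"
      by (rule bounded_linear.has_derivative[OF l1 S_deriv[OF assms]])
    have h2: "((\<lambda>z. S z *v right_j w) has_derivative (\<lambda>v. right_j (frechet_derivative S (at z) v *v w))) (at z)"
      by (subst has_derivative_cong_open[OF open_D assms, of _ "\<lambda>z. right_j (S z *v w)"])
         (use Sp2 in \<open>auto simp: Sp2_def intro: bounded_linear.has_derivative[OF l2 S_deriv[OF assms]]\<close>)
    from fun_cong[OF has_derivative_unique[OF h1 h2], of v] show ?thesis .
  qed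
  moreover have "adj (S z) *v right_j w = right_j (adj (S z) *v w)" for w
  proof -
    have "mat 1 \<in> Sp2"
      by (simp add: Sp2_def) (simp add: adj_def mat_def matrix_matrix_mult_def vec_eq_iff forall_4 sum_4)
    from Sp2_closed[OF this Sp2[OF assms]] show ?thesis by (simp add: Sp2_def)
  qed
  ultimately have "mc S z v *v right_j w = right_j (mc S z v *v w)" for w
    by (simp add: mc_def matrix_vector_mul_assoc[symmetric])
  with 1 show ?thesis by (simp add: sp2_def)
qed

text \<open>With dS = S \<Omega>, the differential of the orbit map is conjugate to the commutator
  of \<Omega> and \<open>base_point\<close>, whose first column below the diagonal is that of
  \<Omega>.\<close>

lemma coframe_orbit_map:
  assumes "z \<in> D"
  shows "coframe (S z) (frechet_derivative (\<lambda>z. orbit_map (S z)) (at z) v)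
    = vector [omega1 (mc S z v), omega2 (mc S z v), omega3 (mc S z v)]"
proof -
  let ?S' = "frechet_derivative S (at z) v" and ?\<Omega> = "mc S z v"
  have "((\<lambda>z. S z ** base_point ** adj (S z)) has_derivative
     (\<lambda>v. (S z ** base_point) ** adj (frechet_derivative S (at z) v)
       + (S z ** 0 + frechet_derivative S (at z) v ** base_point) ** adj (S z))) (at z)"
    by (intro bounded_bilinear.FDERIV[OF bounded_bilinear_matrix_mult]
        bounded_linear.has_derivative[OF bounded_linear_adj] S_deriv assms has_derivative_const)
  from frechet_derivative_eq[OF this]
  have "frechet_derivative (\<lambda>z. orbit_map (S z)) (at z) v
      = S z ** base_point ** adj ?S' + ?S' ** base_point ** adj (S z)"
    by (simp add: orbit_map_def)
  also have "\<dots> = S z ** (?\<Omega> ** base_point - base_point ** ?\<Omega>) ** adj (S z)"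
  proof -
    have "adj ?\<Omega> = - ?\<Omega>" using mc_in_sp2[OF assms] by (simp add: sp2_def)
    then show ?thesis
      by (simp add: mc_eq[OF assms] adj_mult matrix_diff_distrib matrix_mul_assoc matrix_mult_uminus)
  qed
  finally have "adj (S z) ** frechet_derivative (\<lambda>z. orbit_map (S z)) (at z) v ** S z
     = ?\<Omega> ** base_point - base_point ** ?\<Omega>"
    by (simp only: conj_cancel(1)[OF Sp2[OF assms]])
  then show ?thesis
    by (simp add: coframe_def Let_def vec_eq_iff forall_3 vector_3 omega1_def omega2_def omega3_def
      matrix_matrix_mult_def sum_4 base_point_def)
qed

lemma smooth_mc: "smooth_on D (\<lambda>z. mc S z v)"
  unfolding smooth_on_def mc_def
  by (intro allI k_smooth_on_matrix_mult k_smooth_on_adj open_D smooth_onD smooth smooth_on_frechet)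

text \<open>The Maurer-Cartan equation on the coordinate pair (1, \<i>). The second derivatives of
  \<open>S\<close> cancel by symmetry and leave products of first derivatives.\<close>

lemma structure_equation:
  assumes "z \<in> D"
  shows "frechet_derivative (\<lambda>z. mc S z \<i>) (at z) 1 - frechet_derivative (\<lambda>z. mc S z 1) (at z) \<i>
    = mc S z \<i> ** mc S z 1 - mc S z 1 ** mc S z \<i>"
proof -
  let ?S = "\<lambda>v. frechet_derivative S (at z) v"
  have d: "frechet_derivative (\<lambda>z. mc S z v) (at z) w
     = adj (S z) ** frechet_derivative (\<lambda>z. frechet_derivative S (at z) v) (at z) w + adj (?S w) ** ?S v" for v w
  proof -
    have "((\<lambda>z. adj (S z) ** frechet_derivative S (at z) v) has_derivative
      (\<lambda>w. adj (S z) ** frechet_derivative (\<lambda>z. frechet_derivative S (at z) v) (at z) w + adj (?S w) ** ?S v)) (at z)"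
      by (intro bounded_bilinear.FDERIV[OF bounded_bilinear_matrix_mult]
        bounded_linear.has_derivative[OF bounded_linear_adj] S_deriv assms
        smooth_on_has_derivative[OF smooth_on_frechet[OF smooth]])
    from frechet_derivative_eq[OF this] show ?thesis by (simp add: mc_def[abs_def])
  qed
  have "adj (?S w) ** ?S v = - (mc S z w ** mc S z v)" for v w
  proof -
    have "adj (mc S z w) = - mc S z w" using mc_in_sp2[OF assms] by (simp add: sp2_def)
    then show ?thesis
      by (simp add: mc_eq[OF assms] adj_mult matrix_mul_assoc[symmetric] Sp2_cancel Sp2 assms matrix_mult_uminus)
  qed
  then show ?thesis
    using mixed_partials[OF open_D assms smooth_onD[OF smooth]] unfolding d by simp
qed

text \<open>For an entry of type (1,0) the left side of the structure equation is \<i> (d_x + \<i>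
  d_y), that is 2 \<i> \<open>dbar\<close>, applied to its value on 1.\<close>

lemma structure_entry:
  assumes "z \<in> D" "\<And>z. z \<in> D \<Longrightarrow> mc S z \<i> $ k $ l = \<i> * mc S z 1 $ k $ l"
  shows "2 * \<i> * dbar (\<lambda>z. mc S z 1 $ k $ l) z = (mc S z \<i> ** mc S z 1 - mc S z 1 ** mc S z \<i>) $ k $ l"
proof -
  have bl: "bounded_linear (\<lambda>A :: complex^4^4. A $ k $ l)"
    by (intro bounded_linear_compose[OF bounded_linear_vec_nth bounded_linear_vec_nth])
  have e: "((\<lambda>z. mc S z v $ k $ l) has_derivative (\<lambda>w. frechet_derivative (\<lambda>z. mc S z v) (at z) w $ k $ l)) (at z)" for v
    by (rule bounded_linear.has_derivative[OF bl smooth_on_has_derivative[OF smooth_mc assms(1)]])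
  have "((\<lambda>z. \<i> * mc S z 1 $ k $ l) has_derivative (\<lambda>w. \<i> * frechet_derivative (\<lambda>z. mc S z 1) (at z) w $ k $ l)) (at z)"
    by (rule has_derivative_mult_right[OF e])
  then have "((\<lambda>z. mc S z \<i> $ k $ l) has_derivative (\<lambda>w. \<i> * frechet_derivative (\<lambda>z. mc S z 1) (at z) w $ k $ l)) (at z)"
    by (subst has_derivative_cong_open[OF open_D assms(1), of _ "\<lambda>z. \<i> * mc S z 1 $ k $ l"]) (use assms(2) in auto)
  from has_derivative_unique[OF this e]
  have "frechet_derivative (\<lambda>z. mc S z \<i>) (at z) 1 $ k $ l = \<i> * frechet_derivative (\<lambda>z. mc S z 1) (at z) 1 $ k $ l"
    by (rule fun_cong[symmetric])
  moreover have "2 * \<i> * ((p + \<i> * q) / 2) = \<i> * p - q" for p q by (simp add: field_simps)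
  ultimately show ?thesis
    unfolding structure_equation[OF assms(1), symmetric] dbar_eq[OF e] by simp
qed

end

locale adapted_frame = lift +
  assumes w2: "\<And>z v. z \<in> D \<Longrightarrow> omega2 (mc S z v) = 0"
    and w1_J: "\<And>z. z \<in> D \<Longrightarrow> omega1 (mc S z \<i>) = \<i> * omega1 (mc S z 1)"
    and w3_J: "\<And>z. z \<in> D \<Longrightarrow> omega3 (mc S z \<i>) = \<i> * omega3 (mc S z 1)"
    and w1_nz: "\<And>z. z \<in> D \<Longrightarrow> omega1 (mc S z 1) \<noteq> 0"
begin

definition "fa z = omega1 (mc S z 1)"
definition "fb z = omega3 (mc S z 1)"
definition "ft z = tau (mc S z 1)"
text \<open>Twice the (0,1)-components of the connection forms \<i> rho1 and, for \<open>fY\<close>,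
  \<i> rho2.\<close>

definition "fX z = mc S z 1 $ 1 $ 1 + \<i> * mc S z \<i> $ 1 $ 1"
definition "fY z = mc S z 1 $ 3 $ 3 + \<i> * mc S z \<i> $ 3 $ 3"

lemma frame_entries:
  assumes "z \<in> D"
  shows "mc S z 1 $ 2 $ 1 = cnj (fb z)" "mc S z 1 $ 1 $ 2 = - fb z" "mc S z 1 $ 2 $ 2 = - mc S z 1 $ 1 $ 1"
    "mc S z 1 $ 3 $ 1 = fa z / sqrt 2" "mc S z 1 $ 4 $ 1 = 0" "mc S z 1 $ 3 $ 2 = 0" "mc S z 1 $ 2 $ 3 = 0" "mc S z 1 $ 1 $ 4 = 0"
    "mc S z 1 $ 4 $ 2 = cnj (fa z) / sqrt 2" "mc S z 1 $ 1 $ 3 = - cnj (fa z) / sqrt 2" "mc S z 1 $ 2 $ 4 = - fa z / sqrt 2"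
    "mc S z 1 $ 4 $ 3 = ft z" "mc S z 1 $ 3 $ 4 = - cnj (ft z)" "mc S z 1 $ 4 $ 4 = - mc S z 1 $ 3 $ 3"
    "mc S z \<i> $ 2 $ 1 = - \<i> * cnj (fb z)" "mc S z \<i> $ 1 $ 2 = - \<i> * fb z" "mc S z \<i> $ 2 $ 2 = - mc S z \<i> $ 1 $ 1"
    "mc S z \<i> $ 3 $ 1 = \<i> * fa z / sqrt 2" "mc S z \<i> $ 4 $ 1 = 0" "mc S z \<i> $ 3 $ 2 = 0" "mc S z \<i> $ 2 $ 3 = 0" "mc S z \<i> $ 1 $ 4 = 0"
    "mc S z \<i> $ 4 $ 2 = - \<i> * cnj (fa z) / sqrt 2" "mc S z \<i> $ 1 $ 3 = \<i> * cnj (fa z) / sqrt 2"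
    "mc S z \<i> $ 2 $ 4 = - \<i> * fa z / sqrt 2" "mc S z \<i> $ 4 $ 4 = - mc S z \<i> $ 3 $ 3"
  by (simp_all only: sp2_entries[OF mc_in_sp2[OF assms]] w2[OF assms] w1_J[OF assms] w3_J[OF assms])
     (simp_all add: fa_def fb_def ft_def)

text \<open>Since omega2 vanishes identically, so does its exterior derivative; the structure
  equation then says that the wedge product of tau and omega1 is 0, and omega1 is nonzero of type
  (1,0).\<close>

lemma tau_J:
  assumes "z \<in> D" shows "tau (mc S z \<i>) = \<i> * ft z"
proof -
  have "2 * \<i> * dbar (\<lambda>z. mc S z 1 $ 4 $ 1) z = (mc S z \<i> ** mc S z 1 - mc S z 1 ** mc S z \<i>) $ 4 $ 1"
    by (rule structure_entry[OF assms]) (simp add: frame_entries)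
  moreover have "dbar (\<lambda>z. mc S z 1 $ 4 $ 1) z = dbar (\<lambda>z. 0) z"
    by (rule dbar_cong[OF open_D assms]) (simp add: frame_entries)
  ultimately have "(mc S z \<i> ** mc S z 1 - mc S z 1 ** mc S z \<i>) $ 4 $ 1 = 0" by (simp add: dbar_def)
  then have "(tau (mc S z \<i>) - \<i> * ft z) * fa z = 0"
    by (simp add: matrix_matrix_mult_def sum_4 frame_entries assms sp2_entries(15)[OF mc_in_sp2[OF assms]])
       (auto simp: field_simps ft_def simp flip: of_real_mult)
  then show ?thesis using w1_nz[OF assms] by (simp add: fa_def)
qed

lemma frame_entries_tau:
  assumes "z \<in> D" shows "mc S z \<i> $ 4 $ 3 = \<i> * ft z" "mc S z \<i> $ 3 $ 4 = \<i> * cnj (ft z)"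
  by (simp_all add: sp2_entries[OF mc_in_sp2[OF assms]] tau_J[OF assms])

lemma k_smooth_mc_entry: "k_smooth_on k D (\<lambda>z. mc S z v $ i $ j)"
  by (intro k_smooth_on_vec_nth open_D smooth_onD smooth_mc)

lemma smooth_coeffs:
  "smooth_on D fa" "smooth_on D fb" "smooth_on D ft" "smooth_on D fX" "smooth_on D fY"
  unfolding smooth_on_def fa_def[abs_def] fb_def[abs_def] ft_def[abs_def] fX_def[abs_def] fY_def[abs_def]
    omega1_def omega3_def tau_def
  by (intro allI k_smooth_on_mult k_smooth_on_add k_smooth_on_cnj k_smooth_on_const open_D k_smooth_mc_entry)+

lemma coeffs_differentiable:
  assumes "z \<in> D"
  shows "fa differentiable (at z)" "fb differentiable (at z)" "ft differentiable (at z)"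
  using smooth_coeffs smooth_on_has_derivative[OF _ assms] differentiableI by blast+

text \<open>The entries (3,1), (1,2) and (4,3) of the structure equation. Every product not
  containing a diagonal entry contains an entry of omega2 and vanishes, so each coefficient only
  meets the torus part of the connection.\<close>

lemma dbar_coeffs:
  assumes z: "z \<in> D"
  shows "dbar fa z = fa z * (fX z - fY z) / 2" "dbar fb z = - (fb z * fX z)" "dbar ft z = ft z * fY z"
proof -
  have bl: "bounded_linear (\<lambda>A :: complex^4^4. A $ k $ l)" for k l
    by (intro bounded_linear_compose[OF bounded_linear_vec_nth bounded_linear_vec_nth])
  have e: "(\<lambda>z. mc S z 1 $ k $ l) differentiable (at z)" for k l
    using bounded_linear.has_derivative[OF bl smooth_on_has_derivative[OF smooth_mc z]] differentiableI by blast
  have c: "dbar (\<lambda>z. c * mc S z 1 $ k $ l) z = c * dbar (\<lambda>z. mc S z 1 $ k $ l) z" for c k l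
    using dbar_mult[of "\<lambda>_. c", OF _ e] by (simp add: dbar_def[of "\<lambda>_. c"])
  have "dbar fa z = sqrt 2 * dbar (\<lambda>z. mc S z 1 $ 3 $ 1) z"
    unfolding c[symmetric] by (rule dbar_cong[OF open_D z]) (simp add: frame_entries)
  moreover have "2 * \<i> * dbar (\<lambda>z. mc S z 1 $ 3 $ 1) z = (mc S z \<i> ** mc S z 1 - mc S z 1 ** mc S z \<i>) $ 3 $ 1"
    by (rule structure_entry[OF z]) (simp add: frame_entries)
  then have "2 * \<i> * dbar (\<lambda>z. mc S z 1 $ 3 $ 1) z = 2 * \<i> * ((fa z / sqrt 2) * (fX z - fY z) / 2)"
    by (simp add: matrix_matrix_mult_def sum_4 frame_entries z) (simp add: fX_def fY_def field_simps)
  then have "dbar (\<lambda>z. mc S z 1 $ 3 $ 1) z = (fa z / sqrt 2) * (fX z - fY z) / 2"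
    by (rule mult_left_cancel[THEN iffD1, rotated]) simp
  ultimately show "dbar fa z = fa z * (fX z - fY z) / 2" by simp
  have "dbar fb z = - 1 * dbar (\<lambda>z. mc S z 1 $ 1 $ 2) z"
    unfolding c[symmetric] by (rule dbar_cong[OF open_D z]) (simp add: frame_entries)
  moreover have "2 * \<i> * dbar (\<lambda>z. mc S z 1 $ 1 $ 2) z = (mc S z \<i> ** mc S z 1 - mc S z 1 ** mc S z \<i>) $ 1 $ 2"
    by (rule structure_entry[OF z]) (simp add: frame_entries)
  then have "2 * \<i> * dbar (\<lambda>z. mc S z 1 $ 1 $ 2) z = 2 * \<i> * (fb z * fX z)"
    by (simp add: matrix_matrix_mult_def sum_4 frame_entries z) (simp add: fX_def algebra_simps)
  then have "dbar (\<lambda>z. mc S z 1 $ 1 $ 2) z = fb z * fX z" by simp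
  ultimately show "dbar fb z = - (fb z * fX z)" by simp
  have "dbar ft z = 1 * dbar (\<lambda>z. mc S z 1 $ 4 $ 3) z"
    unfolding c[symmetric] by (rule dbar_cong[OF open_D z]) (simp add: frame_entries)
  moreover have "2 * \<i> * dbar (\<lambda>z. mc S z 1 $ 4 $ 3) z = (mc S z \<i> ** mc S z 1 - mc S z 1 ** mc S z \<i>) $ 4 $ 3"
    by (rule structure_entry[OF z]) (simp add: frame_entries frame_entries_tau)
  then have "2 * \<i> * dbar (\<lambda>z. mc S z 1 $ 4 $ 3) z = 2 * \<i> * (ft z * fY z)"
    by (simp add: matrix_matrix_mult_def sum_4 frame_entries frame_entries_tau z) (simp add: fY_def algebra_simps)
  then have "dbar (\<lambda>z. mc S z 1 $ 4 $ 3) z = ft z * fY z" by simp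
  ultimately show "dbar ft z = ft z * fY z" by simp
qed

text \<open>Logarithmically, \<open>dbar\<close> gives (X - Y)/2 for \<open>fa\<close>, - X for
  \<open>fb\<close> and Y for \<open>ft\<close>; with \<open>fa\<close> counted twice these add up
  to 0.\<close>

lemma quartic_holomorphic: "(\<lambda>z. fa z * fa z * fb z * ft z) holomorphic_on D"
proof (rule dbar_0_holomorphic)
  fix z assume z: "z \<in> D"
  note d = coeffs_differentiable[OF z]
  show "(\<lambda>z. fa z * fa z * fb z * ft z) differentiable (at z)"
    by (intro differentiable_mult d)
  show "dbar (\<lambda>z. fa z * fa z * fb z * ft z) z = 0"
    by (simp add: dbar_mult d differentiable_mult dbar_coeffs[OF z] field_simps)
qed

end

section \<open>Change of lift, and existence of adapted lifts\<close>

lemma stabiliser_entries: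
  fixes k :: "complex^4^4"
  assumes "s \<in> Sp2" "s' \<in> Sp2" "orbit_map s = orbit_map s'" and k_def: "k = adj s' ** s"
  shows "k \<in> Sp2"
    "k $ 2 $ 1 = 0" "k $ 3 $ 1 = 0" "k $ 4 $ 1 = 0" "k $ 1 $ 3 = 0" "k $ 1 $ 4 = 0"
    "k $ 2 $ 3 = 0" "k $ 2 $ 4 = 0" "k $ 1 $ 2 = 0" "k $ 3 $ 2 = 0" "k $ 4 $ 2 = 0"
    "k $ 2 $ 2 = cnj (k $ 1 $ 1)" "k $ 4 $ 4 = cnj (k $ 3 $ 3)" "k $ 3 $ 4 = - cnj (k $ 4 $ 3)"
    "cnj (k $ 1 $ 1) * k $ 1 $ 1 = 1" "cnj (k $ 3 $ 3) * k $ 3 $ 3 + cnj (k $ 4 $ 3) * k $ 4 $ 3 = 1"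
proof -
  show k: "k \<in> Sp2" unfolding k_def by (rule Sp2_closed[OF assms(1,2)])
  \<comment> \<open>Both lifts lie over the same point, so \<open>k\<close> commutes with
    \<open>base_point\<close>, which clears row and column 1 off the diagonal; the quaternionic
    relations carry the zeros over to row and column 2.\<close>
  have "k ** base_point = adj s' ** orbit_map s ** s"
    unfolding k_def orbit_map_def by (simp add: matrix_mul_assoc[symmetric] Sp2_inverse[OF assms(1)])
  also have "\<dots> = base_point ** k"
    by (simp only: assms(3)) (simp add: k_def orbit_map_def matrix_mul_assoc[symmetric] Sp2_cancel[OF assms(2)])
  finally have "(k ** base_point) $ i $ j = (base_point ** k) $ i $ j" for i j by simp
  from this[of 2 1] this[of 3 1] this[of 4 1] this[of 1 3] this[of 1 4] this[of 1 2]
  show z: "k $ 2 $ 1 = 0" "k $ 3 $ 1 = 0" "k $ 4 $ 1 = 0" "k $ 1 $ 3 = 0" "k $ 1 $ 4 = 0" "k $ 1 $ 2 = 0"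
    by (simp_all add: matrix_matrix_mult_def sum_4 base_point_def)
  have q: "\<forall>z. k *v right_j z = right_j (k *v z)" using k by (simp add: Sp2_def)
  note e = quaternionic_entries[OF q]
  show z': "k $ 3 $ 2 = 0" "k $ 4 $ 2 = 0" "k $ 2 $ 3 = 0" "k $ 2 $ 4 = 0"
    using e(3,4,5,6) z by auto
  show q': "k $ 2 $ 2 = cnj (k $ 1 $ 1)" "k $ 4 $ 4 = cnj (k $ 3 $ 3)" "k $ 3 $ 4 = - cnj (k $ 4 $ 3)"
    by (rule e)+
  have "(adj k ** k) $ i $ j = (if i = j then 1 else 0)" for i j
    using Sp2_inverse[OF k] by (simp add: mat_def)
  from this[of 1 1] this[of 3 3]
  show "cnj (k $ 1 $ 1) * k $ 1 $ 1 = 1" "cnj (k $ 3 $ 3) * k $ 3 $ 3 + cnj (k $ 4 $ 3) * k $ 4 $ 3 = 1"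
    by (simp_all add: matrix_matrix_mult_def adj_def sum_4 z z')
qed

lemma coframe_stabiliser:
  fixes k :: "complex^4^4"
  assumes "s \<in> Sp2" "s' \<in> Sp2" "orbit_map s = orbit_map s'" and k_def: "k = adj s' ** s"
  shows "coframe s' A $ 1 = cnj (k $ 1 $ 1) * (k $ 3 $ 3 * coframe s A $ 1 + k $ 3 $ 4 * coframe s A $ 2)"
    "coframe s' A $ 2 = cnj (k $ 1 $ 1) * (k $ 4 $ 3 * coframe s A $ 1 + k $ 4 $ 4 * coframe s A $ 2)"
    "coframe s' A $ 3 = k $ 1 $ 1 * k $ 1 $ 1 * coframe s A $ 3"
proof -
  note k = stabiliser_entries[OF assms]
  define B where "B = adj s ** A ** s"
  have B: "adj s' ** A ** s' = k ** B ** adj k"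
    unfolding k_def B_def by (simp add: adj_mult matrix_mul_assoc[symmetric] Sp2_cancel[OF assms(1)])
  show "coframe s' A $ 1 = cnj (k $ 1 $ 1) * (k $ 3 $ 3 * coframe s A $ 1 + k $ 3 $ 4 * coframe s A $ 2)"
    "coframe s' A $ 2 = cnj (k $ 1 $ 1) * (k $ 4 $ 3 * coframe s A $ 1 + k $ 4 $ 4 * coframe s A $ 2)"
    "coframe s' A $ 3 = k $ 1 $ 1 * k $ 1 $ 1 * coframe s A $ 3"
    unfolding coframe_def Let_def B B_def[symmetric]
    by (simp_all add: vector_3 omega1_def omega2_def omega3_def matrix_matrix_mult_def sum_4 adj_def
        k algebra_simps)
qed

definition hin :: "complex^4 \<Rightarrow> complex^4 \<Rightarrow> complex" where
  "hin x y = (\<Sum>i\<in>UNIV. cnj (x $ i) * y $ i)"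

lemma hin_right_j:
  "hin (right_j x) (right_j y) = hin y x" "hin x (right_j y) = cnj (hin (right_j y) x)"
  "hin (right_j x) y = - hin (right_j y) x" "hin (right_j x) x = 0" "hin x (right_j x) = 0" "cnj (hin x y) = hin y x"
  by (simp_all add: hin_def right_j_def sum_4 algebra_simps)

lemma hin_linear:
  "hin x (y + z) = hin x y + hin x z" "hin x (y - z) = hin x y - hin x z" "hin x (c *s y) = c * hin x y"
  "hin (c *s x) y = cnj c * hin x y"
  by (simp_all add: hin_def sum_4 algebra_simps)

lemma hin_self: "hin x x = of_real ((norm x)\<^sup>2)"
  by (simp add: hin_def norm_vec_def L2_set_def sum_4 complex_norm_square mult.commute del: of_real_power)

text \<open>The quaternionic matrix with columns x and y: each column is followed by its right
  multiple by j.\<close>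

definition frame_matrix :: "complex^4 \<Rightarrow> complex^4 \<Rightarrow> complex^4^4" where
  "frame_matrix x y = (\<chi> i j. if j = 1 then x $ i else if j = 2 then right_j x $ i
     else if j = 3 then y $ i else right_j y $ i)"

lemma frame_matrix_Sp2:
  assumes "hin x x = 1" "hin y y = 1" "hin x y = 0" "hin (right_j x) y = 0"
  shows "frame_matrix x y \<in> Sp2"
proof -
  have c: "(adj (frame_matrix x y) ** frame_matrix x y) $ i $ j = hin (column i (frame_matrix x y)) (column j (frame_matrix x y))" for i j
    by (simp add: matrix_matrix_mult_def adj_def hin_def column_def)
  have col: "column 1 (frame_matrix x y) = x" "column 2 (frame_matrix x y) = right_j x"
    "column 3 (frame_matrix x y) = y" "column 4 (frame_matrix x y) = right_j y"
    by (simp_all add: column_def frame_matrix_def vec_eq_iff)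
  have h: "hin y x = 0" "hin (right_j y) x = 0" "hin x (right_j y) = 0" "hin y (right_j x) = 0"
    using hin_right_j(6)[of x y] hin_right_j(3)[of y x] hin_right_j(2)[of x y] hin_right_j(2)[of y x] assms by auto
  have "adj (frame_matrix x y) ** frame_matrix x y = mat 1"
    unfolding vec_eq_iff c by (simp add: forall_4 col mat_def hin_right_j(1,4,5) assms h)
  moreover have "frame_matrix x y *v right_j z = right_j (frame_matrix x y *v z)" for z
    by (simp add: vec_eq_iff forall_4 matrix_vector_mult_def sum_4 frame_matrix_def right_j_def algebra_simps)
  ultimately show ?thesis by (simp add: Sp2_def)
qed

lemma orbit_frame_matrix: "orbit_map (frame_matrix x y) $ i $ j = x $ i * cnj (x $ j)"
  by (simp add: orbit_map_def matrix_matrix_mult_def sum_4 base_point_def frame_matrix_def adj_def)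

text \<open>A nonzero column of the projector spans its image, and \<open>x\<close> is that column
  normalised. The difference \<open>E\<close> of P and the projector onto \<open>x\<close> is again
  a Hermitian projector, of trace 0, so its Hilbert-Schmidt norm vanishes.\<close>

lemma CP3_rank_one:
  fixes P :: "complex^4^4"
  assumes "P \<in> CP3" "Re (P $ j $ j) > 0"
  defines "x \<equiv> (\<chi> i. P $ i $ j / sqrt (Re (P $ j $ j)))"
  shows "hin x x = 1" "\<And>i k. P $ i $ k = x $ i * cnj (x $ k)"
proof -
  have P: "\<And>i k. cnj (P $ k $ i) = P $ i $ k" "\<And>i k. (\<Sum>l\<in>UNIV. P $ i $ l * P $ l $ k) = P $ i $ k" "(\<Sum>i\<in>UNIV. P $ i $ i) = 1"
    using assms(1) by (auto simp: CP3_def adj_def vec_eq_iff matrix_matrix_mult_def trace_def)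
  define r where "r = Re (P $ j $ j)"
  have r: "P $ j $ j = of_real r" using P(1)[of j j] by (simp add: complex_eq_iff r_def)
  have r0: "r > 0" using assms(2) by (simp add: r_def)
  have sq: "of_real (sqrt r) * of_real (sqrt r) = (of_real r :: complex)"
    using r0 by (simp flip: of_real_mult)
  have "hin x x = (\<Sum>l\<in>UNIV. P $ j $ l * P $ l $ j / of_real r)"
    unfolding hin_def x_def r_def[symmetric] by (simp add: P(1) sq)
  also have "\<dots> = 1" unfolding sum_divide_distrib[symmetric] P(2) r using r0 by simp
  finally show xx: "hin x x = 1" .
  define E where "E i k = P $ i $ k - x $ i * cnj (x $ k)" for i k
  have Px: "(\<Sum>l\<in>UNIV. P $ i $ l * x $ l) = x $ i" for i
    unfolding x_def by (simp add: times_divide_eq_right P(2) flip: sum_divide_distrib)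
  have Px': "(\<Sum>l\<in>UNIV. cnj (x $ l) * P $ l $ k) = cnj (x $ k)" for k
    using arg_cong[OF Px[of k], of cnj] by (simp add: P(1) mult.commute)
  have EE: "(\<Sum>l\<in>UNIV. E i l * E l k) = E i k" for i k
  proof -
    have "(\<Sum>l\<in>UNIV. E i l * E l k) = (\<Sum>l\<in>UNIV. P $ i $ l * P $ l $ k) - (\<Sum>l\<in>UNIV. P $ i $ l * x $ l) * cnj (x $ k)
       - x $ i * (\<Sum>l\<in>UNIV. cnj (x $ l) * P $ l $ k) + x $ i * cnj (x $ k) * hin x x"
      unfolding E_def hin_def
      by (simp add: algebra_simps sum.distrib sum_subtractf sum_distrib_left sum_distrib_right)
    then show ?thesis unfolding P(2) Px Px' xx by (simp add: E_def)
  qed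
  have Eh: "cnj (E k i) = E i k" for i k unfolding E_def by (simp add: P(1) mult.commute)
  have "(\<Sum>i\<in>UNIV. E i i) = 0"
    using P(3) xx unfolding E_def hin_def by (simp add: sum_subtractf mult.commute)
  then have "(\<Sum>i\<in>UNIV. \<Sum>l\<in>UNIV. (cmod (E i l))\<^sup>2) = 0"
  proof -
    have "of_real (\<Sum>i\<in>UNIV. \<Sum>l\<in>UNIV. (cmod (E i l))\<^sup>2) = (\<Sum>i\<in>UNIV. \<Sum>l\<in>UNIV. E i l * E l i)"
      by (simp add: complex_norm_square Eh del: of_real_power)
    also have "\<dots> = 0" unfolding EE using \<open>(\<Sum>i\<in>UNIV. E i i) = 0\<close> .
    finally show ?thesis by (simp only: of_real_eq_0_iff)
  qed
  then have "E i k = 0" for i k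
    by (simp add: sum_nonneg_eq_0_iff sum_nonneg)
  then show "\<And>i k. P $ i $ k = x $ i * cnj (x $ k)" by (simp add: E_def)
qed

lemma CP3_diag_positive:
  fixes P :: "complex^4^4"
  assumes "P \<in> CP3" obtains j where "Re (P $ j $ j) > 0"
proof -
  have "(\<Sum>i\<in>UNIV. Re (P $ i $ i)) = 1"
  proof -
    have "(\<Sum>i\<in>UNIV. P $ i $ i) = 1" using assms by (simp add: CP3_def trace_def)
    from arg_cong[OF this, of Re] show ?thesis by simp
  qed
  note sum1 = this
  have "\<exists>j\<in>UNIV. Re (P $ j $ j) > 0"
  proof (rule ccontr)
    assume "\<not> ?thesis"
    then have "(\<Sum>i\<in>UNIV. Re (P $ i $ i)) \<le> 0" by (intro sum_nonpos) (simp add: not_less)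
    with sum1 show False by simp
  qed
  then show ?thesis using that by blast
qed

text \<open>The first quaternionic column is a unit vector \<open>u\<close> spanning the line; the
  second, \<open>v\<close>, is the normalised part \<open>W\<close> of the derivative of
  \<open>u\<close> orthogonal to u and u j. Up to a constant, omega2 is the product of v j with that
  derivative, which only has components along u, u j and v; hence it vanishes.\<close>

lemma adapted_lift_exists:
  fixes \<Phi> :: "complex \<Rightarrow> complex^4^4"
  assumes D0: "open D0" "smooth_on D0 \<Phi>" "\<And>z. z \<in> D0 \<Longrightarrow> \<Phi> z \<in> CP3" "z0 \<in> D0"
    and s: "s \<in> Sp2" "orbit_map s = \<Phi> z0"
      "\<not> (coframe s (frechet_derivative \<Phi> (at z0) 1) $ 1 = 0 \<and> coframe s (frechet_derivative \<Phi> (at z0) 1) $ 2 = 0)"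
  obtains D S where "open D" "z0 \<in> D" "D \<subseteq> D0" "smooth_on D S"
    "\<And>z. z \<in> D \<Longrightarrow> S z \<in> Sp2 \<and> orbit_map (S z) = \<Phi> z \<and> omega2 (mc S z 1) = 0"
proof -
  obtain j where j: "Re (\<Phi> z0 $ j $ j) > 0" using CP3_diag_positive[OF D0(3)[OF D0(4)]] .
  have sm\<Phi>: "k_smooth_on k D0 (\<lambda>z. \<Phi> z $ i $ l)" for k i l
    by (intro k_smooth_on_vec_nth D0(1) smooth_onD D0(2))
  define D1 where "D1 = D0 \<inter> (\<lambda>z. Re (\<Phi> z $ j $ j)) -` {0<..}"
  have "continuous_on D0 (\<lambda>z. Re (\<Phi> z $ j $ j))"
    by (rule continuous_on_Re[OF k_smooth_on_continuous[OF sm\<Phi>[of 0]]])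
  then have D1: "open D1"
    unfolding D1_def by (rule continuous_open_preimage[OF _ D0(1) open_greaterThan])
  have z1: "z0 \<in> D1" using j D0 by (simp add: D1_def)
  define u where "u z = (\<chi> i. \<Phi> z $ i $ j / sqrt (Re (\<Phi> z $ j $ j)))" for z
  have u: "hin (u z) (u z) = 1" "\<Phi> z $ i $ k = u z $ i * cnj (u z $ k)" if "z \<in> D1" for z i k
  proof -
    have "z \<in> D0" "Re (\<Phi> z $ j $ j) > 0" using that by (simp_all add: D1_def)
    note r = CP3_rank_one[OF D0(3)[OF this(1)] this(2), folded u_def]
    show "hin (u z) (u z) = 1" "\<Phi> z $ i $ k = u z $ i * cnj (u z $ k)" by (rule r)+
  qed
  have smu: "smooth_on D1 u"
    unfolding smooth_on_def
  proof (intro allI k_smooth_on_vec D1)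
    fix k i
    have "k_smooth_on k D1 (\<lambda>z. \<Phi> z $ i $ l)" for i l
      by (rule k_smooth_on_subset[OF sm\<Phi>]) (auto simp: D1_def)
    then show "k_smooth_on k D1 (\<lambda>z. u z $ i)"
      unfolding u_def vec_lambda_beta
      by (intro k_smooth_on_divide k_smooth_on_of_real k_smooth_on_sqrt k_smooth_on_Re D1)
         (auto simp: D1_def)
  qed
  define y where "y z = frechet_derivative u (at z) 1" for z
  have smy: "smooth_on D1 y" unfolding y_def[abs_def] by (rule smooth_on_frechet[OF smu])
  define W where "W z = y z - hin (u z) (y z) *s u z - hin (right_j (u z)) (y z) *s right_j (u z)" for z
  have ue: "k_smooth_on k D1 (\<lambda>z. u z $ i)" "k_smooth_on k D1 (\<lambda>z. y z $ i)" for k i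
    by (intro k_smooth_on_vec_nth D1 smooth_onD smu smy)+
  have sj: "k_smooth_on k D1 (\<lambda>z. right_j (u z) $ i)" for k i
  proof -
    have "\<forall>i. k_smooth_on k D1 (\<lambda>z. right_j (u z) $ i)"
      unfolding forall_4 right_j_def vector_4_nth
      by (intro conjI k_smooth_on_minus k_smooth_on_cnj D1 ue)
    then show ?thesis by blast
  qed
  have smW: "smooth_on D1 W"
    unfolding smooth_on_def W_def hin_def
    by (intro allI k_smooth_on_vec D1, simp only: vector_minus_component vector_smult_component)
       (intro k_smooth_on_diff k_smooth_on_mult k_smooth_on_sum k_smooth_on_cnj D1 ue sj)
  \<comment> \<open>If \<open>W\<close> vanished, the derivative of \<open>u\<close> would lie in
    the quaternionic line of \<open>u\<close>, the span of the first two columns of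
    \<open>s\<close>. Then rows 3 and 4 of the first column of the differential are 0, that is, both
    of the first two coframe components, against the hypothesis.\<close>
  have W0: "W z0 \<noteq> 0"
  proof
    assume "W z0 = 0"
    then obtain \<alpha> \<beta> where y0: "y z0 = \<alpha> *s u z0 + \<beta> *s right_j (u z0)"
      by (auto simp: W_def algebra_simps)
    define x where "x = column 1 s"
    have cs: "column 2 s = right_j x"
    proof -
      have "s *v right_j (axis 1 1) = right_j (s *v axis 1 1)" using s(1) by (simp add: Sp2_def)
      moreover have "right_j (axis 1 1) = axis 2 1" by (simp add: right_j_def vec_eq_iff forall_4 axis_def)
      moreover have "s *v axis i 1 = column i s" for i
        by (simp add: vec_eq_iff matrix_vector_mult_def axis_def column_def if_distrib cong: if_cong)
      ultimately show ?thesis by (simp add: x_def)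
    qed
    have orth: "hin (column i s) (column k s) = (if i = k then 1 else 0)" for i k
    proof -
      have "(adj s ** s) $ i $ k = (if i = k then 1 else 0)" using Sp2_inverse[OF s(1)] by (simp add: mat_def)
      then show ?thesis by (simp add: matrix_matrix_mult_def adj_def hin_def column_def)
    qed
    have "\<Phi> z0 $ i $ k = x $ i * cnj (x $ k)" for i k
      unfolding s(2)[symmetric] x_def
      by (simp add: orbit_map_def matrix_matrix_mult_def sum_4 base_point_def adj_def column_def)
    then have ux: "u z0 $ i * cnj (u z0 $ k) = x $ i * cnj (x $ k)" for i k using u(2)[OF z1] by simp
    have "u z0 = hin x (u z0) *s x"
    proof -
      have "u z0 $ i = hin x (u z0) * x $ i" for i
      proof -
        have "u z0 $ i = (\<Sum>k\<in>UNIV. u z0 $ i * cnj (u z0 $ k) * u z0 $ k)"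
          using u(1)[OF z1] by (simp add: hin_def mult.assoc flip: sum_distrib_left)
        also have "\<dots> = hin x (u z0) * x $ i"
          unfolding ux by (simp add: hin_def sum_distrib_left sum_distrib_right mult_ac)
        finally show ?thesis .
      qed
      then show ?thesis by (simp add: vec_eq_iff)
    qed
    then obtain \<theta> where ul: "u z0 = \<theta> *s x" by blast
    have jl: "right_j (u z0) = cnj \<theta> *s right_j x"
      unfolding ul by (simp add: right_j_def vec_eq_iff forall_4)
    have y0': "y z0 = \<alpha> *s (\<theta> *s column 1 s) + \<beta> *s (cnj \<theta> *s column 2 s)"
      unfolding y0 jl cs by (simp only: ul x_def)
    have wy: "hin (column i s) (y z0) = 0" "hin (column i s) (u z0) = 0" if "i = 3 \<or> i = 4" for i
      unfolding y0' unfolding ul x_def using that by (auto simp: hin_linear orth)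
    have dy: "(u has_derivative frechet_derivative u (at z0)) (at z0)"
      by (rule smooth_on_has_derivative[OF smu z1])
    have d\<Phi>: "frechet_derivative \<Phi> (at z0) 1 $ i $ k = y z0 $ i * cnj (u z0 $ k) + u z0 $ i * cnj (y z0 $ k)" for i k
    proof -
      have bl: "bounded_linear (\<lambda>A :: complex^4^4. A $ i $ k)" 
        by (intro bounded_linear_compose[OF bounded_linear_vec_nth bounded_linear_vec_nth])
      have e1: "((\<lambda>z. \<Phi> z $ i $ k) has_derivative (\<lambda>v. frechet_derivative \<Phi> (at z0) v $ i $ k)) (at z0)"
        by (rule bounded_linear.has_derivative[OF bl smooth_on_has_derivative[OF D0(2,4)]])
      have "((\<lambda>z. u z $ i * cnj (u z $ k)) has_derivative
         (\<lambda>v. u z0 $ i * cnj (frechet_derivative u (at z0) v $ k) + frechet_derivative u (at z0) v $ i * cnj (u z0 $ k))) (at z0)"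
        by (rule has_derivative_mult[OF bounded_linear.has_derivative[OF bounded_linear_vec_nth dy]
            bounded_linear.has_derivative[OF bounded_linear_cnj bounded_linear.has_derivative[OF bounded_linear_vec_nth dy]]])
      then have e2: "((\<lambda>z. \<Phi> z $ i $ k) has_derivative
         (\<lambda>v. u z0 $ i * cnj (frechet_derivative u (at z0) v $ k) + frechet_derivative u (at z0) v $ i * cnj (u z0 $ k))) (at z0)"
        by (subst has_derivative_cong_open[OF D1 z1, of _ "\<lambda>z. u z $ i * cnj (u z $ k)"]) (use u(2) in auto)
      from fun_cong[OF has_derivative_unique[OF e1 e2], of 1] show ?thesis by (simp add: y_def)
    qed
    have "(adj s ** frechet_derivative \<Phi> (at z0) 1 ** s) $ i $ 1
       = hin (column i s) (y z0) * hin (u z0) x + hin (column i s) (u z0) * hin (y z0) x" for i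
      unfolding matrix_matrix_mult_def by (simp add: d\<Phi> adj_def hin_def column_def x_def sum_4 algebra_simps)
    then have "(adj s ** frechet_derivative \<Phi> (at z0) 1 ** s) $ i $ 1 = 0" if "i = 3 \<or> i = 4" for i
      using wy[OF that] by simp
    then show False using s(3) by (simp add: coframe_def Let_def vector_3 omega1_def omega2_def)
  qed
  define D where "D = D1 \<inter> W -` (- {0})"
  have oD: "open D" unfolding D_def
    by (rule continuous_open_preimage[OF k_smooth_on_continuous[OF smooth_onD[OF smW, of 0]] D1]) auto
  have zD: "z0 \<in> D" using z1 W0 by (simp add: D_def)
  define v where "v z = of_real (inverse (norm (W z))) *s W z" for z
  have sub: "D \<subseteq> D1" by (auto simp: D_def)
  have uW: "hin (u z) (W z) = 0" "hin (right_j (u z)) (W z) = 0" if "z \<in> D" for z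
    using u(1)[of z] that sub by (auto simp: W_def hin_linear hin_right_j(1,4,5))
  have v: "hin (v z) (v z) = 1" "hin (u z) (v z) = 0" "hin (right_j (u z)) (v z) = 0" if "z \<in> D" for z
  proof -
    have "norm (W z) \<noteq> 0" using that by (auto simp: D_def)
    then show "hin (v z) (v z) = 1"
      unfolding v_def hin_linear(3,4) hin_self[of "W z"] by (simp add: power2_eq_square field_simps)
  qed (use uW that in \<open>auto simp: v_def hin_linear\<close>)
  have smWD: "k_smooth_on k D (\<lambda>z. W z $ i)" "k_smooth_on k D (\<lambda>z. u z $ i)" "k_smooth_on k D (\<lambda>z. right_j (u z) $ i)" for k i
    using k_smooth_on_vec_nth[OF D1 smooth_onD[OF smW]] ue(1) sj by (auto intro!: k_smooth_on_subset[OF _ sub])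
  have smv: "k_smooth_on k D (\<lambda>z. v z $ i)" for k i
  proof -
    \<comment> \<open>Written as the root of a polynomial in real coordinates that is positive on
      \<open>D\<close>, the norm falls under the smoothness rules.\<close>
    have n: "norm (W z) = sqrt (\<Sum>i\<in>UNIV. Re (W z $ i) * Re (W z $ i) + Im (W z $ i) * Im (W z $ i))" for z
      by (simp only: norm_vec_def L2_set_def cmod_power2) (simp only: power2_eq_square)
    have pos: "(\<Sum>i\<in>UNIV. Re (W z $ i) * Re (W z $ i) + Im (W z $ i) * Im (W z $ i)) > 0" if "z \<in> D" for z
    proof -
      have "norm (W z) > 0" using that by (auto simp: D_def)
      then show ?thesis unfolding n by simp
    qed
    have pos0: "(\<Sum>i\<in>UNIV. Re (W z $ i) * Re (W z $ i) + Im (W z $ i) * Im (W z $ i)) \<noteq> 0" if "z \<in> D" for z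
      using pos[OF that] by simp
    show ?thesis
      unfolding v_def vector_smult_component n
      by (intro k_smooth_on_mult k_smooth_on_of_real k_smooth_on_inverse k_smooth_on_sqrt k_smooth_on_sum
         k_smooth_on_add k_smooth_on_Re k_smooth_on_Im oD smWD)
         (simp_all add: pos pos0)
  qed
  have smjv: "k_smooth_on k D (\<lambda>z. right_j (v z) $ i)" for k i
  proof -
    have "\<forall>i. k_smooth_on k D (\<lambda>z. right_j (v z) $ i)"
      unfolding forall_4 right_j_def vector_4_nth
      by (intro conjI k_smooth_on_minus k_smooth_on_cnj oD smv)
    then show ?thesis by blast
  qed
  define S where "S z = frame_matrix (u z) (v z)" for z
  have smS: "smooth_on D S"
    unfolding smooth_on_def
  proof (intro allI k_smooth_on_vec oD)
    fix k i l
    have "\<forall>l. k_smooth_on k D (\<lambda>z. S z $ i $ l)"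
      unfolding forall_4 S_def frame_matrix_def by (simp add: smv smjv smWD)
    then show "k_smooth_on k D (\<lambda>z. S z $ i $ l)" by blast
  qed
  have "S z \<in> Sp2 \<and> orbit_map (S z) = \<Phi> z \<and> omega2 (mc S z 1) = 0" if z: "z \<in> D" for z
  proof (intro conjI)
    have z1: "z \<in> D1" using z sub by auto
    show "S z \<in> Sp2" unfolding S_def by (rule frame_matrix_Sp2[OF u(1)[OF z1] v[OF z]])
    show "orbit_map (S z) = \<Phi> z"
      by (simp add: vec_eq_iff S_def orbit_frame_matrix u(2)[OF z1])
    have "frechet_derivative S (at z) 1 $ i $ 1 = y z $ i" for i
    proof -
      have bl: "bounded_linear (\<lambda>A :: complex^4^4. A $ i $ 1)" 
        by (intro bounded_linear_compose[OF bounded_linear_vec_nth bounded_linear_vec_nth])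
      have e1: "((\<lambda>z. S z $ i $ 1) has_derivative (\<lambda>v. frechet_derivative S (at z) v $ i $ 1)) (at z)"
        by (rule bounded_linear.has_derivative[OF bl smooth_on_has_derivative[OF smS z]])
      have e2: "((\<lambda>z. S z $ i $ 1) has_derivative (\<lambda>v. frechet_derivative u (at z) v $ i)) (at z)"
        using bounded_linear.has_derivative[OF bounded_linear_vec_nth smooth_on_has_derivative[OF smu z1], of i]
        by (simp add: S_def frame_matrix_def)
      from fun_cong[OF has_derivative_unique[OF e1 e2], of 1] show ?thesis by (simp add: y_def)
    qed
    then have "mc S z 1 $ 4 $ 1 = hin (right_j (v z)) (y z)"
      by (simp add: mc_def matrix_matrix_mult_def adj_def hin_def S_def frame_matrix_def)
    also have "y z = W z + hin (u z) (y z) *s u z + hin (right_j (u z)) (y z) *s right_j (u z)"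
      by (simp add: W_def)
    also have "hin (right_j (v z)) \<dots> = 0"
    proof -
      have "W z = of_real (norm (W z)) *s v z" using z by (simp add: v_def D_def vec_eq_iff)
      moreover have "hin (right_j (v z)) (of_real (norm (W z)) *s v z) = 0" by (simp add: hin_linear hin_right_j(4))
      ultimately have "hin (right_j (v z)) (W z) = 0" by metis
      moreover have "hin (right_j (v z)) (u z) = 0" using v(3)[OF z] hin_right_j(3)[of "v z" "u z"] by simp
      moreover have "hin (right_j (v z)) (right_j (u z)) = 0" using v(2)[OF z] hin_right_j(1) by simp
      ultimately show ?thesis by (simp add: hin_linear)
    qed
    finally show "omega2 (mc S z 1) = 0" by (simp add: omega2_def)
  qed
  then show ?thesis using that[OF oD zD _ smS] sub by (auto simp: D1_def)
qed

section \<open>Adapted frames along a transverse curve\<close>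

lemma bounded_linear_entry: "bounded_linear (\<lambda>A :: complex^4^4. A $ k $ l)"
  by (rule bounded_linear_compose[OF bounded_linear_vec_nth bounded_linear_vec_nth])

lemma bounded_linear_coframe: "bounded_linear (coframe s)"
  unfolding linear_conv_bounded_linear[symmetric] coframe_def[abs_def] Let_def omega1_def omega2_def omega3_def
  by (rule linearI) (simp_all add: vec_eq_iff forall_3 vector_3 matrix_add_ldistrib matrix_add_rdistrib'
      matrix_matrix_mult_def sum_4 algebra_simps)

text \<open>omega2 is only tested on the coordinate vector 1; along a J-holomorphic curve complex
  linearity extends its vanishing to all directions.\<close>

definition adapted_on :: "complex set \<Rightarrow> (complex \<Rightarrow> complex^4^4) \<Rightarrow> (complex \<Rightarrow> complex^4^4) \<Rightarrow> bool" where
  "adapted_on D \<Phi> S \<longleftrightarrow> open D \<and> smooth_on D S \<and>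
     (\<forall>z\<in>D. S z \<in> Sp2 \<and> orbit_map (S z) = \<Phi> z \<and> omega2 (mc S z 1) = 0)"

definition quartic :: "(complex \<Rightarrow> complex^4^4) \<Rightarrow> complex \<Rightarrow> complex" where
  "quartic S z = omega1 (mc S z 1) * omega1 (mc S z 1) * omega3 (mc S z 1) * tau (mc S z 1)"

lemma adapted_on_subset: "adapted_on D \<Phi> S \<Longrightarrow> open D' \<Longrightarrow> D' \<subseteq> D \<Longrightarrow> adapted_on D' \<Phi> S"
  unfolding adapted_on_def using smooth_on_subset by blast

lemma adapted_on_cong:
  "adapted_on D \<Phi> S \<Longrightarrow> (\<And>z. z \<in> D \<Longrightarrow> \<Phi> z = \<Phi>' z) \<Longrightarrow> adapted_on D \<Phi>' S"
  unfolding adapted_on_def by auto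

lemma adapted_on_lift: "adapted_on D \<Phi> S \<Longrightarrow> lift D S"
  by (simp add: adapted_on_def lift_def)

lemma mc_compose:
  assumes "lift D' S" "g holomorphic_on B" "open B" "w \<in> B" "g w \<in> D'"
  shows "mc (\<lambda>w. S (g w)) w v = mc S (g w) (deriv g w * v)"
proof -
  have dg: "(g has_derivative (\<lambda>v. deriv g w * v)) (at w)"
    using holomorphic_derivI[OF assms(2,3,4)] by (simp add: has_field_derivative_def)
  from frechet_derivative_eq[OF has_derivative_compose[OF dg lift.S_deriv[OF assms(1,5)]]]
  show ?thesis by (simp add: mc_def)
qed

locale curve = surface \<A> for \<A> :: "('x::t2_space) chart set" +
  fixes \<phi> :: "'x \<Rightarrow> complex^4^4"
  assumes J_curve: "J_holomorphic_curve \<A> \<phi>" and transverse: "transverse_curve \<A> \<phi>"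
begin

lemma \<phi>_CP3: "\<phi> x \<in> CP3"
  using J_curve by (simp add: J_holomorphic_curve_def)

lemma \<phi>_smooth: "param \<A> D \<psi> \<Longrightarrow> smooth_on D (\<phi> \<circ> \<psi>)"
  using param_smooth[of D \<psi> UNIV \<phi>] J_curve by (simp add: J_holomorphic_curve_def)

lemma \<phi>_deriv:
  "param \<A> D \<psi> \<Longrightarrow> z \<in> D \<Longrightarrow> ((\<phi> \<circ> \<psi>) has_derivative frechet_derivative (\<phi> \<circ> \<psi>) (at z)) (at z)"
  by (rule smooth_on_has_derivative[OF \<phi>_smooth])

lemma \<phi>_chart_deriv:
  assumes "param \<A> D \<psi>" "z \<in> D" "c \<in> \<A>" "\<psi> z \<in> fst c"
  obtains \<mu> where "\<mu> \<noteq> 0" "\<And>v. chart_deriv c \<phi> (\<psi> z) v = frechet_derivative (\<phi> \<circ> \<psi>) (at z) (\<mu> * v)"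
proof -
  obtain \<mu> where "\<mu> \<noteq> 0" "\<And>(f :: 'x \<Rightarrow> complex^4^4) v. (f \<circ> \<psi>) differentiable (at z) \<Longrightarrow>
    chart_deriv c f (\<psi> z) v = frechet_derivative (f \<circ> \<psi>) (at z) (\<mu> * v)"
    using param_chart_deriv[OF assms] by blast
  moreover have "(\<phi> \<circ> \<psi>) differentiable (at z)"
    by (rule differentiableI[OF \<phi>_deriv[OF assms(1,2)]])
  ultimately show ?thesis using that by blast
qed

lemma \<phi>_J:
  assumes "param \<A> D \<psi>" "z \<in> D"
  shows "frechet_derivative (\<phi> \<circ> \<psi>) (at z) (\<i> * v) = nk_J (\<phi> (\<psi> z)) (frechet_derivative (\<phi> \<circ> \<psi>) (at z) v)"
proof -
  obtain c where c: "c \<in> \<A>" "\<psi> z \<in> fst c" using chart_exists .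
  obtain \<mu> where \<mu>: "\<mu> \<noteq> 0" "\<And>v. chart_deriv c \<phi> (\<psi> z) v = frechet_derivative (\<phi> \<circ> \<psi>) (at z) (\<mu> * v)"
    by (rule \<phi>_chart_deriv[OF assms c]) blast
  have "chart_deriv c \<phi> (\<psi> z) (\<i> * (v / \<mu>)) = nk_J (\<phi> (\<psi> z)) (chart_deriv c \<phi> (\<psi> z) (v / \<mu>))"
    using J_curve c unfolding J_holomorphic_curve_def by blast
  then show ?thesis using \<mu>(1) by (simp add: \<mu>(2))
qed

lemma \<phi>_tangent:
  assumes "param \<A> D \<psi>" "z \<in> D"
  shows "frechet_derivative (\<phi> \<circ> \<psi>) (at z) v \<in> tangent_CP3 (\<phi> (\<psi> z))"
proof -
  let ?D = "frechet_derivative (\<phi> \<circ> \<psi>) (at z)"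
  note d = \<phi>_deriv[OF assms]
  have P: "adj (\<phi> x) = \<phi> x" "\<phi> x ** \<phi> x = \<phi> x" for x using \<phi>_CP3[of x] by (auto simp: CP3_def)
  have 1: "((\<lambda>z. adj ((\<phi> \<circ> \<psi>) z)) has_derivative (\<lambda>v. adj (?D v))) (at z)"
    by (rule bounded_linear.has_derivative[OF bounded_linear_adj d])
  have one: "(\<lambda>z. adj ((\<phi> \<circ> \<psi>) z)) = \<phi> \<circ> \<psi>" by (auto simp: P)
  have 2: "((\<lambda>z. (\<phi> \<circ> \<psi>) z ** (\<phi> \<circ> \<psi>) z) has_derivative (\<lambda>v. (\<phi> \<circ> \<psi>) z ** ?D v + ?D v ** (\<phi> \<circ> \<psi>) z)) (at z)"
    by (rule bounded_bilinear.FDERIV[OF bounded_bilinear_matrix_mult d d])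
  have two: "(\<lambda>z. (\<phi> \<circ> \<psi>) z ** (\<phi> \<circ> \<psi>) z) = \<phi> \<circ> \<psi>" by (auto simp: P)
  have "(\<lambda>v. adj (?D v)) = ?D" by (rule has_derivative_unique[OF 1[unfolded one] d])
  moreover have "(\<lambda>v. (\<phi> \<circ> \<psi>) z ** ?D v + ?D v ** (\<phi> \<circ> \<psi>) z) = ?D"
    by (rule has_derivative_unique[OF 2[unfolded two] d])
  ultimately show ?thesis
    by (auto simp: tangent_CP3_def fun_eq_iff add.commute)
qed

text \<open>In coframe coordinates J is multiplication by \<i>, so J-holomorphicity makes the
  coordinates of the differential complex linear.\<close>

lemma coframe_J:
  assumes "param \<A> D \<psi>" "z \<in> D" "s \<in> Sp2" "orbit_map s = \<phi> (\<psi> z)"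
  shows "coframe s (frechet_derivative (\<phi> \<circ> \<psi>) (at z) v) = v *s coframe s (frechet_derivative (\<phi> \<circ> \<psi>) (at z) 1)"
proof -
  let ?D = "frechet_derivative (\<phi> \<circ> \<psi>) (at z)"
  have 1: "coframe s (?D \<i>) = \<i> *s coframe s (?D 1)"
    using \<phi>_J[OF assms(1,2), of 1] nk_J_eq[OF assms(3), of "?D 1"] \<phi>_tangent[OF assms(1,2), of 1]
    by (simp add: assms(4) coframe_frame assms(3))
  have l: "linear (\<lambda>v. coframe s (?D v))"
    by (rule bounded_linear.linear[OF bounded_linear_compose[OF bounded_linear_coframe
          has_derivative_bounded_linear[OF \<phi>_deriv[OF assms(1,2)]]]])
  show ?thesis
    by (subst linear_complex_eq[OF l]) (simp add: 1 vec_eq_iff, simp add: complex_eq_iff)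
qed

text \<open>A change of lift mixes coordinates 1 and 2 and rescales coordinate 3. Vanishing in one
  lift is thus vanishing in all, and the tangent line would be vertical or horizontal.\<close>

lemma curve_nondegenerate:
  assumes p: "param \<A> D \<psi>" "z \<in> D" and s: "s \<in> Sp2" "orbit_map s = \<phi> (\<psi> z)"
  defines "A \<equiv> frechet_derivative (\<phi> \<circ> \<psi>) (at z) 1"
  shows "\<not> (coframe s A $ 1 = 0 \<and> coframe s A $ 2 = 0)" "coframe s A $ 3 \<noteq> 0"
proof -
  let ?D = "frechet_derivative (\<phi> \<circ> \<psi>) (at z)"
  have ct: "\<exists>v. B = ?D v" if B: "B \<in> curve_tangent \<A> \<phi> (\<psi> z)" for B
  proof -
    obtain c v where c: "c \<in> \<A>" "\<psi> z \<in> fst c" "B = chart_deriv c \<phi> (\<psi> z) v"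
      using B by (auto simp: curve_tangent_def)
    obtain \<mu> where "\<mu> \<noteq> 0" "\<And>v. chart_deriv c \<phi> (\<psi> z) v = ?D (\<mu> * v)"
      by (rule \<phi>_chart_deriv[OF p c(1,2)]) blast
    then show ?thesis using c(3) by auto
  qed
  have cf: "coframe s (?D v) $ i = v * coframe s A $ i" for v i
    using coframe_J[OF p s, of v] by (simp add: A_def)
  show "\<not> (coframe s A $ 1 = 0 \<and> coframe s A $ 2 = 0)"
  proof
    assume z: "coframe s A $ 1 = 0 \<and> coframe s A $ 2 = 0"
    have "curve_tangent \<A> \<phi> (\<psi> z) \<subseteq> vertical (\<phi> (\<psi> z))"
    proof
      fix B assume "B \<in> curve_tangent \<A> \<phi> (\<psi> z)"
      then obtain v where B: "B = ?D v" using ct by blast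
      have "coframe s' B $ 1 = 0 \<and> coframe s' B $ 2 = 0" if "s' \<in> Sp2" "orbit_map s' = \<phi> (\<psi> z)" for s'
      proof -
        have o: "orbit_map s = orbit_map s'" using that s by simp
        show ?thesis
          unfolding coframe_stabiliser(1,2)[OF s(1) that(1) o refl] B using cf z by simp
      qed
      then show "B \<in> vertical (\<phi> (\<psi> z))"
        using \<phi>_tangent[OF p] by (auto simp: vertical_def B)
    qed
    then show False using transverse by (simp add: transverse_curve_def)
  qed
  show "coframe s A $ 3 \<noteq> 0"
  proof
    assume z: "coframe s A $ 3 = 0"
    have "curve_tangent \<A> \<phi> (\<psi> z) \<subseteq> horizontal (\<phi> (\<psi> z))"
    proof
      fix B assume "B \<in> curve_tangent \<A> \<phi> (\<psi> z)"
      then obtain v where B: "B = ?D v" using ct by blast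
      have "coframe s' B $ 3 = 0" if "s' \<in> Sp2" "orbit_map s' = \<phi> (\<psi> z)" for s'
      proof -
        have o: "orbit_map s = orbit_map s'" using that s by simp
        show ?thesis
          unfolding coframe_stabiliser(3)[OF s(1) that(1) o refl] B using cf z by simp
      qed
      then show "B \<in> horizontal (\<phi> (\<psi> z))"
        using \<phi>_tangent[OF p] by (auto simp: horizontal_def B)
    qed
    then show False using transverse by (simp add: transverse_curve_def)
  qed
qed

lemma adapted_exists:
  assumes "param \<A> D0 \<psi>" "z \<in> D0"
  obtains D S where "z \<in> D" "D \<subseteq> D0" "adapted_on D (\<phi> \<circ> \<psi>) S"
proof -
  \<comment> \<open>A lift of the point comes from non-verticality: a tangent vector outside
    \<open>vertical\<close> violates a condition quantified over all lifts, so at least one lift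
    exists.\<close>
  obtain s where s: "s \<in> Sp2" "orbit_map s = \<phi> (\<psi> z)"
  proof -
    have "\<not> curve_tangent \<A> \<phi> (\<psi> z) \<subseteq> vertical (\<phi> (\<psi> z))"
      using transverse by (simp add: transverse_curve_def)
    then obtain B where B: "B \<in> curve_tangent \<A> \<phi> (\<psi> z)" "B \<notin> vertical (\<phi> (\<psi> z))" by blast
    then obtain c v where c: "c \<in> \<A>" "\<psi> z \<in> fst c" "B = chart_deriv c \<phi> (\<psi> z) v"
      by (auto simp: curve_tangent_def)
    obtain \<mu> where "\<And>v. chart_deriv c \<phi> (\<psi> z) v = frechet_derivative (\<phi> \<circ> \<psi>) (at z) (\<mu> * v)"
      using \<phi>_chart_deriv[OF assms c(1,2)] by metis
    then have "B \<in> tangent_CP3 (\<phi> (\<psi> z))" using \<phi>_tangent[OF assms] c(3) by simp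
    then show ?thesis using B(2) that by (auto simp: vertical_def)
  qed
  have cp: "(\<phi> \<circ> \<psi>) z \<in> CP3" for z using \<phi>_CP3 by simp
  have s': "orbit_map s = (\<phi> \<circ> \<psi>) z" using s(2) by simp
  obtain D S where D: "open D" "z \<in> D" "D \<subseteq> D0" "smooth_on D S"
    "\<And>z. z \<in> D \<Longrightarrow> S z \<in> Sp2 \<and> orbit_map (S z) = (\<phi> \<circ> \<psi>) z \<and> omega2 (mc S z 1) = 0"
    by (rule adapted_lift_exists[OF param_open[OF assms(1)] \<phi>_smooth[OF assms(1)] cp assms(2) s(1) s'
        curve_nondegenerate(1)[OF assms s]]) blast
  then show ?thesis using that[of D S] by (simp add: adapted_on_def)
qed

lemma mc_linear_complex:
  assumes p: "param \<A> D0 \<psi>" and a: "adapted_on D (\<phi> \<circ> \<psi>) S" and D: "D \<subseteq> D0" "z \<in> D"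
  shows "omega1 (mc S z v) = v * omega1 (mc S z 1)" "omega2 (mc S z v) = v * omega2 (mc S z 1)"
    "omega3 (mc S z v) = v * omega3 (mc S z 1)"
    "coframe (S z) (frechet_derivative (\<phi> \<circ> \<psi>) (at z) v) = vector [omega1 (mc S z v), omega2 (mc S z v), omega3 (mc S z v)]"
proof -
  interpret lift D S by (rule adapted_on_lift[OF a])
  have S: "S z \<in> Sp2" "orbit_map (S z) = \<phi> (\<psi> z)" using a D by (auto simp: adapted_on_def)
  have "frechet_derivative (\<lambda>z. orbit_map (S z)) (at z) = frechet_derivative (\<phi> \<circ> \<psi>) (at z)"
    by (rule frechet_derivative_cong[OF open_D D(2)]) (use a in \<open>simp add: adapted_on_def\<close>)
  then have cf: "coframe (S z) (frechet_derivative (\<phi> \<circ> \<psi>) (at z) v)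
      = vector [omega1 (mc S z v), omega2 (mc S z v), omega3 (mc S z v)]" for v
    using coframe_orbit_map[OF D(2), of v] by simp
  then show "coframe (S z) (frechet_derivative (\<phi> \<circ> \<psi>) (at z) v)
      = vector [omega1 (mc S z v), omega2 (mc S z v), omega3 (mc S z v)]" .
  have "z \<in> D0" using D by auto
  from coframe_J[OF p this S, of v] show
    "omega1 (mc S z v) = v * omega1 (mc S z 1)" "omega2 (mc S z v) = v * omega2 (mc S z 1)"
    "omega3 (mc S z v) = v * omega3 (mc S z 1)"
    unfolding cf by (simp_all add: vec_eq_iff forall_3 vector_3)
qed

text \<open>Where omega2 vanishes, non-verticality means that omega1 is nonzero, and
  non-horizontality that omega3 is.\<close>

lemma adapted_frame:
  assumes p: "param \<A> D0 \<psi>" and a: "adapted_on D (\<phi> \<circ> \<psi>) S" and D: "D \<subseteq> D0"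
  shows "adapted_frame D S" "\<And>z. z \<in> D \<Longrightarrow> omega3 (mc S z 1) \<noteq> 0"
proof -
  have w2: "omega2 (mc S z 1) = 0" if "z \<in> D" for z using a that by (simp add: adapted_on_def)
  have nd: "omega1 (mc S z 1) \<noteq> 0" "omega3 (mc S z 1) \<noteq> 0" if z: "z \<in> D" for z
  proof -
    have S: "S z \<in> Sp2" "orbit_map (S z) = \<phi> (\<psi> z)" using a z by (auto simp: adapted_on_def)
    have "z \<in> D0" using z D by auto
    from curve_nondegenerate[OF p this S] show "omega1 (mc S z 1) \<noteq> 0" "omega3 (mc S z 1) \<noteq> 0"
      unfolding mc_linear_complex(4)[OF p a D z] by (simp_all add: vector_3 w2 z)
  qed
  then show "\<And>z. z \<in> D \<Longrightarrow> omega3 (mc S z 1) \<noteq> 0" by blast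
  show "adapted_frame D S"
    unfolding adapted_frame_def adapted_frame_axioms_def
  proof (intro conjI allI impI adapted_on_lift[OF a] nd)
    fix z v assume z: "z \<in> D"
    note m = mc_linear_complex[OF p a D z]
    show "omega2 (mc S z v) = 0" using m(2)[of v] w2[OF z] by simp
    show "omega1 (mc S z \<i>) = \<i> * omega1 (mc S z 1)" by (rule m(1))
    show "omega3 (mc S z \<i>) = \<i> * omega3 (mc S z 1)" by (rule m(3))
  qed
qed

lemma tau_linear:
  assumes p: "param \<A> D0 \<psi>" and a: "adapted_on D (\<phi> \<circ> \<psi>) S" and D: "D \<subseteq> D0" and z: "z \<in> D"
  shows "tau (mc S z v) = v * tau (mc S z 1)"
proof -
  interpret adapted_frame D S by (rule adapted_frame(1)[OF p a D])
  have "linear (\<lambda>v. tau (mc S z v))"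
    using mc_linear[OF z] unfolding tau_def by (auto intro!: linearI simp: linear_add linear_scale)
  from linear_complex_eq[OF this, of v] show ?thesis
    using tau_J[OF z] unfolding ft_def by (simp add: complex_eq_iff)
qed

text \<open>On a disc where \<open>\<psi>\<close> is injective a lift over the plane descends to the
  surface, where \<open>local_lift\<close> is formulated.\<close>

lemma adapted_local_lift:
  assumes p: "param \<A> D0 \<psi>" and a: "adapted_on D (\<phi> \<circ> \<psi>) S" and D: "D \<subseteq> D0" and z: "z \<in> D"
  obtains B s where "open B" "z \<in> B" "B \<subseteq> D" "local_lift \<A> \<phi> (\<psi> ` B) s" "\<And>w. w \<in> B \<Longrightarrow> s (\<psi> w) = S w"
proof -
  have oD: "open D" using a by (simp add: adapted_on_def)
  have pD: "param \<A> D \<psi>" by (rule param_subset[OF p oD D])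
  obtain r where r: "r > 0" "ball z r \<subseteq> D" "inj_on \<psi> (ball z r)" using param_locally_injective[OF pD z] .
  let ?B = "ball z r"
  have pB: "param \<A> ?B \<psi>" by (rule param_subset[OF pD _ r(2)]) simp
  have aB: "adapted_on ?B (\<phi> \<circ> \<psi>) S" by (rule adapted_on_subset[OF a _ r(2)]) simp
  define s where "s = S \<circ> inv_into ?B \<psi>"
  have oV: "open (\<psi> ` ?B)" by (rule param_open_map[OF pB]) auto
  have sS: "s (\<psi> w) = S w" if "w \<in> ?B" for w using that r(3) by (simp add: s_def)
  have "?B \<inter> \<psi> -` (\<psi> ` ?B) = ?B" by auto
  moreover have "smooth_on ?B (s \<circ> \<psi>) \<longleftrightarrow> smooth_on ?B S" by (rule smooth_on_cong) (auto simp: sS)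
  ultimately have "smooth_on (?B \<inter> \<psi> -` (\<psi> ` ?B)) (s \<circ> \<psi>)" using aB by (simp add: adapted_on_def)
  then have "surf_smooth_on \<A> (\<psi> ` ?B) s" by (rule surf_smooth_onI[OF pB oV order_refl])
  moreover have "s x \<in> Sp2 \<and> orbit_map (s x) = \<phi> x" if x: "x \<in> \<psi> ` ?B" for x
  proof -
    obtain w where w: "w \<in> ?B" "x = \<psi> w" using x by blast
    then show ?thesis using aB by (simp add: sS adapted_on_def)
  qed
  ultimately have "local_lift \<A> \<phi> (\<psi> ` ?B) s" unfolding local_lift_def using oV by blast
  then show ?thesis using that[of ?B s] r sS by simp
qed

text \<open>Transversality speaks of lifts on the surface and of charts, so \<open>S\<close> is
  pushed down first. A chart direction is a multiple of the plane direction and tau is complex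
  linear, so a nonzero value in some direction gives one on the vector 1.\<close>

lemma tau_nonzero:
  assumes p: "param \<A> D0 \<psi>" and a: "adapted_on D (\<phi> \<circ> \<psi>) S" and D: "D \<subseteq> D0" and z: "z \<in> D"
  shows "tau (mc S z 1) \<noteq> 0"
proof -
  obtain B s where B: "open B" "z \<in> B" "B \<subseteq> D" "local_lift \<A> \<phi> (\<psi> ` B) s" and sS: "\<And>w. w \<in> B \<Longrightarrow> s (\<psi> w) = S w"
    by (rule adapted_local_lift[OF p a D z]) (rule that)
  have BD: "B \<subseteq> D0" using B(3) D by blast
  have aB: "adapted_on B (\<phi> \<circ> \<psi>) S" by (rule adapted_on_subset[OF a B(1,3)])
  have pull: "\<exists>\<mu>. \<forall>v. mc_pullback c s (\<psi> w) v = mc S w (\<mu> * v)" if c: "c \<in> \<A>" "\<psi> w \<in> fst c" and w: "w \<in> B" for c w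
  proof -
    have wD: "w \<in> D0" using w BD by blast
    obtain \<mu> where "\<mu> \<noteq> 0" and \<mu>: "\<And>(f :: 'x \<Rightarrow> complex^4^4) v. (f \<circ> \<psi>) differentiable (at w) \<Longrightarrow>
      chart_deriv c f (\<psi> w) v = frechet_derivative (f \<circ> \<psi>) (at w) (\<mu> * v)"
      by (rule param_chart_deriv[OF p wD c]) (rule that)
    have e: "frechet_derivative (s \<circ> \<psi>) (at w) = frechet_derivative S (at w)"
      by (rule frechet_derivative_cong[OF B(1) w]) (simp add: sS)
    have "(s \<circ> \<psi>) differentiable (at w) \<longleftrightarrow> S differentiable (at w)"
      by (rule differentiable_cong_open[OF B(1) w]) (simp add: sS)
    then have d: "(s \<circ> \<psi>) differentiable (at w)"
      using differentiableI[OF lift.S_deriv[OF adapted_on_lift[OF aB] w]] by simp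
    show ?thesis
      by (rule exI[of _ \<mu>]) (simp add: mc_pullback_def \<mu>[OF d] e sS[OF w] mc_def)
  qed
  have "adapted_lift \<A> \<phi> (\<psi> ` B) s"
    unfolding adapted_lift_def
  proof (intro conjI ballI allI B(4))
    fix c x v assume c: "c \<in> \<A>" and x: "x \<in> \<psi> ` B \<inter> fst c"
    then obtain w where w: "w \<in> B" "x = \<psi> w" by blast
    have "\<psi> w \<in> fst c" using IntD2[OF x] unfolding w(2) .
    from pull[OF c this w(1)] obtain \<mu> where "\<forall>v. mc_pullback c s (\<psi> w) v = mc S w (\<mu> * v)" by (rule exE)
    moreover have "omega2 (mc S w v) = 0" for v
      using mc_linear_complex(2)[OF p aB BD w(1), of v] aB w(1) by (simp add: adapted_on_def)
    ultimately show "omega2 (mc_pullback c s x v) = 0" by (simp add: w(2))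
  qed
  then have "\<forall>c\<in>\<A>. \<forall>x\<in>\<psi> ` B \<inter> fst c. \<exists>v. tau (mc_pullback c s x v) \<noteq> 0"
    using transverse by (simp add: transverse_curve_def)
  moreover obtain c where c: "c \<in> \<A>" "\<psi> z \<in> fst c" using chart_exists .
  ultimately obtain v where v: "tau (mc_pullback c s (\<psi> z) v) \<noteq> 0" using B(2) by blast
  from pull[OF c B(2)] obtain \<mu> where "\<forall>v. mc_pullback c s (\<psi> z) v = mc S z (\<mu> * v)" by (rule exE)
  then show ?thesis using v tau_linear[OF p a D z, of "\<mu> * v"] by auto
qed

text \<open>The lifts differ by an element \<open>diag(k1, cnj k1, k3, cnj k3)\<close> of the maximal torus.\<close>

lemma adapted_unique:
  assumes p: "param \<A> D0 \<psi>" and a: "adapted_on D (\<phi> \<circ> \<psi>) S" "adapted_on D' (\<phi> \<circ> \<psi>) S'"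
    and D: "D \<subseteq> D0" "D' \<subseteq> D0" and z: "z \<in> D" "z \<in> D'"
  obtains k1 k3 where "cnj k1 * k1 = 1" "cnj k3 * k3 = 1"
    "\<And>A. coframe (S' z) A $ 1 = cnj k1 * k3 * coframe (S z) A $ 1"
    "\<And>A. coframe (S' z) A $ 2 = cnj k1 * cnj k3 * coframe (S z) A $ 2"
    "\<And>A. coframe (S' z) A $ 3 = k1 * k1 * coframe (S z) A $ 3"
    "omega1 (mc S' z 1) = cnj k1 * k3 * omega1 (mc S z 1)"
    "omega3 (mc S' z 1) = k1 * k1 * omega3 (mc S z 1)"
    "tau (mc S' z 1) = cnj k3 * cnj k3 * tau (mc S z 1)"
proof -
  define E where "E = D \<inter> D'"
  have oE: "open E" and zE: "z \<in> E" using a z by (auto simp: E_def adapted_on_def)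
  define k where "k z = adj (S' z) ** S z" for z
  have S: "S w \<in> Sp2" "S' w \<in> Sp2" "orbit_map (S w) = orbit_map (S' w)" if "w \<in> E" for w
    using a that by (auto simp: E_def adapted_on_def)
  interpret S: adapted_frame D S by (rule adapted_frame(1)[OF p a(1) D(1)])
  interpret S': adapted_frame D' S' by (rule adapted_frame(1)[OF p a(2) D(2)])
  have dk: "(k has_derivative (\<lambda>v. adj (S' z) ** frechet_derivative S (at z) v + adj (frechet_derivative S' (at z) v) ** S z)) (at z)"
    if "z \<in> E" for z
    unfolding k_def[abs_def] using that
    by (intro bounded_bilinear.FDERIV[OF bounded_bilinear_matrix_mult] S.S_deriv
        bounded_linear.has_derivative[OF bounded_linear_adj S'.S_deriv]) (auto simp: E_def)
  \<comment> \<open>Differentiating \<open>k\<close> gives dk = k \<Omega> - \<Omega>' k for the two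
    Maurer-Cartan forms. Where an entry of \<open>k\<close> vanishes identically, so does its
    derivative, and the corresponding entries of the two products agree.\<close>
  have gauge: "k z ** mc S z v = mc S' z v ** k z + frechet_derivative k (at z) v" if z: "z \<in> E" for z v
  proof -
    have zz: "z \<in> D" "z \<in> D'" using z by (auto simp: E_def)
    have sk: "adj (mc S' z v) = - mc S' z v" using S'.mc_in_sp2[OF zz(2)] by (simp add: sp2_def)
    have "frechet_derivative k (at z) v = adj (S' z) ** frechet_derivative S (at z) v + adj (frechet_derivative S' (at z) v) ** S z"
      by (simp add: frechet_derivative_eq[OF dk[OF z]])
    also have "adj (S' z) ** frechet_derivative S (at z) v = k z ** mc S z v"
      by (simp add: S.mc_eq[OF zz(1)] k_def matrix_mul_assoc)
    also have "adj (frechet_derivative S' (at z) v) ** S z = - (mc S' z v ** k z)"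
      by (simp add: S'.mc_eq[OF zz(2)] adj_mult sk matrix_mult_uminus k_def matrix_mul_assoc)
    finally show ?thesis by simp
  qed
  note st = stabiliser_entries[OF S refl, folded k_def]
  have z21: "k w $ 2 $ 1 = 0" and z31: "k w $ 3 $ 1 = 0" and z41: "k w $ 4 $ 1 = 0" if "w \<in> E" for w
    by (rule st[OF that that that])+
  have dk0: "frechet_derivative k (at z) v $ i $ j = 0" if z: "z \<in> E" and ij: "\<And>w. w \<in> E \<Longrightarrow> k w $ i $ j = 0" for z v i j
  proof -
    have "k differentiable (at z)" by (rule differentiableI[OF dk[OF z]])
    then have "(k has_derivative frechet_derivative k (at z)) (at z)" by (simp add: frechet_derivative_works)
    then have 1: "((\<lambda>z. k z $ i $ j) has_derivative (\<lambda>v. frechet_derivative k (at z) v $ i $ j)) (at z)"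
      by (rule bounded_linear.has_derivative[OF bounded_linear_entry])
    have 2: "((\<lambda>z. k z $ i $ j) has_derivative (\<lambda>v. 0)) (at z)"
      by (subst has_derivative_cong_open[OF oE z, of _ "\<lambda>z. 0"]) (auto simp: ij)
    show ?thesis using fun_cong[OF has_derivative_unique[OF 1 2]] .
  qed
  have g: "(k z ** mc S z 1) $ i $ j = (mc S' z 1 ** k z) $ i $ j" if "z \<in> E" "\<And>w. w \<in> E \<Longrightarrow> k w $ i $ j = 0" for z i j
    using gauge[OF that(1), of 1] dk0[OF that, of 1] by simp
  have mm: "mc S w 1 $ 4 $ 1 = 0" "mc S w 1 $ 3 $ 1 \<noteq> 0" "mc S' w 1 $ 4 $ 1 = 0" if "w \<in> E" for w
    using that S.frame_entries(4,5)[of w] S'.frame_entries(5)[of w] S.w1_nz[of w] by (auto simp: E_def S.fa_def)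
  \<comment> \<open>Entry (4,1) of the gauge equation reduces to k43 times omega1 up to a constant,
    so adaptedness of both lifts forces \<open>k\<close> into the maximal torus.\<close>
  have k43: "k w $ 4 $ 3 = 0" if w: "w \<in> E" for w
  proof -
    have "k w $ 4 $ 3 * mc S w 1 $ 3 $ 1 = 0"
      using g[OF w z41] by (simp add: matrix_matrix_mult_def sum_4 st[OF w w w] mm w)
    then show ?thesis using mm w by simp
  qed
  have k34: "k w $ 3 $ 4 = 0" if "w \<in> E" for w using st(14)[OF that that that] k43[OF that] by simp
  note zz = zE
  have n: "cnj (k z $ 1 $ 1) * k z $ 1 $ 1 = 1" "cnj (k z $ 3 $ 3) * k z $ 3 $ 3 = 1"
    using st(15,16)[OF zz zz zz] k43[OF zz] by auto
  have e1: "k z $ 3 $ 3 * mc S z 1 $ 3 $ 1 = mc S' z 1 $ 3 $ 1 * k z $ 1 $ 1"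
    using g[OF zz z31] by (simp add: matrix_matrix_mult_def sum_4 st[OF zz zz zz] mm[OF zz] k34[OF zz])
  have e3: "cnj (k z $ 1 $ 1) * mc S z 1 $ 2 $ 1 = mc S' z 1 $ 2 $ 1 * k z $ 1 $ 1"
    using g[OF zz z21] by (simp add: matrix_matrix_mult_def sum_4 st[OF zz zz zz] mm[OF zz] k34[OF zz])
  have et: "cnj (k z $ 3 $ 3) * mc S z 1 $ 4 $ 3 = mc S' z 1 $ 4 $ 3 * k z $ 3 $ 3"
    using g[OF zz k43] by (simp add: matrix_matrix_mult_def sum_4 st[OF zz zz zz] mm[OF zz] k34[OF zz] k43[OF zz])
  have cancel: "x = cnj q * y" if "y = x * q" "cnj q * q = 1" for x y q :: complex
    using that by (simp add: mult.left_commute)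
  show ?thesis
  proof (rule that[OF n])
    note cf = coframe_stabiliser[OF S[OF zz] refl, folded k_def]
    show "coframe (S' z) A $ 1 = cnj (k z $ 1 $ 1) * k z $ 3 $ 3 * coframe (S z) A $ 1" for A
      using cf(1)[of A] by (simp add: k34[OF zz])
    show "coframe (S' z) A $ 2 = cnj (k z $ 1 $ 1) * cnj (k z $ 3 $ 3) * coframe (S z) A $ 2" for A
      using cf(2)[of A] by (simp add: k43[OF zz] st[OF zz zz zz])
    show "coframe (S' z) A $ 3 = k z $ 1 $ 1 * k z $ 1 $ 1 * coframe (S z) A $ 3" for A
      by (rule cf(3))
    show "omega1 (mc S' z 1) = cnj (k z $ 1 $ 1) * k z $ 3 $ 3 * omega1 (mc S z 1)"
      using cancel[OF e1 n(1)] by (simp add: omega1_def mult_ac)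
    have "mc S' z 1 $ 2 $ 1 = cnj (k z $ 1 $ 1) * (cnj (k z $ 1 $ 1) * mc S z 1 $ 2 $ 1)"
      by (rule cancel[OF e3 n(1)])
    from arg_cong[OF this, of cnj] show "omega3 (mc S' z 1) = k z $ 1 $ 1 * k z $ 1 $ 1 * omega3 (mc S z 1)"
      by (simp add: omega3_def mult.assoc)
    show "tau (mc S' z 1) = cnj (k z $ 3 $ 3) * cnj (k z $ 3 $ 3) * tau (mc S z 1)"
      using cancel[OF et n(2)] by (simp add: tau_def mult.assoc)
  qed
qed

end

section \<open>Flat parametrisations and uniformisation\<close>

context surface
begin

lemma param_local:
  assumes "open D" "\<And>z. z \<in> D \<Longrightarrow> \<exists>B. z \<in> B \<and> B \<subseteq> D \<and> param \<A> B \<psi>"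
  shows "param \<A> D \<psi>"
  unfolding param_def
proof (intro conjI ballI assms(1))
  show "continuous_on D \<psi>"
  proof (rule continuous_at_imp_continuous_on, intro ballI)
    fix z assume "z \<in> D"
    then obtain B where "z \<in> B" "param \<A> B \<psi>" using assms(2) by blast
    then show "isCont \<psi> z"
      using param_open param_continuous continuous_on_eq_continuous_at by blast
  qed
  fix c assume c: "c \<in> \<A>"
  show "(snd c \<circ> \<psi>) holomorphic_on (D \<inter> \<psi> -` fst c)"
    unfolding holomorphic_on_def
  proof
    fix z assume z: "z \<in> D \<inter> \<psi> -` fst c"
    then obtain B where B: "z \<in> B" "param \<A> B \<psi>" using assms(2) by blast
    have "(snd c \<circ> \<psi>) field_differentiable (at z)"
      by (rule holomorphic_on_imp_differentiable_at[OF param_holomorphic(1)[OF B(2) c]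
            param_open_vimage[OF B(2) chart_facts(1)[OF c]]]) (use z B in auto)
    then show "(snd c \<circ> \<psi>) field_differentiable (at z within (D \<inter> \<psi> -` fst c))"
      by (rule field_differentiable_at_within)
  qed
  fix z assume z: "z \<in> D \<inter> \<psi> -` fst c"
  then obtain B where B: "z \<in> B" "param \<A> B \<psi>" using assms(2) by blast
  show "deriv (snd c \<circ> \<psi>) z \<noteq> 0" using param_holomorphic(2)[OF B(2) c B(1)] z by simp
qed

end

text \<open>The derivative is continuous with finitely many values on a connected set, hence
  constant.\<close>

lemma holomorphic_fourth_root_of_unity_affine:
  assumes g: "g holomorphic_on ball z r" and r: "r > 0" and d: "\<And>w. w \<in> ball z r \<Longrightarrow> deriv g w ^ 4 = 1"
  obtains \<zeta> where "\<zeta> ^ 4 = 1" "\<And>h. cmod h < r \<Longrightarrow> g (z + h) = g z + \<zeta> * h"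
proof -
  have "deriv g constant_on ball z r"
  proof (rule continuous_finite_range_constant)
    show "continuous_on (ball z r) (deriv g)"
      by (intro holomorphic_on_imp_continuous_on holomorphic_deriv g open_ball)
    have "finite {w :: complex. w ^ 4 = 1}" by (rule finite_roots_unity) simp
    then show "finite (deriv g ` ball z r)"
      by (rule finite_subset[rotated]) (use d in auto)
  qed (rule connected_ball)
  then obtain \<zeta> where \<zeta>: "\<And>w. w \<in> ball z r \<Longrightarrow> deriv g w = \<zeta>" by (auto simp: constant_on_def)
  have "(\<lambda>w. g w - \<zeta> * w) constant_on ball z r"
  proof (rule has_field_derivative_0_imp_constant_on)
    fix w assume w: "w \<in> ball z r"
    have "((\<lambda>w. g w - \<zeta> * w) has_field_derivative deriv g w - \<zeta>) (at w)"
      by (auto intro!: derivative_eq_intros holomorphic_derivI[OF g open_ball w])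
    then show "((\<lambda>w. g w - \<zeta> * w) has_field_derivative 0) (at w)" using \<zeta>[OF w] by simp
  qed (auto simp: convex_connected)
  then obtain c where c: "\<And>w. w \<in> ball z r \<Longrightarrow> g w - \<zeta> * w = c" by (auto simp: constant_on_def)
  show ?thesis
  proof
    show "\<zeta> ^ 4 = 1" using d[of z] \<zeta>[of z] r by simp
    fix h :: complex assume "cmod h < r"
    then have "z + h \<in> ball z r" "z \<in> ball z r" using r by (auto simp: dist_norm)
    from c[OF this(1)] c[OF this(2)] show "g (z + h) = g z + \<zeta> * h" by (simp add: algebra_simps)
  qed
qed

section \<open>Natural coordinates of the quartic differential\<close>

context curve
begin

text \<open>The torus weights cancel in omega1^2 omega3 tau, so only the change of coordinate
  counts, and four (1,0)-forms contribute the fourth power of its derivative.\<close>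

lemma quartic_change:
  assumes p: "param \<A> D0 \<psi>" and p': "param \<A> D0' \<psi>'"
    and g: "g holomorphic_on B" "open B" "z \<in> B" "B \<subseteq> D0" "g ` B \<subseteq> D0'" "\<And>w. w \<in> B \<Longrightarrow> \<psi> w = \<psi>' (g w)"
    and a: "adapted_on D (\<phi> \<circ> \<psi>) S" "D \<subseteq> D0" "z \<in> D"
    and a': "adapted_on D' (\<phi> \<circ> \<psi>') S'" "D' \<subseteq> D0'" "g z \<in> D'"
  shows "quartic S z = deriv g z ^ 4 * quartic S' (g z)"
proof -
  note l' = adapted_on_lift[OF a'(1)]
  define B' where "B' = B \<inter> g -` D'"
  have oB': "open B'"
    unfolding B'_def
    by (rule continuous_open_preimage[OF holomorphic_on_imp_continuous_on[OF g(1)] g(2)])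
       (use a' in \<open>simp add: adapted_on_def\<close>)
  have zB': "z \<in> B'" using g(3) a'(3) by (simp add: B'_def)
  have sub: "B' \<subseteq> B" by (auto simp: B'_def)
  have mc': "mc (\<lambda>w. S' (g w)) w v = mc S' (g w) (deriv g w * v)" if "w \<in> B'" for w v
    by (rule mc_compose[OF l' g(1,2)]) (use that in \<open>auto simp: B'_def\<close>)
  have ad: "adapted_on B' (\<phi> \<circ> \<psi>) (\<lambda>w. S' (g w))"
    unfolding adapted_on_def
  proof (intro conjI ballI oB')
    show "smooth_on B' (\<lambda>w. S' (g w))"
      by (rule smooth_on_compose_holomorphic[OF oB' _ holomorphic_on_subset[OF g(1) sub]])
         (use a'(1) in \<open>auto simp: B'_def adapted_on_def\<close>)
    fix w assume w: "w \<in> B'"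
    then have gw: "g w \<in> D'" "\<psi> w = \<psi>' (g w)" using g(6) by (auto simp: B'_def)
    then show "S' (g w) \<in> Sp2" "orbit_map (S' (g w)) = (\<phi> \<circ> \<psi>) w"
      using a'(1) by (auto simp: adapted_on_def)
    show "omega2 (mc (\<lambda>w. S' (g w)) w 1) = 0"
      unfolding mc'[OF w] using mc_linear_complex(2)[OF p' a'(1,2) gw(1), of "deriv g w * 1"] a'(1) gw(1)
      by (simp add: adapted_on_def)
  qed
  obtain k1 k3 where k: "cnj k1 * k1 = 1" "cnj k3 * k3 = 1"
    "omega1 (mc (\<lambda>w. S' (g w)) z 1) = cnj k1 * k3 * omega1 (mc S z 1)"
    "omega3 (mc (\<lambda>w. S' (g w)) z 1) = k1 * k1 * omega3 (mc S z 1)"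
    "tau (mc (\<lambda>w. S' (g w)) z 1) = cnj k3 * cnj k3 * tau (mc S z 1)"
    by (rule adapted_unique[OF p a(1) ad a(2) _ a(3) zB']) (use sub g(4) in auto)
  have "quartic (\<lambda>w. S' (g w)) z
    = (cnj k1 * k1) * (cnj k1 * k1) * (cnj k3 * k3) * (cnj k3 * k3) * quartic S z"
    unfolding quartic_def k(3,4,5) by (simp only: mult_ac)
  then have "quartic S z = quartic (\<lambda>w. S' (g w)) z" by (simp add: k(1,2))
  also have "\<dots> = deriv g z ^ 4 * quartic S' (g z)"
    unfolding quartic_def mc'[OF zB']
    using mc_linear_complex(1,3)[OF p' a', of "deriv g z * 1"] tau_linear[OF p' a', of "deriv g z * 1"]
    by (simp add: power4_eq_xxxx mult_ac)
  finally show ?thesis .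
qed

text \<open>The quartic differential becomes dz^4 in such a coordinate. Quantifying over all adapted
  lifts on subsets makes the notion stable under restriction and gluing.\<close>

definition flat :: "complex set \<Rightarrow> (complex \<Rightarrow> 'x) \<Rightarrow> bool" where
  "flat D \<psi> \<longleftrightarrow> param \<A> D \<psi> \<and>
     (\<forall>D' S z. adapted_on D' (\<phi> \<circ> \<psi>) S \<and> D' \<subseteq> D \<and> z \<in> D' \<longrightarrow> quartic S z = 1)"

lemma flat_param: "flat D \<psi> \<Longrightarrow> param \<A> D \<psi>"
  by (simp add: flat_def)

lemma flat_open: "flat D \<psi> \<Longrightarrow> open D"
  by (rule param_open[OF flat_param])

lemma flat_subset:
  assumes "flat D \<psi>" "open B" "B \<subseteq> D" shows "flat B \<psi>"
  unfolding flat_def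
proof (intro conjI allI impI)
  show "param \<A> B \<psi>" by (rule param_subset[OF flat_param[OF assms(1)] assms(2,3)])
  fix D' S z assume "adapted_on D' (\<phi> \<circ> \<psi>) S \<and> D' \<subseteq> B \<and> z \<in> D'"
  then show "quartic S z = 1" using assms(1,3) unfolding flat_def by blast
qed

lemma flat_local:
  assumes "open D" "\<And>z. z \<in> D \<Longrightarrow> \<exists>B. z \<in> B \<and> B \<subseteq> D \<and> flat B \<psi>"
  shows "flat D \<psi>"
  unfolding flat_def
proof (intro conjI allI impI)
  show "param \<A> D \<psi>"
    by (rule param_local[OF assms(1)]) (use assms(2) flat_param in blast)
  fix D' S z assume a: "adapted_on D' (\<phi> \<circ> \<psi>) S \<and> D' \<subseteq> D \<and> z \<in> D'"
  then obtain B where B: "z \<in> B" "B \<subseteq> D" "flat B \<psi>" using assms(2) by blast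
  have "open (D' \<inter> B)" using a flat_open[OF B(3)] by (auto simp: adapted_on_def)
  then have "adapted_on (D' \<inter> B) (\<phi> \<circ> \<psi>) S" using a adapted_on_subset[of D' _ S "D' \<inter> B"] by blast
  then show "quartic S z = 1" using B a unfolding flat_def by blast
qed

lemma flat_cong:
  assumes "flat D \<psi>" "\<And>z. z \<in> D \<Longrightarrow> \<psi> z = \<psi>' z" shows "flat D \<psi>'"
  unfolding flat_def
proof (intro conjI allI impI)
  show "param \<A> D \<psi>'" by (rule param_cong[OF flat_param[OF assms(1)] assms(2)])
  fix D' S z assume a: "adapted_on D' (\<phi> \<circ> \<psi>') S \<and> D' \<subseteq> D \<and> z \<in> D'"
  have "adapted_on D' (\<phi> \<circ> \<psi>) S"
    using assms(2) a by (intro adapted_on_cong[OF conjunct1[OF a]]) (auto simp: subset_iff)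
  then show "quartic S z = 1" using a assms(1) unfolding flat_def by blast
qed

text \<open>Translations and fourth roots of unity preserve dz^4.\<close>

lemma flat_affine:
  assumes f: "flat D \<psi>" and \<zeta>: "\<zeta> ^ 4 = 1" and oB: "open B" and B: "\<And>z. z \<in> B \<Longrightarrow> \<zeta> * z + b \<in> D"
  shows "flat B (\<lambda>z. \<psi> (\<zeta> * z + b))"
proof -
  let ?g = "\<lambda>z. \<zeta> * z + b"
  have \<zeta>0: "\<zeta> \<noteq> 0" using \<zeta> by auto
  have hg: "?g holomorphic_on B" by (intro holomorphic_intros)
  have dg: "deriv ?g z = \<zeta>" for z
    by (rule DERIV_imp_deriv) (auto intro!: derivative_eq_intros)
  have sub: "?g ` B \<subseteq> D" using B by auto
  have p: "param \<A> B (\<psi> \<circ> ?g)"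
    by (rule param_compose[OF flat_param[OF f] hg oB sub]) (simp add: dg \<zeta>0)
  show ?thesis
    unfolding flat_def
  proof (intro conjI allI impI)
    show pB: "param \<A> B (\<lambda>z. \<psi> (?g z))" using p by (simp add: o_def)
    fix D' S z assume a: "adapted_on D' (\<phi> \<circ> (\<lambda>z. \<psi> (?g z))) S \<and> D' \<subseteq> B \<and> z \<in> D'"
    then have zB: "z \<in> B" by auto
    obtain E S' where E: "?g z \<in> E" "E \<subseteq> D" "adapted_on E (\<phi> \<circ> \<psi>) S'"
      using adapted_exists[OF flat_param[OF f] B[OF zB]] .
    have "quartic S z = deriv ?g z ^ 4 * quartic S' (?g z)"
      by (rule quartic_change[OF pB flat_param[OF f] hg oB zB order_refl sub refl _ _ _ E(3,2,1)]) (use a in auto)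
    moreover have "quartic S' (?g z) = 1" using f E unfolding flat_def by blast
    ultimately show "quartic S z = 1" by (simp add: dg \<zeta>)
  qed
qed

text \<open>The converse of \<open>flat_affine\<close>: the derivative of the transition has fourth
  power 1, so the transition is affine near the point.\<close>

lemma flat_rigid:
  assumes f: "flat D \<psi>" and f': "flat D' \<psi>'" and z: "z \<in> D" "z' \<in> D'" "\<psi> z = \<psi>' z'"
  obtains \<zeta> \<delta> where "\<zeta> ^ 4 = 1" "\<delta> > 0" "ball z \<delta> \<subseteq> D" "\<And>h. cmod h < \<delta> \<Longrightarrow> z' + \<zeta> * h \<in> D'"
    "\<And>h. cmod h < \<delta> \<Longrightarrow> \<psi> (z + h) = \<psi>' (z' + \<zeta> * h)"
proof -
  note p = flat_param[OF f] and p' = flat_param[OF f']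
  obtain B g where B: "open B" "z \<in> B" "B \<subseteq> D" "g holomorphic_on B" "g z = z'" "g ` B \<subseteq> D'"
    "\<And>w. w \<in> B \<Longrightarrow> deriv g w \<noteq> 0" "\<And>w. w \<in> B \<Longrightarrow> \<psi> w = \<psi>' (g w)"
    using param_transition[OF p p' z] by blast
  obtain r where r: "r > 0" "ball z r \<subseteq> B" using B(1,2) openE by blast
  have d4: "deriv g w ^ 4 = 1" if w: "w \<in> ball z r" for w
  proof -
    have wB: "w \<in> B" using w r by auto
    then have wD: "w \<in> D" "g w \<in> D'" using B by auto
    obtain E S where E: "w \<in> E" "E \<subseteq> D" "adapted_on E (\<phi> \<circ> \<psi>) S" using adapted_exists[OF p wD(1)] .
    obtain E' S' where E': "g w \<in> E'" "E' \<subseteq> D'" "adapted_on E' (\<phi> \<circ> \<psi>') S'" using adapted_exists[OF p' wD(2)] .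
    have "quartic S w = deriv g w ^ 4 * quartic S' (g w)"
      by (rule quartic_change[OF p p' B(4,1) wB B(3,6,8) E(3,2,1) E'(3,2,1)])
    moreover have "quartic S w = 1" "quartic S' (g w) = 1"
      using f f' E E' unfolding flat_def by blast+
    ultimately show ?thesis by simp
  qed
  obtain \<zeta> where \<zeta>: "\<zeta> ^ 4 = 1" "\<And>h. cmod h < r \<Longrightarrow> g (z + h) = g z + \<zeta> * h"
    using holomorphic_fourth_root_of_unity_affine[OF holomorphic_on_subset[OF B(4) r(2)] r(1) d4] by blast
  have zh: "z + h \<in> B" if "cmod h < r" for h using that r by (auto simp: dist_norm subset_iff)
  show ?thesis
  proof (rule that[OF \<zeta>(1) r(1)])
    show "ball z r \<subseteq> D" using r B(3) by auto
    fix h :: complex assume h: "cmod h < r"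
    show "z' + \<zeta> * h \<in> D'" using \<zeta>(2)[OF h] zh[OF h] B(5,6) by (metis image_subset_iff)
    show "\<psi> (z + h) = \<psi>' (z' + \<zeta> * h)" using \<zeta>(2)[OF h] zh[OF h] B(5,8) by simp
  qed
qed

text \<open>In a chart the quartic differential has a coefficient without zeros near the point. A
  primitive of its fourth root is a local coordinate, and the inverse of this coordinate followed by
  the chart inverse is flat.\<close>

lemma flat_exists: obtains r \<psi> where "r > 0" "flat (ball 0 r) \<psi>" "\<psi> 0 = x"
proof -
  obtain c where c: "c \<in> \<A>" "x \<in> fst c" using chart_exists .
  note p = param_chart[OF c(1)]
  let ?w = "snd c x"
  have w: "?w \<in> snd c ` fst c" using c by simp
  obtain D S where D: "?w \<in> D" "D \<subseteq> snd c ` fst c" "adapted_on D (\<phi> \<circ> chart_inv c) S"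
    using adapted_exists[OF p w] .
  interpret adapted_frame D S by (rule adapted_frame(1)[OF p D(3,2)])
  have hq: "quartic S holomorphic_on D"
    using quartic_holomorphic by (simp add: quartic_def[abs_def] fa_def fb_def ft_def)
  have nq: "quartic S z \<noteq> 0" if "z \<in> D" for z
    using w1_nz[OF that] adapted_frame(2)[OF p D(3,2) that] tau_nonzero[OF p D(3,2) that]
    by (simp add: quartic_def)
  obtain \<rho> where \<rho>: "\<rho> > 0" "ball ?w \<rho> \<subseteq> D" using D(1) open_D openE by blast
  obtain l where l: "l holomorphic_on ball ?w \<rho>" "\<And>z. z \<in> ball ?w \<rho> \<Longrightarrow> quartic S z = exp (l z)"
    using contractible_imp_holomorphic_log[OF holomorphic_on_subset[OF hq \<rho>(2)]] nq \<rho>(2)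
    by (metis convex_imp_contractible convex_ball subsetD)
  define k where "k z = exp (l z / 4)" for z
  have hk: "k holomorphic_on ball ?w \<rho>"
    unfolding k_def by (intro holomorphic_intros l) simp_all
  have k4: "k z ^ 4 = quartic S z" if "z \<in> ball ?w \<rho>" for z
    unfolding l(2)[OF that] k_def exp_of_nat_mult[symmetric] by simp
  obtain f0 where f0: "\<And>z. z \<in> ball ?w \<rho> \<Longrightarrow> (f0 has_field_derivative k z) (at z within ball ?w \<rho>)"
    using holomorphic_convex_primitive'[OF convex_ball open_ball hk] by blast
  define f where "f z = f0 z - f0 ?w" for z
  have df: "(f has_field_derivative k z) (at z)" if "z \<in> ball ?w \<rho>" for z
    using f0[OF that] at_within_open[OF that open_ball] unfolding f_def
    by (auto intro!: derivative_eq_intros)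
  have hf: "f holomorphic_on ball ?w \<rho>"
    unfolding holomorphic_on_open[OF open_ball] using df by blast
  have df': "deriv f z = k z" if "z \<in> ball ?w \<rho>" for z using df[OF that] by (rule DERIV_imp_deriv)
  have wb: "?w \<in> ball ?w \<rho>" using \<rho> by simp
  have "deriv f ?w \<noteq> 0" using df'[OF wb] by (simp add: k_def)
  then obtain \<rho>' where \<rho>': "\<rho>' > 0" "ball ?w \<rho>' \<subseteq> ball ?w \<rho>" "inj_on f (ball ?w \<rho>')"
    using has_complex_derivative_locally_injective[OF hf wb open_ball] by blast
  let ?B = "ball ?w \<rho>'"
  have hf': "f holomorphic_on ?B" by (rule holomorphic_on_subset[OF hf \<rho>'(2)])
  obtain g where g: "g holomorphic_on (f ` ?B)" "\<And>z. z \<in> ?B \<Longrightarrow> deriv f z * deriv g (f z) = 1"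
    "\<And>z. z \<in> ?B \<Longrightarrow> g (f z) = z"
    using holomorphic_has_inverse[OF hf' open_ball \<rho>'(3)] by metis
  have "open (f ` ?B)" by (rule open_mapping_thm3[OF hf' open_ball \<rho>'(3)])
  moreover have f0: "f ?w = 0" by (simp add: f_def)
  then have "0 \<in> f ` ?B" using \<rho>'(1) by (auto simp: image_iff intro!: bexI[of _ ?w])
  ultimately obtain r where r: "r > 0" "ball 0 r \<subseteq> f ` ?B" using openE by blast
  have gB: "g z \<in> ?B" "f (g z) = z" if "z \<in> ball 0 r" for z
    using that r(2) g(3) by auto
  have hg: "g holomorphic_on ball 0 r" by (rule holomorphic_on_subset[OF g(1) r(2)])
  have gk: "deriv g z ^ 4 * quartic S (g z) = 1" if "z \<in> ball 0 r" for z
  proof -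
    have "g z \<in> ball ?w \<rho>" using gB(1)[OF that] \<rho>'(2) by blast
    note e = df'[OF this] k4[OF this]
    have "(k (g z) * deriv g z) ^ 4 = 1" using g(2)[OF gB(1)[OF that]] gB(2)[OF that] e(1) by simp
    then show ?thesis by (simp add: power_mult_distrib e(2) mult.commute)
  qed
  have sub: "g ` ball 0 r \<subseteq> D" using gB(1) \<rho>(2) \<rho>'(2) by blast
  then have sub': "g ` ball 0 r \<subseteq> snd c ` fst c" using D(2) by blast
  have dg: "deriv g z \<noteq> 0" if "z \<in> ball 0 r" for z using gk[OF that] by auto
  define \<psi> where "\<psi> = chart_inv c \<circ> g"
  have p\<psi>: "param \<A> (ball 0 r) \<psi>"
    unfolding \<psi>_def by (rule param_compose[OF p hg open_ball sub' dg])
  have "flat (ball 0 r) \<psi>"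
    unfolding flat_def
  proof (intro conjI allI impI p\<psi>)
    fix D' S' z assume a: "adapted_on D' (\<phi> \<circ> \<psi>) S' \<and> D' \<subseteq> ball 0 r \<and> z \<in> D'"
    then have z: "z \<in> ball 0 r" by auto
    have gz: "g z \<in> D" using sub z by blast
    have "quartic S' z = deriv g z ^ 4 * quartic S (g z)"
      by (rule quartic_change[OF p\<psi> p hg open_ball z order_refl sub' _ _ _ _ D(3,2) gz])
         (use a in \<open>auto simp: \<psi>_def\<close>)
    then show "quartic S' z = 1" using gk[OF z] by simp
  qed
  moreover have "\<psi> 0 = x"
    using g(3)[of ?w] \<rho>'(1) f0 chart_facts(5)[OF c] by (simp add: \<psi>_def)
  ultimately show ?thesis using that r(1) by blast
qed

lemma fourth_root_norm: "\<zeta> ^ 4 = 1 \<Longrightarrow> cmod \<zeta> = 1" for \<zeta> :: complex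
  by (metis norm_ge_zero norm_one norm_power power_eq_1_iff zero_neq_numeral)

text \<open>At a limit of agreement points the two maps agree up to a rotation by \<zeta>. A nearby
  agreement point together with local injectivity forces \<zeta> = 1, so the agreement set is closed
  as well as open.\<close>

lemma flat_unique:
  assumes f: "flat D \<psi>" and f': "flat D \<psi>'" and D: "connected D"
    and z0: "z0 \<in> D" "\<delta>0 > 0" "\<And>w. w \<in> ball z0 \<delta>0 \<Longrightarrow> \<psi> w = \<psi>' w" and z: "z \<in> D"
  shows "\<psi> z = \<psi>' z"
proof -
  note p = flat_param[OF f] and p' = flat_param[OF f'] and oD = flat_open[OF f]
  define A where "A = {z \<in> D. \<exists>\<delta>>0. \<forall>w\<in>ball z \<delta>. \<psi> w = \<psi>' w}"
  have "openin (top_of_set D) A"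
  proof (subst openin_open_eq[OF oD], intro conjI)
    show "A \<subseteq> D" by (auto simp: A_def)
    show "open A"
    proof (subst open_contains_ball, intro ballI)
      fix a assume "a \<in> A"
      then obtain \<delta> where \<delta>: "a \<in> D" "\<delta> > 0" "\<forall>w\<in>ball a \<delta>. \<psi> w = \<psi>' w" by (auto simp: A_def)
      obtain e where e: "e > 0" "ball a e \<subseteq> D" using oD \<delta>(1) openE by blast
      have "ball a (min \<delta> e) \<subseteq> A"
      proof
        fix b assume b: "b \<in> ball a (min \<delta> e)"
        then obtain d where "d > 0" "ball b d \<subseteq> ball a (min \<delta> e)" using openE[OF open_ball] by blast
        then show "b \<in> A" using \<delta> e b by (fastforce simp: A_def)
      qed
      then show "\<exists>e>0. ball a e \<subseteq> A" using \<delta>(2) e(1) by (intro exI[of _ "min \<delta> e"]) auto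
    qed
  qed
  moreover have "closedin (top_of_set D) A"
  proof (subst closedin_limpt, intro conjI allI impI)
    show "A \<subseteq> D" by (auto simp: A_def)
    fix a assume a: "a islimpt A \<and> a \<in> D"
    have eq: "\<psi> a = \<psi>' a"
    proof (rule tendsto_unique)
      show "at a within A \<noteq> bot" using a by (simp add: trivial_limit_within)
      have sub: "A \<subseteq> D" by (auto simp: A_def)
      show "(\<psi> \<longlongrightarrow> \<psi> a) (at a within A)"
        using param_continuous[OF p] a sub by (auto simp: continuous_on_def intro: tendsto_within_subset)
      have 1: "(\<psi>' \<longlongrightarrow> \<psi>' a) (at a within A)"
        using param_continuous[OF p'] a sub by (auto simp: continuous_on_def intro: tendsto_within_subset)
      have "eventually (\<lambda>w. \<psi>' w = \<psi> w) (at a within A)"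
        unfolding eventually_at_filter by (rule always_eventually) (auto simp: A_def)
      with 1 show "(\<psi> \<longlongrightarrow> \<psi>' a) (at a within A)" by (rule Lim_transform_eventually)
    qed
    obtain \<zeta> \<delta> where \<zeta>: "\<zeta> ^ 4 = 1" "\<delta> > 0" "\<And>h. cmod h < \<delta> \<Longrightarrow> \<psi> (a + h) = \<psi>' (a + \<zeta> * h)"
      using flat_rigid[OF f f' _ _ eq] a by metis
    obtain r where r: "r > 0" "inj_on \<psi>' (ball a r)" using param_locally_injective[OF p'] a by metis
    have "min \<delta> r > 0" using \<zeta>(2) r(1) by simp
    then have "\<exists>b\<in>A. b \<noteq> a \<and> dist b a < min \<delta> r" using a unfolding islimpt_approachable by blast
    then obtain b where b: "b \<in> A" "b \<noteq> a" "dist b a < min \<delta> r" by blast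
    define h where "h = b - a"
    have h: "cmod h < \<delta>" "cmod h < r" "h \<noteq> 0" using b by (auto simp: h_def dist_norm)
    have "\<psi>' (a + h) = \<psi> (a + h)" using b(1) by (auto simp: A_def h_def)
    also have "\<dots> = \<psi>' (a + \<zeta> * h)" by (rule \<zeta>(3)[OF h(1)])
    finally have "a + h = a + \<zeta> * h"
      by (rule inj_onD[OF r(2)]) (use h(2) fourth_root_norm[OF \<zeta>(1)] in \<open>simp_all add: dist_norm norm_mult\<close>)
    then have "\<zeta> = 1" using h(3) by simp
    have "\<psi> w = \<psi>' w" if "w \<in> ball a \<delta>" for w
      using \<zeta>(3)[of "w - a"] that by (simp add: \<open>\<zeta> = 1\<close> dist_norm norm_minus_commute)
    then show "a \<in> A" using a \<zeta>(2) by (auto simp: A_def)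
  qed
  moreover have "z0 \<in> A" using z0 by (auto simp: A_def)
  ultimately have "A = D" using D[unfolded connected_clopen] by blast
  then obtain \<delta> where "\<delta> > 0" "\<forall>w\<in>ball z \<delta>. \<psi> w = \<psi>' w" using z by (auto simp: A_def)
  then show ?thesis by simp
qed

end

section \<open>Completeness of the flat structure and the covering by the plane\<close>

locale compact_curve = curve +
  assumes compact_surface: "compact (UNIV :: 'a set)"
begin

text \<open>A Lebesgue number argument: finitely many flat discs of half size cover the surface, and
  recentring within the half disc leaves a flat disc of half the radius.\<close>

lemma flat_uniform:
  obtains \<epsilon> where "\<epsilon> > 0" "\<And>x. \<exists>\<psi>. flat (ball 0 \<epsilon>) \<psi> \<and> \<psi> 0 = x"
proof -
  have "\<forall>x. \<exists>r \<psi>. r > 0 \<and> flat (ball 0 r) \<psi> \<and> \<psi> 0 = x" using flat_exists by metis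
  then obtain r \<psi> where r: "\<And>x. r x > 0" "\<And>x. flat (ball 0 (r x)) (\<psi> x)" "\<And>x. \<psi> x 0 = x" by metis
  define U where "U x = \<psi> x ` ball 0 (r x / 2)" for x
  have "open (U x)" for x
    unfolding U_def by (rule param_open_map[OF flat_param[OF r(2)]]) (use r(1)[of x] in auto)
  moreover have "x \<in> U x" for x
    unfolding U_def using r(1)[of x] r(3)[of x] by (intro image_eqI[of _ _ 0]) auto
  ultimately obtain F where F: "finite F" "UNIV = (\<Union>x\<in>F. U x)"
    using compactE_image[OF compact_surface, of UNIV U] by (metis UNIV_I UN_I subsetI top.extremum_uniqueI)
  have ne: "F \<noteq> {}" using F(2) by blast
  define \<epsilon> where "\<epsilon> = Min ((\<lambda>x. r x / 2) ` F)"
  have fi: "finite ((\<lambda>x. r x / 2) ` F)" "(\<lambda>x. r x / 2) ` F \<noteq> {}" using F(1) ne by auto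
  have e: "\<epsilon> > 0" unfolding \<epsilon>_def by (subst Min_gr_iff[OF fi]) (use r(1) in auto)
  have e2: "\<epsilon> \<le> r x / 2" if "x \<in> F" for x
    unfolding \<epsilon>_def by (rule Min_le[OF fi(1)]) (use that in auto)
  have "\<exists>\<psi>. flat (ball 0 \<epsilon>) \<psi> \<and> \<psi> 0 = y" for y
  proof -
    have "y \<in> (\<Union>x\<in>F. U x)" using F(2) by blast
    then obtain x w where x: "x \<in> F" "w \<in> ball 0 (r x / 2)" "y = \<psi> x w" unfolding U_def by blast
    have "flat (ball 0 \<epsilon>) (\<lambda>z. \<psi> x (1 * z + w))"
    proof (rule flat_affine[OF r(2)])
      fix z :: complex assume "z \<in> ball 0 \<epsilon>"
      then show "1 * z + w \<in> ball 0 (r x)"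
        using x(2) e2[OF x(1)] norm_triangle_ineq[of z w] by simp
    qed auto
    then show ?thesis using x(3) by (intro exI[of _ "\<lambda>z. \<psi> x (1 * z + w)"]) simp
  qed
  then show ?thesis using that e by blast
qed

text \<open>Around each point of the disc there is a flat disc of radius \<epsilon>, rotated so that
  it agrees with \<open>p\<close> near its centre. By \<open>flat_unique\<close> these maps agree on
  overlaps, and together their discs fill the larger disc.\<close>

lemma flat_extend:
  assumes e: "\<epsilon> > 0" "\<And>x. \<exists>\<psi>. flat (ball 0 \<epsilon>) \<psi> \<and> \<psi> 0 = x" and p: "flat (ball 0 R) p" and R: "R > 0"
  obtains p' where "flat (ball 0 (R + \<epsilon>)) p'" "\<And>z. z \<in> ball 0 R \<Longrightarrow> p' z = p z"
proof -
  have "\<exists>g. flat (ball z \<epsilon>) g \<and> (\<exists>\<delta>>0. ball z \<delta> \<subseteq> ball 0 R \<and> (\<forall>w\<in>ball z \<delta>. g w = p w))" if z: "z \<in> ball 0 R" for z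
  proof -
    obtain \<psi> where \<psi>: "flat (ball 0 \<epsilon>) \<psi>" "\<psi> 0 = p z" using e(2) by blast
    obtain \<zeta> \<delta> where \<zeta>: "\<zeta> ^ 4 = 1" "\<delta> > 0" "ball z \<delta> \<subseteq> ball 0 R"
      "\<And>h. cmod h < \<delta> \<Longrightarrow> \<zeta> * h \<in> ball 0 \<epsilon>" "\<And>h. cmod h < \<delta> \<Longrightarrow> p (z + h) = \<psi> (\<zeta> * h)"
      using flat_rigid[OF p \<psi>(1) z, of 0] \<psi>(2) e(1) by (metis add_0 centre_in_ball)
    have "flat (ball z \<epsilon>) (\<lambda>w. \<psi> (\<zeta> * w + (- \<zeta> * z)))"
    proof (rule flat_affine[OF \<psi>(1) \<zeta>(1)])
      fix w assume "w \<in> ball z \<epsilon>"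
      moreover have "\<zeta> * w + (- \<zeta> * z) = \<zeta> * (w - z)" by (simp add: algebra_simps)
      ultimately show "\<zeta> * w + (- \<zeta> * z) \<in> ball 0 \<epsilon>"
        using fourth_root_norm[OF \<zeta>(1)] by (simp add: norm_mult dist_norm norm_minus_commute)
    qed simp
    moreover have "\<psi> (\<zeta> * w + (- \<zeta> * z)) = p w" if "w \<in> ball z \<delta>" for w
    proof -
      have "p (z + (w - z)) = \<psi> (\<zeta> * (w - z))" by (rule \<zeta>(5)) (use that in \<open>simp add: dist_norm norm_minus_commute\<close>)
      then show ?thesis by (simp add: algebra_simps)
    qed
    ultimately show ?thesis using \<zeta>(2,3) by (intro exI[of _ "\<lambda>w. \<psi> (\<zeta> * w + (- \<zeta> * z))"]) blast
  qed
  then have "\<forall>z\<in>ball 0 R. \<exists>g. flat (ball z \<epsilon>) g \<and> (\<exists>\<delta>>0. ball z \<delta> \<subseteq> ball 0 R \<and> (\<forall>w\<in>ball z \<delta>. g w = p w))" by blast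
  from bchoice[OF this] obtain g where
    g: "\<And>z. z \<in> ball 0 R \<Longrightarrow> flat (ball z \<epsilon>) (g z)"
      "\<And>z. z \<in> ball 0 R \<Longrightarrow> \<exists>\<delta>>0. ball z \<delta> \<subseteq> ball 0 R \<and> (\<forall>w\<in>ball z \<delta>. g z w = p w)" by blast
  have gp: "g z w = p w" if z: "z \<in> ball 0 R" and w: "w \<in> ball z \<epsilon>" "w \<in> ball 0 R" for z w
  proof -
    obtain \<delta> where \<delta>: "\<delta> > 0" "ball z \<delta> \<subseteq> ball 0 R" "\<And>w. w \<in> ball z \<delta> \<Longrightarrow> g z w = p w" using g(2)[OF z] by blast
    let ?D = "ball z \<epsilon> \<inter> ball 0 R"
    show ?thesis
    proof (rule flat_unique[of ?D])
      show "flat ?D (g z)" by (rule flat_subset[OF g(1)[OF z]]) auto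
      show "flat ?D p" by (rule flat_subset[OF p]) auto
      show "connected ?D" by (intro convex_connected convex_Int convex_ball)
      show "z \<in> ?D" using z e(1) by simp
      show "w \<in> ?D" using w by simp
    qed (use \<delta> in auto)
  qed
  have gg: "g z w = g z' w" if z: "z \<in> ball 0 R" "z' \<in> ball 0 R" and w: "w \<in> ball z \<epsilon>" "w \<in> ball z' \<epsilon>" for z z' w
  proof -
    \<comment> \<open>The midpoint of the centres lies in both small discs and in the big one, where
      both maps equal \<open>p\<close>; it seeds uniqueness on the convex overlap.\<close>
    let ?D = "ball z \<epsilon> \<inter> ball z' \<epsilon>" and ?m = "(1/2) *\<^sub>R z + (1/2) *\<^sub>R z'"
    have mR: "?m \<in> ball 0 R" using convexD[OF convex_ball z, of "1/2" "1/2"] by simp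
    have "dist z z' < 2 * \<epsilon>" using w dist_triangle[of z z' w] by (simp add: dist_commute)
    moreover have "z - ?m = (1/2) *\<^sub>R (z - z')" "z' - ?m = (1/2) *\<^sub>R (z' - z)"
      by (simp_all add: complex_eq_iff field_simps)
    ultimately have mD: "?m \<in> ?D"
      by (simp add: dist_norm norm_minus_commute[of z' z])
    obtain d where d: "d > 0" "ball ?m d \<subseteq> ?D \<inter> ball 0 R"
      using openE[of "?D \<inter> ball 0 R" ?m] mR mD by blast
    show ?thesis
    proof (rule flat_unique[of ?D])
      show "flat ?D (g z)" by (rule flat_subset[OF g(1)[OF z(1)]]) auto
      show "flat ?D (g z')" by (rule flat_subset[OF g(1)[OF z(2)]]) auto
      show "connected ?D" by (intro convex_connected convex_Int convex_ball)
      show "?m \<in> ?D" "d > 0" by fact+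
      show "g z w = g z' w" if "w \<in> ball ?m d" for w
        using gp[OF z(1), of w] gp[OF z(2), of w] subsetD[OF d(2) that] by simp
      show "w \<in> ?D" using w by simp
    qed
  qed
  define c where "c w = (SOME z. z \<in> ball 0 R \<and> w \<in> ball z \<epsilon>)" for w :: complex
  define p' where "p' w = g (c w) w" for w
  have cw: "c w \<in> ball 0 R \<and> w \<in> ball (c w) \<epsilon>" if "z \<in> ball 0 R" "w \<in> ball z \<epsilon>" for z w
    unfolding c_def by (rule someI[of _ z]) (use that in blast)
  have p'g: "p' w = g z w" if "z \<in> ball 0 R" "w \<in> ball z \<epsilon>" for z w
    unfolding p'_def using cw[OF that] that by (intro gg) auto
  show ?thesis
  proof
    show "flat (ball 0 (R + \<epsilon>)) p'"
    proof (rule flat_local[OF open_ball])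
      fix w :: complex assume w: "w \<in> ball 0 (R + \<epsilon>)"
      \<comment> \<open>The radial contraction of w lies in the inner disc, at distance less than
        \<epsilon> from w.\<close>
      define z where "z = (R / (R + \<epsilon>)) *\<^sub>R w"
      have "cmod z = R / (R + \<epsilon>) * cmod w" using R e(1) by (simp add: z_def)
      also have "\<dots> < R / (R + \<epsilon>) * (R + \<epsilon>)" using w R e(1) by (intro mult_strict_left_mono) auto
      finally have z: "z \<in> ball 0 R" using R e(1) by simp
      have "w - z = (\<epsilon> / (R + \<epsilon>)) *\<^sub>R w"
        using R e(1) by (simp add: z_def complex_eq_iff field_simps)
      then have "cmod (w - z) = \<epsilon> / (R + \<epsilon>) * cmod w" using R e(1) by simp
      also have "\<dots> < \<epsilon> / (R + \<epsilon>) * (R + \<epsilon>)" using w R e(1) by (intro mult_strict_left_mono) auto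
      finally have wz: "w \<in> ball z \<epsilon>" using R e(1) by (simp add: dist_norm norm_minus_commute)
      have "ball z \<epsilon> \<subseteq> ball 0 (R + \<epsilon>)"
      proof
        fix y assume "y \<in> ball z \<epsilon>"
        then show "y \<in> ball 0 (R + \<epsilon>)" using z norm_triangle_ineq[of z "y - z"] by (simp add: dist_norm norm_minus_commute)
      qed
      moreover have "flat (ball z \<epsilon>) p'"
        by (rule flat_cong[OF g(1)[OF z]]) (use p'g[OF z] in simp)
      ultimately show "\<exists>B. w \<in> B \<and> B \<subseteq> ball 0 (R + \<epsilon>) \<and> flat B p'" using wz by blast
    qed
    show "p' z = p z" if "z \<in> ball 0 R" for z
      using p'g[OF that, of z] gp[OF that, of z] that e(1) by simp
  qed
qed

text \<open>Each extension gains the same radius, so the discs exhaust the plane and the nested maps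
  glue.\<close>

lemma flat_plane: obtains p where "flat UNIV p"
proof -
  obtain \<epsilon> where e: "\<epsilon> > 0" "\<And>x. \<exists>\<psi>. flat (ball 0 \<epsilon>) \<psi> \<and> \<psi> 0 = x" using flat_uniform by metis
  define R where "R n = \<epsilon> * real (Suc n)" for n
  have R: "R n > 0" "R (Suc n) = R n + \<epsilon>" for n
    using e(1) by (simp add: R_def, simp add: R_def algebra_simps)
  have "\<exists>P. \<forall>n. flat (ball 0 (R n)) (P n) \<and> (\<forall>z\<in>ball 0 (R n). P (Suc n) z = P n z)"
  proof (rule dependent_nat_choice)
    show "\<exists>p. flat (ball 0 (R 0)) p" using e(2) by (auto simp: R_def)
    fix p n assume "flat (ball 0 (R n)) p"
    from flat_extend[OF e this R(1)] show "\<exists>p'. flat (ball 0 (R (Suc n))) p' \<and> (\<forall>z\<in>ball 0 (R n). p' z = p z)"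
      unfolding R(2) by metis
  qed
  then obtain P where P: "\<And>n. flat (ball 0 (R n)) (P n)" "\<And>n z. z \<in> ball 0 (R n) \<Longrightarrow> P (Suc n) z = P n z" by blast
  have Rm: "ball 0 (R n) \<subseteq> ball (0 :: complex) (R (n + k))" for n k
    using e(1) by (intro subset_ball) (simp add: R_def)
  have Pk: "P (n + k) z = P n z" if "z \<in> ball 0 (R n)" for n k z
  proof (induction k)
    case (Suc k)
    have "z \<in> ball 0 (R (n + k))" using that Rm by blast
    then show ?case using P(2)[of z "n + k"] Suc by simp
  qed simp
  have ex: "\<exists>n. z \<in> ball 0 (R n)" for z :: complex
  proof -
    obtain n where "cmod z / \<epsilon> < real n" using reals_Archimedean2 by blast
    then have "cmod z < R n" using e(1) by (simp add: R_def field_simps)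
    then show ?thesis by auto
  qed
  define p where "p z = P (LEAST n. z \<in> ball 0 (R n)) z" for z
  have pP: "p z = P n z" if "z \<in> ball 0 (R n)" for z n
  proof -
    let ?m = "LEAST n. z \<in> ball 0 (R n)"
    have "z \<in> ball 0 (R ?m)" by (rule LeastI[of "\<lambda>n. z \<in> ball 0 (R n)"]) (rule that)
    moreover have "?m \<le> n" by (rule Least_le) (rule that)
    ultimately show ?thesis unfolding p_def using Pk[of z ?m "n - ?m"] by simp
  qed
  have "flat UNIV p"
  proof (rule flat_local[OF open_UNIV])
    fix z :: complex
    obtain n where "z \<in> ball 0 (R n)" using ex by blast
    moreover have "flat (ball 0 (R n)) p" by (rule flat_cong[OF P(1)]) (simp add: pP)
    ultimately show "\<exists>B. z \<in> B \<and> B \<subseteq> UNIV \<and> flat B p" by blast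
  qed
  then show ?thesis by (rule that)
qed

text \<open>The developing map is a covering, its deck transformations are translations because a
  rotation would have a fixed point, and compactness provides two independent periods.\<close>

theorem uniformisation:
  obtains p u v where "param \<A> UNIV p" "range p = UNIV" "\<And>z w h. p z = p w \<Longrightarrow> p (z + h) = p (w + h)"
    "\<And>z. p (z + u) = p z" "\<And>z. p (z + v) = p z" "Im (u * cnj v) \<noteq> 0"
proof -
  obtain \<epsilon> where e: "\<epsilon> > 0" "\<And>x. \<exists>\<psi>. flat (ball 0 \<epsilon>) \<psi> \<and> \<psi> 0 = x" using flat_uniform by metis
  obtain p where p: "flat UNIV p" using flat_plane .
  note pp = flat_param[OF p]
  \<comment> \<open>Every flat disc whose centre is in the image factors through \<open>p\<close> by
    an affine map, because \<open>p\<close> is defined on the whole plane.\<close>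
  have lift: "\<exists>\<zeta>. \<zeta> ^ 4 = 1 \<and> (\<forall>h\<in>ball 0 R. \<psi> h = p (\<zeta> * h + z))" if \<psi>: "flat (ball 0 R) \<psi>" "\<psi> 0 = p z" "R > 0" for \<psi> R z
  proof -
    obtain \<zeta> \<delta> where \<zeta>: "\<zeta> ^ 4 = 1" "\<delta> > 0" "\<And>h. cmod h < \<delta> \<Longrightarrow> \<psi> (0 + h) = p (z + \<zeta> * h)"
      using flat_rigid[OF \<psi>(1) p, of 0 z] \<psi>(2,3) by (metis UNIV_I centre_in_ball)
    have "flat (ball 0 R) (\<lambda>h. p (\<zeta> * h + z))" by (rule flat_affine[OF p \<zeta>(1)]) auto
    then have "\<psi> h = p (\<zeta> * h + z)" if "h \<in> ball 0 R" for h
      by (rule flat_unique[where ?z0.0 = 0, OF \<psi>(1) _ connected_ball _ \<zeta>(2) _ that])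
         (use \<psi>(3) \<zeta>(3) in \<open>auto simp: add.commute\<close>)
    then show ?thesis using \<zeta>(1) by blast
  qed
  have surj: "range p = UNIV"
  proof -
    have o1: "open (range p)" by (rule param_open_map[OF pp]) auto
    \<comment> \<open>If some point of a half-size flat disc about y were in the image, the disc
      recentred there would lift, and y would be in the image too.\<close>
    have o2: "open (- range p)"
    proof (subst open_subopen, intro ballI)
      fix y assume y: "y \<in> - range p"
      obtain \<psi> where \<psi>: "flat (ball 0 \<epsilon>) \<psi>" "\<psi> 0 = y" using e(2) by blast
      let ?T = "\<psi> ` ball 0 (\<epsilon> / 2)"
      have "open ?T" by (rule param_open_map[OF flat_param[OF \<psi>(1)]]) (use e(1) in auto)
      moreover have "y \<in> ?T" using \<psi>(2) e(1) by (intro image_eqI[of _ _ 0]) auto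
      moreover have "?T \<subseteq> - range p"
      proof (rule ccontr)
        assume "\<not> ?T \<subseteq> - range p"
        then obtain h z where h: "h \<in> ball 0 (\<epsilon> / 2)" "\<psi> h = p z" by auto
        have "flat (ball 0 (\<epsilon> / 2)) (\<lambda>k. \<psi> (1 * k + h))"
        proof (rule flat_affine[OF \<psi>(1)])
          fix k :: complex assume "k \<in> ball 0 (\<epsilon> / 2)"
          then show "1 * k + h \<in> ball 0 \<epsilon>" using h(1) norm_triangle_ineq[of k h] by simp
        qed auto
        from lift[OF this, of z] h(2) e(1) obtain \<zeta> where "\<forall>k\<in>ball 0 (\<epsilon> / 2). \<psi> (1 * k + h) = p (\<zeta> * k + z)" by auto
        from this[rule_format, of "- h"] h(1) have "\<psi> 0 = p (\<zeta> * - h + z)" by simp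
        then show False using \<psi>(2) y by auto
      qed
      ultimately show "\<exists>T. open T \<and> y \<in> T \<and> T \<subseteq> - range p" by blast
    qed
    have "connected (UNIV :: 'a set)" using surface by (simp add: riemann_surface_def)
    from connectedD[OF this o1 o2] show ?thesis by auto
  qed
  have deck: "p (z + h) = p (w + h)" if zw: "p z = p w" for z w h
  proof -
    obtain \<zeta> \<delta> where \<zeta>: "\<zeta> ^ 4 = 1" "\<delta> > 0" "\<And>h. cmod h < \<delta> \<Longrightarrow> p (z + h) = p (w + \<zeta> * h)"
      using flat_rigid[OF p p _ _ zw] by (metis UNIV_I)
    have f1: "flat UNIV (\<lambda>h. p (1 * h + z))" by (rule flat_affine[OF p]) auto
    have f2: "flat UNIV (\<lambda>h. p (\<zeta> * h + w))" by (rule flat_affine[OF p \<zeta>(1)]) auto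
    have all: "p (1 * h + z) = p (\<zeta> * h + w)" for h
      by (rule flat_unique[where ?z0.0 = 0, OF f1 f2 connected_UNIV _ \<zeta>(2)]) (use \<zeta>(3) in \<open>auto simp: add.commute\<close>)
    have "\<zeta> = 1"
    proof (rule ccontr)
      assume ne: "\<zeta> \<noteq> 1"
      \<comment> \<open>The solution of h + z = \<zeta> h + w. Around the common value
        \<open>c\<close> the map \<open>p\<close> would be invariant under the rotation by \<zeta>,
        against local injectivity.\<close>
      define h0 where "h0 = (w - z) / (1 - \<zeta>)"
      define c where "c = h0 + z"
      have "(1 - \<zeta>) * h0 = w - z" using ne by (simp add: h0_def)
      then have c: "\<zeta> * h0 + w = c" by (simp add: c_def algebra_simps)
      have ck: "p (c + k) = p (c + \<zeta> * k)" for k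
      proof -
        have "c + k = 1 * (h0 + k) + z" "c + \<zeta> * k = \<zeta> * (h0 + k) + w"
          unfolding c[symmetric] using c by (simp_all add: c_def algebra_simps)
        then show ?thesis using all[of "h0 + k"] by (simp only:)
      qed
      obtain r where r: "r > 0" "inj_on p (ball c r)" using param_locally_injective[OF pp, of c] by auto
      let ?k = "of_real (r / 2) :: complex"
      have "c + ?k \<in> ball c r" "c + \<zeta> * ?k \<in> ball c r"
        using r(1) fourth_root_norm[OF \<zeta>(1)] by (auto simp: dist_norm norm_mult)
      then have "c + ?k = c + \<zeta> * ?k" by (rule inj_onD[OF r(2) ck])
      then show False using ne r(1) by simp
    qed
    then show ?thesis using all[of h] by (simp add: add.commute)
  qed
  obtain R where R: "R > 0" "\<And>x. \<exists>z\<in>cball 0 R. p z = x"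
  proof -
    have "open (p ` ball 0 (real (Suc n)))" for n by (rule param_open_map[OF pp]) auto
    moreover have "UNIV \<subseteq> (\<Union>n. p ` ball 0 (real (Suc n)))"
    proof
      fix x
      obtain z where z: "x = p z" using surj by blast
      obtain n where "cmod z < real n" using reals_Archimedean2 by blast
      then have "z \<in> ball 0 (real (Suc n))" by simp
      then show "x \<in> (\<Union>n. p ` ball 0 (real (Suc n)))" using z by blast
    qed
    ultimately obtain F where F: "finite F" "UNIV \<subseteq> (\<Union>n\<in>F. p ` ball 0 (real (Suc n)))"
      using compactE_image[OF compact_surface, of UNIV "\<lambda>n. p ` ball 0 (real (Suc n))"] by metis
    have "\<exists>z\<in>cball 0 (real (Suc (Max F))). p z = x" for x
    proof -
      obtain n z where n: "n \<in> F" "z \<in> ball 0 (real (Suc n))" "x = p z" using F(2) by blast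
      have "n \<le> Max F" using F(1) n(1) by simp
      then show ?thesis using n(2,3) by (intro bexI[of _ z]) auto
    qed
    then show ?thesis using that[of "real (Suc (Max F))"] by simp
  qed
  have per: "p (z + (a - b)) = p z" if "p a = p b" for a b z
    using deck[OF that, of "z - b"] by (simp add: algebra_simps)
  \<comment> \<open>Every fibre meets the disc of radius R, so 4 R and 4 R \<i> are congruent to
    points a, b of it. The resulting periods are within R of two orthogonal vectors of length 4 R,
    and the estimate R^2 - 9 R^2 < 0 gives independence.\<close>
  obtain a where a: "cmod a \<le> R" "p a = p (of_real (4 * R))" using R(2)[of "p (of_real (4 * R))"] by auto
  obtain b where b: "cmod b \<le> R" "p b = p (\<i> * of_real (4 * R))" using R(2)[of "p (\<i> * of_real (4 * R))"] by auto
  define u where "u = of_real (4 * R) - a"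
  define v where "v = \<i> * of_real (4 * R) - b"
  have "p (z + u) = p z" "p (z + v) = p z" for z
    unfolding u_def v_def using per[OF a(2)[symmetric]] per[OF b(2)[symmetric]] by auto
  moreover have "Im (u * cnj v) \<noteq> 0"
  proof -
    have ab: "\<bar>Re a\<bar> \<le> R" "\<bar>Im a\<bar> \<le> R" "\<bar>Re b\<bar> \<le> R" "\<bar>Im b\<bar> \<le> R"
      using a(1) b(1) abs_Re_le_cmod[of a] abs_Im_le_cmod[of a] abs_Re_le_cmod[of b] abs_Im_le_cmod[of b] by linarith+
    have "Im (u * cnj v) = (- Im a) * (- Re b) - (4 * R - Re a) * (4 * R - Im b)"
      by (simp add: u_def v_def algebra_simps)
    moreover have "(- Im a) * (- Re b) \<le> R * R"
    proof -
      have "\<bar>Im a * Re b\<bar> \<le> R * R" unfolding abs_mult using ab R(1) by (intro mult_mono) auto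
      then show ?thesis by simp
    qed
    moreover have "(3 * R) * (3 * R) \<le> (4 * R - Re a) * (4 * R - Im b)"
      using ab R(1) by (intro mult_mono) auto
    ultimately have "Im (u * cnj v) \<le> R * R - 9 * (R * R)" by simp
    moreover have "R * R > 0" using R(1) by simp
    ultimately show ?thesis by linarith
  qed
  ultimately show ?thesis using that[OF pp surj] deck by blast
qed

end

section \<open>Bump functions\<close>

text \<open>At 0 the difference quotient is the lower power, which tends to 0 since m is
  positive.\<close>

lemma max_power_deriv:
  assumes "m > 0"
  shows "((\<lambda>y. max 0 y ^ Suc m) has_real_derivative real (Suc m) * max 0 y ^ m) (at y)"
proof -
  consider "y > 0" | "y < 0" | "y = 0" by linarith
  then show ?thesis
  proof cases
    case 1
    have "((\<lambda>y. y ^ Suc m) has_real_derivative real (Suc m) * max 0 y ^ m) (at y)"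
      using DERIV_pow[of "Suc m" y] 1 by (simp add: max_def)
    then show ?thesis
      by (rule has_field_derivative_transform_within_open[of _ _ _ "{0<..}"]) (use 1 in auto)
  next
    case 2
    have "((\<lambda>y. 0) has_real_derivative real (Suc m) * max 0 y ^ m) (at y)"
    proof -
      have "real (Suc m) * max 0 y ^ m = 0" using 2 assms by simp
      then show ?thesis by (simp only: DERIV_const)
    qed
    then show ?thesis
      by (rule has_field_derivative_transform_within_open[of _ _ _ "{..<0}"]) (use 2 in auto)
  next
    case 3
    have "(\<lambda>h::real. max 0 h ^ m) \<midarrow>0\<rightarrow> max 0 0 ^ m"
      by (rule tendsto_power[OF tendsto_max[OF tendsto_const tendsto_ident_at]])
    then have lim: "(\<lambda>h::real. max 0 h ^ m) \<midarrow>0\<rightarrow> 0" using assms by (simp only: max.idem power_0_left) simp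
    have eq: "(max 0 h :: real) ^ m = (max 0 (y + h) ^ Suc m - max 0 y ^ Suc m) / h" if "h \<noteq> 0" for h
      using 3 assms that by (auto simp: max_def)
    have lim': "(\<lambda>h. (max 0 (y + h) ^ Suc m - max 0 y ^ Suc m) / h) \<midarrow>0\<rightarrow> (0 :: real)"
      by (rule LIM_cong[THEN iffD1, OF refl _ refl lim]) (rule eq)
    have "real (Suc m) * max 0 y ^ m = 0" using 3 assms by simp
    then show ?thesis using lim' unfolding DERIV_def by (simp only:)
  qed
qed

text \<open>The factor \<open>P\<close> closes the class under differentiation: the derivative is a
  sum of two functions of the same shape, one of them with the exponent lowered by one.\<close>

lemma k_smooth_on_max_power:
  fixes q :: "complex \<Rightarrow> real"
  assumes q: "smooth_on UNIV q"
  shows "smooth_on UNIV P \<Longrightarrow> j > k \<Longrightarrow> k_smooth_on k UNIV (\<lambda>z. max 0 (q z) ^ j * P z)"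
proof (induction k arbitrary: P j)
  case 0
  then show ?case using k_smooth_on_continuous[OF smooth_onD[OF q, of 0]] k_smooth_on_continuous[OF smooth_onD[OF 0(1), of 0]]
    by (auto intro!: continuous_intros continuous_on_max)
next
  case (Suc k)
  obtain m where m: "j = Suc m" "m > k" using Suc.prems(2) by (metis Suc_lessE)
  then have m0: "m > 0" by simp
  have d: "((\<lambda>z. max 0 (q z) ^ j * P z) has_derivative
     (\<lambda>v. max 0 (q z) ^ j * frechet_derivative P (at z) v
        + (frechet_derivative q (at z) v * (real (Suc m) * max 0 (q z) ^ m)) * P z)) (at z)" for z
    unfolding m(1)
    by (intro has_derivative_mult smooth_on_has_derivative[OF Suc.prems(1)]
        DERIV_compose_FDERIV[OF max_power_deriv[OF m0]] smooth_on_has_derivative[OF q] UNIV_I)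
  have sm: "k_smooth_on k UNIV (\<lambda>z. max 0 (q z) ^ j * frechet_derivative P (at z) v
        + max 0 (q z) ^ m * (real (Suc m) * (frechet_derivative q (at z) v * P z)))" for v
  proof (intro k_smooth_on_add[OF open_UNIV] Suc.IH smooth_on_frechet Suc.prems)
    show "smooth_on UNIV (\<lambda>z. real (Suc m) * (frechet_derivative q (at z) v * P z))"
      unfolding smooth_on_def
      by (intro allI k_smooth_on_mult[OF open_UNIV] k_smooth_on_const smooth_onD smooth_on_frechet q Suc.prems)
  qed (use m Suc.prems in auto)
  have fe: "frechet_derivative (\<lambda>z. max 0 (q z) ^ j * P z) (at z) v = max 0 (q z) ^ j * frechet_derivative P (at z) v
        + max 0 (q z) ^ m * (real (Suc m) * (frechet_derivative q (at z) v * P z))" for z v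
    unfolding frechet_derivative_eq[OF d] by (simp only: mult_ac)
  have "k_smooth_on k UNIV (\<lambda>z. frechet_derivative (\<lambda>z. max 0 (q z) ^ j * P z) (at z) v)" for v
    unfolding fe by (rule sm)
  then show ?case using differentiableI[OF d] by simp
qed

text \<open>A power of a truncated quadratic is smooth to a prescribed finite order, which suffices
  because the later constructions consume finitely many derivatives.\<close>

definition bump :: "nat \<Rightarrow> complex \<Rightarrow> real \<Rightarrow> complex \<Rightarrow> real" where
  "bump k a r z = max 0 (1 - (norm (z - a))\<^sup>2 / r\<^sup>2) ^ Suc k"

lemma k_smooth_on_bump: "k_smooth_on k UNIV (bump k a r)"
proof -
  have "smooth_on UNIV (\<lambda>z. 1 - (Re (z - a) * Re (z - a) + Im (z - a) * Im (z - a)) * inverse (r\<^sup>2))"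
    unfolding smooth_on_def
    by (intro allI k_smooth_on_diff[OF open_UNIV] k_smooth_on_mult[OF open_UNIV] k_smooth_on_add[OF open_UNIV]
        k_smooth_on_const k_smooth_on_Re[OF open_UNIV] k_smooth_on_Im[OF open_UNIV]
        k_smooth_on_bounded_linear bounded_linear_ident)
  from k_smooth_on_max_power[OF this, of "\<lambda>_. 1" k "Suc k"]
  have "k_smooth_on k UNIV (\<lambda>z. max 0 (1 - (Re (z - a) * Re (z - a) + Im (z - a) * Im (z - a)) * inverse (r\<^sup>2)) ^ Suc k * 1)"
    by (simp only: smooth_on_def k_smooth_on_const lessI simp_thms)
  moreover have "bump k a r = (\<lambda>z. max 0 (1 - (Re (z - a) * Re (z - a) + Im (z - a) * Im (z - a)) * inverse (r\<^sup>2)) ^ Suc k * 1)"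
    unfolding bump_def cmod_power2 divide_inverse by (simp add: power2_eq_square)
  ultimately show ?thesis by (simp only:)
qed

lemma bump_nonneg: "bump k a r z \<ge> 0"
  by (simp add: bump_def)

lemma bump_pos: "norm (z - a) < r \<Longrightarrow> bump k a r z > 0"
proof -
  assume "norm (z - a) < r"
  then have "(norm (z - a))\<^sup>2 < r\<^sup>2" "r \<noteq> 0" by (auto intro: power_strict_mono)
  then have "0 < 1 - (norm (z - a))\<^sup>2 / r\<^sup>2" by simp
  then show ?thesis by (simp add: bump_def)
qed

lemma bump_zero: "r > 0 \<Longrightarrow> norm (z - a) \<ge> r \<Longrightarrow> bump k a r z = 0"
proof -
  assume "r > 0" "norm (z - a) \<ge> r"
  then have "r\<^sup>2 \<le> (norm (z - a))\<^sup>2" "r\<^sup>2 > 0" by (auto intro: power_mono)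
  then have "1 - (norm (z - a))\<^sup>2 / r\<^sup>2 \<le> 0" by simp
  then show ?thesis by (simp add: bump_def max_def)
qed

section \<open>Extensions of the trivial line bundle over a torus\<close>

text \<open>By \<open>deck\<close> the fibres of \<open>p\<close> are orbits of a group of
  translations; \<open>u\<close> and \<open>v\<close> are two independent members of it that need
  not generate it.\<close>

locale torus_cover = surface \<A> + period_pair u v for \<A> :: "('x::t2_space) chart set" and u v +
  fixes p :: "complex \<Rightarrow> 'x"
  assumes param_p: "param \<A> UNIV p" and surj_p: "range p = UNIV"
    and deck: "p z = p w \<Longrightarrow> p (z + h) = p (w + h)"
    and per_u: "p (z + u) = p z" and per_v: "p (z + v) = p z"
    and compact_surface: "compact (UNIV :: 'x set)"
begin

lemma open_vimage_p: "open U \<Longrightarrow> open (p -` U)"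
  using param_open_vimage[OF param_p] by simp

lemma surf_holomorphic_iff:
  "open U \<Longrightarrow> surf_holomorphic_on \<A> U f \<longleftrightarrow> (\<lambda>z. f (p z)) holomorphic_on p -` U"
  using param_surf_holomorphic[OF param_p, of U f] surf_holomorphic_onI[OF param_p, of U f] surj_p
  by (auto simp: o_def)

lemma surj_obtain: obtains z where "p z = x"
  using surj_p by (metis surjD)

text \<open>The increment of \<open>f\<close> along a deck transformation is entire and bounded, hence constant, and a
  nonzero constant would make \<open>f\<close> unbounded.\<close>

lemma deck_invariant:
  assumes f: "continuous_on UNIV f" "periodic f" "\<And>z. f differentiable (at z)" and g: "\<And>z. dbar f z = g (p z)"
    and zw: "p z = p w"
  shows "f z = f w"
proof -
  define l where "l = w - z"
  have pl: "p (y + l) = p y" for y using deck[OF zw, of "y - z"] by (simp add: l_def algebra_simps)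
  obtain B where B: "\<And>z. cmod (f z) \<le> B" using periodic_bounded[OF f(2,1)] by blast
  define d where "d y = f (y + l) - f y" for y
  have df: "((\<lambda>y. f (y + l)) has_derivative frechet_derivative f (at (y + l))) (at y)" for y
  proof -
    have "((\<lambda>y. y + l) has_derivative (\<lambda>h. h)) (at y)" by (auto intro!: derivative_eq_intros)
    from has_derivative_compose[OF this] show ?thesis
      using f(3)[of "y + l"] by (auto simp: frechet_derivative_works)
  qed
  have "d holomorphic_on UNIV"
  proof (rule dbar_0_holomorphic)
    fix y
    have 1: "(\<lambda>y. f (y + l)) differentiable (at y)" using df differentiableI by blast
    show "d differentiable (at y)" unfolding d_def[abs_def] by (intro differentiable_diff 1 f(3))
    have "dbar (\<lambda>y. f (y + l)) y = dbar f (y + l)"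
      unfolding dbar_eq[OF df] by (simp add: dbar_def)
    then show "dbar d y = 0"
      unfolding d_def[abs_def] dbar_diff[OF 1 f(3)] by (simp add: g pl)
  qed
  moreover have "bounded (range d)"
  proof (rule boundedI)
    fix x assume "x \<in> range d"
    then obtain y where x: "x = f (y + l) - f y" unfolding d_def by blast
    show "cmod x \<le> B + B" unfolding x by (rule order.trans[OF norm_triangle_ineq4 add_mono[OF B B]])
  qed
  ultimately obtain c where c: "\<And>y. d y = c" using Liouville_theorem[of d] unfolding constant_on_def by blast
  have n: "f (y + of_nat n * l) = f y + of_nat n * c" for y n
  proof (induction n)
    case (Suc n)
    have "f (y + of_nat (Suc n) * l) = f ((y + of_nat n * l) + l)" by (simp add: algebra_simps)
    also have "\<dots> = f (y + of_nat n * l) + c" using c[of "y + of_nat n * l"] by (simp add: d_def algebra_simps)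
    finally show ?case using Suc by (simp add: algebra_simps)
  qed simp
  have "real n * cmod c \<le> 2 * B" for n
  proof -
    have "real n * cmod c = cmod (f (z + of_nat n * l) - f z)" unfolding n by (simp add: norm_mult)
    also have "\<dots> \<le> B + B" by (rule order.trans[OF norm_triangle_ineq4 add_mono[OF B B]])
    finally show ?thesis by simp
  qed
  then have "\<not> cmod c > 0" using reals_Archimedean3[of "cmod c"] by (meson not_less)
  then show ?thesis using c[of z] by (simp add: d_def l_def)
qed

text \<open>A planar bump in a disc that \<open>p\<close> maps injectively, pushed to the surface
  and extended by 0. Smoothness is checked on the pullback, which near any other preimage is a deck
  translate of the planar bump.\<close>

lemma surface_bump:
  fixes V :: "'x set"
  assumes "open V" "x \<in> V"
  obtains B :: "'x \<Rightarrow> real" and K where "\<And>y. B y \<ge> 0" "B x > 0" "open {y. B y > 0}" "k_smooth_on k UNIV (\<lambda>z. B (p z))"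
    "closed K" "K \<subseteq> V" "\<And>y. y \<notin> K \<Longrightarrow> B y = 0"
proof -
  obtain z0 where z0: "p z0 = x" using surj_obtain .
  obtain r1 where r1: "r1 > 0" "inj_on p (ball z0 r1)" using param_locally_injective[OF param_p, of z0] by auto
  obtain r2 where r2: "r2 > 0" "ball z0 r2 \<subseteq> p -` V"
    using openE[OF open_vimage_p[OF assms(1)], of z0] assms(2) z0 by auto
  define r where "r = min r1 r2 / 2"
  have r: "r > 0" "2 * r \<le> r1" "2 * r \<le> r2" using r1 r2 by (auto simp: r_def)
  let ?B = "ball z0 (2 * r)"
  have inj: "inj_on p ?B" by (rule inj_on_subset[OF r1(2)]) (use r in auto)
  have sub: "?B \<subseteq> p -` V" using r2(2) r(3) by (meson order_trans subset_ball)
  define B where "B y = (if y \<in> p ` ?B then bump k z0 r (inv_into ?B p y) else 0)" for y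
  have Bp: "B (p w) = bump k z0 r w" if "w \<in> ?B" for w
    using that inj by (simp add: B_def)
  define K where "K = p ` cball z0 r"
  have cK: "compact K"
    unfolding K_def using param_continuous[OF param_p]
    by (intro compact_continuous_image) (auto intro: continuous_on_subset)
  have cs: "cball z0 r \<subseteq> ?B" using r(1) by auto
  have BK: "B y = 0" if "y \<notin> K" for y
  proof (cases "y \<in> p ` ?B")
    case True
    then obtain w where w: "w \<in> ?B" "y = p w" by blast
    have "w \<notin> cball z0 r" using that w(2) by (auto simp: K_def)
    then have "norm (w - z0) \<ge> r" by (simp add: dist_norm norm_minus_commute)
    then show ?thesis using Bp[OF w(1)] bump_zero[OF r(1)] w(2) by simp
  qed (simp add: B_def)
  have sm: "k_smooth_on k UNIV (\<lambda>z. B (p z))"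
  proof (rule k_smooth_on_local)
    fix z :: complex
    show "\<exists>T. open T \<and> z \<in> T \<and> k_smooth_on k T (\<lambda>z. B (p z))"
    proof (cases "p z \<in> p ` ?B")
      case True
      then obtain w where w: "w \<in> ?B" "p z = p w" by blast
      let ?T = "(\<lambda>y. y + (w - z)) -` ?B"
      have oT: "open ?T" by (rule open_vimage) (auto intro!: continuous_intros)
      have "p y = p (y + (w - z))" for y using deck[OF w(2), of "y - z"] by (simp add: algebra_simps)
      then have e: "B (p y) = bump k z0 r (y + (w - z))" if "y \<in> ?T" for y using Bp[of "y + (w - z)"] that by simp
      have "k_smooth_on k ?T (\<lambda>y. bump k z0 r (y + (w - z)))"
        by (rule k_smooth_on_compose[OF oT open_UNIV subset_UNIV k_smooth_on_bump])
           (intro k_smooth_on_add[OF oT] k_smooth_on_const k_smooth_on_bounded_linear bounded_linear_ident)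
      then have "k_smooth_on k ?T (\<lambda>y. B (p y))" by (subst k_smooth_on_cong[OF oT e]) auto
      then show ?thesis using oT w(1) by (intro exI[of _ ?T]) simp
    next
      case False
      let ?T = "p -` (- K)"
      have oT: "open ?T" by (rule open_vimage_p) (simp add: compact_imp_closed[OF cK] open_Compl)
      have "z \<in> ?T" using False cs by (auto simp: K_def)
      moreover have "k_smooth_on k ?T (\<lambda>y. B (p y))"
        by (subst k_smooth_on_cong[OF oT, of _ "\<lambda>_. 0"]) (auto simp: BK)
      ultimately show ?thesis using oT by blast
    qed
  qed
  have eq: "{y. B y > 0} = p ` ((\<lambda>z. B (p z)) -` {0<..})"
  proof (rule equalityI; rule subsetI)
    fix y assume y: "y \<in> {y. B y > 0}"
    obtain z where z: "p z = y" by (rule surj_obtain)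
    show "y \<in> p ` ((\<lambda>z. B (p z)) -` {0<..})" using y z by (intro image_eqI[of _ _ z]) simp_all
  next
    fix y assume "y \<in> p ` ((\<lambda>z. B (p z)) -` {0<..})"
    then obtain z where "y = p z" "B (p z) > 0" by blast
    then show "y \<in> {y. B y > 0}" by simp
  qed
  show ?thesis
  proof (rule that[of B K])
    show "B y \<ge> 0" for y unfolding B_def using bump_nonneg by simp
    show "B x > 0" using Bp[of z0] z0 r(1) bump_pos[of z0 z0 r k] by simp
    show "open {y. B y > 0}" unfolding eq
      by (rule param_open_map[OF param_p open_vimage[OF open_greaterThan k_smooth_on_continuous[OF sm]] subset_UNIV])
    show "K \<subseteq> V" using cs sub by (auto simp: K_def)
    show "k_smooth_on k UNIV (\<lambda>z. B (p z))" by (rule sm)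
    show "closed K" by (rule compact_imp_closed[OF cK])
    show "B y = 0" if "y \<notin> K" for y using BK[OF that] .
  qed
qed

end

section \<open>Rank-two linear algebra and transition matrices\<close>

abbreviation vec2 :: "complex \<Rightarrow> complex \<Rightarrow> complex^2" where "vec2 a b \<equiv> vector [a, b]"

lemma vec2_eta: "vec2 (w $ 1) (w $ 2) = w"
  by (simp add: vec_eq_iff forall_2)

lemma vec2_eq_iff: "vec2 a b = vec2 c d \<longleftrightarrow> a = c \<and> b = d"
  by (simp add: vec_eq_iff forall_2)

lemma vec2_eq_0: "vec2 a b = 0 \<longleftrightarrow> a = 0 \<and> b = 0"
  by (simp add: vec_eq_iff forall_2)

lemma matrix_vec2: "(A :: complex^2^2) *v w = vec2 (A $ 1 $ 1 * w $ 1 + A $ 1 $ 2 * w $ 2) (A $ 2 $ 1 * w $ 1 + A $ 2 $ 2 * w $ 2)"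
  by (simp add: vec_eq_iff forall_2 matrix_vector_mult_def sum_2)

lemma holomorphic_on_local:
  assumes "\<And>z. z \<in> S \<Longrightarrow> \<exists>T. open T \<and> z \<in> T \<and> f holomorphic_on T"
  shows "f holomorphic_on S"
  unfolding holomorphic_on_def
proof
  fix z assume "z \<in> S"
  then obtain T where T: "open T" "z \<in> T" "f holomorphic_on T" using assms by blast
  then have "f field_differentiable (at z)" by (simp add: holomorphic_on_imp_differentiable_at)
  then show "f field_differentiable (at z within S)" by (rule field_differentiable_at_within)
qed

lemma holomorphic_on_matrix_mult:
  fixes G :: "complex \<Rightarrow> complex^'m^'n" and H :: "complex \<Rightarrow> complex^'p^'m"
  assumes "\<And>i j. (\<lambda>z. G z $ i $ j) holomorphic_on S" "\<And>i j. (\<lambda>z. H z $ i $ j) holomorphic_on S"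
  shows "(\<lambda>z. (G z ** H z) $ i $ j) holomorphic_on S"
proof -
  have "(\<lambda>z. \<Sum>k\<in>UNIV. G z $ i $ k * H z $ k $ j) holomorphic_on S"
    by (rule holomorphic_on_sum[OF holomorphic_on_mult[OF assms]])
  then show ?thesis by (simp add: matrix_matrix_mult_def)
qed

definition inv2 :: "complex^2^2 \<Rightarrow> complex^2^2" where
  "inv2 A = (\<chi> i j. (if i = j then (if i = 1 then A $ 2 $ 2 else A $ 1 $ 1) else - A $ i $ j)
     / (A $ 1 $ 1 * A $ 2 $ 2 - A $ 1 $ 2 * A $ 2 $ 1))"

lemma inv2_entries:
  "inv2 A $ 1 $ 1 = A $ 2 $ 2 / (A $ 1 $ 1 * A $ 2 $ 2 - A $ 1 $ 2 * A $ 2 $ 1)"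
  "inv2 A $ 2 $ 2 = A $ 1 $ 1 / (A $ 1 $ 1 * A $ 2 $ 2 - A $ 1 $ 2 * A $ 2 $ 1)"
  "inv2 A $ 1 $ 2 = - A $ 1 $ 2 / (A $ 1 $ 1 * A $ 2 $ 2 - A $ 1 $ 2 * A $ 2 $ 1)"
  "inv2 A $ 2 $ 1 = - A $ 2 $ 1 / (A $ 1 $ 1 * A $ 2 $ 2 - A $ 1 $ 2 * A $ 2 $ 1)"
  by (simp_all add: inv2_def)

text \<open>If the determinant vanished, the columns of the adjugate would lie in the kernel up to
  sign; injectivity makes them 0, so the matrix is 0, which is absurd.\<close>

lemma inj_matrix2:
  assumes "inj ((*v) (A :: complex^2^2))"
  shows "A $ 1 $ 1 * A $ 2 $ 2 - A $ 1 $ 2 * A $ 2 $ 1 \<noteq> 0"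
proof
  assume d: "A $ 1 $ 1 * A $ 2 $ 2 - A $ 1 $ 2 * A $ 2 $ 1 = 0"
  then have d': "A $ 1 $ 1 * A $ 2 $ 2 = A $ 1 $ 2 * A $ 2 $ 1" by simp
  have z: "w = 0" if "A *v w = 0" for w
    using injD[OF assms, of w 0] that by simp
  have 1: "vec2 (A $ 2 $ 2) (- A $ 2 $ 1) = 0"
    by (rule z) (simp only: matrix_vec2 vec2_eq_0 vector_2, use d' in \<open>simp add: mult.commute\<close>)
  have 2: "vec2 (A $ 1 $ 2) (- A $ 1 $ 1) = 0"
    by (rule z) (simp only: matrix_vec2 vec2_eq_0 vector_2, use d' in \<open>simp add: mult.commute\<close>)
  have "A *v vec2 1 0 = 0" using 1 2 unfolding matrix_vec2 vec2_eq_0 by simp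
  from z[OF this] show False unfolding vec2_eq_0 by simp
qed

lemma inv2_right:
  assumes "A $ 1 $ 1 * A $ 2 $ 2 - A $ 1 $ 2 * A $ 2 $ 1 \<noteq> 0"
  shows "A *v (inv2 A *v w) = w"
proof -
  define d where "d = A $ 1 $ 1 * A $ 2 $ 2 - A $ 1 $ 2 * A $ 2 $ 1"
  have d: "d \<noteq> 0" using assms by (simp add: d_def)
  have "inv2 A *v w = vec2 ((A $ 2 $ 2 * w $ 1 - A $ 1 $ 2 * w $ 2) / d) ((A $ 1 $ 1 * w $ 2 - A $ 2 $ 1 * w $ 1) / d)"
    unfolding matrix_vec2 inv2_entries d_def[symmetric] by (simp add: vec2_eq_iff diff_divide_distrib)
  also have "A *v \<dots> = vec2 (d * w $ 1 / d) (d * w $ 2 / d)"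
    unfolding matrix_vec2 by (simp add: vec2_eq_iff d_def add_divide_distrib[symmetric] algebra_simps)
  also have "\<dots> = w" using d by (simp add: vec2_eta)
  finally show ?thesis .
qed

lemma holomorphic_on_inv2:
  assumes "\<And>i j. (\<lambda>z. G z $ i $ j) holomorphic_on S"
    and "\<And>z. z \<in> S \<Longrightarrow> G z $ 1 $ 1 * G z $ 2 $ 2 - G z $ 1 $ 2 * G z $ 2 $ 1 \<noteq> 0"
  shows "(\<lambda>z. inv2 (G z) $ i $ j) holomorphic_on S"
proof -
  let ?d = "\<lambda>z. G z $ 1 $ 1 * G z $ 2 $ 2 - G z $ 1 $ 2 * G z $ 2 $ 1"
  have d: "?d holomorphic_on S"
    by (rule holomorphic_on_diff[OF holomorphic_on_mult[OF assms(1) assms(1)] holomorphic_on_mult[OF assms(1) assms(1)]])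
  have "(\<lambda>z. inv2 (G z) $ 1 $ 1) holomorphic_on S" "(\<lambda>z. inv2 (G z) $ 2 $ 2) holomorphic_on S"
    unfolding inv2_entries by (rule holomorphic_on_divide[OF assms(1) d assms(2)], assumption)+
  moreover have "(\<lambda>z. inv2 (G z) $ 1 $ 2) holomorphic_on S" "(\<lambda>z. inv2 (G z) $ 2 $ 1) holomorphic_on S"
    unfolding inv2_entries
    by (rule holomorphic_on_divide[OF holomorphic_on_minus[OF assms(1)] d assms(2)], assumption)+
  ultimately show ?thesis using exhaust_2[of i] exhaust_2[of j] by metis
qed

lemma holomorphic_bundleD:
  assumes "holomorphic_bundle \<A> E"
  shows "(\<Union>(U, t)\<in>E. U) = UNIV" "(U, t) \<in> E \<Longrightarrow> open U" "(U, t) \<in> E \<Longrightarrow> x \<in> U \<Longrightarrow> inj (t x)"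
  using assms unfolding holomorphic_bundle_def by blast+

lemma holomorphic_bundle_transition:
  assumes "holomorphic_bundle \<A> E" "(U, t) \<in> E" "(U', t') \<in> E"
  obtains G where "\<And>i j. surf_holomorphic_on \<A> (U \<inter> U') (\<lambda>x. G x $ i $ j)"
    "\<And>x w. x \<in> U \<Longrightarrow> x \<in> U' \<Longrightarrow> t' x w = t x (G x *v w)"
proof -
  have "\<forall>(U, t)\<in>E. \<forall>(U', t')\<in>E. \<exists>G. (\<forall>i j. surf_holomorphic_on \<A> (U \<inter> U') (\<lambda>x. G x $ i $ j)) \<and>
        (\<forall>x\<in>U \<inter> U'. \<forall>w. t' x w = t x (G x *v w))"
    using assms(1) unfolding holomorphic_bundle_def by (elim conjE) assumption
  from bspec[OF bspec[OF this assms(2), unfolded split_conv] assms(3), unfolded split_conv]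
  obtain G where G: "\<forall>i j. surf_holomorphic_on \<A> (U \<inter> U') (\<lambda>x. G x $ i $ j)"
    "\<forall>x\<in>U \<inter> U'. \<forall>w. t' x w = t x (G x *v w)" by (elim exE conjE)
  show thesis
  proof (rule that[of G])
    show "surf_holomorphic_on \<A> (U \<inter> U') (\<lambda>x. G x $ i $ j)" for i j using G(1) by blast
    show "t' x w = t x (G x *v w)" if "x \<in> U" "x \<in> U'" for x w using G(2) that by blast
  qed
qed

lemma fibre_eq:
  assumes "holomorphic_bundle \<A> E" "(U, t) \<in> E" "x \<in> U"
  shows "fibre E x = range (t x)"
proof (rule equalityI; rule subsetI)
  fix e assume "e \<in> fibre E x"
  then obtain U' t' where e: "(U', t') \<in> E" "x \<in> U'" "e \<in> range (t' x)" unfolding fibre_def by blast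
  obtain G where "\<And>i j. surf_holomorphic_on \<A> (U \<inter> U') (\<lambda>x. G x $ i $ j)"
    "\<And>x w. x \<in> U \<Longrightarrow> x \<in> U' \<Longrightarrow> t' x w = t x (G x *v w)"
    by (rule holomorphic_bundle_transition[OF assms(1,2) e(1)]) (rule that)
  then show "e \<in> range (t x)" using e(2,3) assms(3) by auto
next
  fix e assume "e \<in> range (t x)"
  then show "e \<in> fibre E x" using assms(2,3) unfolding fibre_def by blast
qed

section \<open>Bundles with a unipotent frame over the plane\<close>

context torus_cover
begin

text \<open>The constant \<open>m\<close> is the extension class, as a multiple of the class of \<open>d(cnj z)\<close>.\<close>

definition unipotent_frame :: "('x, 2, 'v) vector_bundle \<Rightarrow> (complex \<Rightarrow> complex^2 \<Rightarrow> 'v) \<Rightarrow> complex \<Rightarrow> bool" where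
  "unipotent_frame E F m \<longleftrightarrow>
     (\<Union>(U, t)\<in>E. U) = UNIV \<and> (\<forall>z. inj (F z)) \<and>
     (\<forall>z z' w. p z = p z' \<longrightarrow> F z' w = F z (vec2 (w $ 1 - m * cnj (z' - z) * w $ 2) (w $ 2))) \<and>
     (\<forall>(U, t)\<in>E. open U \<and> (\<exists>G :: complex \<Rightarrow> complex^2^2. (\<forall>i j. (\<lambda>z. G z $ i $ j) holomorphic_on p -` U) \<and>
        (\<forall>z\<in>p -` U. inj ((*v) (G z)) \<and> (\<forall>w. t (p z) w = F z (G z *v w)))))"

lemma unipotent_frameD:
  assumes "unipotent_frame E F m"
  shows "(\<Union>(U, t)\<in>E. U) = UNIV" "inj (F z)"
    "p z = p z' \<Longrightarrow> F z' w = F z (vec2 (w $ 1 - m * cnj (z' - z) * w $ 2) (w $ 2))"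
    "(U, t) \<in> E \<Longrightarrow> open U"
  using assms unfolding unipotent_frame_def by blast+

text \<open>Both directions of the change are recorded, so that later proofs pass between a
  trivialisation and \<open>F\<close> without inverting matrices.\<close>

definition frame_change ::
  "'x set \<Rightarrow> ('x \<Rightarrow> complex^2 \<Rightarrow> 'v) \<Rightarrow> (complex \<Rightarrow> complex^2 \<Rightarrow> 'v) \<Rightarrow> (complex \<Rightarrow> complex^2^2) \<Rightarrow> (complex \<Rightarrow> complex^2^2) \<Rightarrow> bool"
where
  "frame_change U t F G G' \<longleftrightarrow>
     (\<forall>i j. (\<lambda>z. G z $ i $ j) holomorphic_on p -` U) \<and> (\<forall>z\<in>p -` U. \<forall>w. t (p z) w = F z (G z *v w)) \<and>
     (\<forall>i j. (\<lambda>z. G' z $ i $ j) holomorphic_on p -` U) \<and> (\<forall>z\<in>p -` U. \<forall>w. F z w = t (p z) (G' z *v w)) \<and>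
     (\<forall>z\<in>p -` U. inj (t (p z)))"

lemma frame_changeD:
  assumes "frame_change U t F G G'"
  shows "\<And>i j. (\<lambda>z. G z $ i $ j) holomorphic_on p -` U" "\<And>z w. p z \<in> U \<Longrightarrow> t (p z) w = F z (G z *v w)"
    "\<And>i j. (\<lambda>z. G' z $ i $ j) holomorphic_on p -` U" "\<And>z w. p z \<in> U \<Longrightarrow> F z w = t (p z) (G' z *v w)"
    "\<And>z. p z \<in> U \<Longrightarrow> inj (t (p z))"
  using assms unfolding frame_change_def by blast+

lemma unipotent_frame_transition:
  assumes "unipotent_frame E F m" "(U, t) \<in> E"
  obtains G G' where "frame_change U t F G G'"
proof -
  obtain G :: "complex \<Rightarrow> complex^2^2" where G: "\<And>i j. (\<lambda>z. G z $ i $ j) holomorphic_on p -` U"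
    "\<And>z. z \<in> p -` U \<Longrightarrow> inj ((*v) (G z)) \<and> (\<forall>w. t (p z) w = F z (G z *v w))"
    using assms unfolding unipotent_frame_def by fast
  have d: "G z $ 1 $ 1 * G z $ 2 $ 2 - G z $ 1 $ 2 * G z $ 2 $ 1 \<noteq> 0" if "z \<in> p -` U" for z
    by (rule inj_matrix2) (use G(2)[OF that] in blast)
  have "frame_change U t F G (\<lambda>z. inv2 (G z))"
    unfolding frame_change_def
  proof (intro conjI allI ballI)
    show "(\<lambda>z. inv2 (G z) $ i $ j) holomorphic_on p -` U" for i j
      by (rule holomorphic_on_inv2[OF G(1) d])
    fix z assume z: "z \<in> p -` U"
    show "F z w = t (p z) (inv2 (G z) *v w)" for w
    proof -
      have "t (p z) (inv2 (G z) *v w) = F z (G z *v (inv2 (G z) *v w))" using G(2)[OF z] by blast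
      then show ?thesis unfolding inv2_right[OF d[OF z]] by simp
    qed
    show "inj (t (p z))"
    proof (rule injI)
      fix w w' assume "t (p z) w = t (p z) w'"
      then have "F z (G z *v w) = F z (G z *v w')" using G(2)[OF z] by simp
      then have "G z *v w = G z *v w'" using unipotent_frameD(2)[OF assms(1)] by (simp add: inj_eq)
      then show "w = w'" using G(2)[OF z] by (simp add: inj_eq)
    qed
  qed (use G in auto)
  then show thesis by (rule that)
qed

lemma unipotent_frame_inj:
  assumes "unipotent_frame E F m" "(U, t) \<in> E" "p z \<in> U" shows "inj (t (p z))"
  by (rule unipotent_frame_transition[OF assms(1,2)]) (rule frame_changeD(5)[OF _ assms(3)])

text \<open>A preimage is chosen for each point; invariance makes the choice immaterial, and
  holomorphy on the surface is holomorphy of the pullback.\<close>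

lemma descend_matrix:
  fixes G :: "complex \<Rightarrow> complex^'r^'s"
  assumes "open U" "\<And>i j. (\<lambda>z. G z $ i $ j) holomorphic_on p -` U"
    and "\<And>z z'. p z = p z' \<Longrightarrow> p z \<in> U \<Longrightarrow> G z = G z'"
  obtains H :: "'x \<Rightarrow> complex^'r^'s" where "\<And>i j. surf_holomorphic_on \<A> U (\<lambda>x. H x $ i $ j)"
    "\<And>z. p z \<in> U \<Longrightarrow> H (p z) = G z"
proof -
  define H where "H x = G (SOME z. p z = x)" for x
  have H: "H (p z) = G z" if "p z \<in> U" for z
    unfolding H_def using someI[of "\<lambda>y. p y = p z" z] that assms(3) by metis
  have "(\<lambda>z. H (p z) $ i $ j) holomorphic_on p -` U" for i j
    by (rule holomorphic_transform[OF assms(2)]) (simp add: H)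
  then show thesis using that H surf_holomorphic_iff[OF assms(1)] by blast
qed

text \<open>Two trivialisations are compared through \<open>F\<close>. The product of the two
  matrices is determined by the trivialisations, which live on the surface, so it is deck invariant
  and descends.\<close>

lemma unipotent_frame_bundle:
  assumes "unipotent_frame E F m" shows "holomorphic_bundle \<A> E"
  unfolding holomorphic_bundle_def
proof (intro conjI ballI, safe)
  fix x show "x \<in> (\<Union>(U, t)\<in>E. U)" using unipotent_frameD(1)[OF assms] by simp
next
  fix U t assume e: "(U, t) \<in> E"
  then show "open U" by (rule unipotent_frameD(4)[OF assms])
  fix x assume "x \<in> U"
  then show "inj (t x)" using unipotent_frame_inj[OF assms e] surj_obtain[of x] by metis
next
  fix U t U' t' assume e: "(U, t) \<in> E" "(U', t') \<in> E"
  obtain Ga G where Ga: "frame_change U t F Ga G" by (rule unipotent_frame_transition[OF assms e(1)])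
  note Ga = frame_changeD[OF Ga]
  note G = Ga(3,4,5)
  obtain G' Gb where Gb: "frame_change U' t' F G' Gb" by (rule unipotent_frame_transition[OF assms e(2)])
  note Gb = frame_changeD[OF Gb]
  note G' = Gb(1,2)
  have t: "t' (p z) w = t (p z) ((G z ** G' z) *v w)" if "p z \<in> U \<inter> U'" for z w
    using that G(2) G'(2) by (simp add: matrix_vector_mul_assoc)
  obtain H :: "'x \<Rightarrow> complex^2^2" where H: "\<And>i j. surf_holomorphic_on \<A> (U \<inter> U') (\<lambda>x. H x $ i $ j)"
    "\<And>z. p z \<in> U \<inter> U' \<Longrightarrow> H (p z) = G z ** G' z"
  proof (rule descend_matrix[of "U \<inter> U'" "\<lambda>z. G z ** G' z"])
    show "open (U \<inter> U')" using unipotent_frameD(4)[OF assms] e by blast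
    show "(\<lambda>z. (G z ** G' z) $ i $ j) holomorphic_on p -` (U \<inter> U')" for i j
      by (rule holomorphic_on_matrix_mult; rule holomorphic_on_subset[OF G(1)] holomorphic_on_subset[OF G'(1)]) auto
    show "G z ** G' z = G z' ** G' z'" if "p z = p z'" "p z \<in> U \<inter> U'" for z z'
    proof -
      have "t (p z) ((G z ** G' z) *v w) = t (p z) ((G z' ** G' z') *v w)" for w
        using t[of z w] t[of z' w] that by simp
      then have "(G z ** G' z) *v w = (G z' ** G' z') *v w" for w
        using G(3)[of z] that(2) by (simp add: inj_eq)
      then show ?thesis by (simp add: matrix_eq)
    qed
  qed blast
  show "\<exists>H :: 'x \<Rightarrow> complex^2^2. (\<forall>i j. surf_holomorphic_on \<A> (U \<inter> U') (\<lambda>x. H x $ i $ j)) \<and>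
     (\<forall>x\<in>U \<inter> U'. \<forall>w. t' x w = t x (H x *v w))"
  proof (intro exI[of _ H] conjI allI ballI H(1))
    fix x w assume x: "x \<in> U \<inter> U'"
    obtain z where z: "p z = x" by (rule surj_obtain)
    show "t' x w = t x (H x *v w)" using t[of z w] H(2)[of z] x z by simp
  qed
qed (rule UNIV_I)

text \<open>The map diag(k, 1) in the frames \<open>F\<close> and \<open>F'\<close>, evaluated at a
  chosen preimage. It respects the two deck actions when \<open>k * m = m'\<close>, and then the
  choice does not matter.\<close>

definition unipotent_map :: "(complex \<Rightarrow> complex^2 \<Rightarrow> 'v) \<Rightarrow> (complex \<Rightarrow> complex^2 \<Rightarrow> 'w) \<Rightarrow> complex \<Rightarrow> 'x \<Rightarrow> 'v \<Rightarrow> 'w" where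
  "unipotent_map F F' k x e = (let z = SOME z. p z = x; w = inv_into UNIV (F z) e in F' z (vec2 (k * w $ 1) (w $ 2)))"

lemma unipotent_map:
  assumes "unipotent_frame E F m" "unipotent_frame E' F' m'" "k * m = m'"
  shows "unipotent_map F F' k (p z) (F z w) = F' z (vec2 (k * w $ 1) (w $ 2))"
proof -
  define y where "y = (SOME y. p y = p z)"
  have y: "p y = p z" unfolding y_def by (rule someI[of _ z]) simp
  have "inv_into UNIV (F y) (F z w) = vec2 (w $ 1 - m * cnj (z - y) * w $ 2) (w $ 2)"
    unfolding unipotent_frameD(3)[OF assms(1) y, of w] by (rule inv_into_f_f[OF unipotent_frameD(2)[OF assms(1)] UNIV_I])
  then have "unipotent_map F F' k (p z) (F z w)
      = F' y (vec2 (k * (w $ 1 - m * cnj (z - y) * w $ 2)) (w $ 2))"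
    unfolding unipotent_map_def Let_def y_def[symmetric] by (simp only: vector_2)
  also have "\<dots> = F' z (vec2 (k * w $ 1) (w $ 2))"
    unfolding unipotent_frameD(3)[OF assms(2) y, of "vec2 (k * w $ 1) (w $ 2)"] assms(3)[symmetric] vector_2 by (simp add: algebra_simps)
  finally show ?thesis .
qed

lemma bundle_hom_unipotent_map:
  assumes "unipotent_frame E F m" "unipotent_frame E' F' m'" "k * m = m'"
  shows "bundle_hom \<A> E E' (unipotent_map F F' k)"
  unfolding bundle_hom_def
proof safe
  fix U t U' t' assume e: "(U, t) \<in> E" "(U', t') \<in> E'"
  obtain G Ga where Ga: "frame_change U t F G Ga" by (rule unipotent_frame_transition[OF assms(1) e(1)])
  note Ga = frame_changeD[OF Ga]
  note G = Ga(1,2)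
  obtain Gb G' where Gb: "frame_change U' t' F' Gb G'" by (rule unipotent_frame_transition[OF assms(2) e(2)])
  note Gb = frame_changeD[OF Gb]
  note G' = Gb(3,4,5)
  define D :: "complex^2^2" where "D = vector [vector [k, 0], vector [0, 1]]"
  have D: "D *v w = vec2 (k * w $ 1) (w $ 2)" for w
    unfolding matrix_vec2 D_def by simp
  let ?f = "unipotent_map F F' k"
  let ?G = "\<lambda>z. G' z ** (D ** G z)"
  have f: "?f (p z) (t (p z) w) = t' (p z) (?G z *v w)" if "p z \<in> U \<inter> U'" for z w
    using that G(2) G'(2) unipotent_map[OF assms] by (simp add: matrix_vector_mul_assoc[symmetric] D)
  obtain H :: "'x \<Rightarrow> complex^2^2" where H: "\<And>i j. surf_holomorphic_on \<A> (U \<inter> U') (\<lambda>x. H x $ i $ j)"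
    "\<And>z. p z \<in> U \<inter> U' \<Longrightarrow> H (p z) = ?G z"
  proof (rule descend_matrix[of "U \<inter> U'" ?G])
    show "open (U \<inter> U')" by (rule open_Int[OF unipotent_frameD(4)[OF assms(1) e(1)] unipotent_frameD(4)[OF assms(2) e(2)]])
    show "(\<lambda>z. ?G z $ i $ j) holomorphic_on p -` (U \<inter> U')" for i j
      by (intro holomorphic_on_matrix_mult holomorphic_on_const;
          rule holomorphic_on_subset[OF G(1)] holomorphic_on_subset[OF G'(1)]) auto
    show "?G z = ?G z'" if "p z = p z'" "p z \<in> U \<inter> U'" for z z'
    proof -
      have "t' (p z) (?G z *v w) = t' (p z) (?G z' *v w)" for w
        using f[of z w] f[of z' w] that by simp
      then have "?G z *v w = ?G z' *v w" for w
        using G'(3)[of z] that(2) by (simp add: inj_eq)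
      then show ?thesis by (simp add: matrix_eq)
    qed
  qed blast
  show "\<exists>H :: 'x \<Rightarrow> complex^2^2. (\<forall>i j. surf_holomorphic_on \<A> (U \<inter> U') (\<lambda>x. H x $ i $ j)) \<and>
     (\<forall>x\<in>U \<inter> U'. \<forall>w. ?f x (t x w) = t' x (H x *v w))"
  proof (intro exI[of _ H] conjI allI ballI H(1))
    fix x w assume x: "x \<in> U \<inter> U'"
    obtain z where z: "p z = x" by (rule surj_obtain)
    show "?f x (t x w) = t' x (H x *v w)" using f[of z w] H(2)[of z] x z by simp
  qed
qed

lemma unipotent_fibre:
  assumes "unipotent_frame E F m" shows "fibre E (p z) = range (F z)"
proof -
  obtain U t where U: "(U, t) \<in> E" "p z \<in> U" using unipotent_frameD(1)[OF assms] by fast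
  obtain G G' where G: "frame_change U t F G G'" by (rule unipotent_frame_transition[OF assms U(1)])
  note G = frame_changeD[OF G]
  have "range (t (p z)) = range (F z)"
    using G(2,4)[OF U(2)] by (metis (no_types, lifting) equalityI image_subsetI rangeI)
  then show ?thesis using fibre_eq[OF unipotent_frame_bundle[OF assms] U] by simp
qed

text \<open>The ratio of the two parameters is the scaling of the first basis vector that matches
  the deck actions.\<close>

lemma unipotent_isomorphic:
  assumes "unipotent_frame E F m" "unipotent_frame E' F' m'" "m \<noteq> 0" "m' \<noteq> 0"
  shows "bundle_isomorphic \<A> E E'"
  unfolding bundle_isomorphic_def
proof (intro exI conjI allI ballI)
  have k: "(m' / m) * m = m'" "(m / m') * m' = m" using assms by simp_all
  show "bundle_hom \<A> E E' (unipotent_map F F' (m' / m))" "bundle_hom \<A> E' E (unipotent_map F' F (m / m'))"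
    by (rule bundle_hom_unipotent_map[OF assms(1,2) k(1)] bundle_hom_unipotent_map[OF assms(2,1) k(2)])+
  fix x obtain z where z: "p z = x" by (rule surj_obtain)
  note * = unipotent_map[OF assms(1,2) k(1)] unipotent_map[OF assms(2,1) k(2)]
  show "unipotent_map F' F (m / m') x (unipotent_map F F' (m' / m) x e) = e" if e: "e \<in> fibre E x" for e
  proof -
    obtain w where w: "e = F z w" using e unfolding z[symmetric] unipotent_fibre[OF assms(1)] by blast
    show ?thesis unfolding z[symmetric] by (simp only: w * vector_2, simp add: assms(3,4) vec2_eta)
  qed
  show "unipotent_map F F' (m' / m) x (unipotent_map F' F (m / m') x e) = e" if e: "e \<in> fibre E' x" for e
  proof -
    obtain w where w: "e = F' z w" using e unfolding z[symmetric] unipotent_fibre[OF assms(2)] by blast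
    show ?thesis unfolding z[symmetric] by (simp only: w * vector_2, simp add: assms(3,4) vec2_eta)
  qed
qed

end

lemma k_smooth_on_dbar: "k_smooth_on (Suc k) S f \<Longrightarrow> open S \<Longrightarrow> k_smooth_on k S (dbar f)"
proof -
  assume f: "k_smooth_on (Suc k) S f" and S: "open S"
  have d: "k_smooth_on k S (\<lambda>z. frechet_derivative f (at z) v)" for v using f by simp
  have "k_smooth_on k S (\<lambda>z. (frechet_derivative f (at z) 1 + \<i> * frechet_derivative f (at z) \<i>) * (1 / 2))"
    by (rule k_smooth_on_mult[OF S k_smooth_on_add[OF S d k_smooth_on_mult[OF S k_smooth_on_const d]] k_smooth_on_const])
  then show ?thesis unfolding dbar_def[abs_def] by simp
qed

context torus_cover
begin

lemma dbar_deck: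
  assumes "p z = p w" shows "dbar (\<lambda>y. g (p y)) z = dbar (\<lambda>y. g (p y)) w"
proof -
  define f where "f y = g (p y)" for y
  have f: "f = (\<lambda>y. f (y + (w - z)))"
    unfolding f_def using deck[OF assms, of "y - z" for y] by (simp add: algebra_simps)
  have s: "(f has_derivative D) (at (y + a)) \<longleftrightarrow> ((\<lambda>y. f (y + a)) has_derivative D) (at y)" for D y a
  proof
    have 1: "((\<lambda>y. y + a) has_derivative (\<lambda>h. h)) (at y)" for a y :: complex by (auto intro!: derivative_eq_intros)
    show "((\<lambda>y. f (y + a)) has_derivative D) (at y)" if fd: "(f has_derivative D) (at (y + a))"
      by (rule has_derivative_compose[OF 1 fd])
    assume "((\<lambda>y. f (y + a)) has_derivative D) (at y)"
    then have "((\<lambda>y. f (y + a)) has_derivative D) (at (y + a + - a))" by simp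
    from has_derivative_compose[OF 1 this] show "(f has_derivative D) (at (y + a))" by simp
  qed
  have "(f has_derivative D) (at z) \<longleftrightarrow> (f has_derivative D) (at w)" for D
    using s[of D z "w - z"] by (subst f) simp
  then have "frechet_derivative f (at z) = frechet_derivative f (at w)"
    unfolding frechet_derivative_def by simp
  then show ?thesis unfolding dbar_def f_def[abs_def] by simp
qed

text \<open>In the frame a morphism from the trivial line is an entire vector function
  \<open>c\<close>; the equivariance \<open>dk\<close> is what makes it descend to the
  surface.\<close>

lemma bundle_hom_from_trivial:
  assumes uf: "unipotent_frame E F m" and c: "\<And>i. (\<lambda>z. c z $ i) holomorphic_on UNIV"
    and dk: "\<And>z z'. p z = p z' \<Longrightarrow> c z = vec2 (c z' $ 1 - m * cnj (z' - z) * c z' $ 2) (c z' $ 2)"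
    and f: "\<And>z a. f (p z) a = F z (a *s c z)"
  shows "bundle_hom \<A> trivial_line E f"
  unfolding bundle_hom_def
proof safe
  fix U0 :: "'x set" and t0 :: "'x \<Rightarrow> complex^1 \<Rightarrow> complex" and U t
  assume t0: "(U0, t0) \<in> trivial_line" and e: "(U, t) \<in> E"
  have t0: "U0 = UNIV" "t0 = (\<lambda>x w. w $ 1)" using t0 by (simp_all add: trivial_line_def)
  obtain G G' where G: "frame_change U t F G G'" by (rule unipotent_frame_transition[OF uf e])
  note G = frame_changeD[OF G]
  define C :: "complex \<Rightarrow> complex^1^2" where "C z = (\<chi> i j. c z $ i)" for z
  have C: "C z *v w = w $ 1 *s c z" for z w by (simp add: C_def vec_eq_iff matrix_vector_mult_def mult.commute)
  let ?G = "\<lambda>z. G' z ** C z"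
  have eq: "f (p z) (w $ 1) = t (p z) (?G z *v w)" if "p z \<in> U" for z w
    unfolding f C[symmetric] G(4)[OF that] by (simp add: matrix_vector_mul_assoc)
  obtain H :: "'x \<Rightarrow> complex^1^2" where H: "\<And>i j. surf_holomorphic_on \<A> U (\<lambda>x. H x $ i $ j)"
    "\<And>z. p z \<in> U \<Longrightarrow> H (p z) = ?G z"
  proof (rule descend_matrix[of U ?G])
    show "open U" by (rule unipotent_frameD(4)[OF uf e])
    have "(\<lambda>z. C z $ i $ j) holomorphic_on p -` U" for i j
      unfolding C_def using holomorphic_on_subset[OF c subset_UNIV] by simp
    then show "(\<lambda>z. ?G z $ i $ j) holomorphic_on p -` U" for i j
      by (rule holomorphic_on_matrix_mult[OF G(3)])
    show "?G z = ?G z'" if z: "p z = p z'" "p z \<in> U" for z z'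
    proof -
      have "t (p z) (?G z *v w) = t (p z) (?G z' *v w)" for w
        using eq[of z w] eq[of z' w] z by simp
      then have "?G z *v w = ?G z' *v w" for w using injD[OF G(5)[OF z(2)]] by blast
      then show ?thesis by (simp add: matrix_eq)
    qed
  qed (rule that)
  show "\<exists>H :: 'x \<Rightarrow> complex^1^2. (\<forall>i j. surf_holomorphic_on \<A> (U0 \<inter> U) (\<lambda>x. H x $ i $ j)) \<and>
     (\<forall>x\<in>U0 \<inter> U. \<forall>w. f x (t0 x w) = t x (H x *v w))"
    unfolding t0 Int_UNIV_left
  proof (intro exI[of _ H] conjI allI ballI H(1))
    fix x w assume x: "x \<in> U"
    obtain z where z: "p z = x" by (rule surj_obtain)
    show "f x (w $ 1) = t x (H x *v w)" using eq[of z w] H(2)[of z] x z by simp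
  qed
qed

text \<open>Local matrices of the morphism give local holomorphic vectors, and injectivity of
  \<open>F z\<close> makes them one function on the plane.\<close>

lemma bundle_hom_from_trivialD:
  assumes uf: "unipotent_frame E F m" and r: "bundle_hom \<A> trivial_line E r"
  obtains c where "\<And>i. (\<lambda>z. c z $ i) holomorphic_on UNIV" "\<And>z a. r (p z) a = F z (a *s c z)"
proof -
  have loc: "\<exists>U C. open U \<and> z0 \<in> p -` U \<and> (\<forall>i. (\<lambda>z. (C z :: complex^2) $ i) holomorphic_on p -` U) \<and>
    (\<forall>z\<in>p -` U. \<forall>a. r (p z) a = F z (a *s C z))" for z0
  proof -
    obtain U t where U: "(U, t) \<in> E" "p z0 \<in> U" using unipotent_frameD(1)[OF uf] by fast
    note oU = unipotent_frameD(4)[OF uf U(1)]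
    obtain G G' where G: "frame_change U t F G G'" by (rule unipotent_frame_transition[OF uf U(1)])
    note G = frame_changeD[OF G]
    have "(UNIV, \<lambda>x w. w $ 1) \<in> (trivial_line :: ('x, 1, complex) vector_bundle)" by (simp add: trivial_line_def)
    from bspec[OF bspec[OF r[unfolded bundle_hom_def] this, unfolded split_conv] U(1), unfolded split_conv Int_UNIV_left]
    obtain H :: "'x \<Rightarrow> complex^1^2" where H: "\<forall>i j. surf_holomorphic_on \<A> U (\<lambda>x. H x $ i $ j)"
      "\<forall>x\<in>U. \<forall>w. r x (w $ 1) = t x (H x *v w)" by (elim exE conjE)
    have Hh: "(\<lambda>z. H (p z) $ i $ j) holomorphic_on p -` U" for i j
      using surf_holomorphic_iff[OF oU, of "\<lambda>x. H x $ i $ j"] H(1) by simp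
    show ?thesis
    proof (intro exI[of _ U] exI[of _ "\<lambda>z. \<chi> i. (G z ** H (p z)) $ i $ 1"] conjI allI ballI oU)
      show "z0 \<in> p -` U" using U(2) by simp
      show "(\<lambda>z. (\<chi> i. (G z ** H (p z)) $ i $ 1) $ i) holomorphic_on p -` U" for i
        using holomorphic_on_matrix_mult[OF G(1) Hh, of i 1] by simp
      fix z a assume "z \<in> p -` U"
      then have z: "p z \<in> U" by simp
      have "r (p z) a = t (p z) (H (p z) *v (\<chi> i. a))"
        using H(2) z by (metis (no_types, lifting) vec_lambda_beta)
      also have "\<dots> = F z ((G z ** H (p z)) *v (\<chi> i. a))"
        unfolding G(2)[OF z] by (simp add: matrix_vector_mul_assoc)
      also have "(G z ** H (p z)) *v (\<chi> i. a) = a *s (\<chi> i. (G z ** H (p z)) $ i $ 1)"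
        by (simp add: vec_eq_iff matrix_vector_mult_def mult.commute)
      finally show "r (p z) a = F z (a *s (\<chi> i. (G z ** H (p z)) $ i $ 1))" .
    qed
  qed
  define c where "c z = inv_into UNIV (F z) (r (p z) 1)" for z
  have cC: "c z = C" if "r (p z) 1 = F z (1 *s C)" for z C
    unfolding c_def that by (simp add: inv_into_f_f[OF unipotent_frameD(2)[OF uf] UNIV_I])
  show thesis
  proof (rule that[of c])
    show "r (p z) a = F z (a *s c z)" for z a
    proof -
      obtain U C where C: "z \<in> p -` U" "\<forall>z\<in>p -` U. \<forall>a. r (p z) a = F z (a *s C z)" using loc[of z] by (elim exE conjE)
      have "c z = C z" by (rule cC) (use C in blast)
      then show ?thesis using C by simp
    qed
    show "(\<lambda>z. c z $ i) holomorphic_on UNIV" for i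
    proof (rule holomorphic_on_local)
      fix z :: complex
      obtain U C where C: "open U" "z \<in> p -` U" "\<forall>i. (\<lambda>z. C z $ i) holomorphic_on p -` U"
        "\<forall>z\<in>p -` U. \<forall>a. r (p z) a = F z (a *s C z)" using loc[of z] by (elim exE conjE)
      have "c y = C y" if "y \<in> p -` U" for y by (rule cC) (use C that in blast)
      then have "(\<lambda>z. c z $ i) holomorphic_on p -` U"
        using holomorphic_transform[of "\<lambda>z. C z $ i" "p -` U" "\<lambda>z. c z $ i"] C(3) by simp
      then show "\<exists>T. open T \<and> z \<in> T \<and> (\<lambda>z. c z $ i) holomorphic_on T"
        using open_vimage_p[OF C(1)] C(2) by blast
    qed
  qed
qed

text \<open>A splitting would give an entire function with the additive periods \<open>m * cnj u\<close>, \<open>m * cnj v\<close>;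
  its derivative is periodic, so it is affine, and \<open>u\<close>, \<open>v\<close> would be linearly dependent.\<close>

lemma unipotent_splits_iff:
  assumes uf: "unipotent_frame E F m" and \<pi>: "\<And>z w. \<pi> (p z) (F z w) = w $ 2"
  shows "extension_splits \<A> E \<pi> \<longleftrightarrow> m = 0"
proof
  assume "m = 0"
  \<comment> \<open>For m = 0 the second basis vector of the frame is invariant under deck
    transformations and defines the splitting.\<close>
  define r where "r x a = (let z = SOME z. p z = x in F z (vec2 0 a))" for x a
  have r: "r (p z) a = F z (a *s vec2 0 1)" for z a
  proof -
    define y where "y = (SOME y. p y = p z)"
    have "p y = p z" unfolding y_def by (rule someI[of _ z]) simp
    then have "F y (vec2 0 a) = F z (vec2 0 a)"
      using unipotent_frameD(3)[OF uf, of z y "vec2 0 a"] \<open>m = 0\<close> by simp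
    moreover have "a *s vec2 0 1 = vec2 0 a" by (simp add: vec_eq_iff forall_2)
    ultimately show ?thesis unfolding r_def Let_def y_def by simp
  qed
  have "bundle_hom \<A> trivial_line E r"
    by (rule bundle_hom_from_trivial[OF uf _ _ r]) (simp_all add: \<open>m = 0\<close> holomorphic_on_const)
  moreover have "\<pi> x (r x a) = a" for x a
  proof -
    obtain z where "p z = x" by (rule surj_obtain)
    then show ?thesis using r[of z a] \<pi>[of z] by auto
  qed
  ultimately show "extension_splits \<A> E \<pi>" unfolding extension_splits_def by blast
next
  assume "extension_splits \<A> E \<pi>"
  then obtain r where r: "bundle_hom \<A> trivial_line E r" "\<And>x a. \<pi> x (r x a) = a"
    unfolding extension_splits_def by blast
  obtain c where c: "\<And>i. (\<lambda>z. c z $ i) holomorphic_on UNIV" "\<And>z a. r (p z) a = F z (a *s c z)"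
    by (rule bundle_hom_from_trivialD[OF uf r(1)]) (rule that)
  have c2: "c z $ 2 = 1" for z using r(2)[of "p z" 1] unfolding c(2) \<pi> by simp
  have ck: "c z' $ 1 = c z $ 1 + m * cnj (z' - z)" if "p z = p z'" for z z'
  proof -
    have "F z' (c z') = F z (c z)" using c(2)[of z 1] c(2)[of z' 1] that by simp
    then have "c z = vec2 (c z' $ 1 - m * cnj (z' - z) * c z' $ 2) (c z' $ 2)"
      unfolding unipotent_frameD(3)[OF uf that] using injD[OF unipotent_frameD(2)[OF uf]] by metis
    then have "c z $ 1 = c z' $ 1 - m * cnj (z' - z) * c z' $ 2" by (metis vector_2(1))
    then show ?thesis unfolding c2 by simp
  qed
  define e where "e z = c z $ 1" for z
  have e: "e holomorphic_on UNIV" using c(1) unfolding e_def[abs_def] .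
  have per: "e (z + u) = e z + m * cnj u" "e (z + v) = e z + m * cnj v" for z
    using ck[of z "z + u"] ck[of z "z + v"] per_u per_v by (simp_all add: e_def)
  have de: "(e has_field_derivative deriv e z) (at z)" for z
    using e holomorphic_derivI[OF e open_UNIV UNIV_I] by simp
  have dper: "deriv e (z + l) = deriv e z" if "\<And>z. e (z + l) = e z + k" for z l k
  proof -
    have "((\<lambda>z. e (z + l)) has_field_derivative deriv e (z + l)) (at z)"
      using DERIV_shift[of e "deriv e (z + l)" z l] de by simp
    then have "((\<lambda>z. e z + k) has_field_derivative deriv e (z + l)) (at z)" unfolding that .
    moreover have "((\<lambda>z. e z + k) has_field_derivative deriv e z) (at z)"
      using DERIV_add[OF de DERIV_const] by simp
    ultimately show ?thesis by (rule DERIV_unique)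
  qed
  have "periodic (deriv e)" unfolding periodic_def using dper[OF per(1)] dper[OF per(2)] by simp
  moreover have dh: "deriv e holomorphic_on UNIV" by (rule holomorphic_deriv[OF e open_UNIV])
  ultimately obtain B where "\<And>z. cmod (deriv e z) \<le> B"
    using periodic_bounded[OF _ holomorphic_on_imp_continuous_on] by metis
  then have "bounded (range (deriv e))" by (intro boundedI[of _ B]) blast
  then obtain a where a: "\<And>z. deriv e z = a" using Liouville_theorem[OF dh] unfolding constant_on_def by blast
  have "((\<lambda>z. e z - a * z) has_field_derivative 0) (at z)" for z
    using DERIV_diff[OF de[of z] DERIV_cmult_Id[of a z]] a by simp
  then have "\<exists>k. \<forall>z\<in>UNIV. e z - a * z = k"
    by (intro has_field_derivative_zero_constant) auto
  then obtain k where "\<And>z. e z - a * z = k" by blast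
  then have ee: "e z = a * z + k" for z by (simp add: algebra_simps eq_diff_eq)
  have "a * u = m * cnj u" "a * v = m * cnj v" using per[of 0] unfolding ee by simp_all
  \<comment> \<open>Multiplying the first equation by \<open>v\<close> and the second by
    \<open>u\<close> gives the same left side a u v.\<close>
  then have "m * (cnj u * v) = m * (u * cnj v)" by (metis mult.assoc mult.commute)
  moreover have "cnj u * v \<noteq> u * cnj v"
  proof
    assume "cnj u * v = u * cnj v"
    then have "cnj (u * cnj v) = u * cnj v" by simp
    then have "Im (u * cnj v) = 0" by (metis complex_cnj_cancel_iff cnj.simps(2) eq_neg_iff_add_eq_0 add_self_div_2 div_0 neg_equal_zero)
    then show False using indep by simp
  qed
  ultimately show "m = 0" by simp
qed

text \<open>The first basis vector and the second coordinate are unaffected by the unipotent deck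
  action, so they descend to an inclusion and a projection.\<close>

lemma unipotent_nontrivial:
  assumes uf: "unipotent_frame E F m" and m: "m \<noteq> 0"
  shows "nontrivial_extension \<A> E"
proof -
  define zh where "zh x = (SOME z. p z = x)" for x
  have zh: "p (zh x) = x" for x unfolding zh_def using surj_obtain[of x] by (metis (mono_tags) someI_ex)
  define \<iota> where "\<iota> x a = F (zh x) (vec2 a 0)" for x a
  define \<pi> where "\<pi> x e = inv_into UNIV (F (zh x)) e $ 2" for x e
  have i1: "\<iota> (p z) a = F z (vec2 a 0)" for z a
    unfolding \<iota>_def unipotent_frameD(3)[OF uf zh[symmetric], of z "vec2 a 0"] by simp
  have p1: "\<pi> (p z) (F z w) = w $ 2" for z w
    unfolding \<pi>_def unipotent_frameD(3)[OF uf zh, of z w] inv_into_f_f[OF unipotent_frameD(2)[OF uf] UNIV_I] by simp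
  have ih: "bundle_hom \<A> trivial_line E \<iota>"
  proof (rule bundle_hom_from_trivial[OF uf, of "\<lambda>_. vec2 1 0"])
    show "\<iota> (p z) a = F z (a *s vec2 1 0)" for z a
      unfolding i1 by (rule arg_cong[of _ _ "F z"]) (simp add: vec_eq_iff forall_2)
  qed simp_all
  have ph: "bundle_hom \<A> E trivial_line \<pi>"
    unfolding bundle_hom_def
  proof safe
    fix U0 :: "'x set" and t0 :: "'x \<Rightarrow> complex^1 \<Rightarrow> complex" and U t
    assume t0: "(U0, t0) \<in> trivial_line" and e: "(U, t) \<in> E"
    have t0: "U0 = UNIV" "t0 = (\<lambda>x w. w $ 1)" using t0 by (simp_all add: trivial_line_def)
    obtain G G' where G: "frame_change U t F G G'" by (rule unipotent_frame_transition[OF uf e])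
    note G = frame_changeD[OF G]
    define L :: "complex^2^1" where "L = (\<chi> i j. if j = 2 then 1 else 0)"
    have L: "(L *v w) $ 1 = w $ 2" for w by (simp add: L_def matrix_vector_mult_def sum_2)
    let ?G = "\<lambda>z. L ** G z"
    have eq: "\<pi> (p z) (t (p z) w) = (?G z *v w) $ 1" if "p z \<in> U" for z w
      unfolding G(2)[OF that] p1 by (simp add: matrix_vector_mul_assoc[symmetric] L)
    obtain H :: "'x \<Rightarrow> complex^2^1" where H: "\<And>i j. surf_holomorphic_on \<A> U (\<lambda>x. H x $ i $ j)"
      "\<And>z. p z \<in> U \<Longrightarrow> H (p z) = ?G z"
    proof (rule descend_matrix[of U ?G])
      show "open U" by (rule unipotent_frameD(4)[OF uf e])
      show "(\<lambda>z. ?G z $ i $ j) holomorphic_on p -` U" for i j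
        by (rule holomorphic_on_matrix_mult[OF holomorphic_on_const G(1)])
      show "?G z = ?G z'" if z: "p z = p z'" "p z \<in> U" for z z'
      proof -
        have "?G z *v w = ?G z' *v w" for w
          unfolding vec_eq_iff forall_1 using eq[of z w] eq[of z' w] z by simp
        then show ?thesis by (simp add: matrix_eq)
      qed
    qed (rule that)
    show "\<exists>H :: 'x \<Rightarrow> complex^2^1. (\<forall>i j. surf_holomorphic_on \<A> (U \<inter> U0) (\<lambda>x. H x $ i $ j)) \<and>
       (\<forall>x\<in>U \<inter> U0. \<forall>w. \<pi> x (t x w) = t0 x (H x *v w))"
      unfolding t0 Int_UNIV_right
    proof (intro exI[of _ H] conjI allI ballI H(1))
      fix x w assume x: "x \<in> U"
      obtain z where z: "p z = x" by (rule surj_obtain)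
      show "\<pi> x (t x w) = (H x *v w) $ 1" using eq[of z w] H(2)[of z] x z by simp
    qed
  qed
  have ex: "inj (\<iota> x) \<and> range (\<iota> x) = {e \<in> fibre E x. \<pi> x e = 0} \<and> \<pi> x ` fibre E x = UNIV" for x
  proof -
    obtain z where z: "p z = x" by (rule surj_obtain)
    note inj = injD[OF unipotent_frameD(2)[OF uf, of z]]
    show ?thesis
      unfolding z[symmetric] unipotent_fibre[OF uf]
    proof (intro conjI)
      show "inj (\<iota> (p z))"
      proof (rule injI)
        fix a b assume "\<iota> (p z) a = \<iota> (p z) b"
        then have "vec2 a 0 = vec2 b 0" unfolding i1 by (rule inj)
        then show "a = b" by (simp add: vec2_eq_iff)
      qed
      show "range (\<iota> (p z)) = {e \<in> range (F z). \<pi> (p z) e = 0}"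
      proof (rule equalityI; rule subsetI)
        fix e assume "e \<in> {e \<in> range (F z). \<pi> (p z) e = 0}"
        then obtain w where w: "e = F z w" "w $ 2 = 0" using p1 by auto
        have "e = \<iota> (p z) (w $ 1)" unfolding i1 w(1) using w(2) vec2_eta[of w] by simp
        then show "e \<in> range (\<iota> (p z))" by blast
      qed (auto simp: i1 p1)
      show "\<pi> (p z) ` range (F z) = UNIV"
      proof (rule equalityI[OF subset_UNIV]; rule subsetI)
        fix a
        have "a = \<pi> (p z) (F z (vec2 0 a))" unfolding p1 by simp
        then show "a \<in> \<pi> (p z) ` range (F z)" by blast
      qed
    qed
  qed
  have "extension_of_trivial \<A> E \<iota> \<pi>"
    unfolding extension_of_trivial_def using unipotent_frame_bundle[OF uf] ih ph ex by blast
  moreover have "\<not> extension_splits \<A> E \<pi>" using unipotent_splits_iff[of E F m \<pi>, OF uf p1] m by blast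
  ultimately show ?thesis unfolding nontrivial_extension_def by blast
qed

end

section \<open>From an extension to its normal form\<close>

context torus_cover
begin

text \<open>Local splittings: the inclusion becomes the first axis and the projection the second
  coordinate, so two of these trivialisations differ by a shear.\<close>

definition adapted_triv ::
  "('x, 2, 'v) vector_bundle \<Rightarrow> ('x \<Rightarrow> complex \<Rightarrow> 'v) \<Rightarrow> ('x \<Rightarrow> 'v \<Rightarrow> complex) \<Rightarrow> 'x set \<Rightarrow> ('x \<Rightarrow> complex^2 \<Rightarrow> 'v) \<Rightarrow> bool" where
  "adapted_triv E \<iota> \<pi> V \<tau> \<longleftrightarrow> open V \<and>
     (\<forall>x\<in>V. inj (\<tau> x) \<and> (\<forall>a. \<iota> x a = \<tau> x (vec2 a 0)) \<and> (\<forall>w. \<pi> x (\<tau> x w) = w $ 2)) \<and>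
     (\<forall>(U, t)\<in>E. \<exists>G :: 'x \<Rightarrow> complex^2^2. (\<forall>i j. (\<lambda>z. G (p z) $ i $ j) holomorphic_on p -` (U \<inter> V)) \<and>
        (\<forall>x\<in>U \<inter> V. inj ((*v) (G x)) \<and> (\<forall>w. t x w = \<tau> x (G x *v w))))"

lemma adapted_trivD:
  assumes "adapted_triv E \<iota> \<pi> V \<tau>"
  shows "open V" "x \<in> V \<Longrightarrow> inj (\<tau> x)" "x \<in> V \<Longrightarrow> \<iota> x a = \<tau> x (vec2 a 0)" "x \<in> V \<Longrightarrow> \<pi> x (\<tau> x w) = w $ 2"
  using assms unfolding adapted_triv_def by blast+

lemma adapted_triv_transition:
  assumes "adapted_triv E \<iota> \<pi> V \<tau>" "(U, t) \<in> E"
  obtains G :: "'x \<Rightarrow> complex^2^2" where "\<And>i j. (\<lambda>z. G (p z) $ i $ j) holomorphic_on p -` (U \<inter> V)"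
    "\<And>x. x \<in> U \<Longrightarrow> x \<in> V \<Longrightarrow> inj ((*v) (G x))" "\<And>x w. x \<in> U \<Longrightarrow> x \<in> V \<Longrightarrow> t x w = \<tau> x (G x *v w)"
proof -
  have "\<forall>(U, t)\<in>E. \<exists>G :: 'x \<Rightarrow> complex^2^2. (\<forall>i j. (\<lambda>z. G (p z) $ i $ j) holomorphic_on p -` (U \<inter> V)) \<and>
        (\<forall>x\<in>U \<inter> V. inj ((*v) (G x)) \<and> (\<forall>w. t x w = \<tau> x (G x *v w)))"
    using assms(1) unfolding adapted_triv_def by (elim conjE) assumption
  from bspec[OF this assms(2), unfolded split_conv]
  obtain G :: "'x \<Rightarrow> complex^2^2" where G: "\<forall>i j. (\<lambda>z. G (p z) $ i $ j) holomorphic_on p -` (U \<inter> V)"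
    "\<forall>x\<in>U \<inter> V. inj ((*v) (G x)) \<and> (\<forall>w. t x w = \<tau> x (G x *v w))" by (elim exE conjE)
  show thesis
  proof (rule that[of G])
    show "(\<lambda>z. G (p z) $ i $ j) holomorphic_on p -` (U \<inter> V)" for i j using G(1) by blast
    show "inj ((*v) (G x))" if "x \<in> U" "x \<in> V" for x using G(2) that by blast
    show "t x w = \<tau> x (G x *v w)" if "x \<in> U" "x \<in> V" for x w using G(2) that by blast
  qed
qed

text \<open>The image of 1 under the inclusion is the first column. Surjectivity gives the
  projection a nonzero coefficient, at position \<open>k\<close> say, and dividing the k-th basis
  vector by it gives a second column that projects to 1.\<close>

lemma adapted_triv_exists:
  assumes ext: "extension_of_trivial \<A> E \<iota> \<pi>"
  obtains V \<tau> where "x0 \<in> V" "adapted_triv E \<iota> \<pi> V \<tau>"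
proof -
  have hb: "holomorphic_bundle \<A> E" and hi: "bundle_hom \<A> trivial_line E \<iota>" and hp: "bundle_hom \<A> E trivial_line \<pi>"
    using ext unfolding extension_of_trivial_def by blast+
  have ex: "inj (\<iota> x)" "range (\<iota> x) = {e \<in> fibre E x. \<pi> x e = 0}" "\<pi> x ` fibre E x = UNIV" for x
    using ext unfolding extension_of_trivial_def by blast+
  obtain U t where U: "(U, t) \<in> E" "x0 \<in> U" using holomorphic_bundleD(1)[OF hb] by fast
  note oU = holomorphic_bundleD(2)[OF hb U(1)]
  have ti: "inj (t x)" if "x \<in> U" for x by (rule holomorphic_bundleD(3)[OF hb U(1) that])
  have tl: "(UNIV, \<lambda>x w. w $ 1) \<in> (trivial_line :: ('x, 1, complex) vector_bundle)" by (simp add: trivial_line_def)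
  from bspec[OF bspec[OF hi[unfolded bundle_hom_def] tl, unfolded split_conv] U(1), unfolded split_conv Int_UNIV_left]
  obtain N :: "'x \<Rightarrow> complex^1^2" where N: "\<forall>i j. surf_holomorphic_on \<A> U (\<lambda>x. N x $ i $ j)"
    "\<forall>x\<in>U. \<forall>w. \<iota> x (w $ 1) = t x (N x *v w)" by (elim exE conjE)
  from bspec[OF bspec[OF hp[unfolded bundle_hom_def] U(1), unfolded split_conv] tl, unfolded split_conv Int_UNIV_right]
  obtain Q :: "'x \<Rightarrow> complex^2^1" where Q: "\<forall>i j. surf_holomorphic_on \<A> U (\<lambda>x. Q x $ i $ j)"
    "\<forall>x\<in>U. \<forall>w. \<pi> x (t x w) = (Q x *v w) $ 1" by (elim exE conjE)
  have Nh: "(\<lambda>z. N (p z) $ i $ j) holomorphic_on p -` U" for i j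
    using surf_holomorphic_iff[OF oU, of "\<lambda>x. N x $ i $ j"] N(1) by simp
  have Qh: "(\<lambda>z. Q (p z) $ i $ j) holomorphic_on p -` U" for i j
    using surf_holomorphic_iff[OF oU, of "\<lambda>x. Q x $ i $ j"] Q(1) by simp
  have i: "\<iota> x a = t x (vec2 (a * N x $ 1 $ 1) (a * N x $ 2 $ 1))" if "x \<in> U" for x a
  proof -
    have "\<iota> x a = t x (N x *v (\<chi> i. a))" using N(2) that by (metis (no_types, lifting) vec_lambda_beta)
    also have "N x *v (\<chi> i. a) = vec2 (a * N x $ 1 $ 1) (a * N x $ 2 $ 1)"
      by (simp add: vec_eq_iff forall_2 matrix_vector_mult_def mult.commute)
    finally show ?thesis .
  qed
  have q: "\<pi> x (t x w) = Q x $ 1 $ 1 * w $ 1 + Q x $ 1 $ 2 * w $ 2" if "x \<in> U" for x w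
    using Q(2) that by (simp add: matrix_vector_mult_def sum_2)
  have Qn: "Q x0 $ 1 $ 1 \<noteq> 0 \<or> Q x0 $ 1 $ 2 \<noteq> 0"
  proof (rule ccontr)
    assume n: "\<not> ?thesis"
    obtain e where e: "e \<in> fibre E x0" "\<pi> x0 e = 1" using ex(3)[of x0] by (metis UNIV_I imageE)
    then obtain w where "e = t x0 w" using fibre_eq[OF hb U] by blast
    then show False using e(2) q[OF U(2), of w] n by simp
  qed
  then obtain k where k: "Q x0 $ 1 $ k \<noteq> 0" by blast
  define V where "V = {x \<in> U. Q x $ 1 $ k \<noteq> 0}"
  have V: "x \<in> U" "Q x $ 1 $ k \<noteq> 0" if "x \<in> V" for x using that by (auto simp: V_def)
  have oV: "open V"
  proof -
    have eq: "V = p ` ((p -` U) \<inter> (\<lambda>z. Q (p z) $ 1 $ k) -` (- {0}))"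
    proof (rule equalityI; rule subsetI)
      fix y assume y: "y \<in> V"
      obtain z where z: "p z = y" by (rule surj_obtain)
      show "y \<in> p ` ((p -` U) \<inter> (\<lambda>z. Q (p z) $ 1 $ k) -` (- {0}))"
        by (rule image_eqI[of _ _ z]) (use y z in \<open>simp_all add: V_def\<close>)
    qed (auto simp: V_def)
    have "open ((p -` U) \<inter> (\<lambda>z. Q (p z) $ 1 $ k) -` (- {0}))"
      by (rule continuous_open_preimage[OF holomorphic_on_imp_continuous_on[OF Qh] open_vimage_p[OF oU]]) auto
    then show ?thesis unfolding eq by (rule param_open_map[OF param_p _ subset_UNIV])
  qed
  define M :: "'x \<Rightarrow> complex^2^2" where
    "M x = (\<chi> i j. if j = 1 then N x $ i $ 1 else if i = k then inverse (Q x $ 1 $ k) else 0)" for x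
  have Mh: "(\<lambda>z. M (p z) $ i $ j) holomorphic_on p -` V" for i j
  proof -
    have sub: "p -` V \<subseteq> p -` U" using V(1) by blast
    have "(\<lambda>z. inverse (Q (p z) $ 1 $ k)) holomorphic_on p -` V"
      by (rule holomorphic_on_inverse[OF holomorphic_on_subset[OF Qh sub]]) (use V(2) in simp)
    moreover have "(\<lambda>z. N (p z) $ i $ 1) holomorphic_on p -` V" by (rule holomorphic_on_subset[OF Nh sub])
    ultimately show ?thesis unfolding M_def by (cases "j = 1"; cases "i = k") simp_all
  qed
  define \<tau> where "\<tau> x w = t x (M x *v w)" for x w
  have tau_i: "\<iota> x a = \<tau> x (vec2 a 0)" if "x \<in> V" for x a
    unfolding \<tau>_def i[OF V(1)[OF that]] by (rule arg_cong[of _ _ "t x"]) (simp add: matrix_vec2 vec2_eq_iff M_def mult.commute)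
  have QN: "Q x $ 1 $ 1 * N x $ 1 $ 1 + Q x $ 1 $ 2 * N x $ 2 $ 1 = 0" if x: "x \<in> U" for x
  proof -
    have "\<pi> x (\<iota> x 1) = 0" using ex(2)[of x] by blast
    then show ?thesis unfolding i[OF x] q[OF x] by simp
  qed
  have k2: "k = 1 \<or> k = 2" using exhaust_2 by blast
  have tau_p: "\<pi> x (\<tau> x w) = w $ 2" if x: "x \<in> V" for x w
  proof -
    have 1: "Q x $ 1 $ 1 * M x $ 1 $ 1 + Q x $ 1 $ 2 * M x $ 2 $ 1 = 0" using QN[OF V(1)[OF x]] by (simp add: M_def)
    have 2: "Q x $ 1 $ 1 * M x $ 1 $ 2 + Q x $ 1 $ 2 * M x $ 2 $ 2 = 1"
      using k2 V(2)[OF x] by (elim disjE) (simp_all add: M_def)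
    have "Q x $ 1 $ 1 * (M x $ 1 $ 1 * w $ 1 + M x $ 1 $ 2 * w $ 2) + Q x $ 1 $ 2 * (M x $ 2 $ 1 * w $ 1 + M x $ 2 $ 2 * w $ 2)
      = (Q x $ 1 $ 1 * M x $ 1 $ 1 + Q x $ 1 $ 2 * M x $ 2 $ 1) * w $ 1 + (Q x $ 1 $ 1 * M x $ 1 $ 2 + Q x $ 1 $ 2 * M x $ 2 $ 2) * w $ 2"
      by (simp only: distrib_left distrib_right mult.assoc add_ac)
    then have "Q x $ 1 $ 1 * (M x $ 1 $ 1 * w $ 1 + M x $ 1 $ 2 * w $ 2) + Q x $ 1 $ 2 * (M x $ 2 $ 1 * w $ 1 + M x $ 2 $ 2 * w $ 2) = w $ 2"
      unfolding 1 2 by simp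
    then show ?thesis unfolding \<tau>_def q[OF V(1)[OF x]] matrix_vec2 by simp
  qed
  have Mi: "inj ((*v) (M x))" if x: "x \<in> V" for x
  proof -
    have "w = 0" if w: "M x *v w = 0" for w
    proof -
      have "w $ 2 = \<pi> x (\<tau> x w)" using tau_p[OF x] by simp
      also have "\<dots> = \<pi> x (\<tau> x 0)" unfolding \<tau>_def w by simp
      finally have w2: "w $ 2 = 0" unfolding tau_p[OF x] by simp
      have "\<iota> x (w $ 1) = \<tau> x w" unfolding tau_i[OF x] using w2 vec2_eta[of w] by simp
      also have "\<dots> = \<tau> x (vec2 0 0)" unfolding \<tau>_def w by (rule arg_cong[of _ _ "t x"]) (simp add: matrix_vec2 vec_eq_iff forall_2)
      also have "\<dots> = \<iota> x 0" unfolding tau_i[OF x] by simp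
      finally have "w $ 1 = 0" by (rule injD[OF ex(1)])
      then show ?thesis using w2 by (simp add: vec_eq_iff forall_2)
    qed
    then show ?thesis by (metis (no_types, lifting) injI matrix_vector_mult_diff_distrib right_minus_eq)
  qed
  have taui: "inj (\<tau> x)" if x: "x \<in> V" for x
    unfolding \<tau>_def by (rule injI) (use injD[OF ti[OF V(1)[OF x]]] injD[OF Mi[OF x]] in blast)
  have det: "M x $ 1 $ 1 * M x $ 2 $ 2 - M x $ 1 $ 2 * M x $ 2 $ 1 \<noteq> 0" if "x \<in> V" for x
    by (rule inj_matrix2[OF Mi[OF that]])
  have tr: "\<exists>G :: 'x \<Rightarrow> complex^2^2. (\<forall>i j. (\<lambda>z. G (p z) $ i $ j) holomorphic_on p -` (U' \<inter> V)) \<and>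
        (\<forall>x\<in>U' \<inter> V. inj ((*v) (G x)) \<and> (\<forall>w. t' x w = \<tau> x (G x *v w)))" if e': "(U', t') \<in> E" for U' t'
  proof -
    obtain G where G: "\<And>i j. surf_holomorphic_on \<A> (U \<inter> U') (\<lambda>x. G x $ i $ j)"
      "\<And>x w. x \<in> U \<Longrightarrow> x \<in> U' \<Longrightarrow> t' x w = t x (G x *v w)"
      by (rule holomorphic_bundle_transition[OF hb U(1) e']) (rule that)
    have oI: "open (U \<inter> U')" using oU holomorphic_bundleD(2)[OF hb e'] by (rule open_Int)
    have Gh: "(\<lambda>z. G (p z) $ i $ j) holomorphic_on p -` (U \<inter> U')" for i j
      using surf_holomorphic_iff[OF oI, of "\<lambda>x. G x $ i $ j"] G(1) by simp
    have sub: "p -` (U' \<inter> V) \<subseteq> p -` (U \<inter> U')" "p -` (U' \<inter> V) \<subseteq> p -` V" using V(1) by blast+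
    have eq: "t' x w = \<tau> x ((inv2 (M x) ** G x) *v w)" if "x \<in> U' \<inter> V" for x w
    proof -
      have x: "x \<in> V" "x \<in> U'" "x \<in> U" using that V(1) by auto
      have "\<tau> x ((inv2 (M x) ** G x) *v w) = t x (M x *v (inv2 (M x) *v (G x *v w)))"
        unfolding \<tau>_def by (simp add: matrix_vector_mul_assoc)
      then show ?thesis unfolding inv2_right[OF det[OF x(1)]] G(2)[OF x(3,2)] by simp
    qed
    show ?thesis
    proof (intro exI[of _ "\<lambda>x. inv2 (M x) ** G x"] conjI allI ballI)
      show "(\<lambda>z. (inv2 (M (p z)) ** G (p z)) $ i $ j) holomorphic_on p -` (U' \<inter> V)" for i j
      proof (rule holomorphic_on_matrix_mult)
        show "(\<lambda>z. inv2 (M (p z)) $ i $ j) holomorphic_on p -` (U' \<inter> V)" for i j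
          by (rule holomorphic_on_inv2[OF holomorphic_on_subset[OF Mh sub(2)]]) (use det in simp)
        show "(\<lambda>z. G (p z) $ i $ j) holomorphic_on p -` (U' \<inter> V)" for i j
          by (rule holomorphic_on_subset[OF Gh sub(1)])
      qed
      fix x assume x: "x \<in> U' \<inter> V"
      show "t' x w = \<tau> x ((inv2 (M x) ** G x) *v w)" for w by (rule eq[OF x])
      have "inj (t' x)" by (rule holomorphic_bundleD(3)[OF hb e']) (use x in blast)
      then show "inj ((*v) (inv2 (M x) ** G x))"
        using eq[OF x] by (metis (no_types, lifting) injD injI)
    qed
  qed
  show thesis
  proof (rule that[of V \<tau>])
    show "x0 \<in> V" using U(2) k by (simp add: V_def)
    show "adapted_triv E \<iota> \<pi> V \<tau>"
      unfolding adapted_triv_def using oV taui tau_i tau_p tr by blast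
  qed
qed

text \<open>Both trivialisations respect inclusion and projection, so the transition matrix fixes
  the first axis and the second coordinate; its one free entry \<open>h\<close> is the cocycle of
  the extension.\<close>

lemma adapted_triv_change:
  fixes \<tau> \<tau>' :: "'x \<Rightarrow> complex^2 \<Rightarrow> 'v"
  assumes hb: "holomorphic_bundle \<A> E" and a: "adapted_triv E \<iota> \<pi> V \<tau>" and a': "adapted_triv E \<iota> \<pi> V' \<tau>'"
  defines "h \<equiv> \<lambda>x. inv_into UNIV (\<tau>' x) (\<tau> x (vec2 0 1)) $ 1"
  shows "(\<lambda>z. h (p z)) holomorphic_on p -` (V \<inter> V')"
    "\<And>x w. x \<in> V \<Longrightarrow> x \<in> V' \<Longrightarrow> \<tau> x w = \<tau>' x (vec2 (w $ 1 + h x * w $ 2) (w $ 2))"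
proof -
  have loc: "\<exists>U K. open U \<and> x0 \<in> U \<and> (\<lambda>z. K (p z)) holomorphic_on p -` (U \<inter> (V \<inter> V')) \<and>
    (\<forall>x\<in>U \<inter> (V \<inter> V'). h x = K x \<and> (\<forall>w. \<tau> x w = \<tau>' x (vec2 (w $ 1 + K x * w $ 2) (w $ 2))))" for x0
  proof -
    obtain U t where U: "(U, t) \<in> E" "x0 \<in> U" using holomorphic_bundleD(1)[OF hb] by fast
    note oU = holomorphic_bundleD(2)[OF hb U(1)]
    obtain G :: "'x \<Rightarrow> complex^2^2" where G: "\<And>i j. (\<lambda>z. G (p z) $ i $ j) holomorphic_on p -` (U \<inter> V)"
      "\<And>x. x \<in> U \<Longrightarrow> x \<in> V \<Longrightarrow> inj ((*v) (G x))" "\<And>x w. x \<in> U \<Longrightarrow> x \<in> V \<Longrightarrow> t x w = \<tau> x (G x *v w)"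
      by (rule adapted_triv_transition[OF a U(1)]) (rule that)
    obtain G' :: "'x \<Rightarrow> complex^2^2" where G': "\<And>i j. (\<lambda>z. G' (p z) $ i $ j) holomorphic_on p -` (U \<inter> V')"
      "\<And>x. x \<in> U \<Longrightarrow> x \<in> V' \<Longrightarrow> inj ((*v) (G' x))" "\<And>x w. x \<in> U \<Longrightarrow> x \<in> V' \<Longrightarrow> t x w = \<tau>' x (G' x *v w)"
      by (rule adapted_triv_transition[OF a' U(1)]) (rule that)
    define K where "K x = G' x ** inv2 (G x)" for x
    have Kh: "(\<lambda>z. K (p z) $ i $ j) holomorphic_on p -` (U \<inter> (V \<inter> V'))" for i j
      unfolding K_def
    proof (rule holomorphic_on_matrix_mult)
      show "(\<lambda>z. G' (p z) $ i $ j) holomorphic_on p -` (U \<inter> (V \<inter> V'))" for i j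
        by (rule holomorphic_on_subset[OF G'(1)]) blast
      show "(\<lambda>z. inv2 (G (p z)) $ i $ j) holomorphic_on p -` (U \<inter> (V \<inter> V'))" for i j
      proof (rule holomorphic_on_inv2)
        show "(\<lambda>z. G (p z) $ i $ j) holomorphic_on p -` (U \<inter> (V \<inter> V'))" for i j
          by (rule holomorphic_on_subset[OF G(1)]) blast
        show "G (p z) $ 1 $ 1 * G (p z) $ 2 $ 2 - G (p z) $ 1 $ 2 * G (p z) $ 2 $ 1 \<noteq> 0"
          if "z \<in> p -` (U \<inter> (V \<inter> V'))" for z
          by (rule inj_matrix2[OF G(2)]) (use that in blast)+
      qed
    qed
    have eq: "h x = K x $ 1 $ 2 \<and> (\<forall>w. \<tau> x w = \<tau>' x (vec2 (w $ 1 + K x $ 1 $ 2 * w $ 2) (w $ 2)))" if "x \<in> U \<inter> (V \<inter> V')" for x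
    proof -
      have x: "x \<in> U" "x \<in> V" "x \<in> V'" using that by auto
      have tK: "\<tau> x w = \<tau>' x (K x *v w)" for w
      proof -
        have "\<tau> x w = t x (inv2 (G x) *v w)"
          unfolding G(3)[OF x(1,2)] inv2_right[OF inj_matrix2[OF G(2)[OF x(1,2)]]] ..
        then show ?thesis unfolding G'(3)[OF x(1,3)] K_def by (simp add: matrix_vector_mul_assoc)
      qed
      have "\<tau>' x (vec2 1 0) = \<tau>' x (K x *v vec2 1 0)"
        using adapted_trivD(3)[OF a x(2), of 1] adapted_trivD(3)[OF a' x(3), of 1] tK[of "vec2 1 0"] by simp
      then have "vec2 1 0 = K x *v vec2 1 0" by (rule injD[OF adapted_trivD(2)[OF a' x(3)]])
      then have K1: "K x $ 1 $ 1 = 1" "K x $ 2 $ 1 = 0" unfolding matrix_vec2 vec2_eq_iff by simp_all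
      have K2: "K x $ 2 $ 2 = 1"
        using adapted_trivD(4)[OF a x(2), of "vec2 0 1"] adapted_trivD(4)[OF a' x(3), of "K x *v vec2 0 1"]
        unfolding tK[symmetric] by (simp add: matrix_vec2)
      have Kw: "K x *v w = vec2 (w $ 1 + K x $ 1 $ 2 * w $ 2) (w $ 2)" for w
        unfolding matrix_vec2 K1 K2 by simp
      have "h x = K x $ 1 $ 2"
        unfolding h_def tK Kw inv_into_f_f[OF adapted_trivD(2)[OF a' x(3)] UNIV_I] by simp
      then show ?thesis unfolding tK Kw by simp
    qed
    show ?thesis by (intro exI[of _ U] exI[of _ "\<lambda>x. K x $ 1 $ 2"] conjI oU U(2) Kh ballI eq)
  qed
  show "(\<lambda>z. h (p z)) holomorphic_on p -` (V \<inter> V')"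
  proof (rule holomorphic_on_local)
    fix z assume z: "z \<in> p -` (V \<inter> V')"
    obtain U K where U: "open U" "p z \<in> U" "(\<lambda>z. K (p z)) holomorphic_on p -` (U \<inter> (V \<inter> V'))"
      "\<forall>x\<in>U \<inter> (V \<inter> V'). h x = K x \<and> (\<forall>w. \<tau> x w = \<tau>' x (vec2 (w $ 1 + K x * w $ 2) (w $ 2)))"
      using loc[of "p z"] by (elim exE conjE)
    have "(\<lambda>z. h (p z)) holomorphic_on p -` (U \<inter> (V \<inter> V'))"
      by (rule holomorphic_transform[OF U(3)]) (use U(4) in simp)
    moreover have "open (p -` (U \<inter> (V \<inter> V')))"
      by (intro open_vimage_p open_Int U(1) adapted_trivD(1)[OF a] adapted_trivD(1)[OF a'])
    ultimately show "\<exists>T. open T \<and> z \<in> T \<and> (\<lambda>z. h (p z)) holomorphic_on T"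
      using z U(2) by (intro exI[of _ "p -` (U \<inter> (V \<inter> V'))"]) simp
  qed
  fix x w assume x: "x \<in> V" "x \<in> V'"
  obtain U K where U: "open U" "x \<in> U" "(\<lambda>z. K (p z)) holomorphic_on p -` (U \<inter> (V \<inter> V'))"
    "\<forall>x\<in>U \<inter> (V \<inter> V'). h x = K x \<and> (\<forall>w. \<tau> x w = \<tau>' x (vec2 (w $ 1 + K x * w $ 2) (w $ 2)))"
    using loc[of x] by (elim exE conjE)
  have hK: "h x = K x \<and> (\<forall>w. \<tau> x w = \<tau>' x (vec2 (w $ 1 + K x * w $ 2) (w $ 2)))"
    using U(4) U(2) x by blast
  then show "\<tau> x w = \<tau>' x (vec2 (w $ 1 + h x * w $ 2) (w $ 2))" by (simp only: simp_thms)
qed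

text \<open>The passage from Cech to Dolbeault. The cocycle \<open>h i j\<close> is split by the
  smooth functions \<open>W j\<close>, their \<open>dbar\<close> derivatives glue to one function
  \<open>g\<close>, and solving for \<open>g\<close> minus its mean makes the corrected functions
  holomorphic. Shearing the trivialisations by these gives one frame over the plane.\<close>

theorem extension_unipotent:
  fixes E :: "('x, 2, 'v) vector_bundle"
  assumes ext: "extension_of_trivial \<A> E \<iota> \<pi>"
  obtains F m where "unipotent_frame E F m" "\<And>z w. \<pi> (p z) (F z w) = w $ 2"
proof -
  have hb: "holomorphic_bundle \<A> E" using ext unfolding extension_of_trivial_def by blast
  \<comment> \<open>The order 10 is counted backwards: a differentiable \<open>f\<close> needs
    \<open>g\<close> of order 2 * 1 + 7 = 9, and \<open>g\<close> is one derivative of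
    \<open>W\<close>.\<close>
  define good where "good x V \<tau> B K \<longleftrightarrow> x \<in> V \<and> adapted_triv E \<iota> \<pi> V \<tau> \<and> (\<forall>y. B y \<ge> (0 :: real)) \<and> B x > 0 \<and> open {y. B y > 0} \<and>
     k_smooth_on 10 UNIV (\<lambda>z. B (p z)) \<and> closed K \<and> K \<subseteq> V \<and> (\<forall>y. y \<notin> K \<longrightarrow> B y = 0)"
    for x V and \<tau> :: "'x \<Rightarrow> complex^2 \<Rightarrow> 'v" and B K
  have ex: "\<exists>V \<tau> B K. good x V \<tau> B K" for x
  proof -
    obtain V and \<tau> :: "'x \<Rightarrow> complex^2 \<Rightarrow> 'v" where V: "x \<in> V" "adapted_triv E \<iota> \<pi> V \<tau>"
      by (rule adapted_triv_exists[OF ext]) (rule that)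
    obtain B :: "'x \<Rightarrow> real" and K where "\<And>y. B y \<ge> 0" "B x > 0" "open {y. B y > 0}" "k_smooth_on 10 UNIV (\<lambda>z. B (p z))"
      "closed K" "K \<subseteq> V" "\<And>y. y \<notin> K \<Longrightarrow> B y = 0"
      by (rule surface_bump[OF adapted_trivD(1)[OF V(2)] V(1)]) (rule that)
    then show ?thesis unfolding good_def using V by blast
  qed
  then obtain V \<tau> B K where good: "\<And>x. good x (V x) (\<tau> x) (B x) (K x)" by metis
  have xV: "x \<in> V x" and adV: "adapted_triv E \<iota> \<pi> (V x) (\<tau> x)" and B0: "B x y \<ge> 0" and Bx: "B x x > 0"
    and oB: "open {y. B x y > 0}" and Bs: "k_smooth_on 10 UNIV (\<lambda>z. B x (p z))" and cK: "closed (K x)"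
    and KV: "K x \<subseteq> V x" and BK: "y \<notin> K x \<Longrightarrow> B x y = 0" for x y
    using good[of x] unfolding good_def by blast+
  note oV = adapted_trivD(1)[OF adV]
  have cov: "UNIV \<subseteq> (\<Union>x\<in>UNIV. {y. B x y > 0})" using Bx by blast
  obtain I where I: "finite I" "UNIV \<subseteq> (\<Union>x\<in>I. {y. B x y > 0})"
    using compactE_image[OF compact_surface oB cov] by metis
  define s where "s y = (\<Sum>i\<in>I. B i y)" for y
  have s0: "s y > 0" for y
  proof -
    obtain i where "i \<in> I" "B i y > 0" using I(2) by blast
    then show ?thesis unfolding s_def by (intro sum_pos2[OF I(1)]) (auto simp: B0)
  qed
  define \<psi> where "\<psi> i y = complex_of_real (B i y / s y)" for i y
  have chi_sum: "(\<Sum>i\<in>I. \<psi> i y) = 1" for y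
    unfolding \<psi>_def of_real_sum[symmetric] sum_divide_distrib[symmetric] s_def[symmetric] using s0[of y] by simp
  have chi_s: "k_smooth_on 10 UNIV (\<lambda>z. \<psi> i (p z))" for i
    unfolding \<psi>_def s_def[abs_def]
    by (rule k_smooth_on_of_real[OF open_UNIV k_smooth_on_divide[OF open_UNIV _ Bs k_smooth_on_sum[OF open_UNIV Bs]]])
       (use s0 in \<open>simp add: s_def less_imp_neq[symmetric]\<close>)
  have chi0: "\<psi> i y = 0" if "y \<notin> K i" for i y using BK[OF that] by (simp add: \<psi>_def)
  define h where "h i j x = inv_into UNIV (\<tau> j x) (\<tau> i x (vec2 0 1)) $ 1" for i j x
  have h_hol: "(\<lambda>z. h i j (p z)) holomorphic_on p -` (V i \<inter> V j)" for i j
    unfolding h_def by (rule adapted_triv_change(1)[OF hb adV adV])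
  have h_eq: "\<tau> i x w = \<tau> j x (vec2 (w $ 1 + h i j x * w $ 2) (w $ 2))" if "x \<in> V i" "x \<in> V j" for i j x w
    unfolding h_def by (rule adapted_triv_change(2)[OF hb adV adV that])
  have coc: "h i k x = h i j x + h j k x" if x: "x \<in> V i" "x \<in> V j" "x \<in> V k" for i j k x
  proof -
    have "\<tau> k x (vec2 (h i k x) 1) = \<tau> i x (vec2 0 1)" unfolding h_eq[OF x(1,3)] by simp
    also have "\<dots> = \<tau> k x (vec2 (h i j x + h j k x) 1)" unfolding h_eq[OF x(1,2)] h_eq[OF x(2,3)] by simp
    finally have "vec2 (h i k x) 1 = vec2 (h i j x + h j k x) 1" by (rule injD[OF adapted_trivD(2)[OF adV x(3)]])
    then show ?thesis by (simp add: vec2_eq_iff)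
  qed
  \<comment> \<open>Outside \<open>V i\<close> the value of \<open>h i j\<close> is meaningless, but
    there the factor \<open>\<psi> i\<close> is 0, since it vanishes off a closed subset of
    \<open>V i\<close>.\<close>
  define W where "W j x = (\<Sum>i\<in>I. \<psi> i x * h i j x)" for j x
  have W_s: "k_smooth_on 10 (p -` V j) (\<lambda>z. W j (p z))" for j
    unfolding W_def
  proof (rule k_smooth_on_sum[OF open_vimage_p[OF oV]])
    fix i
    show "k_smooth_on 10 (p -` V j) (\<lambda>z. \<psi> i (p z) * h i j (p z))"
    proof (rule k_smooth_on_local)
      fix z assume z: "z \<in> p -` V j"
      show "\<exists>T. open T \<and> z \<in> T \<and> k_smooth_on 10 T (\<lambda>z. \<psi> i (p z) * h i j (p z))"
      proof (cases "p z \<in> V i")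
        case True
        let ?T = "p -` (V i \<inter> V j)"
        have oT: "open ?T" by (rule open_vimage_p[OF open_Int[OF oV oV]])
        have "k_smooth_on 10 ?T (\<lambda>z. \<psi> i (p z) * h i j (p z))"
          by (rule k_smooth_on_mult[OF oT k_smooth_on_subset[OF chi_s subset_UNIV] k_smooth_on_holomorphic[OF oT h_hol]])
        then show ?thesis using oT z True by (intro exI[of _ ?T]) simp
      next
        case False
        let ?T = "p -` (- K i)"
        have oT: "open ?T" by (rule open_vimage_p) (simp add: open_Compl cK)
        have "k_smooth_on 10 ?T (\<lambda>z. \<psi> i (p z) * h i j (p z))"
          by (rule k_smooth_on_cong[THEN iffD2, OF oT _ k_smooth_on_const[of _ _ 0]]) (simp add: chi0)
        moreover have "z \<in> ?T" using False KV[of i] by blast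
        ultimately show ?thesis using oT by blast
      qed
    qed
  qed
  have W_eq: "W k x = W j x + h j k x" if x: "x \<in> V j" "x \<in> V k" for j k x
  proof -
    have "\<psi> i x * h i k x = \<psi> i x * h i j x + \<psi> i x * h j k x" for i
    proof (cases "x \<in> V i")
      case True
      then show ?thesis using coc[OF True x] by (simp add: distrib_left)
    next
      case False
      then have "\<psi> i x = 0" using KV[of i] by (intro chi0) blast
      then show ?thesis by simp
    qed
    then have "W k x = W j x + (\<Sum>i\<in>I. \<psi> i x) * h j k x"
      unfolding W_def by (simp add: sum.distrib sum_distrib_right)
    then show ?thesis unfolding chi_sum by simp
  qed
  have W_d: "(\<lambda>z. W j (p z)) differentiable (at z)" if "p z \<in> V j" for j z
  proof -
    have "k_smooth_on (Suc 9) (p -` V j) (\<lambda>z. W j (p z))" using W_s[of j] by (rule k_smooth_on_mono) simp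
    from k_smooth_on_differentiable[OF this] show ?thesis using that by simp
  qed
  \<comment> \<open>The index \<open>p z\<close> merely selects one neighbourhood containing the
    point; the differences of the \<open>W j\<close> are holomorphic, so any other index gives the
    same value.\<close>
  define g where "g z = dbar (\<lambda>y. W (p z) (p y)) z" for z
  have g_eq: "g z = dbar (\<lambda>y. W j (p y)) z" if z: "p z \<in> V j" for j z
  proof -
    let ?T = "p -` (V j \<inter> V (p z))"
    have oT: "open ?T" by (rule open_vimage_p[OF open_Int[OF oV oV]])
    have zT: "z \<in> ?T" using z xV[of "p z"] by simp
    have hd: "(\<lambda>y. h j (p z) (p y)) differentiable (at z)"
      using holomorphic_on_imp_differentiable_at[OF h_hol oT zT] by (rule field_differentiable_imp_differentiable)
    have "g z = dbar (\<lambda>y. W j (p y) + h j (p z) (p y)) z"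
      unfolding g_def by (rule dbar_cong[OF oT zT]) (use W_eq in simp)
    also have "\<dots> = dbar (\<lambda>y. W j (p y)) z"
      unfolding dbar_add[OF W_d[OF z] hd] dbar_holomorphic[OF h_hol oT zT] by simp
    finally show ?thesis .
  qed
  have g_s: "k_smooth_on 9 UNIV g"
  proof (rule k_smooth_on_local)
    fix z :: complex
    let ?T = "p -` V (p z)"
    have oT: "open ?T" by (rule open_vimage_p[OF oV])
    have W9: "k_smooth_on (Suc 9) ?T (\<lambda>y. W (p z) (p y))" using W_s by (rule k_smooth_on_mono) simp
    have "k_smooth_on 9 ?T g"
      by (rule k_smooth_on_cong[THEN iffD2, OF oT _ k_smooth_on_dbar[OF W9 oT]]) (use g_eq in simp)
    then show "\<exists>T. open T \<and> z \<in> T \<and> k_smooth_on 9 T g" using oT xV[of "p z"] by (intro exI[of _ ?T]) simp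
  qed
  have g_deck: "g z = g w" if "p z = p w" for z w
    unfolding g_def that by (rule dbar_deck[OF that])
  have g_per: "periodic g" unfolding periodic_def using g_deck per_u per_v by blast
  obtain f where f: "\<And>z. dbar f z = g z - coeff g 0 0" "periodic f"
    "\<And>k. k_smooth_on (2 * k + 7) UNIV g \<Longrightarrow> k_smooth_on k UNIV f"
    by (rule dbar_solvable[OF k_smooth_on_mono[OF g_s] g_per]) (simp, rule that)
  define m where "m = coeff g 0 0"
  have f1: "k_smooth_on (Suc 0) UNIV f" by (rule f(3)) (use g_s in simp)
  have fd: "f differentiable (at z)" for z by (rule k_smooth_on_differentiable[OF f1 UNIV_I])
  have f_deck: "f z = f w" if "p z = p w" for z w
  proof (rule deck_invariant[OF k_smooth_on_continuous[OF f1] f(2) fd _ that])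
    fix z
    have "g (SOME y. p y = p z) = g z" by (rule g_deck, rule someI[of _ z]) simp
    then show "dbar f z = (\<lambda>x. g (SOME y. p y = x) - coeff g 0 0) (p z)" unfolding f(1) by simp
  qed
  define H where "H j z = W j (p z) - f z - m * cnj z" for j z
  have H_hol: "H j holomorphic_on p -` V j" for j
  proof (rule dbar_0_holomorphic)
    fix z assume "z \<in> p -` V j"
    then have z: "p z \<in> V j" by simp
    have cd: "(\<lambda>z. m * cnj z) differentiable (at z)"
      by (rule bounded_linear_imp_differentiable) (rule bounded_linear_const_mult[OF bounded_linear_cnj])
    have d: "(\<lambda>z. W j (p z) - f z) differentiable (at z)" by (rule differentiable_diff[OF W_d[OF z] fd])
    show "H j differentiable (at z)" unfolding H_def[abs_def] by (rule differentiable_diff[OF d cd])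
    show "dbar (H j) z = 0"
      unfolding H_def[abs_def] dbar_diff[OF d cd] dbar_diff[OF W_d[OF z] fd] f(1) dbar_cnj_id g_eq[OF z, symmetric] by (simp add: m_def)
  qed
  \<comment> \<open>The shears absorb the cocycle: the difference of \<open>H k\<close> and
    \<open>H j\<close> is \<open>h j k\<close>, so every index j with p z in \<open>V j\<close>
    gives the same vector. Under deck transformations only the term m cnj z changes.\<close>
  define F where "F z w = \<tau> (p z) (p z) (vec2 (w $ 1 + H (p z) z * w $ 2) (w $ 2))" for z and w :: "complex^2"
  have F: "F z w = \<tau> j (p z) (vec2 (w $ 1 + H j z * w $ 2) (w $ 2))" if z: "p z \<in> V j" for z j and w :: "complex^2"
    unfolding F_def h_eq[OF xV z] vector_2 H_def W_eq[OF xV z] by (simp add: algebra_simps)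
  have F_inj: "inj (F z)" for z
  proof (rule injI)
    fix w w' assume "F z w = F z w'"
    then have "vec2 (w $ 1 + H (p z) z * w $ 2) (w $ 2) = vec2 (w' $ 1 + H (p z) z * w' $ 2) (w' $ 2)"
      unfolding F_def by (rule injD[OF adapted_trivD(2)[OF adV xV]])
    then have "w $ 1 + H (p z) z * w $ 2 = w' $ 1 + H (p z) z * w' $ 2" "w $ 2 = w' $ 2" unfolding vec2_eq_iff by blast+
    then show "w = w'" by (simp add: vec_eq_iff forall_2)
  qed
  have F_deck: "F z' w = F z (vec2 (w $ 1 - m * cnj (z' - z) * w $ 2) (w $ 2))" if z: "p z = p z'" for z z' w
    unfolding F_def z[symmetric] H_def f_deck[OF z] vector_2 by (simp add: algebra_simps)
  have F_tr: "\<exists>G :: complex \<Rightarrow> complex^2^2. (\<forall>i j. (\<lambda>z. G z $ i $ j) holomorphic_on p -` U) \<and>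
        (\<forall>z\<in>p -` U. inj ((*v) (G z)) \<and> (\<forall>w. t (p z) w = F z (G z *v w)))" if e: "(U, t) \<in> E" for U t
  proof -
    have oU: "open U" by (rule holomorphic_bundleD(2)[OF hb e])
    have ti: "inj (t (p z))" if "p z \<in> U" for z by (rule holomorphic_bundleD(3)[OF hb e that])
    have loc: "\<exists>A :: complex \<Rightarrow> complex^2^2. (\<forall>i k. (\<lambda>z. A z $ i $ k) holomorphic_on p -` (U \<inter> V j)) \<and>
      (\<forall>z\<in>p -` (U \<inter> V j). \<forall>w. t (p z) w = F z (A z *v w))" for j
    proof -
      obtain G :: "'x \<Rightarrow> complex^2^2" where G: "\<And>i k. (\<lambda>z. G (p z) $ i $ k) holomorphic_on p -` (U \<inter> V j)"
        "\<And>x. x \<in> U \<Longrightarrow> x \<in> V j \<Longrightarrow> inj ((*v) (G x))" "\<And>x w. x \<in> U \<Longrightarrow> x \<in> V j \<Longrightarrow> t x w = \<tau> j x (G x *v w)"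
        by (rule adapted_triv_transition[OF adV[of j] e]) (rule that)
      define A :: "complex \<Rightarrow> complex^2^2" where
        "A z = (\<chi> i k. if i = 1 then G (p z) $ 1 $ k - H j z * G (p z) $ 2 $ k else G (p z) $ 2 $ k)" for z
      have "(\<lambda>z. A z $ i $ k) holomorphic_on p -` (U \<inter> V j)" for i k
      proof -
        have "H j holomorphic_on p -` (U \<inter> V j)" by (rule holomorphic_on_subset[OF H_hol]) blast
        from holomorphic_on_diff[OF G(1) holomorphic_on_mult[OF this G(1)]] G(1)
        show ?thesis unfolding A_def by (cases "i = 1") simp_all
      qed
      moreover have "t (p z) w = F z (A z *v w)" if "p z \<in> U" "p z \<in> V j" for z w
        unfolding F[OF that(2)] G(3)[OF that] by (rule arg_cong[of _ _ "\<tau> j (p z)"])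
          (simp add: matrix_vec2 vec2_eq_iff A_def algebra_simps)
      ultimately show ?thesis by (intro exI[of _ A]) simp
    qed
    then obtain A :: "'x \<Rightarrow> complex \<Rightarrow> complex^2^2" where A:
      "\<And>j. (\<forall>i k. (\<lambda>z. A j z $ i $ k) holomorphic_on p -` (U \<inter> V j)) \<and> (\<forall>z\<in>p -` (U \<inter> V j). \<forall>w. t (p z) w = F z (A j z *v w))"
      using choice[of "\<lambda>j A. (\<forall>i k. (\<lambda>z. A z $ i $ k) holomorphic_on p -` (U \<inter> V j)) \<and> (\<forall>z\<in>p -` (U \<inter> V j). \<forall>w. t (p z) w = F z (A z *v w))"]
      by blast
    have A2: "t (p z) w = F z (A j z *v w)" if "p z \<in> U" "p z \<in> V j" for j z w using A[of j] that by blast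
    show ?thesis
    proof (intro exI[of _ "\<lambda>z. A (p z) z"] conjI allI ballI)
      have eq: "A (p z) z = A j z" if z: "p z \<in> U" "p z \<in> V j" for z j
      proof -
        have "F z (A (p z) z *v w) = F z (A j z *v w)" for w
          using A2[OF z(1) xV, of w] A2[OF z, of w] by simp
        then have "A (p z) z *v w = A j z *v w" for w using injD[OF F_inj] by blast
        then show ?thesis by (simp add: matrix_eq)
      qed
      show "(\<lambda>z. A (p z) z $ i $ k) holomorphic_on p -` U" for i k
      proof (rule holomorphic_on_local)
        fix z assume z: "z \<in> p -` U"
        let ?T = "p -` (U \<inter> V (p z))"
        have "(\<lambda>y. A (p y) y $ i $ k) holomorphic_on ?T"
        proof (rule holomorphic_transform)
          show "(\<lambda>y. A (p z) y $ i $ k) holomorphic_on ?T" using A[of "p z"] by blast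
          show "A (p z) y $ i $ k = A (p y) y $ i $ k" if "y \<in> ?T" for y
            using eq[of y "p z"] that by simp
        qed
        then show "\<exists>T. open T \<and> z \<in> T \<and> (\<lambda>z. A (p z) z $ i $ k) holomorphic_on T"
          using open_vimage_p[OF open_Int[OF oU oV]] z xV[of "p z"] by (intro exI[of _ ?T]) simp
      qed
      fix z assume "z \<in> p -` U"
      then have z: "p z \<in> U" by simp
      show tF: "t (p z) w = F z (A (p z) z *v w)" for w by (rule A2[OF z xV])
      show "inj ((*v) (A (p z) z))"
      proof (rule injI)
        fix w w' assume "A (p z) z *v w = A (p z) z *v w'"
        then have "t (p z) w = t (p z) w'" unfolding tF by simp
        then show "w = w'" by (rule injD[OF ti[OF z]])
      qed
    qed
  qed
  show thesis
  proof (rule that[of F m])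
    show "unipotent_frame E F m"
      unfolding unipotent_frame_def
    proof (intro conjI allI ballI impI)
      show "(\<Union>(U, t)\<in>E. U) = UNIV" by (rule holomorphic_bundleD(1)[OF hb])
      show "inj (F z)" for z by (rule F_inj)
      show "F z' w = F z (vec2 (w $ 1 - m * cnj (z' - z) * w $ 2) (w $ 2))" if "p z = p z'" for z z' w
        by (rule F_deck[OF that])
      fix e assume "e \<in> E"
      then obtain U t where e: "e = (U, t)" "(U, t) \<in> E" by (metis surj_pair)
      show "case e of (U, t) \<Rightarrow> open U \<and> (\<exists>G :: complex \<Rightarrow> complex^2^2. (\<forall>i j. (\<lambda>z. G z $ i $ j) holomorphic_on p -` U) \<and>
        (\<forall>z\<in>p -` U. inj ((*v) (G z)) \<and> (\<forall>w. t (p z) w = F z (G z *v w))))"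
        unfolding e(1) split_conv using holomorphic_bundleD(2)[OF hb e(2)] F_tr[OF e(2)] by (rule conjI)
    qed
    show "\<pi> (p z) (F z w) = w $ 2" for z w
      unfolding F_def adapted_trivD(4)[OF adV xV] by simp
  qed
qed

theorem nontrivial_extensions_isomorphic:
  fixes E :: "('x, 2, 'v) vector_bundle"
  assumes "nontrivial_extension \<A> E" "unipotent_frame E' F' m'" "m' \<noteq> 0"
  shows "bundle_isomorphic \<A> E E'"
proof -
  obtain \<iota> \<pi> where ext: "extension_of_trivial \<A> E \<iota> \<pi>" and ns: "\<not> extension_splits \<A> E \<pi>"
    using assms(1) unfolding nontrivial_extension_def by blast
  obtain F m where F: "unipotent_frame E F m" "\<And>z w. \<pi> (p z) (F z w) = w $ 2"
    by (rule extension_unipotent[OF ext]) (rule that)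
  have "m \<noteq> 0" using unipotent_splits_iff[of E F m \<pi>, OF F] ns by blast
  then show ?thesis by (rule unipotent_isomorphic[OF F(1) assms(2) _ assms(3)])
qed

end

section \<open>The nearly Kaehler connection in a lift\<close>

lemma has_derivative_vec:
  fixes f :: "'a::real_normed_vector \<Rightarrow> 'b::euclidean_space^'n"
  assumes "\<And>i. ((\<lambda>x. f x $ i) has_derivative (\<lambda>v. f' v $ i)) (at x)"
  shows "(f has_derivative f') (at x)"
proof -
  have 0: "bounded_linear (axis i :: 'b \<Rightarrow> 'b^'n)" for i
    by (intro linear_conv_bounded_linear[THEN iffD1] linearI) (auto simp: axis_def vec_eq_iff)
  have eq: "w = (\<Sum>i\<in>UNIV. axis i (w $ i))" for w :: "'b^'n"
    by (simp add: vec_eq_iff axis_def if_distrib cong: if_cong)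
  have "((\<lambda>x. \<Sum>i\<in>UNIV. axis i (f x $ i)) has_derivative (\<lambda>v. \<Sum>i\<in>UNIV. axis i (f' v $ i))) (at x)"
    by (rule has_derivative_sum) (rule bounded_linear.has_derivative[OF 0 assms])
  then show ?thesis unfolding eq[symmetric] .
qed

text \<open>The infinitesimal version of the change of coframe, which is cnj k11 times the lower
  block in coordinates 1 and 2 and k11^2 in coordinate 3.\<close>

lemma kappa_sp2:
  assumes "\<Omega> \<in> sp2"
  shows "kappa \<Omega> *v c = vector [(\<Omega> $ 3 $ 3 - \<Omega> $ 1 $ 1) * c $ 1 + \<Omega> $ 3 $ 4 * c $ 2,
    \<Omega> $ 4 $ 3 * c $ 1 + (\<Omega> $ 4 $ 4 - \<Omega> $ 1 $ 1) * c $ 2, 2 * \<Omega> $ 1 $ 1 * c $ 3]"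
  by (simp add: vec_eq_iff forall_3 vector_3 kappa_def matrix_vector_mult_def sum_3 sp2_entries[OF assms] algebra_simps)

lemma k_smooth_on_coframe:
  assumes D: "open D" and S: "k_smooth_on k D S" and A: "k_smooth_on k D A"
  shows "k_smooth_on k D (\<lambda>z. coframe (S z) (A z))"
proof -
  have B: "k_smooth_on k D (\<lambda>z. (adj (S z) ** A z ** S z) $ i $ j)" for i j
    by (intro k_smooth_on_vec_nth[OF D] k_smooth_on_matrix_mult[OF D] k_smooth_on_adj[OF D] S A)
  have "k_smooth_on k D (\<lambda>z. coframe (S z) (A z) $ i)" if "i = 1 \<or> i = 2 \<or> i = 3" for i
    using that unfolding coframe_def Let_def omega1_def omega2_def omega3_def
    by (elim disjE) (simp_all only: vector_3 k_smooth_on_mult[OF D k_smooth_on_const B] k_smooth_on_cnj[OF D B])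
  then show ?thesis using exhaust_3 by (intro k_smooth_on_vec[OF D]) blast
qed

lemma k_smooth_on_frame:
  assumes D: "open D" and S: "k_smooth_on k D S" and c: "\<And>i. k_smooth_on k D (\<lambda>z. c z $ i)"
  shows "k_smooth_on k D (\<lambda>z. frame (S z) (c z))"
proof -
  define \<Omega> where "\<Omega> c = maurer_cartan 0 0 (c $ 1) (c $ 2) (c $ 3) 0" for c :: "complex^3"
  have e: "k_smooth_on k D (\<lambda>z. (\<Omega> (c z) ** base_point - base_point ** \<Omega> (c z)) $ i $ j)" (is "?P i j") for i j
  proof -
    have b: "bounded_linear (\<lambda>c. (\<Omega> c ** base_point - base_point ** \<Omega> c) $ i $ j)"
      unfolding linear_conv_bounded_linear[symmetric]
    proof (rule linearI)
      have "(\<Omega> (c + d) ** base_point - base_point ** \<Omega> (c + d)) = (\<Omega> c ** base_point - base_point ** \<Omega> c) + (\<Omega> d ** base_point - base_point ** \<Omega> d)" for c d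
        by (simp add: vec_eq_iff forall_4 \<Omega>_def matrix_matrix_mult_def sum_4 base_point_def maurer_cartan_def add_divide_distrib diff_divide_distrib)
      then show "(\<Omega> (c + d) ** base_point - base_point ** \<Omega> (c + d)) $ i $ j
        = (\<Omega> c ** base_point - base_point ** \<Omega> c) $ i $ j + (\<Omega> d ** base_point - base_point ** \<Omega> d) $ i $ j" for c d
        by (simp only: vector_add_component)
      have "(\<Omega> (r *\<^sub>R c) ** base_point - base_point ** \<Omega> (r *\<^sub>R c)) = r *\<^sub>R (\<Omega> c ** base_point - base_point ** \<Omega> c)" for r c
        by (simp add: vec_eq_iff forall_4 \<Omega>_def matrix_matrix_mult_def sum_4 base_point_def maurer_cartan_def scaleR_conv_of_real[where 'a = complex])
      then show "(\<Omega> (r *\<^sub>R c) ** base_point - base_point ** \<Omega> (r *\<^sub>R c)) $ i $ j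
        = r *\<^sub>R (\<Omega> c ** base_point - base_point ** \<Omega> c) $ i $ j" for r c
        by (simp only: vector_scaleR_component)
    qed
    have "k_smooth_on k D c" by (rule k_smooth_on_vec[OF D c])
    then show ?thesis by (rule k_smooth_on_linear[OF b D])
  qed
  have "k_smooth_on k D (\<lambda>z. \<Omega> (c z) ** base_point - base_point ** \<Omega> (c z))"
    by (intro k_smooth_on_vec[OF D] e)
  then show ?thesis
    unfolding frame_def Let_def \<Omega>_def[symmetric]
    by (intro k_smooth_on_matrix_mult[OF D] k_smooth_on_adj[OF D] S)
qed

definition nk_conn :: "(complex \<Rightarrow> complex^4^4) \<Rightarrow> (complex \<Rightarrow> complex^4^4) \<Rightarrow> complex \<Rightarrow> complex \<Rightarrow> complex^4^4" where
  "nk_conn S \<sigma> z v = frame (S z)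
     (frechet_derivative (\<lambda>y. coframe (S y) (\<sigma> y)) (at z) v + kappa (mc S z v) *v coframe (S z) (\<sigma> z))"

text \<open>Independence of the lift: with \<open>k = adj S' ** S\<close> block diagonal, the two coframes are related by
  \<open>cnj k\<^sub>1\<^sub>1\<close> times the lower block of \<open>k\<close> and by \<open>k\<^sub>1\<^sub>1\<^sup>2\<close>, and \<open>k\<close> satisfies the gauge equation
  \<open>dk = k mc S - mc S' k\<close>.\<close>

lemma nk_conn_gauge:
  assumes lS: "lift D S" and lS': "lift D S'" and o: "\<And>w. w \<in> D \<Longrightarrow> orbit_map (S w) = orbit_map (S' w)"
    and z: "z \<in> D" and d: "(\<lambda>y. coframe (S y) (\<sigma> y)) differentiable (at z)"
  shows "nk_conn S \<sigma> z v = nk_conn S' \<sigma> z v"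
proof -
  interpret S: lift D S by (rule lS)
  interpret S': lift D S' by (rule lS')
  define k where "k z = adj (S' z) ** S z" for z
  define C where "C y = coframe (S y) (\<sigma> y)" for y
  have Sp: "S w \<in> Sp2" "S' w \<in> Sp2" "orbit_map (S w) = orbit_map (S' w)" if "w \<in> D" for w
    using S.Sp2 S'.Sp2 o that by auto
  define k' where "k' v = adj (S' z) ** frechet_derivative S (at z) v + adj (frechet_derivative S' (at z) v) ** S z" for v
  have dk: "(k has_derivative k') (at z)"
    unfolding k_def[abs_def] k'_def[abs_def]
    by (intro bounded_bilinear.FDERIV[OF bounded_bilinear_matrix_mult] S.S_deriv
        bounded_linear.has_derivative[OF bounded_linear_adj S'.S_deriv] z)
  let ?O = "mc S z v" and ?P = "mc S' z v"
  have sk: "adj ?P = - ?P" using S'.mc_in_sp2[OF z] by (simp add: sp2_def)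
  have k'v: "k' v = k z ** ?O - ?P ** k z"
    by (simp add: k'_def S.mc_eq[OF z] S'.mc_eq[OF z] adj_mult sk matrix_mult_uminus k_def matrix_mul_assoc)
  note st = stabiliser_entries[OF Sp[OF z] refl, folded k_def]
  have ke: "k' v $ 1 $ 1 = k z $ 1 $ 1 * ?O $ 1 $ 1 - ?P $ 1 $ 1 * k z $ 1 $ 1"
    "k' v $ 3 $ 3 = k z $ 3 $ 3 * ?O $ 3 $ 3 + k z $ 3 $ 4 * ?O $ 4 $ 3 - (?P $ 3 $ 3 * k z $ 3 $ 3 + ?P $ 3 $ 4 * k z $ 4 $ 3)"
    "k' v $ 3 $ 4 = k z $ 3 $ 3 * ?O $ 3 $ 4 + k z $ 3 $ 4 * ?O $ 4 $ 4 - (?P $ 3 $ 3 * k z $ 3 $ 4 + ?P $ 3 $ 4 * k z $ 4 $ 4)"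
    "k' v $ 4 $ 3 = k z $ 4 $ 3 * ?O $ 3 $ 3 + k z $ 4 $ 4 * ?O $ 4 $ 3 - (?P $ 4 $ 3 * k z $ 3 $ 3 + ?P $ 4 $ 4 * k z $ 4 $ 3)"
    "k' v $ 4 $ 4 = k z $ 4 $ 3 * ?O $ 3 $ 4 + k z $ 4 $ 4 * ?O $ 4 $ 4 - (?P $ 4 $ 3 * k z $ 3 $ 4 + ?P $ 4 $ 4 * k z $ 4 $ 4)"
    unfolding k'v by (simp_all add: matrix_matrix_mult_def sum_4 st(2-11))
  have cO: "cnj (?O $ 1 $ 1) = - ?O $ 1 $ 1" "cnj (?P $ 1 $ 1) = - ?P $ 1 $ 1"
    using sp2_entries(1)[OF S.mc_in_sp2[OF z]] sp2_entries(1)[OF S'.mc_in_sp2[OF z]] by simp_all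
  define c where "c = frechet_derivative C (at z)"
  have dC: "(C has_derivative c) (at z)" using d unfolding C_def[abs_def] c_def by (simp add: frechet_derivative_works)
  have ck: "((\<lambda>y. k y $ i $ j) has_derivative (\<lambda>v. k' v $ i $ j)) (at z)" for i j
    by (rule bounded_linear.has_derivative[OF bounded_linear_entry dk])
  have cc: "((\<lambda>y. C y $ i) has_derivative (\<lambda>v. c v $ i)) (at z)" for i
    by (rule bounded_linear.has_derivative[OF bounded_linear_vec_nth dC])
  have ccnj: "((\<lambda>y. cnj (k y $ 1 $ 1)) has_derivative (\<lambda>v. cnj (k' v $ 1 $ 1))) (at z)"
    by (rule bounded_linear.has_derivative[OF bounded_linear_cnj ck])
  define C' where "C' y = coframe (S' y) (\<sigma> y)" for y
  \<comment> \<open>The product rule for the changed coframe; the gauge equation for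
    \<open>k'\<close> then trades the derivatives of \<open>k\<close> for the two Maurer-Cartan
    forms.\<close>
  define c' where "c' v = (vector [
      cnj (k z $ 1 $ 1) * (k z $ 3 $ 3 * c v $ 1 + k' v $ 3 $ 3 * C z $ 1 + (k z $ 3 $ 4 * c v $ 2 + k' v $ 3 $ 4 * C z $ 2))
        + cnj (k' v $ 1 $ 1) * (k z $ 3 $ 3 * C z $ 1 + k z $ 3 $ 4 * C z $ 2),
      cnj (k z $ 1 $ 1) * (k z $ 4 $ 3 * c v $ 1 + k' v $ 4 $ 3 * C z $ 1 + (k z $ 4 $ 4 * c v $ 2 + k' v $ 4 $ 4 * C z $ 2))
        + cnj (k' v $ 1 $ 1) * (k z $ 4 $ 3 * C z $ 1 + k z $ 4 $ 4 * C z $ 2),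
      k z $ 1 $ 1 * k z $ 1 $ 1 * c v $ 3 + (k z $ 1 $ 1 * k' v $ 1 $ 1 + k' v $ 1 $ 1 * k z $ 1 $ 1) * C z $ 3] :: complex^3)" for v
  have C'_eq: "C' y $ 1 = cnj (k y $ 1 $ 1) * (k y $ 3 $ 3 * C y $ 1 + k y $ 3 $ 4 * C y $ 2)"
    "C' y $ 2 = cnj (k y $ 1 $ 1) * (k y $ 4 $ 3 * C y $ 1 + k y $ 4 $ 4 * C y $ 2)"
    "C' y $ 3 = k y $ 1 $ 1 * k y $ 1 $ 1 * C y $ 3" if "y \<in> D" for y
    unfolding C'_def C_def by (rule coframe_stabiliser[OF Sp[OF that] refl, folded k_def])+
  have "((\<lambda>y. C' y $ i) has_derivative (\<lambda>v. c' v $ i)) (at z)" if "i = 1 \<or> i = 2 \<or> i = 3" for i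
  proof -
    have 1: "((\<lambda>y. C' y $ 1) has_derivative (\<lambda>v. c' v $ 1)) (at z)"
      unfolding c'_def vector_3
      by (subst has_derivative_cong_open[OF S.open_D z C'_eq(1)], assumption)
         (intro has_derivative_mult has_derivative_add ck cc ccnj)
    have 2: "((\<lambda>y. C' y $ 2) has_derivative (\<lambda>v. c' v $ 2)) (at z)"
      unfolding c'_def vector_3
      by (subst has_derivative_cong_open[OF S.open_D z C'_eq(2)], assumption)
         (intro has_derivative_mult has_derivative_add ck cc ccnj)
    have 3: "((\<lambda>y. C' y $ 3) has_derivative (\<lambda>v. c' v $ 3)) (at z)"
      unfolding c'_def vector_3
      by (subst has_derivative_cong_open[OF S.open_D z C'_eq(3)], assumption)
         (intro has_derivative_mult has_derivative_add ck cc ccnj)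
    show ?thesis using that 1 2 3 by blast
  qed
  then have "(C' has_derivative c') (at z)"
    by (rule has_derivative_vec[of C' c']) (rule exhaust_3)
  then have c'f: "frechet_derivative C' (at z) v = c' v" by (simp add: frechet_derivative_eq)
  define w where "w = c v + kappa ?O *v C z"
  have w: "w $ 1 = c v $ 1 + ((?O $ 3 $ 3 - ?O $ 1 $ 1) * C z $ 1 + ?O $ 3 $ 4 * C z $ 2)"
    "w $ 2 = c v $ 2 + (?O $ 4 $ 3 * C z $ 1 + (?O $ 4 $ 4 - ?O $ 1 $ 1) * C z $ 2)"
    "w $ 3 = c v $ 3 + 2 * ?O $ 1 $ 1 * C z $ 3"
    unfolding w_def kappa_sp2[OF S.mc_in_sp2[OF z]] by (simp_all add: vector_3)
  have A: "frame (S z) w \<in> tangent_CP3 (orbit_map (S' z))"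
    using frame_tangent[OF Sp(1)[OF z], of w] o[OF z] by simp
  have "c' v + kappa ?P *v C' z = coframe (S' z) (frame (S z) w)"
    unfolding vec_eq_iff forall_3 kappa_sp2[OF S'.mc_in_sp2[OF z]] coframe_stabiliser[OF Sp[OF z] refl, folded k_def]
      coframe_frame[OF Sp(1)[OF z]] w vector_add_component vector_3 c'_def C'_eq[OF z] ke complex_cnj_diff complex_cnj_mult cO
    by (simp add: algebra_simps)
  then have "nk_conn S' \<sigma> z v = frame (S' z) (coframe (S' z) (frame (S z) w))"
    unfolding nk_conn_def C'_def[symmetric] c'f by simp
  also have "\<dots> = frame (S z) w" by (rule frame_coframe[OF Sp(2)[OF z] A])
  also have "\<dots> = nk_conn S \<sigma> z v" unfolding nk_conn_def w_def c_def C_def[symmetric] by simp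
  finally show ?thesis by simp
qed

context adapted_frame
begin

text \<open>Twice the \<open>(0,1)\<close>-part of the connection, evaluated on the coordinate vector \<open>1\<close>.\<close>

definition dbar_conn :: "(complex \<Rightarrow> complex^3) \<Rightarrow> complex \<Rightarrow> complex^3" where
  "dbar_conn c z = (frechet_derivative c (at z) 1 + kappa (mc S z 1) *v c z)
     + \<i> *s (frechet_derivative c (at z) \<i> + kappa (mc S z \<i>) *v c z)"

text \<open>Since tau is of type (1,0), its own contribution cancels in the (0,1)-part while that of
  - cnj tau doubles: component 2 enters component 1 but not conversely. This triangular shape is the
  source of the extension.\<close>

lemma dbar_conn_components:
  assumes z: "z \<in> D" and c: "c differentiable (at z)"
  shows "dbar_conn c z $ 1 = 2 * dbar (\<lambda>y. c y $ 1) z + (fY z - fX z) * c z $ 1 - 2 * cnj (ft z) * c z $ 2"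
    "dbar_conn c z $ 2 = 2 * dbar (\<lambda>y. c y $ 2) z - (fX z + fY z) * c z $ 2"
    "dbar_conn c z $ 3 = 2 * dbar (\<lambda>y. c y $ 3) z + 2 * fX z * c z $ 3"
proof -
  have d: "((\<lambda>y. c y $ i) has_derivative (\<lambda>v. frechet_derivative c (at z) v $ i)) (at z)" for i
    using bounded_linear.has_derivative[OF bounded_linear_vec_nth] c by (auto simp: frechet_derivative_works)
  have e: "dbar (\<lambda>y. c y $ i) z = (frechet_derivative c (at z) 1 $ i + \<i> * frechet_derivative c (at z) \<i> $ i) / 2" for i
    by (rule dbar_eq[OF d])
  note m = kappa_sp2[OF mc_in_sp2[OF z]] frame_entries[OF z] frame_entries_tau[OF z]
  show "dbar_conn c z $ 1 = 2 * dbar (\<lambda>y. c y $ 1) z + (fY z - fX z) * c z $ 1 - 2 * cnj (ft z) * c z $ 2"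
    "dbar_conn c z $ 2 = 2 * dbar (\<lambda>y. c y $ 2) z - (fX z + fY z) * c z $ 2"
    "dbar_conn c z $ 3 = 2 * dbar (\<lambda>y. c y $ 3) z + 2 * fX z * c z $ 3"
    unfolding dbar_conn_def e m vector_add_component vector_smult_component vector_3 fX_def fY_def
    by (simp_all add: algebra_simps)
qed

text \<open>The (0,1)-part is conjugate linear in the direction, so the vector 1 decides all
  directions.\<close>

lemma dbar_conn_type:
  assumes z: "z \<in> D" and c: "c differentiable (at z)"
  shows "(frechet_derivative c (at z) v + kappa (mc S z v) *v c z)
     + \<i> *s (frechet_derivative c (at z) (\<i> * v) + kappa (mc S z (\<i> * v)) *v c z) = cnj v *s dbar_conn c z"
proof -
  define L where "L v = frechet_derivative c (at z) v + kappa (mc S z v) *v c z" for v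
  have "linear (frechet_derivative c (at z))"
    using c by (simp add: frechet_derivative_works has_derivative_linear)
  moreover have "linear (\<lambda>v. kappa (mc S z v) *v c z)"
    unfolding kappa_sp2[OF mc_in_sp2[OF z]] using mc_linear[OF z]
    by (intro linearI) (simp_all add: linear_add linear_scale vec_eq_iff forall_3 vector_3 algebra_simps)
  ultimately have "linear L" unfolding L_def by (rule linear_compose_add)
  from linear_complex_eq[OF this, of v] linear_complex_eq[OF this, of "\<i> * v"]
  have "L v + \<i> *s L (\<i> * v) = cnj v *s (L 1 + \<i> *s L \<i>)"
    by (simp add: vec_eq_iff) (simp add: complex_eq_iff algebra_simps)
  then show ?thesis unfolding L_def dbar_conn_def .
qed

text \<open>Components of a normal vector with coordinates \<open>w\<close>: the line spanned by the curve is
  \<open>(fa, 0, fb)\<close>, and the coordinates are \<open>c\<^sub>1/fa - c\<^sub>3/fb\<close> and \<open>c\<^sub>2/(fa ft)\<close>.\<close>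

definition normal_vec :: "complex \<Rightarrow> complex^2 \<Rightarrow> complex^3" where
  "normal_vec z w = vector [fa z * (fb z * cnj (fb z)) * w $ 1 / (fa z * cnj (fa z) + fb z * cnj (fb z)),
     fa z * ft z * w $ 2,
     - fb z * (fa z * cnj (fa z)) * w $ 1 / (fa z * cnj (fa z) + fb z * cnj (fb z))]"

end

lemma norm_square_pos:
  assumes "a \<noteq> 0" shows "a * cnj a + b * cnj b \<noteq> (0 :: complex)"
proof -
  have "a * cnj a + b * cnj b = of_real ((cmod a)\<^sup>2 + (cmod b)\<^sup>2)" unfolding of_real_add complex_norm_square ..
  moreover have "(cmod a)\<^sup>2 + (cmod b)\<^sup>2 > 0" using assms by (simp add: add_pos_nonneg)
  ultimately show ?thesis by (simp only: of_real_eq_0_iff)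
qed

locale transverse_frame = adapted_frame +
  assumes w3_nz: "\<And>z. z \<in> D \<Longrightarrow> omega3 (mc S z 1) \<noteq> 0" and tau_nz: "\<And>z. z \<in> D \<Longrightarrow> tau (mc S z 1) \<noteq> 0"
begin

lemma nz:
  assumes "z \<in> D" shows "fa z \<noteq> 0" "fb z \<noteq> 0" "ft z \<noteq> 0" "fa z * cnj (fa z) + fb z * cnj (fb z) \<noteq> 0"
  using w1_nz[OF assms] w3_nz[OF assms] tau_nz[OF assms] norm_square_pos[of "fa z" "fb z"]
  by (simp_all add: fa_def fb_def ft_def)

lemma normal_vec_normal:
  "cnj (fa z) * normal_vec z w $ 1 + cnj (fb z) * normal_vec z w $ 3 = 0"
  unfolding normal_vec_def vector_3 by (simp add: mult_ac)

lemma normal_vec_coords: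
  assumes z: "z \<in> D"
  shows "normal_vec z w $ 1 / fa z - normal_vec z w $ 3 / fb z = w $ 1" "normal_vec z w $ 2 / (fa z * ft z) = w $ 2"
proof -
  define q where "q = fa z * cnj (fa z) + fb z * cnj (fb z)"
  have q: "q \<noteq> 0" using nz(4)[OF z] by (simp add: q_def)
  have "normal_vec z w $ 1 / fa z - normal_vec z w $ 3 / fb z = (fb z * cnj (fb z)) * w $ 1 / q + (fa z * cnj (fa z)) * w $ 1 / q"
    unfolding normal_vec_def vector_3 q_def[symmetric] using nz(1,2)[OF z] by (simp add: mult.assoc)
  also have "\<dots> = q * w $ 1 / q" unfolding q_def by (simp add: add_divide_distrib distrib_right add.commute)
  finally show "normal_vec z w $ 1 / fa z - normal_vec z w $ 3 / fb z = w $ 1" using q by simp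
  show "normal_vec z w $ 2 / (fa z * ft z) = w $ 2" unfolding normal_vec_def vector_3 using nz[OF z] by simp
qed

lemma normal_vec_eqI:
  assumes z: "z \<in> D" and n: "cnj (fa z) * c $ 1 + cnj (fb z) * c $ 3 = 0"
  shows "c = normal_vec z (vec2 (c $ 1 / fa z - c $ 3 / fb z) (c $ 2 / (fa z * ft z)))"
proof -
  define q where "q = fa z * cnj (fa z) + fb z * cnj (fb z)"
  have q: "q \<noteq> 0" using nz(4)[OF z] by (simp add: q_def)
  note ab = nz(1,2)[OF z]
  have 1: "fa z * (fb z * cnj (fb z)) * (c $ 1 / fa z - c $ 3 / fb z) = q * c $ 1 - fa z * (cnj (fa z) * c $ 1 + cnj (fb z) * c $ 3)"
    using ab by (simp add: q_def field_simps)
  have 3: "- fb z * (fa z * cnj (fa z)) * (c $ 1 / fa z - c $ 3 / fb z) = q * c $ 3 - fb z * (cnj (fa z) * c $ 1 + cnj (fb z) * c $ 3)"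
    using ab by (simp add: q_def field_simps)
  show ?thesis
    unfolding vec_eq_iff forall_3 normal_vec_def vector_3 vector_2 q_def[symmetric] 1 3 n
    using q nz[OF z] by simp
qed

text \<open>The diagonal connection terms cancel against the \<open>dbar\<close> derivatives of
  \<open>fa\<close>, \<open>fb\<close> and fa ft once these are factored out of components 1, 3 and
  2. The rest is tangent exactly when component 2 is 0 and components 1 and 3, divided by
  \<open>fa\<close> and \<open>fb\<close>, agree.\<close>

lemma dbar_conn_normal_vec:
  assumes oB: "open B" "B \<subseteq> D" and z: "z \<in> B" and w: "\<And>i. (\<lambda>y. w y $ i) differentiable (at z)"
    and c: "\<And>y. y \<in> B \<Longrightarrow> c y = normal_vec y (w y)" and cd: "c differentiable (at z)"
  shows "(\<exists>l. dbar_conn c z = l *s vector [fa z, 0, fb z]) \<longleftrightarrow>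
    dbar (\<lambda>y. w y $ 2) z = 0 \<and> dbar (\<lambda>y. w y $ 1) z = ft z * cnj (ft z) * w z $ 2"
proof -
  have zD: "z \<in> D" using z oB(2) by blast
  note nz' = nz[OF zD]
  note fd = coeffs_differentiable[OF zD] and db = dbar_coeffs[OF zD]
  have ci: "(\<lambda>y. c y $ i) differentiable (at z)" for i
    using bounded_linear.has_derivative[OF bounded_linear_vec_nth] cd frechet_derivative_works differentiableI by blast
  define g1 where "g1 y = c y $ 1 / fa y" for y
  define g3 where "g3 y = c y $ 3 / fb y" for y
  have g: "g1 differentiable (at z)" "g3 differentiable (at z)"
    unfolding g1_def[abs_def] g3_def[abs_def] using nz' by (auto intro!: differentiable_divide ci fd)
  have e1: "dbar (\<lambda>y. c y $ 1) z = fa z * dbar g1 z + dbar fa z * g1 z"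
    unfolding dbar_mult[OF fd(1) g(1), symmetric]
    by (rule dbar_cong[OF oB(1) z]) (use nz oB(2) in \<open>auto simp: g1_def\<close>)
  have e3: "dbar (\<lambda>y. c y $ 3) z = fb z * dbar g3 z + dbar fb z * g3 z"
    unfolding dbar_mult[OF fd(2) g(2), symmetric]
    by (rule dbar_cong[OF oB(1) z]) (use nz oB(2) in \<open>auto simp: g3_def\<close>)
  have ew: "dbar (\<lambda>y. w y $ 1) z = dbar g1 z - dbar g3 z"
    unfolding dbar_diff[OF g, symmetric]
    by (rule dbar_cong[OF oB(1) z]) (use normal_vec_coords(1) c oB(2) in \<open>auto simp: g1_def g3_def\<close>)
  have fat: "(\<lambda>y. fa y * ft y) differentiable (at z)" by (rule differentiable_mult[OF fd(1,3)])
  have e2: "dbar (\<lambda>y. c y $ 2) z = (fa z * ft z) * dbar (\<lambda>y. w y $ 2) z + dbar (\<lambda>y. fa y * ft y) z * w z $ 2"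
    unfolding dbar_mult[OF fat w, symmetric]
    by (rule dbar_cong[OF oB(1) z]) (simp add: c normal_vec_def vector_3)
  have eat: "dbar (\<lambda>y. fa y * ft y) z = fa z * ft z * (fX z + fY z) / 2"
    unfolding dbar_mult[OF fd(1,3)] db by (simp add: field_simps)
  have c2: "c z $ 2 = fa z * ft z * w z $ 2" using c[OF z] by (simp add: normal_vec_def vector_3)
  have c1: "c z $ 1 = fa z * g1 z" "c z $ 3 = fb z * g3 z" using nz' by (simp_all add: g1_def g3_def)
  note dc = dbar_conn_components[OF zD cd]
  have D1: "dbar_conn c z $ 1 = fa z * (2 * dbar g1 z - 2 * (ft z * cnj (ft z)) * w z $ 2)"
    unfolding dc e1 db c1 c2 by (simp add: field_simps)
  have D2: "dbar_conn c z $ 2 = 2 * (fa z * ft z) * dbar (\<lambda>y. w y $ 2) z"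
    unfolding dc e2 eat c2 by (simp add: field_simps)
  have D3: "dbar_conn c z $ 3 = fb z * (2 * dbar g3 z)"
    unfolding dc e3 db c1 by (simp add: field_simps)
  have "(\<exists>l. dbar_conn c z = l *s vector [fa z, 0, fb z]) \<longleftrightarrow>
      dbar_conn c z $ 2 = 0 \<and> (\<exists>l. dbar_conn c z $ 1 = l * fa z \<and> dbar_conn c z $ 3 = l * fb z)"
    unfolding vec_eq_iff forall_3 vector_smult_component vector_3 by auto
  also have "(\<exists>l. dbar_conn c z $ 1 = l * fa z \<and> dbar_conn c z $ 3 = l * fb z) \<longleftrightarrow>
     2 * dbar g1 z - 2 * (ft z * cnj (ft z)) * w z $ 2 = 2 * dbar g3 z"
    unfolding D1 D3 using nz' by (auto simp: mult.commute)
  also have "2 * dbar g1 z - 2 * (ft z * cnj (ft z)) * w z $ 2 = 2 * dbar g3 z \<longleftrightarrow>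
      dbar g1 z - dbar g3 z = ft z * cnj (ft z) * w z $ 2"
  proof -
    have "2 * x - 2 * y * q = 2 * x' \<longleftrightarrow> x - x' = y * q" for x x' y q :: complex
    proof -
      have "2 * x - 2 * y * q - 2 * x' = 2 * (x - x' - y * q)" by (simp add: algebra_simps)
      then show ?thesis by (metis eq_iff_diff_eq_0 mult_eq_0_iff zero_neq_numeral)
    qed
    then show ?thesis .
  qed
  finally show ?thesis unfolding D2 ew using nz' by simp
qed

end

section \<open>Tangent line, normal space and projection in an adapted frame\<close>

lemma frame_linear: "frame s (c + d) = frame s c + frame s d" "frame s (r *\<^sub>R c) = r *\<^sub>R frame s c" "frame s 0 = 0"
proof -
  define \<Omega> where "\<Omega> c = maurer_cartan 0 0 (c $ 1) (c $ 2) (c $ 3) 0 ** base_point - base_point ** maurer_cartan 0 0 (c $ 1) (c $ 2) (c $ 3) 0" for c :: "complex^3"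
  have f: "frame s c = s ** \<Omega> c ** adj s" for c by (simp add: frame_def Let_def \<Omega>_def)
  have "\<Omega> (c + d) = \<Omega> c + \<Omega> d"
    by (simp add: vec_eq_iff forall_4 \<Omega>_def matrix_matrix_mult_def sum_4 base_point_def maurer_cartan_def add_divide_distrib diff_divide_distrib)
  then show "frame s (c + d) = frame s c + frame s d" unfolding f by (simp add: matrix_add_ldistrib matrix_add_rdistrib')
  have sc: "\<Omega> (r *\<^sub>R c) = r *\<^sub>R \<Omega> c" for r c
    by (simp add: vec_eq_iff forall_4 \<Omega>_def matrix_matrix_mult_def sum_4 base_point_def maurer_cartan_def scaleR_conv_of_real[where 'a = complex])
  have sc': "frame s (r *\<^sub>R c) = r *\<^sub>R frame s c" for r c
    unfolding f sc bounded_bilinear.scaleR_left[OF bounded_bilinear_matrix_mult]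
      bounded_bilinear.scaleR_right[OF bounded_bilinear_matrix_mult] ..
  show "frame s (r *\<^sub>R c) = r *\<^sub>R frame s c" by (rule sc')
  show "frame s 0 = 0" using sc'[of 0 0] by simp
qed

lemma frame_complex: "frame s (a *s c) = Re a *\<^sub>R frame s c + Im a *\<^sub>R frame s (\<i> *s c)"
proof -
  have "a *s c = Re a *\<^sub>R c + Im a *\<^sub>R (\<i> *s c)"
    by (simp add: vec_eq_iff) (simp add: complex_eq_iff)
  then show ?thesis by (simp add: frame_linear)
qed

lemma frame_eq_iff: "s \<in> Sp2 \<Longrightarrow> frame s c = frame s d \<longleftrightarrow> c = d"
  using coframe_frame by metis

lemma nk_J_frame:
  assumes "s \<in> Sp2" "orbit_map s = P" shows "nk_J P (frame s c) = frame s (\<i> *s c)"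
  using nk_J_eq[OF assms(1) frame_tangent[OF assms(1)], of c] coframe_frame[OF assms(1), of c] assms(2) by simp

locale torus_curve = curve \<A> \<phi> + torus_cover \<A> u v p
  for \<A> :: "('x::t2_space) chart set" and \<phi> u v p
begin

abbreviation "tangent_vec S z \<equiv> (vector [omega1 (mc S z 1), 0, omega3 (mc S z 1)] :: complex^3)"
abbreviation "adapted D S \<equiv> adapted_on D (\<phi> \<circ> p) S"

lemma adapted_transverse: "adapted D S \<Longrightarrow> transverse_frame D S"
  unfolding transverse_frame_def transverse_frame_axioms_def
  using adapted_frame[OF param_p, of D S] tau_nonzero[OF param_p, of D S] by simp

lemma adaptedD: "adapted D S \<Longrightarrow> open D" "adapted D S \<Longrightarrow> smooth_on D S"
  "adapted D S \<Longrightarrow> z \<in> D \<Longrightarrow> S z \<in> Sp2" "adapted D S \<Longrightarrow> z \<in> D \<Longrightarrow> orbit_map (S z) = \<phi> (p z)"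
  by (simp_all add: adapted_on_def)

lemma adapted_obtain: obtains D S where "z \<in> D" "adapted D S"
  by (rule adapted_exists[OF param_p UNIV_I, of z]) (rule that)

lemma curve_tangent_eq:
  assumes a: "adapted D S" and z: "z \<in> D"
  shows "curve_tangent \<A> \<phi> (p z) = range (\<lambda>v. frame (S z) (v *s tangent_vec S z))"
proof -
  let ?D = "frechet_derivative (\<phi> \<circ> p) (at z)"
  interpret transverse_frame D S by (rule adapted_transverse[OF a])
  note S = adaptedD(3,4)[OF a z]
  have f: "frame (S z) (v *s tangent_vec S z) = ?D v" for v
  proof -
    have "?D v = frame (S z) (coframe (S z) (?D v))"
      by (rule frame_coframe[OF S(1), symmetric]) (use \<phi>_tangent[OF param_p UNIV_I, of z v] S(2) in simp)
    also have "coframe (S z) (?D v) = v *s coframe (S z) (?D 1)" by (rule coframe_J[OF param_p UNIV_I S])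
    also have "coframe (S z) (?D 1) = tangent_vec S z"
      unfolding mc_linear_complex(4)[OF param_p a subset_UNIV z] w2[OF z] ..
    finally show ?thesis by (rule sym)
  qed
  show ?thesis
    unfolding f
  proof (rule equalityI; rule subsetI)
    fix B assume "B \<in> curve_tangent \<A> \<phi> (p z)"
    then obtain c v where c: "c \<in> \<A>" "p z \<in> fst c" "B = chart_deriv c \<phi> (p z) v"
      by (auto simp: curve_tangent_def)
    obtain \<mu> where "\<mu> \<noteq> 0" "\<And>v. chart_deriv c \<phi> (p z) v = ?D (\<mu> * v)"
      by (rule \<phi>_chart_deriv[OF param_p UNIV_I c(1,2)]) (rule that)
    then show "B \<in> range ?D" using c(3) by simp
  next
    fix B assume "B \<in> range ?D"
    then obtain v where B: "B = ?D v" by blast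
    obtain c where c: "c \<in> \<A>" "p z \<in> fst c" by (rule chart_exists)
    obtain \<mu> where "\<mu> \<noteq> 0" "\<And>v. chart_deriv c \<phi> (p z) v = ?D (\<mu> * v)"
      by (rule \<phi>_chart_deriv[OF param_p UNIV_I c]) (rule that)
    then have "B = chart_deriv c \<phi> (p z) (v / \<mu>)" using B by simp
    then show "B \<in> curve_tangent \<A> \<phi> (p z)" unfolding curve_tangent_def using c by blast
  qed
qed

text \<open>Real orthogonality to a complex line is Hermitian orthogonality to its generator: the
  real part of cnj v times the Hermitian product vanishes for all v, in particular for v equal to
  that product.\<close>

lemma normal_space_eq:
  assumes a: "adapted D S" and z: "z \<in> D"
  shows "normal_space \<A> \<phi> (p z) = {frame (S z) c | c. cnj (omega1 (mc S z 1)) * c $ 1 + cnj (omega3 (mc S z 1)) * c $ 3 = 0}"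
proof -
  note S = adaptedD(3,4)[OF a z]
  let ?a = "omega1 (mc S z 1)" and ?b = "omega3 (mc S z 1)"
  have g: "nk_g (\<phi> (p z)) (frame (S z) c) (frame (S z) (v *s tangent_vec S z)) = Re (cnj v * (cnj ?a * c $ 1 + cnj ?b * c $ 3))" for c v
    unfolding S(2)[symmetric] nk_g_eq[OF S(1)] coframe_frame[OF S(1)]
    by (simp add: sum_3 vector_3 algebra_simps)
  have iff: "(\<forall>B\<in>curve_tangent \<A> \<phi> (p z). nk_g (\<phi> (p z)) (frame (S z) c) B = 0) \<longleftrightarrow> cnj ?a * c $ 1 + cnj ?b * c $ 3 = 0" for c
  proof
    assume "\<forall>B\<in>curve_tangent \<A> \<phi> (p z). nk_g (\<phi> (p z)) (frame (S z) c) B = 0"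
    then have "nk_g (\<phi> (p z)) (frame (S z) c) (frame (S z) ((cnj ?a * c $ 1 + cnj ?b * c $ 3) *s tangent_vec S z)) = 0"
      unfolding curve_tangent_eq[OF a z] by blast
    then have "Re (cnj (cnj ?a * c $ 1 + cnj ?b * c $ 3) * (cnj ?a * c $ 1 + cnj ?b * c $ 3)) = 0" unfolding g .
    moreover have "Re (cnj x * x) = (cmod x)\<^sup>2" for x unfolding cmod_power2 by (simp add: power2_eq_square)
    ultimately have "(cmod (cnj ?a * c $ 1 + cnj ?b * c $ 3))\<^sup>2 = 0" by (simp only:)
    then show "cnj ?a * c $ 1 + cnj ?b * c $ 3 = 0" by simp
  next
    assume 0: "cnj ?a * c $ 1 + cnj ?b * c $ 3 = 0"
    show "\<forall>B\<in>curve_tangent \<A> \<phi> (p z). nk_g (\<phi> (p z)) (frame (S z) c) B = 0"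
      unfolding curve_tangent_eq[OF a z] ball_simps g 0 by simp
  qed
  show ?thesis
  proof (rule equalityI; rule subsetI)
    fix A assume A: "A \<in> normal_space \<A> \<phi> (p z)"
    then have t: "A \<in> tangent_CP3 (orbit_map (S z))" by (simp add: normal_space_def S(2))
    have e: "frame (S z) (coframe (S z) A) = A" by (rule frame_coframe[OF S(1) t])
    then show "A \<in> {frame (S z) c | c. cnj ?a * c $ 1 + cnj ?b * c $ 3 = 0}"
      using A iff[of "coframe (S z) A"] by (auto simp: normal_space_def intro!: exI[of _ "coframe (S z) A"])
  next
    fix A assume "A \<in> {frame (S z) c | c. cnj ?a * c $ 1 + cnj ?b * c $ 3 = 0}"
    then obtain c where c: "A = frame (S z) c" "cnj ?a * c $ 1 + cnj ?b * c $ 3 = 0" by blast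
    then show "A \<in> normal_space \<A> \<phi> (p z)"
      using frame_tangent[OF S(1), of c] iff[of c] by (simp add: normal_space_def S(2))
  qed
qed

lemma normal_proj_eq:
  assumes a: "adapted D S" and z: "z \<in> D"
  defines "\<alpha> \<equiv> omega1 (mc S z 1)" and "\<beta> \<equiv> omega3 (mc S z 1)"
  shows "normal_proj \<A> \<phi> (p z) (frame (S z) c)
    = frame (S z) (c - ((cnj \<alpha> * c $ 1 + cnj \<beta> * c $ 3) / (\<alpha> * cnj \<alpha> + \<beta> * cnj \<beta>)) *s tangent_vec S z)"
proof -
  interpret transverse_frame D S by (rule adapted_transverse[OF a])
  note S = adaptedD(3,4)[OF a z]
  define q where "q = \<alpha> * cnj \<alpha> + \<beta> * cnj \<beta>"
  have q: "q \<noteq> 0" using nz(4)[OF z] by (simp add: q_def \<alpha>_def \<beta>_def fa_def fb_def)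
  define l where "l = (cnj \<alpha> * c $ 1 + cnj \<beta> * c $ 3) / q"
  have lin: "frame (S z) x - frame (S z) y = frame (S z) (x - y)" for x y
    using frame_linear(1)[of "S z" "x - y" y] by simp
  show ?thesis
    unfolding normal_proj_def normal_space_eq[OF a z] curve_tangent_eq[OF a z] q_def[symmetric] l_def[symmetric]
      \<alpha>_def[symmetric] \<beta>_def[symmetric]
  proof (rule the_equality)
    let ?d = "c - l *s (vector [\<alpha>, 0, \<beta>] :: complex^3)"
    have "cnj \<alpha> * ?d $ 1 + cnj \<beta> * ?d $ 3 = (cnj \<alpha> * c $ 1 + cnj \<beta> * c $ 3) - l * q"
      unfolding q_def vector_minus_component vector_smult_component vector_3 by (simp add: algebra_simps)
    also have "\<dots> = 0" using q by (simp add: l_def)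
    finally have "cnj \<alpha> * ?d $ 1 + cnj \<beta> * ?d $ 3 = 0" .
    moreover have "frame (S z) c - frame (S z) ?d = frame (S z) (l *s (vector [\<alpha>, 0, \<beta>] :: complex^3))" unfolding lin by simp
    ultimately show "frame (S z) ?d \<in> {frame (S z) c | c. cnj \<alpha> * c $ 1 + cnj \<beta> * c $ 3 = 0} \<and>
      frame (S z) c - frame (S z) ?d \<in> range (\<lambda>v. frame (S z) (v *s vector [\<alpha>, 0, \<beta>]))" by blast
    fix B assume B: "B \<in> {frame (S z) c | c. cnj \<alpha> * c $ 1 + cnj \<beta> * c $ 3 = 0} \<and>
      frame (S z) c - B \<in> range (\<lambda>v. frame (S z) (v *s vector [\<alpha>, 0, \<beta>]))"
    then obtain d where d: "B = frame (S z) d" "cnj \<alpha> * d $ 1 + cnj \<beta> * d $ 3 = 0" by blast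
    obtain m where "frame (S z) c - B = frame (S z) (m *s vector [\<alpha>, 0, \<beta>])" using B by blast
    then have m: "c - d = m *s vector [\<alpha>, 0, \<beta>]" unfolding d(1) lin frame_eq_iff[OF S(1)] .
    then have m': "c $ i = d $ i + (m *s vector [\<alpha>, 0, \<beta>]) $ i" for i
      by (metis add.commute diff_add_cancel vector_add_component)
    have "cnj \<alpha> * c $ 1 + cnj \<beta> * c $ 3 = (cnj \<alpha> * d $ 1 + cnj \<beta> * d $ 3) + m * q"
      unfolding m'[of 1] m'[of 3] vector_smult_component vector_3 q_def by (simp add: algebra_simps)
    then have "l = m" unfolding l_def d(2) using q by simp
    then have "d = ?d" using m by (metis add_diff_cancel_left' diff_add_cancel diff_diff_eq2)
    then show "B = frame (S z) ?d" using d(1) by simp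
  qed
qed

text \<open>In frame coordinates the projection is complex linear, and its kernel is the tangent
  line.\<close>

lemma normal_dbar_iff:
  assumes a: "adapted D S" and z: "z \<in> D"
  shows "normal_proj \<A> \<phi> (p z) (frame (S z) c) + nk_J (\<phi> (p z)) (normal_proj \<A> \<phi> (p z) (frame (S z) d)) = 0
    \<longleftrightarrow> (\<exists>l. c + \<i> *s d = l *s tangent_vec S z)"
proof -
  interpret transverse_frame D S by (rule adapted_transverse[OF a])
  note S = adaptedD(3,4)[OF a z]
  let ?a = "omega1 (mc S z 1)" and ?b = "omega3 (mc S z 1)"
  define q where "q = ?a * cnj ?a + ?b * cnj ?b"
  have q: "q \<noteq> 0" using nz(4)[OF z] by (simp add: q_def fa_def fb_def)
  let ?Z = "tangent_vec S z"
  define n where "n c = (cnj ?a * c $ 1 + cnj ?b * c $ 3) / q" for c :: "complex^3"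
  have nZ: "n (l *s ?Z) = l" for l
    unfolding n_def vector_smult_component vector_3 using q unfolding q_def by (simp add: field_simps)
  have nn: "n (c + \<i> *s d) = n c + \<i> * n d"
    unfolding n_def vector_smult_component vector_add_component by (simp add: add_divide_distrib algebra_simps)
  have "normal_proj \<A> \<phi> (p z) (frame (S z) c) + nk_J (\<phi> (p z)) (normal_proj \<A> \<phi> (p z) (frame (S z) d))
      = frame (S z) ((c - n c *s ?Z) + \<i> *s (d - n d *s ?Z))"
    unfolding normal_proj_eq[OF a z] q_def[symmetric] n_def[symmetric] nk_J_frame[OF S] frame_linear ..
  also have "(c - n c *s ?Z) + \<i> *s (d - n d *s ?Z) = (c + \<i> *s d) - n (c + \<i> *s d) *s ?Z"
    unfolding nn by (simp add: vec_eq_iff algebra_simps)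
  finally have e: "normal_proj \<A> \<phi> (p z) (frame (S z) c) + nk_J (\<phi> (p z)) (normal_proj \<A> \<phi> (p z) (frame (S z) d))
      = frame (S z) ((c + \<i> *s d) - n (c + \<i> *s d) *s ?Z)" .
  have "frame (S z) ((c + \<i> *s d) - n (c + \<i> *s d) *s ?Z) = 0 \<longleftrightarrow> (c + \<i> *s d) - n (c + \<i> *s d) *s ?Z = 0"
    using frame_eq_iff[OF S(1), of _ 0] frame_linear(3) by metis
  also have "\<dots> \<longleftrightarrow> (\<exists>l. c + \<i> *s d = l *s ?Z)"
  proof
    assume "\<exists>l. c + \<i> *s d = l *s ?Z"
    then obtain l where l: "c + \<i> *s d = l *s ?Z" by blast
    show "(c + \<i> *s d) - n (c + \<i> *s d) *s ?Z = 0" unfolding l nZ by simp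
  next
    assume "(c + \<i> *s d) - n (c + \<i> *s d) *s ?Z = 0"
    then have "c + \<i> *s d = n (c + \<i> *s d) *s ?Z" by simp
    then show "\<exists>l. c + \<i> *s d = l *s ?Z" by blast
  qed
  finally show ?thesis unfolding e .
qed

end

section \<open>The normal bundle over the plane\<close>

context torus_curve
begin

lemma local_lift_exists:
  obtains V s where "local_lift \<A> \<phi> V s" "p z \<in> V"
proof -
  obtain D S where a: "z \<in> D" "adapted D S" by (rule adapted_obtain)
  obtain B s where B: "open B" "z \<in> B" "B \<subseteq> D" "local_lift \<A> \<phi> (p ` B) s" "\<And>w. w \<in> B \<Longrightarrow> s (p w) = S w"
    by (rule adapted_local_lift[OF param_p a(2) subset_UNIV a(1)]) (rule that)
  have "p z \<in> p ` B" using B(2) by blast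
  then show ?thesis by (rule that[OF B(4)])
qed

text \<open>The holomorphic structure is defined by testing all lifts on the surface in all charts.
  Gauge independence replaces the lift by an adapted one, and the chart contributes only the factor
  \<open>\<mu>\<close>.\<close>

lemma connection_in_adapted_frame:
  assumes a: "adapted D S" and z: "z \<in> D" and s: "local_lift \<A> \<phi> V s" "p z \<in> V" and c: "c \<in> \<A>" "p z \<in> fst c"
    and \<sigma>: "smooth_on D (\<sigma> \<circ> p)"
  obtains \<mu> where "\<mu> \<noteq> 0" "\<And>v. nk_connection c s \<sigma> (p z) v = nk_conn S (\<sigma> \<circ> p) z (\<mu> * v)"
proof -
  have oV: "open V" and sV: "surf_smooth_on \<A> V s" and ss: "\<And>x. x \<in> V \<Longrightarrow> s x \<in> Sp2 \<and> orbit_map (s x) = \<phi> x"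
    using s(1) unfolding local_lift_def by blast+
  let ?B = "D \<inter> p -` V"
  have oB: "open ?B" by (rule open_Int[OF adaptedD(1)[OF a] open_vimage_p[OF oV]])
  have zB: "z \<in> ?B" using z s(2) by simp
  have sp: "smooth_on ?B (s \<circ> p)" by (rule smooth_on_subset[OF param_smooth[OF param_p oV sV]]) blast
  have l: "lift ?B (s \<circ> p)" unfolding lift_def using oB sp ss by simp
  have l': "lift ?B S" by (rule adapted_on_lift[OF adapted_on_subset[OF a oB]]) blast
  have \<sigma>B: "smooth_on ?B (\<sigma> \<circ> p)" by (rule smooth_on_subset[OF \<sigma>]) blast
  have cs: "k_smooth_on k ?B (\<lambda>y. coframe ((s \<circ> p) y) ((\<sigma> \<circ> p) y))" for k
    by (rule k_smooth_on_coframe[OF oB smooth_onD[OF sp] smooth_onD[OF \<sigma>B]])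
  have cd: "(\<lambda>y. coframe ((s \<circ> p) y) ((\<sigma> \<circ> p) y)) differentiable (at z)"
    by (rule k_smooth_on_differentiable[OF cs zB])
  have sd: "(s \<circ> p) differentiable (at z)" by (rule k_smooth_on_differentiable[OF smooth_onD[OF sp] zB])
  obtain \<mu> where \<mu>: "\<mu> \<noteq> 0" "\<And>(f :: 'x \<Rightarrow> complex^4^4) v. (f \<circ> p) differentiable (at z) \<Longrightarrow>
      chart_deriv c f (p z) v = frechet_derivative (f \<circ> p) (at z) (\<mu> * v)"
    "\<And>(f :: 'x \<Rightarrow> complex^3) v. (f \<circ> p) differentiable (at z) \<Longrightarrow>
      chart_deriv c f (p z) v = frechet_derivative (f \<circ> p) (at z) (\<mu> * v)"
    by (rule param_chart_deriv2[OF param_p UNIV_I c]) (rule that)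
  show thesis
  proof (rule that[OF \<mu>(1)])
    fix v
    have 1: "chart_deriv c (\<lambda>y. coframe (s y) (\<sigma> y)) (p z) v
      = frechet_derivative (\<lambda>y. coframe ((s \<circ> p) y) ((\<sigma> \<circ> p) y)) (at z) (\<mu> * v)"
      using \<mu>(3)[of "\<lambda>y. coframe (s y) (\<sigma> y)" v] cd by (simp add: comp_def)
    have 2: "mc_pullback c s (p z) v = mc (s \<circ> p) z (\<mu> * v)"
      unfolding mc_pullback_def mc_def \<mu>(2)[OF sd] by simp
    have "nk_connection c s \<sigma> (p z) v = nk_conn (s \<circ> p) (\<sigma> \<circ> p) z (\<mu> * v)"
      unfolding nk_connection_def nk_conn_def 1 2 by simp
    also have "\<dots> = nk_conn S (\<sigma> \<circ> p) z (\<mu> * v)"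
      by (rule nk_conn_gauge[OF l l' _ zB cd]) (use ss adaptedD(4)[OF a] in simp)
    finally show "nk_connection c s \<sigma> (p z) v = nk_conn S (\<sigma> \<circ> p) z (\<mu> * v)" .
  qed
qed

text \<open>An arbitrary choice at each point, without continuity in z; by
  \<open>adapted_independent\<close> the objects built from it do not depend on the choice.\<close>

definition some_adapted :: "complex \<Rightarrow> complex \<Rightarrow> complex^4^4" where
  "some_adapted z = (SOME S. \<exists>D. z \<in> D \<and> adapted D S)"

definition normal_frame :: "complex \<Rightarrow> complex^2 \<Rightarrow> complex^4^4" where
  "normal_frame z w = frame (some_adapted z z) (adapted_frame.normal_vec (some_adapted z) z w)"

definition tau_square :: "complex \<Rightarrow> real" where
  "tau_square z = (cmod (tau (mc (some_adapted z) z 1)))\<^sup>2"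

lemma some_adapted: obtains D where "z \<in> D" "adapted D (some_adapted z)"
proof -
  obtain D0 S0 where "z \<in> D0" "adapted D0 S0" by (rule adapted_obtain)
  then have "\<exists>S D. z \<in> D \<and> adapted D S" by (intro exI conjI)
  from someI_ex[OF this] obtain D where "z \<in> D" "adapted D (some_adapted z)"
    unfolding some_adapted_def by (elim exE conjE)
  then show ?thesis by (rule that)
qed

lemma unimodular_square: "cnj k * k = 1 \<Longrightarrow> (k * a) * cnj (k * a) = a * cnj a" for k a :: complex
proof -
  assume k: "cnj k * k = 1"
  have "(k * a) * cnj (k * a) = (cnj k * k) * (a * cnj a)" by (simp add: mult_ac)
  then show ?thesis by (simp add: k)
qed

text \<open>The coframe components and the coefficients in \<open>normal_vec\<close> carry the same
  torus weights, so \<open>w\<close> describes the same vector in either lift; tau changes by a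
  unimodular factor.\<close>

lemma adapted_independent:
  assumes a: "adapted D S" "adapted D' S'" and z: "z \<in> D" "z \<in> D'"
  shows "frame (S z) (adapted_frame.normal_vec S z w) = frame (S' z) (adapted_frame.normal_vec S' z w)"
    "cmod (tau (mc S z 1)) = cmod (tau (mc S' z 1))"
proof -
  interpret S: transverse_frame D S by (rule adapted_transverse[OF a(1)])
  interpret S': transverse_frame D' S' by (rule adapted_transverse[OF a(2)])
  obtain k1 k3 where k: "cnj k1 * k1 = 1" "cnj k3 * k3 = 1"
    "\<And>A. coframe (S' z) A $ 1 = cnj k1 * k3 * coframe (S z) A $ 1"
    "\<And>A. coframe (S' z) A $ 2 = cnj k1 * cnj k3 * coframe (S z) A $ 2"
    "\<And>A. coframe (S' z) A $ 3 = k1 * k1 * coframe (S z) A $ 3"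
    "omega1 (mc S' z 1) = cnj k1 * k3 * omega1 (mc S z 1)"
    "omega3 (mc S' z 1) = k1 * k1 * omega3 (mc S z 1)"
    "tau (mc S' z 1) = cnj k3 * cnj k3 * tau (mc S z 1)"
    by (rule adapted_unique[OF param_p a subset_UNIV subset_UNIV z]) (rule that)
  have n: "cmod k3 = 1"
  proof -
    have "(cmod k3)\<^sup>2 = cmod (cnj k3 * k3)" by (simp add: norm_mult power2_eq_square)
    then have "(cmod k3)\<^sup>2 = 1" by (simp add: k(2))
    then show ?thesis using norm_ge_zero[of k3] unfolding power2_eq_1_iff by linarith
  qed
  then show "cmod (tau (mc S z 1)) = cmod (tau (mc S' z 1))" unfolding k(8) by (simp add: norm_mult)
  have u: "cnj (cnj k1 * k3) * (cnj k1 * k3) = 1" "cnj (k1 * k1) * (k1 * k1) = 1"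
  proof -
    have "cnj (cnj k1 * k3) * (cnj k1 * k3) = (cnj k1 * k1) * (cnj k3 * k3)" by (simp add: mult_ac)
    then show "cnj (cnj k1 * k3) * (cnj k1 * k3) = 1" by (simp add: k)
    have "cnj (k1 * k1) * (k1 * k1) = (cnj k1 * k1) * (cnj k1 * k1)" by (simp add: mult_ac)
    then show "cnj (k1 * k1) * (k1 * k1) = 1" by (simp add: k)
  qed
  let ?A = "frame (S z) (S.normal_vec z w)"
  have aa: "S'.fa z * cnj (S'.fa z) = S.fa z * cnj (S.fa z)" "S'.fb z * cnj (S'.fb z) = S.fb z * cnj (S.fb z)"
    unfolding S.fa_def S'.fa_def S.fb_def S'.fb_def k(6,7) by (rule unimodular_square[OF u(1)], rule unimodular_square[OF u(2)])
  have at: "S'.fa z * S'.ft z = cnj k1 * cnj k3 * (S.fa z * S.ft z)"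
  proof -
    have "S'.fa z * S'.ft z = cnj k1 * (cnj k3 * k3) * cnj k3 * (S.fa z * S.ft z)"
      unfolding S.fa_def S'.fa_def S.ft_def S'.ft_def k(6,8) by (simp only: mult_ac)
    then show ?thesis by (simp add: k)
  qed
  have "coframe (S' z) ?A = S'.normal_vec z w"
    unfolding vec_eq_iff forall_3 k(3-5) coframe_frame[OF adaptedD(3)[OF a(1) z(1)]] S.normal_vec_def S'.normal_vec_def vector_3 aa at
    by (simp add: S.fa_def S'.fa_def S.fb_def S'.fb_def k(6,7) mult_ac)
  moreover have "?A \<in> tangent_CP3 (orbit_map (S' z))"
    using frame_tangent[OF adaptedD(3)[OF a(1) z(1)]] adaptedD(4)[OF a(1) z(1)] adaptedD(4)[OF a(2) z(2)] by simp
  ultimately show "?A = frame (S' z) (S'.normal_vec z w)"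
    using frame_coframe[OF adaptedD(3)[OF a(2) z(2)], of ?A] by simp
qed

lemma normal_frame_eq:
  assumes "adapted D S" "z \<in> D"
  shows "normal_frame z w = frame (S z) (adapted_frame.normal_vec S z w)" "tau_square z = (cmod (tau (mc S z 1)))\<^sup>2"
proof -
  obtain D' where D': "z \<in> D'" "adapted D' (some_adapted z)" by (rule some_adapted)
  show "normal_frame z w = frame (S z) (adapted_frame.normal_vec S z w)"
    unfolding normal_frame_def by (rule adapted_independent(1)[OF D'(2) assms(1) D'(1) assms(2)])
  show "tau_square z = (cmod (tau (mc S z 1)))\<^sup>2"
    unfolding tau_square_def adapted_independent(2)[OF D'(2) assms(1) D'(1) assms(2)] ..
qed

text \<open>A deck translate of an adapted lift is adapted over the same curve and has the
  translated Maurer-Cartan values.\<close>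

lemma normal_frame_deck:
  assumes "p z = p z'" shows "normal_frame z' = normal_frame z" "tau_square z' = tau_square z"
proof -
  define l where "l = z' - z"
  have pl: "p (y + l) = p y" for y using deck[OF assms, of "y - z"] by (simp add: l_def algebra_simps)
  obtain D S where a: "z' \<in> D" "adapted D S" by (rule adapted_obtain)
  define B where "B = (\<lambda>y. y + l) -` D"
  have oB: "open B" unfolding B_def by (rule open_vimage[OF adaptedD(1)[OF a(2)]]) (intro continuous_intros)
  have zB: "z \<in> B" using a(1) by (simp add: B_def l_def)
  have hl: "(\<lambda>y. y + l) holomorphic_on B" by (intro holomorphic_intros)
  have dl: "deriv (\<lambda>y. y + l) y = 1" for y by (rule DERIV_imp_deriv) (auto intro!: derivative_eq_intros)
  have m: "mc (\<lambda>y. S (y + l)) y v = mc S (y + l) v" if "y \<in> B" for y v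
    using mc_compose[OF adapted_on_lift[OF a(2)] hl oB that, of v] that by (simp add: dl B_def)
  have aB: "adapted B (\<lambda>y. S (y + l))"
    unfolding adapted_on_def
  proof (intro conjI ballI oB)
    show "smooth_on B (\<lambda>y. S (y + l))"
      by (rule smooth_on_compose_holomorphic[OF oB adaptedD(1)[OF a(2)] hl _ adaptedD(2)[OF a(2)]]) (auto simp: B_def)
    fix y assume y: "y \<in> B"
    then have y': "y + l \<in> D" by (simp add: B_def)
    show "S (y + l) \<in> Sp2" by (rule adaptedD(3)[OF a(2) y'])
    show "orbit_map (S (y + l)) = (\<phi> \<circ> p) y" using adaptedD(4)[OF a(2) y'] by (simp add: pl)
    show "omega2 (mc (\<lambda>y. S (y + l)) y 1) = 0" unfolding m[OF y] using a(2) y' by (simp add: adapted_on_def)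
  qed
  interpret T: transverse_frame B "\<lambda>y. S (y + l)" by (rule adapted_transverse[OF aB])
  interpret S: transverse_frame D S by (rule adapted_transverse[OF a(2)])
  have zl: "z + l = z'" by (simp add: l_def)
  have "T.normal_vec z w = S.normal_vec z' w" for w
    unfolding S.normal_vec_def T.normal_vec_def S.fa_def T.fa_def S.fb_def T.fb_def S.ft_def T.ft_def m[OF zB] zl ..
  then show "normal_frame z' = normal_frame z"
    by (intro ext) (simp add: normal_frame_eq(1)[OF a(2,1)] normal_frame_eq(1)[OF aB zB] zl)
  show "tau_square z' = tau_square z"
    unfolding normal_frame_eq(2)[OF a(2,1)] normal_frame_eq(2)[OF aB zB] m[OF zB] zl ..
qed

lemma normal_frame_bij: "bij_betw (normal_frame z) UNIV (normal_space \<A> \<phi> (p z))"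
proof -
  obtain D S where a: "z \<in> D" "adapted D S" by (rule adapted_obtain)
  interpret S: transverse_frame D S by (rule adapted_transverse[OF a(2)])
  note Sz = adaptedD(3)[OF a(2,1)]
  show ?thesis
    unfolding bij_betw_def normal_space_eq[OF a(2,1)]
  proof (intro conjI)
    show "inj (normal_frame z)"
    proof (rule injI)
      fix w w' assume "normal_frame z w = normal_frame z w'"
      then have "S.normal_vec z w = S.normal_vec z w'"
        unfolding normal_frame_eq(1)[OF a(2,1)] frame_eq_iff[OF Sz] .
      then have "w $ 1 = w' $ 1" "w $ 2 = w' $ 2"
        using S.normal_vec_coords[OF a(1), of w] S.normal_vec_coords[OF a(1), of w'] by metis+
      then show "w = w'" by (simp add: vec_eq_iff forall_2)
    qed
    show "range (normal_frame z) = {frame (S z) c |c. cnj (omega1 (mc S z 1)) * c $ 1 + cnj (omega3 (mc S z 1)) * c $ 3 = 0}"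
    proof (rule equalityI; rule subsetI)
      fix A assume "A \<in> range (normal_frame z)"
      then obtain w where "A = frame (S z) (S.normal_vec z w)" unfolding normal_frame_eq(1)[OF a(2,1)] by blast
      then show "A \<in> {frame (S z) c |c. cnj (omega1 (mc S z 1)) * c $ 1 + cnj (omega3 (mc S z 1)) * c $ 3 = 0}"
        using S.normal_vec_normal[of z w] unfolding S.fa_def S.fb_def by blast
    next
      fix A assume "A \<in> {frame (S z) c |c. cnj (omega1 (mc S z 1)) * c $ 1 + cnj (omega3 (mc S z 1)) * c $ 3 = 0}"
      then obtain c where c: "A = frame (S z) c" "cnj (S.fa z) * c $ 1 + cnj (S.fb z) * c $ 3 = 0"
        unfolding S.fa_def S.fb_def by blast
      have "A = normal_frame z (vec2 (c $ 1 / S.fa z - c $ 3 / S.fb z) (c $ 2 / (S.fa z * S.ft z)))"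
        unfolding c(1) normal_frame_eq(1)[OF a(2,1)] S.normal_vec_eqI[OF a(1) c(2), symmetric] ..
      then show "A \<in> range (normal_frame z)" by blast
    qed
  qed
qed

lemma normal_frame_linear:
  "normal_frame z (w + w') = normal_frame z w + normal_frame z w'"
  "normal_frame z (a *s w) = Re a *\<^sub>R normal_frame z w + Im a *\<^sub>R nk_J (\<phi> (p z)) (normal_frame z w)"
proof -
  obtain D S where a: "z \<in> D" "adapted D S" by (rule adapted_obtain)
  interpret S: transverse_frame D S by (rule adapted_transverse[OF a(2)])
  note Sz = adaptedD(3,4)[OF a(2,1)]
  have l: "S.normal_vec z (w + w') = S.normal_vec z w + S.normal_vec z w'"
    by (simp add: vec_eq_iff forall_3 S.normal_vec_def vector_3 distrib_left add_divide_distrib diff_divide_distrib)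
  have c: "S.normal_vec z (a *s w) = a *s S.normal_vec z w" for a
    by (simp add: vec_eq_iff forall_3 S.normal_vec_def vector_3 mult_ac)
  show "normal_frame z (w + w') = normal_frame z w + normal_frame z w'"
    unfolding normal_frame_eq(1)[OF a(2,1)] l frame_linear ..
  show "normal_frame z (a *s w) = Re a *\<^sub>R normal_frame z w + Im a *\<^sub>R nk_J (\<phi> (p z)) (normal_frame z w)"
    unfolding normal_frame_eq(1)[OF a(2,1)] c nk_J_frame[OF Sz] by (rule frame_complex)
qed

end

context transverse_frame
begin

lemma smooth_normal_vec:
  assumes oB: "open B" "B \<subseteq> D" and w: "\<And>i. smooth_on B (\<lambda>y. w y $ i)"
  shows "k_smooth_on k B (\<lambda>y. normal_vec y (w y) $ i)"
proof -
  have fa: "k_smooth_on k B fa" "k_smooth_on k B fb" "k_smooth_on k B ft"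
    by (rule smooth_onD[OF smooth_on_subset[OF smooth_coeffs(1) oB(2)]], rule smooth_onD[OF smooth_on_subset[OF smooth_coeffs(2) oB(2)]],
        rule smooth_onD[OF smooth_on_subset[OF smooth_coeffs(3) oB(2)]])
  note wk = smooth_onD[OF w]
  have aa: "k_smooth_on k B (\<lambda>y. fa y * cnj (fa y))" "k_smooth_on k B (\<lambda>y. fb y * cnj (fb y))"
    by (rule k_smooth_on_mult[OF oB(1) fa(1) k_smooth_on_cnj[OF oB(1) fa(1)]],
        rule k_smooth_on_mult[OF oB(1) fa(2) k_smooth_on_cnj[OF oB(1) fa(2)]])
  have q: "k_smooth_on k B (\<lambda>y. fa y * cnj (fa y) + fb y * cnj (fb y))" by (rule k_smooth_on_add[OF oB(1) aa])
  have qn: "fa y * cnj (fa y) + fb y * cnj (fb y) \<noteq> 0" if "y \<in> B" for y using nz(4) that oB(2) by blast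
  have "k_smooth_on k B (\<lambda>y. normal_vec y (w y) $ 1)" "k_smooth_on k B (\<lambda>y. normal_vec y (w y) $ 2)"
    "k_smooth_on k B (\<lambda>y. normal_vec y (w y) $ 3)"
    unfolding normal_vec_def vector_3
    by (rule k_smooth_on_divide[OF oB(1) qn k_smooth_on_mult[OF oB(1) k_smooth_on_mult[OF oB(1) fa(1) aa(2)] wk] q], assumption,
        rule k_smooth_on_mult[OF oB(1) k_smooth_on_mult[OF oB(1) fa(1) fa(3)] wk],
        rule k_smooth_on_divide[OF oB(1) qn k_smooth_on_mult[OF oB(1) k_smooth_on_mult[OF oB(1) k_smooth_on_minus[OF oB(1) fa(2)] aa(1)] wk] q], assumption)
  then show ?thesis using exhaust_3[of i] by metis
qed

end

context torus_curve
begin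

text \<open>Smoothness is read off in any adapted lift, where passing between \<open>w\<close> and
  coframe components only divides by smooth functions without zeros.\<close>

lemma smooth_normal_section:
  assumes oD: "open D0" and w: "\<And>z. z \<in> D0 \<Longrightarrow> \<sigma> (p z) = normal_frame z (w z)"
  shows "smooth_on D0 (\<sigma> \<circ> p) \<longleftrightarrow> (\<forall>i. smooth_on D0 (\<lambda>z. w z $ i))"
proof
  assume s: "smooth_on D0 (\<sigma> \<circ> p)"
  have "smooth_on D0 (\<lambda>z. w z $ i)" if i: "i = 1 \<or> i = 2" for i
  proof (rule smooth_on_local)
    fix z assume z: "z \<in> D0"
    obtain D S where a: "z \<in> D" "adapted D S" by (rule adapted_obtain)
    interpret S: transverse_frame D S by (rule adapted_transverse[OF a(2)])
    let ?B = "D \<inter> D0"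
    have oB: "open ?B" by (rule open_Int[OF adaptedD(1)[OF a(2)] oD])
    have sub: "?B \<subseteq> D" "?B \<subseteq> D0" by blast+
    have c: "k_smooth_on k ?B (\<lambda>y. coframe (S y) ((\<sigma> \<circ> p) y))" for k
      by (rule k_smooth_on_coframe[OF oB smooth_onD[OF smooth_on_subset[OF adaptedD(2)[OF a(2)] sub(1)]]
          smooth_onD[OF smooth_on_subset[OF s sub(2)]]])
    have ce: "coframe (S y) ((\<sigma> \<circ> p) y) = S.normal_vec y (w y)" if "y \<in> ?B" for y
      using that w[of y] normal_frame_eq(1)[OF a(2), of y] coframe_frame[OF adaptedD(3)[OF a(2), of y]] by simp
    have n: "k_smooth_on k ?B (\<lambda>y. S.normal_vec y (w y) $ j)" for k j
      by (rule k_smooth_on_cong[THEN iffD1, OF oB _ k_smooth_on_vec_nth[OF oB c, where i = j]])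
        (rule arg_cong[of _ _ "\<lambda>v. v $ j"], rule ce)
    have fa: "k_smooth_on k ?B S.fa" "k_smooth_on k ?B S.fb" "k_smooth_on k ?B S.ft" for k
      by (rule smooth_onD[OF smooth_on_subset[OF S.smooth_coeffs(1) sub(1)]], rule smooth_onD[OF smooth_on_subset[OF S.smooth_coeffs(2) sub(1)]],
          rule smooth_onD[OF smooth_on_subset[OF S.smooth_coeffs(3) sub(1)]])
    have nzB: "S.fa y \<noteq> 0" "S.fb y \<noteq> 0" "S.fa y * S.ft y \<noteq> 0" if "y \<in> ?B" for y using S.nz[of y] that by auto
    have 1: "k_smooth_on k ?B (\<lambda>y. w y $ 1)" for k
      by (rule k_smooth_on_cong[THEN iffD1, OF oB _ k_smooth_on_diff[OF oB k_smooth_on_divide[OF oB nzB(1) n[of _ 1] fa(1)] k_smooth_on_divide[OF oB nzB(2) n[of _ 3] fa(2)]]])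
         (auto simp: S.normal_vec_coords)
    have 2: "k_smooth_on k ?B (\<lambda>y. w y $ 2)" for k
      by (rule k_smooth_on_cong[THEN iffD1, OF oB _ k_smooth_on_divide[OF oB nzB(3) n[of _ 2] k_smooth_on_mult[OF oB fa(1) fa(3)]]])
         (auto simp: S.normal_vec_coords)
    have "smooth_on ?B (\<lambda>z. w z $ i)" unfolding smooth_on_def using i 1 2 by blast
    then show "\<exists>T. open T \<and> z \<in> T \<and> smooth_on T (\<lambda>z. w z $ i)" using oB a(1) z by blast
  qed
  then show "\<forall>i. smooth_on D0 (\<lambda>z. w z $ i)" using exhaust_2 by blast
next
  assume s: "\<forall>i. smooth_on D0 (\<lambda>z. w z $ i)"
  show "smooth_on D0 (\<sigma> \<circ> p)"
  proof (rule smooth_on_local)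
    fix z assume z: "z \<in> D0"
    obtain D S where a: "z \<in> D" "adapted D S" by (rule adapted_obtain)
    interpret S: transverse_frame D S by (rule adapted_transverse[OF a(2)])
    let ?B = "D \<inter> D0"
    have oB: "open ?B" by (rule open_Int[OF adaptedD(1)[OF a(2)] oD])
    have sub: "?B \<subseteq> D" "?B \<subseteq> D0" by blast+
    have ws: "smooth_on ?B (\<lambda>z. w z $ i)" for i by (rule smooth_on_subset[OF s[rule_format] sub(2)])
    have "k_smooth_on k ?B (\<sigma> \<circ> p)" for k
    proof (rule k_smooth_on_cong[THEN iffD1, OF oB])
      show "k_smooth_on k ?B (\<lambda>y. frame (S y) (S.normal_vec y (w y)))"
        by (rule k_smooth_on_frame[OF oB smooth_onD[OF smooth_on_subset[OF adaptedD(2)[OF a(2)] sub(1)]]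
            S.smooth_normal_vec[OF oB sub(1) ws]])
      show "frame (S y) (S.normal_vec y (w y)) = (\<sigma> \<circ> p) y" if "y \<in> ?B" for y
        using that w[of y] normal_frame_eq(1)[OF a(2), of y] by simp
    qed
    then have "smooth_on ?B (\<sigma> \<circ> p)" unfolding smooth_on_def by blast
    then show "\<exists>T. open T \<and> z \<in> T \<and> smooth_on T (\<sigma> \<circ> p)" using oB a(1) z by blast
  qed
qed

lemma normal_connection_dbar:
  assumes a: "adapted D S" and z: "z \<in> D" and s: "local_lift \<A> \<phi> V s" "p z \<in> V" and c: "c \<in> \<A>" "p z \<in> fst c"
    and \<sigma>: "smooth_on D (\<sigma> \<circ> p)"
  obtains \<mu> where "\<mu> \<noteq> 0" "\<And>v. (normal_connection \<A> \<phi> c s \<sigma> (p z) v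
        + nk_J (\<phi> (p z)) (normal_connection \<A> \<phi> c s \<sigma> (p z) (\<i> * v)) = 0) \<longleftrightarrow>
     (\<exists>l. cnj (\<mu> * v) *s adapted_frame.dbar_conn S (\<lambda>y. coframe (S y) ((\<sigma> \<circ> p) y)) z = l *s tangent_vec S z)"
proof -
  interpret S: transverse_frame D S by (rule adapted_transverse[OF a])
  obtain \<mu> where \<mu>: "\<mu> \<noteq> 0" "\<And>v. nk_connection c s \<sigma> (p z) v = nk_conn S (\<sigma> \<circ> p) z (\<mu> * v)"
    by (rule connection_in_adapted_frame[OF a z s c \<sigma>]) (rule that)
  let ?c = "\<lambda>y. coframe (S y) ((\<sigma> \<circ> p) y)"
  have "k_smooth_on k D ?c" for k
    by (rule k_smooth_on_coframe[OF adaptedD(1)[OF a] smooth_onD[OF adaptedD(2)[OF a]] smooth_onD[OF \<sigma>]])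
  then have cd: "?c differentiable (at z)" by (rule k_smooth_on_differentiable[OF _ z])
  show thesis
  proof (rule that[OF \<mu>(1)])
    fix v
    have e: "\<mu> * (\<i> * v) = \<i> * (\<mu> * v)" by (simp add: mult_ac)
    show "(normal_connection \<A> \<phi> c s \<sigma> (p z) v
        + nk_J (\<phi> (p z)) (normal_connection \<A> \<phi> c s \<sigma> (p z) (\<i> * v)) = 0) \<longleftrightarrow>
     (\<exists>l. cnj (\<mu> * v) *s S.dbar_conn ?c z = l *s tangent_vec S z)"
      unfolding normal_connection_def \<mu>(2) e nk_conn_def normal_dbar_iff[OF a z] S.dbar_conn_type[OF z cd] ..
  qed
qed

text \<open>The condition over all lifts, charts and directions collapses at each point to one
  equation in one adapted lift, which \<open>dbar_conn_normal_vec\<close> translates into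
  coordinates.\<close>

lemma normal_holomorphic_iff:
  assumes oD: "open D0" and w: "\<And>z. z \<in> D0 \<Longrightarrow> \<sigma> (p z) = normal_frame z (w z)"
  shows "normal_holomorphic \<A> \<phi> (p ` D0) \<sigma> \<longleftrightarrow> (\<forall>i. smooth_on D0 (\<lambda>z. w z $ i)) \<and>
    (\<forall>z\<in>D0. dbar (\<lambda>y. w y $ 2) z = 0 \<and> dbar (\<lambda>y. w y $ 1) z = of_real (tau_square z) * w z $ 2)"
proof -
  have oU: "open (p ` D0)" by (rule param_open_map[OF param_p oD subset_UNIV])
  have pD: "param \<A> D0 p" by (rule param_subset[OF param_p oD subset_UNIV])
  have sm: "surf_smooth_on \<A> (p ` D0) \<sigma> \<longleftrightarrow> smooth_on D0 (\<sigma> \<circ> p)"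
  proof
    assume "surf_smooth_on \<A> (p ` D0) \<sigma>"
    from param_smooth[OF param_p oU this] show "smooth_on D0 (\<sigma> \<circ> p)"
      by (rule smooth_on_subset) blast
  next
    assume s: "smooth_on D0 (\<sigma> \<circ> p)"
    show "surf_smooth_on \<A> (p ` D0) \<sigma>"
      by (rule surf_smooth_onI[OF pD oU order_refl smooth_on_subset[OF s]]) blast
  qed
  have ns: "\<sigma> x \<in> normal_space \<A> \<phi> x" if "x \<in> p ` D0" for x
  proof -
    obtain z where z: "z \<in> D0" "x = p z" using \<open>x \<in> p ` D0\<close> by blast
    show ?thesis unfolding z(2) w[OF z(1)] by (rule bij_betwE[OF normal_frame_bij, rule_format, OF UNIV_I])
  qed
  define Q where "Q c s x \<longleftrightarrow> (\<forall>v. normal_connection \<A> \<phi> c s \<sigma> x v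
      + nk_J (\<phi> x) (normal_connection \<A> \<phi> c s \<sigma> x (\<i> * v)) = 0)" for c s x
  define good where "good x \<longleftrightarrow> (\<forall>V s. local_lift \<A> \<phi> V s \<longrightarrow> x \<in> V \<longrightarrow> (\<forall>c\<in>\<A>. x \<in> fst c \<longrightarrow> Q c s x))" for x
  have nh: "normal_holomorphic \<A> \<phi> (p ` D0) \<sigma> \<longleftrightarrow> smooth_on D0 (\<sigma> \<circ> p) \<and> (\<forall>z\<in>D0. good (p z))"
    unfolding normal_holomorphic_def sm Q_def[symmetric]
  proof (intro iffI conjI ballI allI impI)
    show "good (p z)" if "smooth_on D0 (\<sigma> \<circ> p) \<and> (\<forall>x\<in>p ` D0. \<sigma> x \<in> normal_space \<A> \<phi> x) \<and>
      (\<forall>V s. local_lift \<A> \<phi> V s \<longrightarrow> (\<forall>c\<in>\<A>. \<forall>x\<in>p ` D0 \<inter> V \<inter> fst c. Q c s x))" "z \<in> D0" for z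
      unfolding good_def using that by blast
    show "Q c s x" if "smooth_on D0 (\<sigma> \<circ> p) \<and> (\<forall>z\<in>D0. good (p z))" "local_lift \<A> \<phi> V s" "c \<in> \<A>" "x \<in> p ` D0 \<inter> V \<inter> fst c"
      for V s c x using that unfolding good_def by blast
  qed (use ns in blast)+
  have g: "good (p z) \<longleftrightarrow> dbar (\<lambda>y. w y $ 2) z = 0 \<and> dbar (\<lambda>y. w y $ 1) z = of_real (tau_square z) * w z $ 2"
    if s: "smooth_on D0 (\<sigma> \<circ> p)" and z: "z \<in> D0" for z
  proof -
    obtain D' S where a': "z \<in> D'" "adapted D' S" by (rule adapted_obtain)
    define D where "D = D' \<inter> D0"
    have oB: "open D" unfolding D_def by (rule open_Int[OF adaptedD(1)[OF a'(2)] oD])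
    have a: "adapted D S" by (rule adapted_on_subset[OF a'(2) oB]) (simp add: D_def)
    have zD: "z \<in> D" using a'(1) z by (simp add: D_def)
    have sD: "smooth_on D (\<sigma> \<circ> p)" by (rule smooth_on_subset[OF s]) (simp add: D_def)
    interpret S: transverse_frame D S by (rule adapted_transverse[OF a])
    let ?c = "\<lambda>y. coframe (S y) ((\<sigma> \<circ> p) y)"
    have ce: "?c y = S.normal_vec y (w y)" if "y \<in> D" for y
      using that w[of y] normal_frame_eq(1)[OF a that] coframe_frame[OF adaptedD(3)[OF a that]] by (simp add: D_def)
    have "k_smooth_on k D ?c" for k
      by (rule k_smooth_on_coframe[OF oB smooth_onD[OF adaptedD(2)[OF a]] smooth_onD[OF sD]])
    then have cd: "?c differentiable (at z)" by (rule k_smooth_on_differentiable[OF _ zD])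
    have ws: "smooth_on D0 (\<lambda>z. w z $ i)" for i
      using smooth_normal_section[of D0 \<sigma> w, OF oD w] s by blast
    have wd: "(\<lambda>y. w y $ i) differentiable (at z)" for i
      by (rule k_smooth_on_differentiable[OF smooth_onD[OF ws] z])
    have tt: "S.ft z * cnj (S.ft z) = of_real (tau_square z)"
      unfolding normal_frame_eq(2)[OF a zD] S.ft_def complex_norm_square ..
    have tv: "tangent_vec S z = vector [S.fa z, 0, S.fb z]" unfolding S.fa_def S.fb_def ..
    have iff: "(\<exists>l. S.dbar_conn ?c z = l *s tangent_vec S z) \<longleftrightarrow>
      dbar (\<lambda>y. w y $ 2) z = 0 \<and> dbar (\<lambda>y. w y $ 1) z = of_real (tau_square z) * w z $ 2"
      unfolding tv tt[symmetric] by (rule S.dbar_conn_normal_vec[OF oB order_refl zD wd ce cd])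
    have "good (p z) \<longleftrightarrow> (\<exists>l. S.dbar_conn ?c z = l *s tangent_vec S z)"
    proof
      assume g: "good (p z)"
      obtain V s where V: "local_lift \<A> \<phi> V s" "p z \<in> V" by (rule local_lift_exists)
      obtain c where c: "c \<in> \<A>" "p z \<in> fst c" by (rule chart_exists)
      obtain \<mu> where \<mu>: "\<mu> \<noteq> 0" "\<And>v. (normal_connection \<A> \<phi> c s \<sigma> (p z) v
        + nk_J (\<phi> (p z)) (normal_connection \<A> \<phi> c s \<sigma> (p z) (\<i> * v)) = 0) \<longleftrightarrow>
        (\<exists>l. cnj (\<mu> * v) *s S.dbar_conn ?c z = l *s tangent_vec S z)"
        by (rule normal_connection_dbar[OF a zD V c sD]) (rule that)
      \<comment> \<open>The direction \<open>inverse \<mu>\<close> of the chart is the coordinate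
        vector 1 of the plane.\<close>
      have "normal_connection \<A> \<phi> c s \<sigma> (p z) (inverse \<mu>)
        + nk_J (\<phi> (p z)) (normal_connection \<A> \<phi> c s \<sigma> (p z) (\<i> * inverse \<mu>)) = 0"
        using g V c unfolding good_def Q_def by blast
      then show "\<exists>l. S.dbar_conn ?c z = l *s tangent_vec S z" unfolding \<mu>(2) using \<mu>(1) by simp
    next
      assume "\<exists>l. S.dbar_conn ?c z = l *s tangent_vec S z"
      then obtain l where l: "S.dbar_conn ?c z = l *s tangent_vec S z" by blast
      show "good (p z)"
        unfolding good_def Q_def
      proof (intro allI impI ballI)
        fix V s c v assume V: "local_lift \<A> \<phi> V s" "p z \<in> V" and c: "c \<in> \<A>" "p z \<in> fst c"
        obtain \<mu> where \<mu>: "\<mu> \<noteq> 0" "\<And>v. (normal_connection \<A> \<phi> c s \<sigma> (p z) v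
          + nk_J (\<phi> (p z)) (normal_connection \<A> \<phi> c s \<sigma> (p z) (\<i> * v)) = 0) \<longleftrightarrow>
          (\<exists>l. cnj (\<mu> * v) *s S.dbar_conn ?c z = l *s tangent_vec S z)"
          by (rule normal_connection_dbar[OF a zD V c sD]) (rule that)
        have "cnj (\<mu> * v) *s S.dbar_conn ?c z = (cnj (\<mu> * v) * l) *s tangent_vec S z"
          unfolding l by (simp add: vec_eq_iff mult.assoc)
        then show "normal_connection \<A> \<phi> c s \<sigma> (p z) v
          + nk_J (\<phi> (p z)) (normal_connection \<A> \<phi> c s \<sigma> (p z) (\<i> * v)) = 0" unfolding \<mu>(2) by blast
      qed
    qed
    then show ?thesis unfolding iff .
  qed
  have "(\<forall>i. smooth_on D0 (\<lambda>z. w z $ i)) \<longleftrightarrow> smooth_on D0 (\<sigma> \<circ> p)"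
    by (rule smooth_normal_section[of D0 \<sigma> w, OF oD w, symmetric])
  then show ?thesis unfolding nh using g by (metis (no_types, lifting))
qed

lemma tau_square_pos: "tau_square z > 0"
proof -
  obtain D S where a: "z \<in> D" "adapted D S" by (rule adapted_obtain)
  show ?thesis unfolding normal_frame_eq(2)[OF a(2,1)]
    using tau_nonzero[OF param_p a(2) subset_UNIV a(1)] by simp
qed

lemma tau_square_smooth: "k_smooth_on k UNIV (\<lambda>z. complex_of_real (tau_square z))"
proof (rule k_smooth_on_local)
  fix z :: complex
  obtain D S where a: "z \<in> D" "adapted D S" by (rule adapted_obtain)
  interpret S: transverse_frame D S by (rule adapted_transverse[OF a(2)])
  note oD = adaptedD(1)[OF a(2)]
  have ft: "k_smooth_on k D (\<lambda>y. S.ft y * cnj (S.ft y))"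
    by (rule k_smooth_on_mult[OF oD smooth_onD[OF S.smooth_coeffs(3)] k_smooth_on_cnj[OF oD smooth_onD[OF S.smooth_coeffs(3)]]])
  have "k_smooth_on k D (\<lambda>z. complex_of_real (tau_square z))"
  proof (rule k_smooth_on_cong[THEN iffD1, OF oD _ ft])
    show "S.ft y * cnj (S.ft y) = complex_of_real (tau_square y)" if "y \<in> D" for y
      unfolding normal_frame_eq(2)[OF a(2) that] S.ft_def complex_norm_square ..
  qed
  then show "\<exists>T. open T \<and> z \<in> T \<and> k_smooth_on k T (\<lambda>z. complex_of_real (tau_square z))" using oD a(1) by blast
qed

text \<open>With \<open>dbar h = tau_square\<close> the sections with coordinates \<open>(1, 0)\<close> and \<open>(h, 1)\<close> are holomorphic;
  the average of \<open>tau_square\<close> is the obstruction to choosing \<open>h\<close> periodic.\<close>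

theorem normal_bundle_unipotent:
  obtains F m where "unipotent_frame (normal_bundle \<A> \<phi>) F m" "m \<noteq> 0"
proof -
  let ?r = "\<lambda>z. complex_of_real (tau_square z)"
  have r_per: "periodic ?r" "periodic tau_square"
    unfolding periodic_def normal_frame_deck(2)[OF per_u[symmetric]] normal_frame_deck(2)[OF per_v[symmetric]]
    by simp_all
  obtain f where f: "\<And>z. dbar f z = ?r z - coeff ?r 0 0" "periodic f"
    "\<And>k. k_smooth_on (2 * k + 7) UNIV ?r \<Longrightarrow> k_smooth_on k UNIV f"
    by (rule dbar_solvable[OF tau_square_smooth r_per(1)]) (rule that)
  define m where "m = coeff ?r 0 0"
  have m: "m \<noteq> 0"
    unfolding m_def
  proof (rule coeff_0_pos[OF _ tau_square_pos r_per(2)])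
    have "continuous_on UNIV (\<lambda>z. Re (?r z))"
      by (rule continuous_on_Re[OF k_smooth_on_continuous[OF tau_square_smooth]])
    then show "continuous_on UNIV tau_square" by simp
  qed
  have fs: "k_smooth_on k UNIV f" for k by (rule f(3)[OF tau_square_smooth])
  have fd: "f differentiable (at z)" for z by (rule k_smooth_on_differentiable[OF fs UNIV_I])
  have f_deck: "f z = f w" if "p z = p w" for z w
  proof (rule deck_invariant[OF k_smooth_on_continuous[OF fs] f(2) fd _ that])
    fix z
    have "p (SOME y. p y = p z) = p z" by (rule someI[of _ z]) simp
    then have "tau_square (SOME y. p y = p z) = tau_square z" by (rule normal_frame_deck(2)[symmetric])
    then show "dbar f z = (\<lambda>x. ?r (SOME y. p y = x) - coeff ?r 0 0) (p z)" unfolding f(1) by simp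
  qed
  define h where "h z = f z + m * cnj z" for z
  have cd: "(\<lambda>z. m * cnj z) differentiable (at z)" for z
    by (rule bounded_linear_imp_differentiable) (rule bounded_linear_const_mult[OF bounded_linear_cnj])
  have hs: "k_smooth_on k UNIV h" for k
    unfolding h_def[abs_def]
    by (rule k_smooth_on_add[OF open_UNIV fs k_smooth_on_bounded_linear[OF bounded_linear_const_mult[OF bounded_linear_cnj]]])
  have hd: "h differentiable (at z)" for z by (rule k_smooth_on_differentiable[OF hs UNIV_I])
  have dh: "dbar h z = ?r z" for z
    unfolding h_def[abs_def] dbar_add[OF fd cd] f(1) dbar_cnj_id by (simp add: m_def)
  \<comment> \<open>The shear by a multiple of \<open>h\<close>; parameters 1 and - 1 are inverse to
    each other. It turns the triangular system for the coordinates into plain holomorphy, because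
    \<open>dbar h\<close> is the coupling coefficient.\<close>
  define sh where "sh a z w = vec2 (w $ 1 + a * h z * w $ 2) (w $ 2)" for a z and w :: "complex^2"
  have sh_inv: "sh (- 1) z (sh 1 z w) = w" "sh 1 z (sh (- 1) z w) = w" for z w
    by (simp_all add: sh_def vec2_eta)
  define F where "F z w = normal_frame z (sh 1 z w)" for z w
  have F_bij: "bij_betw (F z) UNIV (normal_space \<A> \<phi> (p z))" for z
  proof -
    have "bij_betw (sh 1 z) UNIV UNIV" by (rule bij_betw_byWitness[where f' = "sh (- 1) z"]) (use sh_inv in auto)
    from bij_betw_trans[OF this normal_frame_bij[of z]] show ?thesis unfolding F_def[abs_def] comp_def .
  qed
  have F_inj: "inj (F z)" for z using F_bij[of z] by (rule bij_betw_imp_inj_on)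
  have sh_lin: "sh b z (w + w') = sh b z w + sh b z w'" "sh b z (a *s w) = a *s sh b z w" for a b z w w'
    by (simp_all add: sh_def vec_eq_iff forall_2 algebra_simps)
  have F_add: "F z (w + w') = F z w + F z w'" for z w w'
    unfolding F_def sh_lin normal_frame_linear ..
  have F_scale: "F z (a *s w) = Re a *\<^sub>R F z w + Im a *\<^sub>R nk_J (\<phi> (p z)) (F z w)" for a z w
    unfolding F_def sh_lin by (rule normal_frame_linear)
  have F_deck: "F z' w = F z (vec2 (w $ 1 - (- m) * cnj (z' - z) * w $ 2) (w $ 2))" if z: "p z = p z'" for z z' w
    unfolding F_def normal_frame_deck(1)[OF z] by (rule arg_cong[of _ _ "normal_frame z"])
      (simp add: sh_def vec2_eq_iff h_def f_deck[OF z] algebra_simps)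
  have F_hol: "normal_holomorphic \<A> \<phi> (p ` D) \<sigma> \<longleftrightarrow> (\<forall>i. (\<lambda>z. w z $ i) holomorphic_on D)"
    if oD: "open D" and w: "\<And>z. z \<in> D \<Longrightarrow> \<sigma> (p z) = F z (w z)" for D \<sigma> w
  proof -
    have w': "\<sigma> (p z) = normal_frame z (sh 1 z (w z))" if "z \<in> D" for z using w[OF that] by (simp add: F_def)
    have iff: "normal_holomorphic \<A> \<phi> (p ` D) \<sigma> \<longleftrightarrow> (\<forall>i. smooth_on D (\<lambda>z. sh 1 z (w z) $ i)) \<and>
        (\<forall>z\<in>D. dbar (\<lambda>y. sh 1 y (w y) $ 2) z = 0 \<and> dbar (\<lambda>y. sh 1 y (w y) $ 1) z = ?r z * sh 1 z (w z) $ 2)"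
      by (rule normal_holomorphic_iff[OF oD w'])
    have s1: "sh 1 z (w z) $ 1 = w z $ 1 + h z * w z $ 2" "sh 1 z (w z) $ 2 = w z $ 2" for z by (simp_all add: sh_def)
    have hsD: "k_smooth_on k D h" for k by (rule k_smooth_on_subset[OF hs subset_UNIV])
    show ?thesis
    proof
      assume "normal_holomorphic \<A> \<phi> (p ` D) \<sigma>"
      note c = iff[THEN iffD1, OF this]
      have s: "smooth_on D (\<lambda>z. sh 1 z (w z) $ i)" for i using conjunct1[OF c] by (rule spec)
      have d: "dbar (\<lambda>y. w y $ 2) z = 0 \<and> dbar (\<lambda>y. w y $ 1 + h y * w y $ 2) z = ?r z * w z $ 2" if "z \<in> D" for z
        using bspec[OF conjunct2[OF c] that] unfolding s1 .
      have s2: "k_smooth_on k D (\<lambda>z. w z $ 2)" for k using smooth_onD[OF s[of 2], of k] unfolding s1 .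
      have d2: "(\<lambda>z. w z $ 2) differentiable (at z)" if "z \<in> D" for z by (rule k_smooth_on_differentiable[OF s2 that])
      have s1': "k_smooth_on k D (\<lambda>z. w z $ 1)" for k
        using k_smooth_on_diff[OF oD smooth_onD[OF s[of 1], of k] k_smooth_on_mult[OF oD hsD s2]] unfolding s1 by simp
      have d1: "(\<lambda>z. w z $ 1) differentiable (at z)" if "z \<in> D" for z by (rule k_smooth_on_differentiable[OF s1' that])
      have "(\<lambda>z. w z $ 2) holomorphic_on D" by (rule dbar_0_holomorphic[OF d2]) (use d in auto)
      moreover have "(\<lambda>z. w z $ 1) holomorphic_on D"
      proof (rule dbar_0_holomorphic[OF d1])
        fix z assume z: "z \<in> D"
        have "dbar (\<lambda>y. w y $ 1 + h y * w y $ 2) z = dbar (\<lambda>y. w y $ 1) z + ?r z * w z $ 2"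
          unfolding dbar_add[OF d1[OF z] differentiable_mult[OF hd d2[OF z]]] dbar_mult[OF hd d2[OF z]] dh using d[OF z] by simp
        then show "dbar (\<lambda>y. w y $ 1) z = 0" using d[OF z] by simp
      qed
      ultimately show "\<forall>i. (\<lambda>z. w z $ i) holomorphic_on D" using exhaust_2 by metis
    next
      assume hol: "\<forall>i. (\<lambda>z. w z $ i) holomorphic_on D"
      have ks: "k_smooth_on k D (\<lambda>z. w z $ i)" for k i by (rule k_smooth_on_holomorphic[OF oD hol[rule_format]])
      have wd: "(\<lambda>z. w z $ i) differentiable (at z)" if "z \<in> D" for z i by (rule k_smooth_on_differentiable[OF ks that])
      have w0: "dbar (\<lambda>y. w y $ i) z = 0" if "z \<in> D" for z i by (rule dbar_holomorphic[OF hol[rule_format] oD that])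
      have "k_smooth_on k D (\<lambda>z. sh 1 z (w z) $ i)" if "i = 1 \<or> i = 2" for i k
        using that by (elim disjE) (simp_all only: s1 ks k_smooth_on_add[OF oD ks k_smooth_on_mult[OF oD hsD ks]])
      then have "\<forall>i. smooth_on D (\<lambda>z. sh 1 z (w z) $ i)" unfolding smooth_on_def using exhaust_2 by blast
      moreover have "dbar (\<lambda>y. w y $ 1 + h y * w y $ 2) z = ?r z * w z $ 2" if z: "z \<in> D" for z
        unfolding dbar_add[OF wd[OF z] differentiable_mult[OF hd wd[OF z]]] dbar_mult[OF hd wd[OF z]] dh w0[OF z] by simp
      ultimately show "normal_holomorphic \<A> \<phi> (p ` D) \<sigma>" unfolding iff s1 using w0 by blast
    qed
  qed
  have nb: "(U, t) \<in> normal_bundle \<A> \<phi> \<longleftrightarrow> open U \<and>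
     (\<forall>x\<in>U. bij_betw (t x) UNIV (normal_space \<A> \<phi> x) \<and>
        (\<forall>w w'. t x (w + w') = t x w + t x w') \<and>
        (\<forall>a w. t x (a *s w) = Re a *\<^sub>R t x w + Im a *\<^sub>R nk_J (\<phi> x) (t x w))) \<and>
     (\<forall>w. normal_holomorphic \<A> \<phi> U (\<lambda>x. t x w))" for U t
    unfolding normal_bundle_def by simp
  have cover: "\<exists>U t. (U, t) \<in> normal_bundle \<A> \<phi> \<and> x \<in> U" for x
  proof -
    obtain z where z: "p z = x" by (rule surj_obtain)
    \<comment> \<open>On a disc where \<open>p\<close> is injective the frame descends to a
      trivialisation of the normal bundle; constant coordinates are holomorphic there.\<close>
    obtain r where r: "r > 0" "ball z r \<subseteq> UNIV" "inj_on p (ball z r)" using param_locally_injective[OF param_p UNIV_I] .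
    define t where "t y = F (inv_into (ball z r) p y)" for y
    have tp: "t (p y) = F y" if "y \<in> ball z r" for y using r(3) that by (simp add: t_def)
    have "(p ` ball z r, t) \<in> normal_bundle \<A> \<phi>"
      unfolding nb
    proof (intro conjI ballI allI)
      show "open (p ` ball z r)" by (rule param_open_map[OF param_p open_ball subset_UNIV])
      show "normal_holomorphic \<A> \<phi> (p ` ball z r) (\<lambda>x. t x w)" for w
        by (subst F_hol[of "ball z r" _ "\<lambda>_. w"]) (simp_all add: tp)
      fix x assume "x \<in> p ` ball z r"
      then obtain y where y: "y \<in> ball z r" "x = p y" by blast
      show "bij_betw (t x) UNIV (normal_space \<A> \<phi> x)" unfolding y(2) tp[OF y(1)] by (rule F_bij)
      show "t x (w + w') = t x w + t x w'" for w w' unfolding y(2) tp[OF y(1)] by (rule F_add)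
      show "t x (a *s w) = Re a *\<^sub>R t x w + Im a *\<^sub>R nk_J (\<phi> x) (t x w)" for a w
        unfolding y(2) tp[OF y(1)] by (rule F_scale)
    qed
    moreover have "x \<in> p ` ball z r" unfolding z[symmetric] using r(1) by simp
    ultimately show ?thesis by blast
  qed
  have tr: "\<exists>G :: complex \<Rightarrow> complex^2^2. (\<forall>i j. (\<lambda>z. G z $ i $ j) holomorphic_on p -` U) \<and>
        (\<forall>z\<in>p -` U. inj ((*v) (G z)) \<and> (\<forall>w. t (p z) w = F z (G z *v w)))" if e: "(U, t) \<in> normal_bundle \<A> \<phi>" for U t
  proof -
    have oU: "open U" and tb: "\<And>x. x \<in> U \<Longrightarrow> bij_betw (t x) UNIV (normal_space \<A> \<phi> x)"
      and ta: "\<And>x w w'. x \<in> U \<Longrightarrow> t x (w + w') = t x w + t x w'"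
      and ts: "\<And>x a w. x \<in> U \<Longrightarrow> t x (a *s w) = Re a *\<^sub>R t x w + Im a *\<^sub>R nk_J (\<phi> x) (t x w)"
      and th: "\<And>w. normal_holomorphic \<A> \<phi> U (\<lambda>x. t x w)"
      using e unfolding nb by blast+
    \<comment> \<open>Both \<open>t\<close> and \<open>F z\<close> are bijections onto the normal
      space, complex linear with respect to J, so their comparison is a matrix. Its columns are
      holomorphic because \<open>t\<close> maps constant vectors to holomorphic sections.\<close>
    define g where "g z w = inv_into UNIV (F z) (t (p z) w)" for z w
    have g: "t (p z) w = F z (g z w)" if "p z \<in> U" for z w
    proof -
      have "t (p z) w \<in> range (F z)"
        using tb[OF that] F_bij[of z] unfolding bij_betw_def by (metis rangeI)
      then show ?thesis unfolding g_def by (rule f_inv_into_f[symmetric])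
    qed
    have gI: "g z w = w'" if "p z \<in> U" "t (p z) w = F z w'" for z w w'
      using g[OF that(1), of w] that(2) injD[OF F_inj] by metis
    have ga: "g z (w + w') = g z w + g z w'" if "p z \<in> U" for z w w'
      by (rule gI[OF that], subst ta[OF that]) (simp add: F_add g[OF that])
    have gs: "g z (a *s w) = a *s g z w" if "p z \<in> U" for z a w
      by (rule gI[OF that], subst ts[OF that]) (simp add: F_scale g[OF that])
    define G :: "complex \<Rightarrow> complex^2^2" where "G z = (\<chi> i j. g z (axis j 1) $ i)" for z
    have Gg: "G z *v w = g z w" if "p z \<in> U" for z w
    proof -
      have "g z w = g z (w $ 1 *s axis 1 1 + w $ 2 *s axis 2 1)"
        by (rule arg_cong[of _ _ "g z"]) (simp add: vec_eq_iff forall_2 axis_def)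
      also have "\<dots> = w $ 1 *s g z (axis 1 1) + w $ 2 *s g z (axis 2 1)" unfolding ga[OF that] gs[OF that] ..
      also have "\<dots> = G z *v w" by (simp add: vec_eq_iff G_def matrix_vector_mult_def sum_2 mult.commute)
      finally show ?thesis ..
    qed
    have pU: "p ` (p -` U) = U" using surj_p by (metis surj_image_vimage_eq)
    have Gh: "(\<lambda>z. G z $ i $ j) holomorphic_on p -` U" for i j
    proof -
      have "\<forall>i. (\<lambda>z. g z (axis j 1) $ i) holomorphic_on p -` U"
        by (rule F_hol[of "p -` U" "\<lambda>x. t x (axis j 1)" "\<lambda>z. g z (axis j 1)", OF open_vimage_p[OF oU], THEN iffD1])
           (simp add: g, unfold pU, rule th)
      then show ?thesis unfolding G_def by simp
    qed
    show ?thesis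
    proof (intro exI[of _ G] conjI allI ballI Gh)
      fix z assume "z \<in> p -` U"
      then have z: "p z \<in> U" by simp
      show "t (p z) w = F z (G z *v w)" for w unfolding Gg[OF z] by (rule g[OF z])
      show "inj ((*v) (G z))"
      proof (rule injI)
        fix w w' assume "G z *v w = G z *v w'"
        then have "t (p z) w = t (p z) w'" unfolding Gg[OF z] g[OF z] by simp
        then show "w = w'" by (rule injD[OF bij_betw_imp_inj_on[OF tb[OF z]]])
      qed
    qed
  qed
  show thesis
  \<comment> \<open>The shear adds m cnj z where the normal form subtracts it, hence the parameter -
    m.\<close>
  proof (rule that[of F "- m"])
    show "- m \<noteq> 0" using m by simp
    show "unipotent_frame (normal_bundle \<A> \<phi>) F (- m)"
      unfolding unipotent_frame_def
    proof (intro conjI allI ballI impI)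
      show "(\<Union>(U, t)\<in>normal_bundle \<A> \<phi>. U) = UNIV" using cover by fast
      show "inj (F z)" for z by (rule F_inj)
      show "F z' w = F z (vec2 (w $ 1 - - m * cnj (z' - z) * w $ 2) (w $ 2))" if "p z = p z'" for z z' w
        by (rule F_deck[OF that])
      fix e assume "e \<in> normal_bundle \<A> \<phi>"
      then obtain U t where e: "e = (U, t)" "(U, t) \<in> normal_bundle \<A> \<phi>" by (metis surj_pair)
      have "open U" using e(2) unfolding nb by (rule conjunct1)
      then show "case e of (U, t) \<Rightarrow> open U \<and> (\<exists>G :: complex \<Rightarrow> complex^2^2. (\<forall>i j. (\<lambda>z. G z $ i $ j) holomorphic_on p -` U) \<and>
        (\<forall>z\<in>p -` U. inj ((*v) (G z)) \<and> (\<forall>w. t (p z) w = F z (G z *v w))))"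
        unfolding e(1) split_conv using tr[OF e(2)] by (rule conjI)
    qed
  qed
qed

end

theorem proposition4p13:
  fixes \<A> :: "('x::t2_space) chart set" and \<phi> :: "'x \<Rightarrow> complex^4^4"
  assumes "compact_riemann_surface \<A>" and "has_genus TYPE('x) 1"
    and "J_holomorphic_curve \<A> \<phi>" and "transverse_curve \<A> \<phi>"
  shows "nontrivial_extension \<A> (normal_bundle \<A> \<phi>) \<and>
    (\<forall>E :: ('x, 2, 'v) vector_bundle. nontrivial_extension \<A> E \<longrightarrow>
       bundle_isomorphic \<A> E (normal_bundle \<A> \<phi>))"
proof -
  interpret compact_curve \<A> \<phi>
    using assms by unfold_locales (auto simp: compact_riemann_surface_def)
  obtain p u v where p: "param \<A> UNIV p" "range p = UNIV" "\<And>z w h. p z = p w \<Longrightarrow> p (z + h) = p (w + h)"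
    "\<And>z. p (z + u) = p z" "\<And>z. p (z + v) = p z" "Im (u * cnj v) \<noteq> 0"
    by (rule uniformisation) (rule that)
  interpret torus_curve \<A> \<phi> u v p
    by unfold_locales (fact p compact_surface)+
  obtain F m where F: "unipotent_frame (normal_bundle \<A> \<phi>) F m" "m \<noteq> 0"
    by (rule normal_bundle_unipotent) (rule that)
  \<comment> \<open>The nonzero parameter serves twice: it excludes a splitting of the normal
    bundle, and it is the target to which any other nonzero parameter is rescaled.\<close>
  show ?thesis
    using unipotent_nontrivial[OF F] nontrivial_extensions_isomorphic[OF _ F] by blast
qed

end
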